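(* Let $(X,W)$ be a Landau–Ginzburg pair and assume that the critical set $Z_W$ is compact. Then the inclusion functor $j:\mathrm{DF}_c(X,W)\to\mathrm{DF}(X,W)$ is a quasi-equivalence of $\mathbb Z_2$-graded $\mathrm O(X)$-linear dg-categories.
   Context: Landau–Ginzburg pair: $X$ is a connected, paracompact, non-compact complex manifold of dimension $d\ge1$ which admits a Kähler metric and whose canonical bundle $\wedge^dT^*X$ is holomorphically trivial; $W:X\to\mathbb C$ is a non-constant holomorphic function. $Z_W=\{p\in X:(\partial W)(p)=0\}$. $\mathrm O(X)$ is the algebra of holomorphic functions on $X$; $\mathcal A(X,E)=\bigoplus_j\Omega^{0,j}(X,E)$ is the space of smooth $(0,* )$-forms valued in a holomorphic vector bundle $E$. A holomorphic factorization of $W$ is $a=(E,D)$ with $E=E^{\hat0}\oplus E^{\hat1}$ a $\mathbb Z_2$-graded holomorphic vector bundle on $X$ and $D$ an odd holomorphic section of $\mathrm{End}(E)$ with $D^2=W\,\mathrm{id}_E$. $\mathrm{DF}(X,W)$ is the $\mathbb Z_2$-graded $\mathrm O(X)$-linear dg-category whose objects are the holomorphic factorizations of $W$, with $\mathrm{Hom}(a_1,a_2)=\mathcal A(X,Hom(E_1,E_2))$, $\mathbb Z_2$-degree $\deg(\rho\otimes f)=\mathrm{rk}\rho+\sigma(f)$ ($\mathrm{rk}$ = form degree mod 2, $\sigma$ = bundle degree), composition $(\rho\otimes f)\circ(\eta\otimes g)=(-1)^{\sigma(f)\mathrm{rk}\eta}(\rho\wedge\eta)\otimes(f\circ g)$,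 and differential $\delta_{a_1,a_2}=\bar\partial_{Hom(E_1,E_2)}+\mathfrak d_{a_1,a_2}$, where $\mathfrak d_{a_1,a_2}(\rho\otimes f)=(-1)^{\mathrm{rk}\rho}\rho\otimes(D_2\circ f)-(-1)^{\mathrm{rk}\rho+\sigma(f)}\rho\otimes(f\circ D_1)$. $\mathrm{DF}_c(X,W)$ has the same objects; its morphisms are the compactly supported elements of $\mathcal A(X,Hom(E_1,E_2))$, with differentials and composition induced from $\mathrm{DF}(X,W)$ (identity morphisms exist only at the level of cohomology in general). *)

theory Defs
  imports
    "HOL-Analysis.Analysis"
    "HOL-Library.Z2"
    "Jordan_Normal_Form.Gauss_Jordan_Elimination"
begin

section \<open>\<open>\<int>\<^sub>2\<close>-graded linear dg-categories\<close>

text \<open>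
  \<open>dg_comp C a b c g f\<close> is the composite of \<open>f : a \<rightarrow> b\<close> and \<open>g : b \<rightarrow> c\<close>. The fields
  \<open>mult\<close> and \<open>one\<close> of the records \<open>dg_hom C a b\<close> play no role (a module record extends a
  ring record).
\<close>

record ('o, 'm, 'r) dg_cat =
  dg_obj :: "'o set"
  dg_hom :: "'o \<Rightarrow> 'o \<Rightarrow> ('r, 'm) module"
  dg_deg :: "'o \<Rightarrow> 'o \<Rightarrow> bit \<Rightarrow> 'm set"
  dg_diff :: "'o \<Rightarrow> 'o \<Rightarrow> 'm \<Rightarrow> 'm"
  dg_comp :: "'o \<Rightarrow> 'o \<Rightarrow> 'o \<Rightarrow> 'm \<Rightarrow> 'm \<Rightarrow> 'm"

definition cocycles :: "('o, 'm, 'r) dg_cat \<Rightarrow> 'o \<Rightarrow> 'o \<Rightarrow> 'm set" where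
  "cocycles C a b = {f \<in> carrier (dg_hom C a b). dg_diff C a b f = \<zero>\<^bsub>dg_hom C a b\<^esub>}"

definition cohomologous :: "('o, 'm, 'r) dg_cat \<Rightarrow> 'o \<Rightarrow> 'o \<Rightarrow> 'm \<Rightarrow> 'm \<Rightarrow> bool" where
  "cohomologous C a b f g \<longleftrightarrow>
     (\<exists>h \<in> carrier (dg_hom C a b). f = g \<oplus>\<^bsub>dg_hom C a b\<^esub> dg_diff C a b h)"

definition coh_class :: "('o, 'm, 'r) dg_cat \<Rightarrow> 'o \<Rightarrow> 'o \<Rightarrow> 'm \<Rightarrow> 'm set" where
  "coh_class C a b f = {g \<in> cocycles C a b. cohomologous C a b g f}"

definition cohomology :: "('o, 'm, 'r) dg_cat \<Rightarrow> 'o \<Rightarrow> 'o \<Rightarrow> 'm set set" where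
  "cohomology C a b = coh_class C a b ` cocycles C a b"

text \<open>An even cocycle whose class is the identity of \<open>a\<close> in the cohomology category.\<close>

definition coh_identity :: "('o, 'm, 'r) dg_cat \<Rightarrow> 'o \<Rightarrow> 'm \<Rightarrow> bool" where
  "coh_identity C a u \<longleftrightarrow>
     u \<in> cocycles C a a \<inter> dg_deg C a a 0 \<and>
     (\<forall>b \<in> dg_obj C. \<forall>f \<in> cocycles C a b. cohomologous C a b (dg_comp C a a b f u) f) \<and>
     (\<forall>b \<in> dg_obj C. \<forall>f \<in> cocycles C b a. cohomologous C b a (dg_comp C b a a u f) f)"

text \<open>
  Strict identity morphisms are not required: the category of compactly supported morphisms
  below has them only in cohomology.
\<close>

locale dg_category =
  fixes R :: "('r, 'z) ring_scheme" and C :: "('o, 'm, 'r) dg_cat"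
  assumes hom_module:
    "\<lbrakk>a \<in> dg_obj C; b \<in> dg_obj C\<rbrakk> \<Longrightarrow> Module.module R (dg_hom C a b)"
  and deg_submodule:
    "\<lbrakk>a \<in> dg_obj C; b \<in> dg_obj C\<rbrakk> \<Longrightarrow> submodule (dg_deg C a b s) R (dg_hom C a b)"
  and deg_decomposition:
    "\<lbrakk>a \<in> dg_obj C; b \<in> dg_obj C; f \<in> carrier (dg_hom C a b)\<rbrakk> \<Longrightarrow>
       \<exists>!(f0, f1). f0 \<in> dg_deg C a b 0 \<and> f1 \<in> dg_deg C a b 1 \<and> f = f0 \<oplus>\<^bsub>dg_hom C a b\<^esub> f1"
  and diff_deg:
    "\<lbrakk>a \<in> dg_obj C; b \<in> dg_obj C; f \<in> dg_deg C a b s\<rbrakk> \<Longrightarrow> dg_diff C a b f \<in> dg_deg C a b (s + 1)"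
  and diff_add:
    "\<lbrakk>a \<in> dg_obj C; b \<in> dg_obj C; f \<in> carrier (dg_hom C a b); g \<in> carrier (dg_hom C a b)\<rbrakk> \<Longrightarrow>
       dg_diff C a b (f \<oplus>\<^bsub>dg_hom C a b\<^esub> g) = dg_diff C a b f \<oplus>\<^bsub>dg_hom C a b\<^esub> dg_diff C a b g"
  and diff_smult:
    "\<lbrakk>a \<in> dg_obj C; b \<in> dg_obj C; f \<in> carrier (dg_hom C a b); r \<in> carrier R\<rbrakk> \<Longrightarrow>
       dg_diff C a b (r \<odot>\<^bsub>dg_hom C a b\<^esub> f) = r \<odot>\<^bsub>dg_hom C a b\<^esub> dg_diff C a b f"
  and diff_diff:
    "\<lbrakk>a \<in> dg_obj C; b \<in> dg_obj C; f \<in> carrier (dg_hom C a b)\<rbrakk> \<Longrightarrow>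
       dg_diff C a b (dg_diff C a b f) = \<zero>\<^bsub>dg_hom C a b\<^esub>"
  and comp_deg:
    "\<lbrakk>a \<in> dg_obj C; b \<in> dg_obj C; c \<in> dg_obj C; f \<in> dg_deg C a b s; g \<in> dg_deg C b c t\<rbrakk> \<Longrightarrow>
       dg_comp C a b c g f \<in> dg_deg C a c (t + s)"
  and comp_add_right:
    "\<lbrakk>a \<in> dg_obj C; b \<in> dg_obj C; c \<in> dg_obj C;
      f \<in> carrier (dg_hom C a b); f' \<in> carrier (dg_hom C a b); g \<in> carrier (dg_hom C b c)\<rbrakk> \<Longrightarrow>
       dg_comp C a b c g (f \<oplus>\<^bsub>dg_hom C a b\<^esub> f') =
       dg_comp C a b c g f \<oplus>\<^bsub>dg_hom C a c\<^esub> dg_comp C a b c g f'"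
  and comp_add_left:
    "\<lbrakk>a \<in> dg_obj C; b \<in> dg_obj C; c \<in> dg_obj C;
      f \<in> carrier (dg_hom C a b); g \<in> carrier (dg_hom C b c); g' \<in> carrier (dg_hom C b c)\<rbrakk> \<Longrightarrow>
       dg_comp C a b c (g \<oplus>\<^bsub>dg_hom C b c\<^esub> g') f =
       dg_comp C a b c g f \<oplus>\<^bsub>dg_hom C a c\<^esub> dg_comp C a b c g' f"
  and comp_smult_right:
    "\<lbrakk>a \<in> dg_obj C; b \<in> dg_obj C; c \<in> dg_obj C; r \<in> carrier R;
      f \<in> carrier (dg_hom C a b); g \<in> carrier (dg_hom C b c)\<rbrakk> \<Longrightarrow>
       dg_comp C a b c g (r \<odot>\<^bsub>dg_hom C a b\<^esub> f) = r \<odot>\<^bsub>dg_hom C a c\<^esub> dg_comp C a b c g f"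
  and comp_smult_left:
    "\<lbrakk>a \<in> dg_obj C; b \<in> dg_obj C; c \<in> dg_obj C; r \<in> carrier R;
      f \<in> carrier (dg_hom C a b); g \<in> carrier (dg_hom C b c)\<rbrakk> \<Longrightarrow>
       dg_comp C a b c (r \<odot>\<^bsub>dg_hom C b c\<^esub> g) f = r \<odot>\<^bsub>dg_hom C a c\<^esub> dg_comp C a b c g f"
  and comp_assoc:
    "\<lbrakk>a \<in> dg_obj C; b \<in> dg_obj C; c \<in> dg_obj C; d \<in> dg_obj C;
      f \<in> carrier (dg_hom C a b); g \<in> carrier (dg_hom C b c); h \<in> carrier (dg_hom C c d)\<rbrakk> \<Longrightarrow>
       dg_comp C a c d h (dg_comp C a b c g f) = dg_comp C a b d (dg_comp C b c d h g) f"
  and leibniz: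
    "\<lbrakk>a \<in> dg_obj C; b \<in> dg_obj C; c \<in> dg_obj C;
      f \<in> carrier (dg_hom C a b); g \<in> dg_deg C b c s\<rbrakk> \<Longrightarrow>
       dg_diff C a c (dg_comp C a b c g f) =
         dg_comp C a b c (dg_diff C b c g) f \<oplus>\<^bsub>dg_hom C a c\<^esub>
         (if s = 0 then dg_comp C a b c g (dg_diff C a b f)
          else \<ominus>\<^bsub>dg_hom C a c\<^esub> dg_comp C a b c g (dg_diff C a b f))"
  and coh_unital:
    "a \<in> dg_obj C \<Longrightarrow> \<exists>u. coh_identity C a u"

locale dg_functor = source: dg_category R C + target: dg_category R D
  for R :: "('r, 'z) ring_scheme" and C :: "('o, 'm, 'r) dg_cat" and D :: "('p, 'n, 'r) dg_cat" +
  fixes F :: "'o \<Rightarrow> 'p" and \<Phi> :: "'o \<Rightarrow> 'o \<Rightarrow> 'm \<Rightarrow> 'n"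
  assumes map_obj: "a \<in> dg_obj C \<Longrightarrow> F a \<in> dg_obj D"
  and map_deg:
    "\<lbrakk>a \<in> dg_obj C; b \<in> dg_obj C; f \<in> dg_deg C a b s\<rbrakk> \<Longrightarrow> \<Phi> a b f \<in> dg_deg D (F a) (F b) s"
  and map_add:
    "\<lbrakk>a \<in> dg_obj C; b \<in> dg_obj C; f \<in> carrier (dg_hom C a b); g \<in> carrier (dg_hom C a b)\<rbrakk> \<Longrightarrow>
       \<Phi> a b (f \<oplus>\<^bsub>dg_hom C a b\<^esub> g) = \<Phi> a b f \<oplus>\<^bsub>dg_hom D (F a) (F b)\<^esub> \<Phi> a b g"
  and map_smult:
    "\<lbrakk>a \<in> dg_obj C; b \<in> dg_obj C; f \<in> carrier (dg_hom C a b); r \<in> carrier R\<rbrakk> \<Longrightarrow>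
       \<Phi> a b (r \<odot>\<^bsub>dg_hom C a b\<^esub> f) = r \<odot>\<^bsub>dg_hom D (F a) (F b)\<^esub> \<Phi> a b f"
  and map_diff:
    "\<lbrakk>a \<in> dg_obj C; b \<in> dg_obj C; f \<in> carrier (dg_hom C a b)\<rbrakk> \<Longrightarrow>
       \<Phi> a b (dg_diff C a b f) = dg_diff D (F a) (F b) (\<Phi> a b f)"
  and map_comp:
    "\<lbrakk>a \<in> dg_obj C; b \<in> dg_obj C; c \<in> dg_obj C;
      f \<in> carrier (dg_hom C a b); g \<in> carrier (dg_hom C b c)\<rbrakk> \<Longrightarrow>
       \<Phi> a c (dg_comp C a b c g f) = dg_comp D (F a) (F b) (F c) (\<Phi> b c g) (\<Phi> a b f)"
  and map_identity:
    "\<lbrakk>a \<in> dg_obj C; coh_identity C a u\<rbrakk> \<Longrightarrow> coh_identity D (F a) (\<Phi> a a u)"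

definition coh_isomorphic :: "('o, 'm, 'r) dg_cat \<Rightarrow> 'o \<Rightarrow> 'o \<Rightarrow> bool" where
  "coh_isomorphic C a b \<longleftrightarrow>
     (\<exists>f \<in> cocycles C a b \<inter> dg_deg C a b 0. \<exists>g \<in> cocycles C b a \<inter> dg_deg C b a 0.
        coh_identity C a (dg_comp C a b a g f) \<and> coh_identity C b (dg_comp C b a b f g))"

text \<open>
  In \<open>quasi_fully_faithful\<close> the classes of the images of all representatives of a class
  coincide, so the union is the image of the class under the induced map on cohomology.
\<close>

locale quasi_equivalence = dg_functor +
  assumes quasi_fully_faithful:
    "\<lbrakk>a \<in> dg_obj C; b \<in> dg_obj C\<rbrakk> \<Longrightarrow>
       bij_betw (\<lambda>K. \<Union>f\<in>K. coh_class D (F a) (F b) (\<Phi> a b f))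
         (cohomology C a b) (cohomology D (F a) (F b))"
  and essentially_surjective:
    "b \<in> dg_obj D \<Longrightarrow> \<exists>a \<in> dg_obj C. coh_isomorphic D (F a) b"


section \<open>Holomorphic and smooth functions of several complex variables\<close>

text \<open>Both notions are only used for open \<open>S\<close>.\<close>

definition cholomorphic_on :: "(complex ^ 'd::finite \<Rightarrow> complex) \<Rightarrow> (complex ^ 'd) set \<Rightarrow> bool" where
  "cholomorphic_on f S \<longleftrightarrow>
     (\<forall>z\<in>S. \<exists>f'. (f has_derivative f') (at z) \<and> (\<forall>c v. f' (c *s v) = c * f' v))"

fun Ck_on :: "nat \<Rightarrow> (complex ^ 'd::finite \<Rightarrow> complex) \<Rightarrow> (complex ^ 'd) set \<Rightarrow> bool" where
  "Ck_on 0 f S \<longleftrightarrow> continuous_on S f"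
| "Ck_on (Suc k) f S \<longleftrightarrow>
     (\<forall>z\<in>S. f differentiable (at z)) \<and> (\<forall>v. Ck_on k (\<lambda>z. frechet_derivative f (at z) v) S)"

definition smooth_on :: "(complex ^ 'd::finite \<Rightarrow> complex) \<Rightarrow> (complex ^ 'd) set \<Rightarrow> bool" where
  "smooth_on f S \<longleftrightarrow> (\<forall>k. Ck_on k f S)"

text \<open>Complex-linear and complex-antilinear parts of the real derivative of \<open>f\<close> at \<open>z\<close>.\<close>

definition del_at ::
    "(complex ^ 'd::finite \<Rightarrow> complex) \<Rightarrow> complex ^ 'd \<Rightarrow> complex ^ 'd \<Rightarrow> complex" where
  "del_at f z v =
     (frechet_derivative f (at z) v - \<i> * frechet_derivative f (at z) (\<i> *s v)) / 2"

definition delbar_at ::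
    "(complex ^ 'd::finite \<Rightarrow> complex) \<Rightarrow> complex ^ 'd \<Rightarrow> complex ^ 'd \<Rightarrow> complex" where
  "delbar_at f z v =
     (frechet_derivative f (at z) v + \<i> * frechet_derivative f (at z) (\<i> *s v)) / 2"


section \<open>Complex manifolds\<close>

definition paracompact_space :: "'a topology \<Rightarrow> bool" where
  "paracompact_space X \<longleftrightarrow>
     (\<forall>\<U>. (\<forall>U\<in>\<U>. openin X U) \<and> \<Union>\<U> = topspace X \<longrightarrow>
        (\<exists>\<V>. (\<forall>V\<in>\<V>. openin X V) \<and> \<Union>\<V> = topspace X \<and>
             (\<forall>V\<in>\<V>. \<exists>U\<in>\<U>. V \<subseteq> U) \<and> locally_finite_in X \<V>))"

type_synonym ('x, 'd) chart = "'x set \<times> ('x \<Rightarrow> complex ^ 'd)"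

definition chart_image :: "('x, 'd::finite) chart \<Rightarrow> 'x set \<Rightarrow> (complex ^ 'd) set" where
  "chart_image c S = snd c ` (fst c \<inter> S)"

definition chart_inv :: "('x, 'd::finite) chart \<Rightarrow> complex ^ 'd \<Rightarrow> 'x" where
  "chart_inv c = inv_into (fst c) (snd c)"

text \<open>
  The manifold is the whole type \<open>'x\<close>; its complex dimension is \<open>CARD('d)\<close>.
\<close>

definition complex_atlas :: "('x::t2_space, 'd::finite) chart set \<Rightarrow> bool" where
  "complex_atlas A \<longleftrightarrow>
     (\<Union>c\<in>A. fst c) = UNIV \<and>
     (\<forall>c\<in>A. open (fst c) \<and> open (chart_image c UNIV) \<and>
        homeomorphism (fst c) (chart_image c UNIV) (snd c) (chart_inv c)) \<and>
     (\<forall>c\<in>A. \<forall>c'\<in>A. \<forall>k.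
        cholomorphic_on (\<lambda>z. snd c' (chart_inv c z) $ k) (chart_image c (fst c')))"

text \<open>
  The tangent space \<open>T\<^sub>pX\<close> is realised as \<open>\<complex>\<^sup>d\<close> by means of a preferred chart at \<open>p\<close>
  (which in general does not depend continuously on \<open>p\<close>). Then \<open>chart_deriv A c p\<close> is the
  differential of the chart \<open>c\<close> as a map \<open>T\<^sub>pX \<rightarrow> \<complex>\<^sup>d\<close>, and \<open>chart_vec A c p v\<close> is the
  tangent vector at \<open>p\<close> whose components in the chart \<open>c\<close> are \<open>v\<close>.
\<close>

definition chart_at :: "('x, 'd::finite) chart set \<Rightarrow> 'x \<Rightarrow> ('x, 'd) chart" where
  "chart_at A p = (SOME c. c \<in> A \<and> p \<in> fst c)"

definition chart_deriv ::
    "('x, 'd::finite) chart set \<Rightarrow> ('x, 'd) chart \<Rightarrow> 'x \<Rightarrow> complex ^ 'd \<Rightarrow> complex ^ 'd" where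
  "chart_deriv A c p =
     frechet_derivative (\<lambda>z. snd c (chart_inv (chart_at A p) z)) (at (snd (chart_at A p) p))"

definition chart_vec ::
    "('x, 'd::finite) chart set \<Rightarrow> ('x, 'd) chart \<Rightarrow> 'x \<Rightarrow> complex ^ 'd \<Rightarrow> complex ^ 'd" where
  "chart_vec A c p =
     frechet_derivative (\<lambda>z. snd (chart_at A p) (chart_inv c z)) (at (snd c p))"

definition holomorphic_fun ::
    "('x, 'd::finite) chart set \<Rightarrow> 'x set \<Rightarrow> ('x \<Rightarrow> complex) \<Rightarrow> bool" where
  "holomorphic_fun A S f \<longleftrightarrow> (\<forall>c\<in>A. cholomorphic_on (\<lambda>z. f (chart_inv c z)) (chart_image c S))"

definition holomorphic_ring :: "('x, 'd::finite) chart set \<Rightarrow> ('x \<Rightarrow> complex) ring" where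
  "holomorphic_ring A =
     \<lparr> carrier = {f. holomorphic_fun A UNIV f},
       mult = (\<lambda>f g p. f p * g p), one = (\<lambda>p. 1),
       zero = (\<lambda>p. 0), add = (\<lambda>f g p. f p + g p) \<rparr>"

text \<open>The critical set, i.e. the zero set of the (1,0)-form \<open>\<partial>W\<close>.\<close>

definition critical_set :: "('x, 'd::finite) chart set \<Rightarrow> ('x \<Rightarrow> complex) \<Rightarrow> 'x set" where
  "critical_set A W =
     {p. \<forall>v. del_at (\<lambda>z. W (chart_inv (chart_at A p) z)) (snd (chart_at A p) p) v = 0}"

text \<open>
  A Hermitian metric \<open>h\<close> on the tangent spaces is Kaehler if its fundamental form
  \<open>\<omega> = - Im h\<close> is closed; in a chart, \<open>(d\<omega>)(u,v,w)\<close> for constant vector fields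
  \<open>u\<close>, \<open>v\<close>, \<open>w\<close> is \<open>D\<^sub>u(\<omega>(v,w)) - D\<^sub>v(\<omega>(u,w)) + D\<^sub>w(\<omega>(u,v))\<close>.
\<close>

definition chart_metric ::
    "('x, 'd::finite) chart set \<Rightarrow> ('x \<Rightarrow> complex ^ 'd \<Rightarrow> complex ^ 'd \<Rightarrow> complex) \<Rightarrow>
     ('x, 'd) chart \<Rightarrow> complex ^ 'd \<Rightarrow> complex ^ 'd \<Rightarrow> complex ^ 'd \<Rightarrow> complex" where
  "chart_metric A h c u v z =
     (let p = chart_inv c z in h p (chart_vec A c p u) (chart_vec A c p v))"

definition kaehler_metric ::
    "('x, 'd::finite) chart set \<Rightarrow> ('x \<Rightarrow> complex ^ 'd \<Rightarrow> complex ^ 'd \<Rightarrow> complex) \<Rightarrow> bool" where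
  "kaehler_metric A h \<longleftrightarrow>
     (\<forall>p u v w. h p (u + v) w = h p u w + h p v w) \<and>
     (\<forall>p a u v. h p (a *s u) v = a * h p u v) \<and>
     (\<forall>p u v. h p v u = cnj (h p u v)) \<and>
     (\<forall>p v. v \<noteq> 0 \<longrightarrow> Re (h p v v) > 0) \<and>
     (\<forall>c\<in>A. \<forall>u v. smooth_on (chart_metric A h c u v) (chart_image c UNIV)) \<and>
     (\<forall>c\<in>A. \<forall>z \<in> chart_image c UNIV. \<forall>u v w.
        (let d\<omega> = (\<lambda>x y t. frechet_derivative (\<lambda>z. - Im (chart_metric A h c y t z)) (at z) x)
         in d\<omega> u v w - d\<omega> v u w + d\<omega> w u v = 0))"


section \<open>Holomorphic vector bundles\<close>

text \<open>
  A holomorphic vector bundle of rank \<open>r\<close> (constant, as \<open>X\<close> will be connected) has fibres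
  \<open>E\<^sub>p = \<complex>\<^sup>r\<close>, which merely amounts to choosing a basis in each fibre, independently of each
  other. All topological and holomorphic information is in the local trivialisations
  \<open>(U, \<tau>)\<close>, where \<open>\<tau> p : E\<^sub>p \<rightarrow> \<complex>\<^sup>r\<close> is an isomorphism for \<open>p \<in> U\<close>; any two of them are
  related by a holomorphic transition function. No regularity of \<open>\<tau>\<close> itself is assumed, so
  every holomorphic vector bundle is isomorphic to one of this form.
\<close>

type_synonym 'x triv = "'x set \<times> ('x \<Rightarrow> complex mat)"

record 'x holo_bundle =
  bundle_rank :: nat
  bundle_trivs :: "'x triv set"

abbreviation mat_inv :: "complex mat \<Rightarrow> complex mat" where
  "mat_inv M \<equiv> the (mat_inverse M)"

definition holomorphic_bundle ::
    "('x::t2_space, 'd::finite) chart set \<Rightarrow> 'x holo_bundle \<Rightarrow> bool" where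
  "holomorphic_bundle A E \<longleftrightarrow>
     (\<Union>t\<in>bundle_trivs E. fst t) = UNIV \<and>
     (\<forall>t\<in>bundle_trivs E. open (fst t) \<and>
        (\<forall>p\<in>fst t. snd t p \<in> carrier_mat (bundle_rank E) (bundle_rank E) \<and>
                   invertible_mat (snd t p))) \<and>
     (\<forall>t\<in>bundle_trivs E. \<forall>t'\<in>bundle_trivs E. \<forall>i<bundle_rank E. \<forall>j<bundle_rank E.
        holomorphic_fun A (fst t \<inter> fst t') (\<lambda>p. (snd t' p * mat_inv (snd t p)) $$ (i, j)))"

definition direct_sum_bundle :: "'x holo_bundle \<Rightarrow> 'x holo_bundle \<Rightarrow> 'x holo_bundle" where
  "direct_sum_bundle E F =
     \<lparr> bundle_rank = bundle_rank E + bundle_rank F,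
       bundle_trivs = {(U \<inter> V, \<lambda>p. four_block_mat (\<sigma> p) (0\<^sub>m (bundle_rank E) (bundle_rank F))
                                       (0\<^sub>m (bundle_rank F) (bundle_rank E)) (\<tau> p)) | U \<sigma> V \<tau>.
                       (U, \<sigma>) \<in> bundle_trivs E \<and> (V, \<tau>) \<in> bundle_trivs F} \<rparr>"

definition holomorphic_homs ::
    "('x, 'd::finite) chart set \<Rightarrow> 'x holo_bundle \<Rightarrow> 'x holo_bundle \<Rightarrow> ('x \<Rightarrow> complex mat) set" where
  "holomorphic_homs A E F =
     {s. (\<forall>p. s p \<in> carrier_mat (bundle_rank F) (bundle_rank E)) \<and>
         (\<forall>t\<in>bundle_trivs E. \<forall>t'\<in>bundle_trivs F. \<forall>i<bundle_rank F. \<forall>j<bundle_rank E.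
            holomorphic_fun A (fst t \<inter> fst t')
              (\<lambda>p. (snd t' p * s p * mat_inv (snd t p)) $$ (i, j)))}"

definition trivial_bundle :: "nat \<Rightarrow> 'x holo_bundle" where
  "trivial_bundle r = \<lparr> bundle_rank = r, bundle_trivs = {(UNIV, \<lambda>p. 1\<^sub>m r)} \<rparr>"

definition holomorphically_trivial :: "('x, 'd::finite) chart set \<Rightarrow> 'x holo_bundle \<Rightarrow> bool" where
  "holomorphically_trivial A E \<longleftrightarrow>
     (\<exists>s \<in> holomorphic_homs A (trivial_bundle (bundle_rank E)) E. \<forall>p. invertible_mat (s p))"

text \<open>
  The fibre of \<open>\<and>\<^sup>dT\<^sup>*X\<close> at \<open>p\<close> is the complex line spanned by the determinant form on
  \<open>T\<^sub>pX = \<complex>\<^sup>d\<close>. A chart \<open>c = (U, \<phi>)\<close> trivialises it over \<open>U\<close> by the frame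
  \<open>d\<phi>\<^sup>1 \<and> \<dots> \<and> d\<phi>\<^sup>d = det(d\<phi>\<^sub>p) \<cdot> det\<close>.
\<close>

definition canonical_bundle :: "('x, 'd::finite) chart set \<Rightarrow> 'x holo_bundle" where
  "canonical_bundle A =
     \<lparr> bundle_rank = 1,
       bundle_trivs =
         (\<lambda>c. (fst c, \<lambda>p. mat 1 1 (\<lambda>_. inverse (Determinants.det (matrix (chart_deriv A c p)))))) ` A \<rparr>"


section \<open>Landau--Ginzburg pairs\<close>

definition landau_ginzburg_pair ::
    "('x::t2_space, 'd::finite) chart set \<Rightarrow> ('x \<Rightarrow> complex) \<Rightarrow> bool" where
  "landau_ginzburg_pair A W \<longleftrightarrow>
     complex_atlas A \<and>
     connected (UNIV :: 'x set) \<and>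
     paracompact_space (euclidean :: 'x topology) \<and>
     \<not> compact (UNIV :: 'x set) \<and>
     (\<exists>h. kaehler_metric A h) \<and>
     holomorphically_trivial A (canonical_bundle A) \<and>
     holomorphic_fun A UNIV W \<and>
     \<not> W constant_on UNIV"


section \<open>Bundle-valued (0,*)-forms\<close>

text \<open>
  An antiholomorphic exterior form on \<open>T\<^sub>pX\<close> with values in \<open>Hom(E, F)\<^sub>p\<close> is encoded as one function on lists of tangent
  vectors; its restriction to lists of length \<open>j\<close>, which is an alternating
  complex-antilinear map, is the component of form degree \<open>j\<close>.
\<close>

type_synonym ('x, 'd) matform = "'x \<Rightarrow> (complex ^ 'd) list \<Rightarrow> complex mat"

definition antilinear_alternating ::
    "nat \<Rightarrow> nat \<Rightarrow> ((complex ^ 'd::finite) list \<Rightarrow> complex mat) \<Rightarrow> bool" where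
  "antilinear_alternating m n \<alpha> \<longleftrightarrow>
     (\<forall>vs. \<alpha> vs \<in> carrier_mat m n) \<and>
     (\<forall>vs i u v. i < length vs \<longrightarrow> \<alpha> (vs[i := u + v]) = \<alpha> (vs[i := u]) + \<alpha> (vs[i := v])) \<and>
     (\<forall>vs i a v. i < length vs \<longrightarrow> \<alpha> (vs[i := a *s v]) = cnj a \<cdot>\<^sub>m \<alpha> (vs[i := v])) \<and>
     (\<forall>vs i j. i < j \<and> j < length vs \<and> vs ! i = vs ! j \<longrightarrow> \<alpha> vs = 0\<^sub>m m n)"

definition local_form ::
    "('x, 'd::finite) chart set \<Rightarrow> ('x, 'd) chart \<Rightarrow> 'x triv \<Rightarrow> 'x triv \<Rightarrow> ('x, 'd) matform \<Rightarrow>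
     complex ^ 'd \<Rightarrow> (complex ^ 'd) list \<Rightarrow> complex mat" where
  "local_form A c t t' \<alpha> z vs =
     (let p = chart_inv c z
      in snd t' p * \<alpha> p (map (chart_vec A c p) vs) * mat_inv (snd t p))"

definition hom_forms ::
    "('x, 'd::finite) chart set \<Rightarrow> 'x holo_bundle \<Rightarrow> 'x holo_bundle \<Rightarrow> ('x, 'd) matform set" where
  "hom_forms A E F =
     {\<alpha>. (\<forall>p. antilinear_alternating (bundle_rank F) (bundle_rank E) (\<alpha> p)) \<and>
         (\<forall>c\<in>A. \<forall>t\<in>bundle_trivs E. \<forall>t'\<in>bundle_trivs F. \<forall>vs.
            \<forall>i<bundle_rank F. \<forall>j<bundle_rank E.
              smooth_on (\<lambda>z. local_form A c t t' \<alpha> z vs $$ (i, j)) (chart_image c (fst t \<inter> fst t')))}"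

text \<open>
  The Dolbeault operator of \<open>Hom(E, F)\<close>, computed at each point \<open>p\<close> in the preferred chart
  (in which tangent vectors at \<open>p\<close> are their own components) and some holomorphic
  trivialisations of \<open>E\<close> and \<open>F\<close> near \<open>p\<close>:
  \<open>(\<partial>-bar \<alpha>)(v\<^sub>0,\<dots>,v\<^sub>j) = \<Sum>\<^sub>k (-1)\<^sup>k \<partial>-bar\<^bsub>v\<^sub>k\<^esub> (\<alpha>(v\<^sub>0,\<dots>,v\<^sub>k omitted,\<dots>,v\<^sub>j))\<close> for constant vector fields.
\<close>

definition triv_at :: "'x holo_bundle \<Rightarrow> 'x \<Rightarrow> 'x triv" where
  "triv_at E p = (SOME t. t \<in> bundle_trivs E \<and> p \<in> fst t)"

definition dolbeault ::
    "('x, 'd::finite) chart set \<Rightarrow> 'x holo_bundle \<Rightarrow> 'x holo_bundle \<Rightarrow>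
     ('x, 'd) matform \<Rightarrow> ('x, 'd) matform" where
  "dolbeault A E F \<alpha> p vs =
     (let c = chart_at A p; t = triv_at E p; t' = triv_at F p
      in mat_inv (snd t' p) *
         mat (bundle_rank F) (bundle_rank E)
           (\<lambda>(i, j). \<Sum>k<length vs. (-1) ^ k *
              delbar_at (\<lambda>z. local_form A c t t' \<alpha> z (take k vs @ drop (Suc k) vs) $$ (i, j))
                (snd c p) (vs ! k)) *
         snd t p)"

definition form_support ::
    "'x holo_bundle \<Rightarrow> 'x holo_bundle \<Rightarrow> ('x::topological_space, 'd) matform \<Rightarrow> 'x set" where
  "form_support E F \<alpha> = closure {p. \<exists>vs. \<alpha> p vs \<noteq> 0\<^sub>m (bundle_rank F) (bundle_rank E)}"


section \<open>Holomorphic factorizations and the categories DF and \<open>DF\<^sub>c\<close>\<close>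

record 'x factorization =
  fact_even :: "'x holo_bundle"
  fact_odd :: "'x holo_bundle"
  fact_map :: "'x \<Rightarrow> complex mat"

definition fact_bundle :: "'x factorization \<Rightarrow> 'x holo_bundle" where
  "fact_bundle a = direct_sum_bundle (fact_even a) (fact_odd a)"

abbreviation fact_rank :: "'x factorization \<Rightarrow> nat" where
  "fact_rank a \<equiv> bundle_rank (fact_bundle a)"

definition index_parity :: "'x factorization \<Rightarrow> nat \<Rightarrow> bit" where
  "index_parity a i = (if i < bundle_rank (fact_even a) then 0 else 1)"

definition hom_homogeneous ::
    "'x factorization \<Rightarrow> 'x factorization \<Rightarrow> bit \<Rightarrow> complex mat \<Rightarrow> bool" where
  "hom_homogeneous a b s M \<longleftrightarrow>
     (\<forall>i<fact_rank b. \<forall>j<fact_rank a. M $$ (i, j) \<noteq> 0 \<longrightarrow> index_parity b i + index_parity a j = s)"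

definition holomorphic_factorization ::
    "('x::t2_space, 'd::finite) chart set \<Rightarrow> ('x \<Rightarrow> complex) \<Rightarrow> 'x factorization \<Rightarrow> bool" where
  "holomorphic_factorization A W a \<longleftrightarrow>
     holomorphic_bundle A (fact_even a) \<and>
     holomorphic_bundle A (fact_odd a) \<and>
     fact_map a \<in> holomorphic_homs A (fact_bundle a) (fact_bundle a) \<and>
     (\<forall>p. hom_homogeneous a a 1 (fact_map a p)) \<and>
     (\<forall>p. fact_map a p * fact_map a p = W p \<cdot>\<^sub>m 1\<^sub>m (fact_rank a))"

text \<open>The linear extension of \<open>f \<mapsto> (-1)\<^bsup>k \<sigma>(f)\<^esup> f\<close> from homogeneous \<open>f\<close> to all of \<open>Hom(a, b)\<^sub>p\<close>.\<close>

definition grading_sign ::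
    "'x factorization \<Rightarrow> 'x factorization \<Rightarrow> nat \<Rightarrow> complex mat \<Rightarrow> complex mat" where
  "grading_sign a b k M =
     mat (fact_rank b) (fact_rank a)
       (\<lambda>(i, j). (if index_parity b i + index_parity a j = 0 then 1 else (-1) ^ k) * M $$ (i, j))"

text \<open>
  Composition: \<open>(\<rho> \<otimes> f) \<circ> (\<eta> \<otimes> g) = (-1)\<^bsup>\<sigma>(f) rk \<eta>\<^esup> (\<rho> \<and> \<eta>) \<otimes> (f \<circ> g)\<close>, with the wedge product
  given by the sum over shuffles: \<open>S\<close> is the set of positions of the arguments passed to \<open>\<rho>\<close>.
\<close>

definition shuffle_sign :: "nat \<Rightarrow> nat set \<Rightarrow> complex" where
  "shuffle_sign n S = (-1) ^ card {(i, j). i \<in> S \<and> j \<in> {..<n} - S \<and> j < i}"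

definition DF_comp ::
    "'x factorization \<Rightarrow> 'x factorization \<Rightarrow> 'x factorization \<Rightarrow>
     ('x, 'd) matform \<Rightarrow> ('x, 'd) matform \<Rightarrow> ('x, 'd) matform" where
  "DF_comp a b c \<beta> \<alpha> p vs =
     mat (fact_rank c) (fact_rank a)
       (\<lambda>(i, j). \<Sum>S\<in>Pow {..<length vs}. shuffle_sign (length vs) S *
          (grading_sign b c (length vs - card S) (\<beta> p (nths vs S)) * \<alpha> p (nths vs (- S))) $$ (i, j))"

text \<open>
  \<open>\<dd>(\<rho> \<otimes> f) = (-1)\<^bsup>rk \<rho>\<^esup> \<rho> \<otimes> (D\<^sub>b \<circ> f) - (-1)\<^bsup>rk \<rho> + \<sigma>(f)\<^esup> \<rho> \<otimes> (f \<circ> D\<^sub>a)\<close>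
\<close>

definition defect_diff ::
    "'x factorization \<Rightarrow> 'x factorization \<Rightarrow> ('x, 'd) matform \<Rightarrow> ('x, 'd) matform" where
  "defect_diff a b \<alpha> p vs =
     (-1) ^ length vs \<cdot>\<^sub>m (fact_map b p * \<alpha> p vs) -
     (-1) ^ length vs \<cdot>\<^sub>m (grading_sign a b 1 (\<alpha> p vs) * fact_map a p)"

definition DF_diff ::
    "('x, 'd::finite) chart set \<Rightarrow> 'x factorization \<Rightarrow> 'x factorization \<Rightarrow>
     ('x, 'd) matform \<Rightarrow> ('x, 'd) matform" where
  "DF_diff A a b \<alpha> p vs =
     dolbeault A (fact_bundle a) (fact_bundle b) \<alpha> p vs + defect_diff a b \<alpha> p vs"

definition form_module ::
    "'x factorization \<Rightarrow> 'x factorization \<Rightarrow> ('x, 'd) matform set \<Rightarrow>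
     ('x \<Rightarrow> complex, ('x, 'd) matform) module" where
  "form_module a b S =
     \<lparr> carrier = S, mult = undefined, one = undefined,
       zero = (\<lambda>p vs. 0\<^sub>m (fact_rank b) (fact_rank a)),
       add = (\<lambda>\<alpha> \<beta> p vs. \<alpha> p vs + \<beta> p vs),
       smult = (\<lambda>f \<alpha> p vs. f p \<cdot>\<^sub>m \<alpha> p vs) \<rparr>"

text \<open>Degree \<open>s\<close>: the component of form degree \<open>j\<close> has bundle degree \<open>s - j = s + j\<close> mod 2.\<close>

definition form_deg ::
    "'x factorization \<Rightarrow> 'x factorization \<Rightarrow> bit \<Rightarrow> ('x, 'd) matform set" where
  "form_deg a b s = {\<alpha>. \<forall>p vs. hom_homogeneous a b (s + of_nat (length vs)) (\<alpha> p vs)}"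

definition DF ::
    "('x::t2_space, 'd::finite) chart set \<Rightarrow> ('x \<Rightarrow> complex) \<Rightarrow>
     ('x factorization, ('x, 'd) matform, 'x \<Rightarrow> complex) dg_cat" where
  "DF A W =
     \<lparr> dg_obj = {a. holomorphic_factorization A W a},
       dg_hom = (\<lambda>a b. form_module a b (hom_forms A (fact_bundle a) (fact_bundle b))),
       dg_deg = (\<lambda>a b s. hom_forms A (fact_bundle a) (fact_bundle b) \<inter> form_deg a b s),
       dg_diff = DF_diff A,
       dg_comp = DF_comp \<rparr>"

definition compact_hom_forms ::
    "('x::t2_space, 'd::finite) chart set \<Rightarrow> 'x factorization \<Rightarrow> 'x factorization \<Rightarrow>
     ('x, 'd) matform set" where
  "compact_hom_forms A a b =
     {\<alpha> \<in> hom_forms A (fact_bundle a) (fact_bundle b).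
        compact (form_support (fact_bundle a) (fact_bundle b) \<alpha>)}"

definition DF\<^sub>c ::
    "('x::t2_space, 'd::finite) chart set \<Rightarrow> ('x \<Rightarrow> complex) \<Rightarrow>
     ('x factorization, ('x, 'd) matform, 'x \<Rightarrow> complex) dg_cat" where
  "DF\<^sub>c A W =
     \<lparr> dg_obj = {a. holomorphic_factorization A W a},
       dg_hom = (\<lambda>a b. form_module a b (compact_hom_forms A a b)),
       dg_deg = (\<lambda>a b s. compact_hom_forms A a b \<inter> form_deg a b s),
       dg_diff = DF_diff A,
       dg_comp = DF_comp \<rparr>"

definition incl_obj :: "'x factorization \<Rightarrow> 'x factorization" where
  "incl_obj a = a"

definition incl_mor ::
    "'x factorization \<Rightarrow> 'x factorization \<Rightarrow> ('x, 'd) matform \<Rightarrow> ('x, 'd) matform" where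
  "incl_mor a b \<alpha> = \<alpha>"

end

theory Submission
  imports Defs "HOL-Complex_Analysis.Cauchy_Integral_Formula"
begin

text \<open>
  Compactly supported morphisms form a dg-ideal. The inclusion of a dg-ideal is a
  quasi-equivalence as soon as each identity is homotopic to an even cocycle \<open>u\<close> in the ideal,
  because composition with \<open>u\<close> is then homotopic to the identity and takes values in the ideal.

  To find \<open>u\<close>, differentiate \<open>D\<^sup>2 = W\<close>: in a local trivialisation, \<open>\<partial>\<^sub>vD / \<partial>\<^sub>vW\<close> anticommutes with
  \<open>D\<close> to \<open>1\<close> wherever \<open>\<partial>\<^sub>vW \<noteq> 0\<close>. Bump functions glue these sections to an odd section \<open>Q\<close> with
  \<open>D Q + Q D = 1\<close> outside a compact neighbourhood of the critical set. There \<open>T = 1 - \<delta>Q\<close> has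
  only components of positive form degree, so that \<open>T\<^sup>n = 0\<close> for \<open>n > d\<close>, whereas \<open>T\<^sup>n\<close> is
  homotopic to \<open>1\<close> on all of \<open>X\<close>. Hence \<open>u = T\<^bsup>d + 1\<^esup>\<close> has compact support.
\<close>

section \<open>Ideals in dg-categories\<close>

text \<open>A morphism is a fibrewise object: each fibre carries a basis chosen independently of its
  neighbours, so a form has no derivative as it stands. All analysis is done on its components in a
  chart and two trivialisations. Transition matrices are holomorphic and even, hence compatible with
  the Dolbeault operator, the grading signs and the product; this makes the fibrewise operations
  globally consistent. Holomorphy means only complex differentiability at each point, so Cauchy's
  formula must first supply smoothness. The glued section need not be odd. Since \<open>D\<close> is
  odd, the odd part of any solution of \<open>D Q + Q D = 1\<close> is again a solution, so the
  parity is corrected once at the end. A power of \<open>T\<close> is taken because away from the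
  critical set \<open>T\<close> still contains the Dolbeault derivative of \<open>Q\<close>, which
  has no reason to vanish there. The morphism \<open>u\<close> plays three parts: it is a
  cohomological unit of the ideal, it moves an arbitrary cocycle into the ideal, and it moves a
  primitive into the ideal. The last two give surjectivity and injectivity on cohomology.\<close>

context dg_category
begin

lemma submodule_carrier: "submodule H R M \<Longrightarrow> H \<subseteq> carrier M"
  using subgroup.subset by (force simp: submodule_def)

lemma hom_abelian_group:
  "\<lbrakk>a \<in> dg_obj C; b \<in> dg_obj C\<rbrakk> \<Longrightarrow> abelian_group (dg_hom C a b)"
  using hom_module unfolding Module.module_def by blast

lemma deg_carrier:
  "\<lbrakk>a \<in> dg_obj C; b \<in> dg_obj C; f \<in> dg_deg C a b s\<rbrakk> \<Longrightarrow> f \<in> carrier (dg_hom C a b)"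
  using submodule_carrier[OF deg_submodule] by blast

lemma deg_parts:
  assumes "a \<in> dg_obj C" "b \<in> dg_obj C" "f \<in> carrier (dg_hom C a b)"
  obtains f0 f1 where "f0 \<in> dg_deg C a b 0" "f1 \<in> dg_deg C a b 1" "f = f0 \<oplus>\<^bsub>dg_hom C a b\<^esub> f1"
  using deg_decomposition[OF assms] by blast

lemma deg_zero: "\<lbrakk>a \<in> dg_obj C; b \<in> dg_obj C\<rbrakk> \<Longrightarrow> \<zero>\<^bsub>dg_hom C a b\<^esub> \<in> dg_deg C a b s"
  using subgroup.one_closed[of "dg_deg C a b s" "add_monoid (dg_hom C a b)"] deg_submodule[of a b s]
  by (simp add: submodule_def)

lemma deg_parts_unique:
  assumes "a \<in> dg_obj C" "b \<in> dg_obj C"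
    and "f0 \<in> dg_deg C a b 0" "f1 \<in> dg_deg C a b 1" "g0 \<in> dg_deg C a b 0" "g1 \<in> dg_deg C a b 1"
    and "f0 \<oplus>\<^bsub>dg_hom C a b\<^esub> f1 = g0 \<oplus>\<^bsub>dg_hom C a b\<^esub> g1"
  shows "f0 = g0" "f1 = g1"
proof -
  interpret M: abelian_group "dg_hom C a b" using hom_abelian_group assms by blast
  have "f0 \<oplus>\<^bsub>dg_hom C a b\<^esub> f1 \<in> carrier (dg_hom C a b)"
    using assms deg_carrier by blast
  from deg_decomposition[OF assms(1,2) this] assms show "f0 = g0" "f1 = g1" by fast+
qed

text \<open>The axioms describe the differential only on homogeneous elements; splitting by parity
  extends closure to all of them.\<close>

lemma diff_carrier:
  assumes "a \<in> dg_obj C" "b \<in> dg_obj C" "f \<in> carrier (dg_hom C a b)"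
  shows "dg_diff C a b f \<in> carrier (dg_hom C a b)"
proof -
  interpret M: abelian_group "dg_hom C a b" using hom_abelian_group assms by blast
  obtain f0 f1 where "f0 \<in> dg_deg C a b 0" "f1 \<in> dg_deg C a b 1" "f = f0 \<oplus>\<^bsub>dg_hom C a b\<^esub> f1"
    using deg_parts assms by blast
  then show ?thesis
    using diff_add diff_deg deg_carrier assms by (metis M.a_closed)
qed

lemma comp_carrier:
  assumes o: "a \<in> dg_obj C" "b \<in> dg_obj C" "c \<in> dg_obj C"
    and f: "f \<in> carrier (dg_hom C a b)" and g: "g \<in> carrier (dg_hom C b c)"
  shows "dg_comp C a b c g f \<in> carrier (dg_hom C a c)"
proof -
  interpret M: abelian_group "dg_hom C a c" using hom_abelian_group o by blast
  interpret N: abelian_group "dg_hom C b c" using hom_abelian_group o by blast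
  obtain f0 f1 where f': "f0 \<in> dg_deg C a b 0" "f1 \<in> dg_deg C a b 1" "f = f0 \<oplus>\<^bsub>dg_hom C a b\<^esub> f1"
    using deg_parts o f by blast
  obtain g0 g1 where g': "g0 \<in> dg_deg C b c 0" "g1 \<in> dg_deg C b c 1" "g = g0 \<oplus>\<^bsub>dg_hom C b c\<^esub> g1"
    using deg_parts o g by blast
  have "dg_comp C a b c h k \<in> carrier (dg_hom C a c)"
    if "h \<in> dg_deg C b c s" "k \<in> dg_deg C a b t" for h k s t
    using comp_deg deg_carrier o that by meson
  then show ?thesis
    unfolding f'(3) using f' g' o g
    by (simp add: comp_add_right comp_add_left deg_carrier)
qed

lemma diff_zero:
  assumes "a \<in> dg_obj C" "b \<in> dg_obj C"
  shows "dg_diff C a b \<zero>\<^bsub>dg_hom C a b\<^esub> = \<zero>\<^bsub>dg_hom C a b\<^esub>"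
proof -
  interpret M: abelian_group "dg_hom C a b" using hom_abelian_group assms by blast
  have "dg_diff C a b (\<zero>\<^bsub>dg_hom C a b\<^esub> \<oplus>\<^bsub>dg_hom C a b\<^esub> \<zero>\<^bsub>dg_hom C a b\<^esub>)
      = dg_diff C a b \<zero>\<^bsub>dg_hom C a b\<^esub> \<oplus>\<^bsub>dg_hom C a b\<^esub> dg_diff C a b \<zero>\<^bsub>dg_hom C a b\<^esub>"
    using diff_add[of a b "\<zero>\<^bsub>dg_hom C a b\<^esub>" "\<zero>\<^bsub>dg_hom C a b\<^esub>"] assms by simp
  then show ?thesis
    using diff_carrier[OF assms, of "\<zero>\<^bsub>dg_hom C a b\<^esub>"] by simp
qed

lemma diff_minus:
  assumes "a \<in> dg_obj C" "b \<in> dg_obj C" "f \<in> carrier (dg_hom C a b)"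
  shows "dg_diff C a b (\<ominus>\<^bsub>dg_hom C a b\<^esub> f) = \<ominus>\<^bsub>dg_hom C a b\<^esub> dg_diff C a b f"
proof -
  interpret M: abelian_group "dg_hom C a b" using hom_abelian_group assms by blast
  have "dg_diff C a b (\<ominus>\<^bsub>dg_hom C a b\<^esub> f) \<oplus>\<^bsub>dg_hom C a b\<^esub> dg_diff C a b f = \<zero>\<^bsub>dg_hom C a b\<^esub>"
    using diff_add[of a b "\<ominus>\<^bsub>dg_hom C a b\<^esub> f" f] assms diff_zero by (simp add: M.l_neg)
  then show ?thesis
    using M.minus_equality diff_carrier assms by simp
qed

lemma comp_zero_right:
  assumes "a \<in> dg_obj C" "b \<in> dg_obj C" "c \<in> dg_obj C" "g \<in> carrier (dg_hom C b c)"
  shows "dg_comp C a b c g \<zero>\<^bsub>dg_hom C a b\<^esub> = \<zero>\<^bsub>dg_hom C a c\<^esub>"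
proof -
  interpret M: abelian_group "dg_hom C a b" using hom_abelian_group assms by blast
  interpret N: abelian_group "dg_hom C a c" using hom_abelian_group assms by blast
  show ?thesis
    using comp_add_right[of a b c "\<zero>\<^bsub>dg_hom C a b\<^esub>" "\<zero>\<^bsub>dg_hom C a b\<^esub>" g] assms
      comp_carrier[of a b c "\<zero>\<^bsub>dg_hom C a b\<^esub>" g] by simp
qed

lemma comp_zero_left:
  assumes "a \<in> dg_obj C" "b \<in> dg_obj C" "c \<in> dg_obj C" "f \<in> carrier (dg_hom C a b)"
  shows "dg_comp C a b c \<zero>\<^bsub>dg_hom C b c\<^esub> f = \<zero>\<^bsub>dg_hom C a c\<^esub>"
proof -
  interpret M: abelian_group "dg_hom C b c" using hom_abelian_group assms by blast
  interpret N: abelian_group "dg_hom C a c" using hom_abelian_group assms by blast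
  show ?thesis
    using comp_add_left[of a b c f "\<zero>\<^bsub>dg_hom C b c\<^esub>" "\<zero>\<^bsub>dg_hom C b c\<^esub>"] assms
      comp_carrier[of a b c f "\<zero>\<^bsub>dg_hom C b c\<^esub>"] by simp
qed

text \<open>The differential exchanges the parities, so the images of the two parts lie in different
  summands and can only vanish separately.\<close>

lemma cocycle_parts:
  assumes o: "a \<in> dg_obj C" "b \<in> dg_obj C"
    and f: "f0 \<in> dg_deg C a b 0" "f1 \<in> dg_deg C a b 1" "f0 \<oplus>\<^bsub>dg_hom C a b\<^esub> f1 \<in> cocycles C a b"
  shows "dg_diff C a b f0 = \<zero>\<^bsub>dg_hom C a b\<^esub>" "dg_diff C a b f1 = \<zero>\<^bsub>dg_hom C a b\<^esub>"
proof -
  interpret M: abelian_group "dg_hom C a b" using hom_abelian_group assms by blast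
  have d: "dg_diff C a b f0 \<in> dg_deg C a b 1" "dg_diff C a b f1 \<in> dg_deg C a b 0"
    using diff_deg[OF o f(1)] diff_deg[OF o f(2)] by simp_all
  have "dg_diff C a b f1 \<oplus>\<^bsub>dg_hom C a b\<^esub> dg_diff C a b f0 = \<zero>\<^bsub>dg_hom C a b\<^esub> \<oplus>\<^bsub>dg_hom C a b\<^esub> \<zero>\<^bsub>dg_hom C a b\<^esub>"
    using f(3) diff_add[OF o deg_carrier[OF o f(1)] deg_carrier[OF o f(2)]] d o
    by (simp add: cocycles_def deg_carrier M.a_comm)
  from deg_parts_unique[OF o d(2,1) deg_zero[OF o] deg_zero[OF o] this]
  show "dg_diff C a b f0 = \<zero>\<^bsub>dg_hom C a b\<^esub>" "dg_diff C a b f1 = \<zero>\<^bsub>dg_hom C a b\<^esub>" by auto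
qed

section \<open>Being cohomologous as an equivalence relation\<close>

lemma cohomologous_refl:
  assumes "a \<in> dg_obj C" "b \<in> dg_obj C" "f \<in> carrier (dg_hom C a b)"
  shows "cohomologous C a b f f"
proof -
  interpret M: abelian_group "dg_hom C a b" using hom_abelian_group assms by blast
  show ?thesis unfolding cohomologous_def
    using assms diff_zero by (intro bexI[of _ "\<zero>\<^bsub>dg_hom C a b\<^esub>"]) auto
qed

lemma cohomologous_sym:
  assumes "a \<in> dg_obj C" "b \<in> dg_obj C" "g \<in> carrier (dg_hom C a b)" "cohomologous C a b f g"
  shows "cohomologous C a b g f"
proof -
  interpret M: abelian_group "dg_hom C a b" using hom_abelian_group assms by blast
  obtain h where h: "h \<in> carrier (dg_hom C a b)" "f = g \<oplus>\<^bsub>dg_hom C a b\<^esub> dg_diff C a b h"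
    using assms unfolding cohomologous_def by blast
  show ?thesis unfolding cohomologous_def
    using assms h diff_carrier[OF assms(1,2) h(1)]
    by (intro bexI[of _ "\<ominus>\<^bsub>dg_hom C a b\<^esub> h"]) (auto simp: diff_minus M.a_assoc M.r_neg)
qed

lemma cohomologous_trans:
  assumes "a \<in> dg_obj C" "b \<in> dg_obj C" "k \<in> carrier (dg_hom C a b)"
    "cohomologous C a b f g" "cohomologous C a b g k"
  shows "cohomologous C a b f k"
proof -
  interpret M: abelian_group "dg_hom C a b" using hom_abelian_group assms by blast
  obtain h h' where h: "h \<in> carrier (dg_hom C a b)" "f = g \<oplus>\<^bsub>dg_hom C a b\<^esub> dg_diff C a b h"
    "h' \<in> carrier (dg_hom C a b)" "g = k \<oplus>\<^bsub>dg_hom C a b\<^esub> dg_diff C a b h'"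
    using assms unfolding cohomologous_def by blast
  show ?thesis unfolding cohomologous_def
    using assms h diff_carrier
    by (intro bexI[of _ "h' \<oplus>\<^bsub>dg_hom C a b\<^esub> h"]) (auto simp: diff_add M.a_assoc)
qed

lemma coh_class_eqI:
  assumes "a \<in> dg_obj C" "b \<in> dg_obj C" "f \<in> cocycles C a b" "g \<in> cocycles C a b"
    "cohomologous C a b f g"
  shows "coh_class C a b f = coh_class C a b g"
proof -
  have "cohomologous C a b g f" using assms cohomologous_sym unfolding cocycles_def by blast
  then show ?thesis
    using assms cohomologous_trans unfolding coh_class_def cocycles_def by blast
qed

lemma cohomologous_if_coh_class_eq:
  assumes "a \<in> dg_obj C" "b \<in> dg_obj C" "f \<in> cocycles C a b"
    "coh_class C a b f = coh_class C a b g"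
  shows "cohomologous C a b f g"
proof -
  have "f \<in> coh_class C a b f"
    using assms cohomologous_refl unfolding coh_class_def cocycles_def by blast
  then show ?thesis using assms(4) unfolding coh_class_def by blast
qed

text \<open>Stronger than \<open>coh_identity\<close>, which holds only up to boundaries. The
  homotopies below expand \<open>f \<circ> e\<close> with \<open>e = u + dg\<close> and therefore
  need \<open>f \<circ> e = f\<close> exactly.\<close>

definition strict_identity :: "'o \<Rightarrow> 'm \<Rightarrow> bool" where
  "strict_identity a e \<longleftrightarrow> e \<in> dg_deg C a a 0 \<and>
     (\<forall>b \<in> dg_obj C. \<forall>f \<in> carrier (dg_hom C a b). dg_comp C a a b f e = f) \<and>
     (\<forall>b \<in> dg_obj C. \<forall>f \<in> carrier (dg_hom C b a). dg_comp C b a a e f = f)"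

text \<open>Leibniz applied to \<open>e \<circ> e = e\<close> gives \<open>de = de + de\<close>,
  because \<open>e\<close> is even and a unit on both sides.\<close>

lemma strict_identity_closed:
  assumes "a \<in> dg_obj C" "strict_identity a e"
  shows "dg_diff C a a e = \<zero>\<^bsub>dg_hom C a a\<^esub>"
proof -
  interpret M: abelian_group "dg_hom C a a" using hom_abelian_group assms by blast
  have e: "e \<in> carrier (dg_hom C a a)" "e \<in> dg_deg C a a 0"
    using assms deg_carrier unfolding strict_identity_def by blast+
  have "dg_diff C a a e = dg_diff C a a e \<oplus>\<^bsub>dg_hom C a a\<^esub> dg_diff C a a e"
    using leibniz[of a a a e e 0] e assms diff_carrier[of a a e]
    unfolding strict_identity_def by simp
  then show ?thesis using diff_carrier[of a a e] e assms by simp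
qed

lemma strict_identity_coh_identity:
  assumes "a \<in> dg_obj C" "strict_identity a e"
  shows "coh_identity C a e"
  using assms strict_identity_closed[OF assms] cohomologous_refl deg_carrier
  unfolding coh_identity_def strict_identity_def cocycles_def by auto

text \<open>The homotopy \<open>h\<close> is \<open>\<plusminus> f \<circ> g\<close>, with the sign given by the degree of \<open>f\<close>.\<close>

lemma right_unit_up_to_homotopy:
  assumes o: "a \<in> dg_obj C" "b \<in> dg_obj C" and e: "strict_identity a e"
    and u: "u \<in> carrier (dg_hom C a a)" and g: "g \<in> carrier (dg_hom C a a)"
    and eug: "e = u \<oplus>\<^bsub>dg_hom C a a\<^esub> dg_diff C a a g"
    and f: "f0 \<in> dg_deg C a b 0" "f1 \<in> dg_deg C a b 1" "f = f0 \<oplus>\<^bsub>dg_hom C a b\<^esub> f1"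
    and cf: "f \<in> cocycles C a b"
    and h: "h = dg_comp C a a b f0 g \<oplus>\<^bsub>dg_hom C a b\<^esub> \<ominus>\<^bsub>dg_hom C a b\<^esub> dg_comp C a a b f1 g"
  shows "f = dg_comp C a a b f u \<oplus>\<^bsub>dg_hom C a b\<^esub> dg_diff C a b h"
proof -
  interpret M: abelian_group "dg_hom C a b" using hom_abelian_group o by blast
  interpret N: abelian_group "dg_hom C a a" using hom_abelian_group o by blast
  have f0: "f0 \<in> carrier (dg_hom C a b)" and f1: "f1 \<in> carrier (dg_hom C a b)"
    using f deg_carrier o by blast+
  have dg: "dg_diff C a a g \<in> carrier (dg_hom C a a)" using diff_carrier o g by blast
  have z: "dg_diff C a b f0 = \<zero>\<^bsub>dg_hom C a b\<^esub>" "dg_diff C a b f1 = \<zero>\<^bsub>dg_hom C a b\<^esub>"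
    using cocycle_parts[OF o f(1,2)] cf f(3) by auto
  have l0: "dg_diff C a b (dg_comp C a a b f0 g) = dg_comp C a a b f0 (dg_diff C a a g)"
    using leibniz[OF o(1,1,2) g f(1)] z o g f0 comp_carrier[OF o(1,1,2) dg f0]
    by (simp add: comp_zero_left)
  \<comment> \<open>The odd part picks up a sign from Leibniz; the minus sign in \<open>h\<close>
    compensates it.\<close>
  have l1: "dg_diff C a b (dg_comp C a a b f1 g) = \<ominus>\<^bsub>dg_hom C a b\<^esub> dg_comp C a a b f1 (dg_diff C a a g)"
    using leibniz[OF o(1,1,2) g f(2)] z o g f1 comp_carrier[OF o(1,1,2) dg f1]
    by (simp add: comp_zero_left)
  have c: "dg_comp C a a b f0 g \<in> carrier (dg_hom C a b)" "dg_comp C a a b f1 g \<in> carrier (dg_hom C a b)"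
    "dg_comp C a a b f1 (dg_diff C a a g) \<in> carrier (dg_hom C a b)"
    using comp_carrier o g f0 f1 dg by blast+
  have "dg_diff C a b h = dg_comp C a a b f (dg_diff C a a g)"
    unfolding h using c o f(3) f0 f1 dg
    by (simp add: diff_add diff_minus l0 l1 comp_add_left)
  moreover have "f = dg_comp C a a b f e"
    using e cf o unfolding strict_identity_def cocycles_def by auto
  moreover have "dg_comp C a a b f e = dg_comp C a a b f u \<oplus>\<^bsub>dg_hom C a b\<^esub> dg_comp C a a b f (dg_diff C a a g)"
    unfolding eug using comp_add_right o u dg cf unfolding cocycles_def by blast
  ultimately show ?thesis by simp
qed

text \<open>Leibniz asks for a homogeneous left factor, which here is \<open>g\<close>, so
  \<open>f\<close> need not be decomposed; the signed term contains \<open>df = 0\<close>.\<close>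

lemma left_unit_up_to_homotopy:
  assumes o: "a \<in> dg_obj C" "b \<in> dg_obj C" and e: "strict_identity b e"
    and u: "u \<in> carrier (dg_hom C b b)" and g: "g \<in> dg_deg C b b 1"
    and eug: "e = u \<oplus>\<^bsub>dg_hom C b b\<^esub> dg_diff C b b g"
    and cf: "f \<in> cocycles C a b"
  shows "f = dg_comp C a b b u f \<oplus>\<^bsub>dg_hom C a b\<^esub> dg_diff C a b (dg_comp C a b b g f)"
proof -
  interpret M: abelian_group "dg_hom C a b" using hom_abelian_group o by blast
  interpret N: abelian_group "dg_hom C b b" using hom_abelian_group o by blast
  have f: "f \<in> carrier (dg_hom C a b)" "dg_diff C a b f = \<zero>\<^bsub>dg_hom C a b\<^esub>"
    using cf unfolding cocycles_def by auto
  have gc: "g \<in> carrier (dg_hom C b b)" using g deg_carrier o by blast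
  have dg: "dg_diff C b b g \<in> carrier (dg_hom C b b)" using diff_carrier o gc by blast
  have "dg_diff C a b (dg_comp C a b b g f) = dg_comp C a b b (dg_diff C b b g) f"
    using leibniz[OF o(1,2,2) f(1) g] f o gc comp_carrier[OF o(1,2,2) f(1) dg]
    by (simp add: comp_zero_right)
  moreover have "f = dg_comp C a b b e f" using e f o unfolding strict_identity_def by auto
  moreover have "dg_comp C a b b e f
      = dg_comp C a b b u f \<oplus>\<^bsub>dg_hom C a b\<^esub> dg_comp C a b b (dg_diff C b b g) f"
    unfolding eug using comp_add_left o u dg f by blast
  ultimately show ?thesis by simp
qed

end

section \<open>Restriction to an ideal that contains the identities up to homotopy\<close>

definition dg_restrict :: "('o, 'm, 'r) dg_cat \<Rightarrow> ('o \<Rightarrow> 'o \<Rightarrow> 'm set) \<Rightarrow> ('o, 'm, 'r) dg_cat" where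
  "dg_restrict D S =
     \<lparr> dg_obj = dg_obj D, dg_hom = (\<lambda>a b. (dg_hom D a b)\<lparr>carrier := S a b\<rparr>),
       dg_deg = (\<lambda>a b s. dg_deg D a b s \<inter> S a b), dg_diff = dg_diff D, dg_comp = dg_comp D \<rparr>"

text \<open>The closure conditions make \<open>S\<close> a two-sided dg-ideal stable under parity
  projections. The substantial condition is \<open>unit\<close>. There \<open>g\<close> may lie
  outside \<open>S\<close>; only its composites with members of \<open>S\<close> have to lie in
  \<open>S\<close>.\<close>

locale unital_dg_ideal = dg_category R D
  for R :: "('r, 'z) ring_scheme" and D :: "('o, 'm, 'r) dg_cat" +
  fixes S :: "'o \<Rightarrow> 'o \<Rightarrow> 'm set"
  assumes sub: "\<lbrakk>a \<in> dg_obj D; b \<in> dg_obj D\<rbrakk> \<Longrightarrow> submodule (S a b) R (dg_hom D a b)"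
    and parts: "\<lbrakk>a \<in> dg_obj D; b \<in> dg_obj D; f0 \<in> dg_deg D a b 0; f1 \<in> dg_deg D a b 1;
        f0 \<oplus>\<^bsub>dg_hom D a b\<^esub> f1 \<in> S a b\<rbrakk> \<Longrightarrow> f0 \<in> S a b \<and> f1 \<in> S a b"
    and diff_closed: "\<lbrakk>a \<in> dg_obj D; b \<in> dg_obj D; f \<in> S a b\<rbrakk> \<Longrightarrow> dg_diff D a b f \<in> S a b"
    and comp_left: "\<lbrakk>a \<in> dg_obj D; b \<in> dg_obj D; c \<in> dg_obj D; f \<in> S a b; g \<in> carrier (dg_hom D b c)\<rbrakk> \<Longrightarrow>
        dg_comp D a b c g f \<in> S a c"
    and comp_right: "\<lbrakk>a \<in> dg_obj D; b \<in> dg_obj D; c \<in> dg_obj D; f \<in> carrier (dg_hom D a b); g \<in> S b c\<rbrakk> \<Longrightarrow>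
        dg_comp D a b c g f \<in> S a c"
    and unit: "a \<in> dg_obj D \<Longrightarrow> \<exists>e u g. strict_identity a e \<and> u \<in> dg_deg D a a 0 \<inter> S a a \<and>
        g \<in> dg_deg D a a 1 \<and> e = u \<oplus>\<^bsub>dg_hom D a a\<^esub> dg_diff D a a g"
begin

abbreviation "I \<equiv> dg_restrict D S"

lemma sub_carrier: "\<lbrakk>a \<in> dg_obj D; b \<in> dg_obj D; f \<in> S a b\<rbrakk> \<Longrightarrow> f \<in> carrier (dg_hom D a b)"
  using submodule_carrier[OF sub] by blast

text \<open>Additive inverses are defined relative to a carrier, so their agreement after shrinking
  the carrier to \<open>S\<close> is a fact about subgroups.\<close>

lemma sub_minus:
  assumes "a \<in> dg_obj D" "b \<in> dg_obj D" "f \<in> S a b"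
  shows "\<ominus>\<^bsub>dg_hom D a b\<^esub> f \<in> S a b" "\<ominus>\<^bsub>(dg_hom D a b)\<lparr>carrier := S a b\<rparr>\<^esub> f = \<ominus>\<^bsub>dg_hom D a b\<^esub> f"
proof -
  interpret M: abelian_group "dg_hom D a b" using hom_abelian_group assms by blast
  have s: "subgroup (S a b) (add_monoid (dg_hom D a b))"
    using sub[OF assms(1,2)] by (simp add: submodule_def)
  show "\<ominus>\<^bsub>dg_hom D a b\<^esub> f \<in> S a b"
    using subgroup.m_inv_closed[OF s assms(3)] by (simp add: a_inv_def)
  show "\<ominus>\<^bsub>(dg_hom D a b)\<lparr>carrier := S a b\<rparr>\<^esub> f = \<ominus>\<^bsub>dg_hom D a b\<^esub> f"
    using group.m_inv_consistent[OF M.a_group s assms(3)] by (simp add: a_inv_def)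
qed

lemma sub_add: "\<lbrakk>a \<in> dg_obj D; b \<in> dg_obj D; f \<in> S a b; g \<in> S a b\<rbrakk> \<Longrightarrow> f \<oplus>\<^bsub>dg_hom D a b\<^esub> g \<in> S a b"
  using sub unfolding submodule_def by (metis monoid.simps(1) subgroup.m_closed)

lemma I_simps: "dg_obj I = dg_obj D" "carrier (dg_hom I a b) = S a b"
  "dg_deg I a b s = dg_deg D a b s \<inter> S a b" "dg_diff I = dg_diff D" "dg_comp I = dg_comp D"
  "(\<oplus>\<^bsub>dg_hom I a b\<^esub>) = (\<oplus>\<^bsub>dg_hom D a b\<^esub>)" "\<zero>\<^bsub>dg_hom I a b\<^esub> = \<zero>\<^bsub>dg_hom D a b\<^esub>"
  "(\<odot>\<^bsub>dg_hom I a b\<^esub>) = (\<odot>\<^bsub>dg_hom D a b\<^esub>)"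
  "\<lbrakk>a \<in> dg_obj D; b \<in> dg_obj D; f \<in> S a b\<rbrakk> \<Longrightarrow> \<ominus>\<^bsub>dg_hom I a b\<^esub> f = \<ominus>\<^bsub>dg_hom D a b\<^esub> f"
  using sub_minus(2) by (auto simp: dg_restrict_def)

lemma cocycles_I: "\<lbrakk>a \<in> dg_obj D; b \<in> dg_obj D\<rbrakk> \<Longrightarrow> cocycles I a b = cocycles D a b \<inter> S a b"
  using sub_carrier unfolding cocycles_def I_simps by blast

lemma cohomologous_I: "\<lbrakk>a \<in> dg_obj D; b \<in> dg_obj D; cohomologous I a b f g\<rbrakk> \<Longrightarrow> cohomologous D a b f g"
  using sub_carrier unfolding cohomologous_def I_simps by blast

text \<open>The primitives are composites with \<open>g\<close>. They lie in the ideal as soon as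
  \<open>f\<close> does, so one primitive serves in \<open>D\<close> and in the ideal; hence each
  relation appears twice.\<close>

lemma unit_homotopies:
  assumes "a \<in> dg_obj D" "strict_identity a e" "u \<in> dg_deg D a a 0 \<inter> S a a"
    "g \<in> dg_deg D a a 1" "e = u \<oplus>\<^bsub>dg_hom D a a\<^esub> dg_diff D a a g"
  shows "u \<in> cocycles I a a"
    and "\<And>b f. b \<in> dg_obj D \<Longrightarrow> f \<in> cocycles D a b \<Longrightarrow> cohomologous D a b f (dg_comp D a a b f u)"
    and "\<And>b f. b \<in> dg_obj D \<Longrightarrow> f \<in> cocycles I a b \<Longrightarrow> cohomologous I a b f (dg_comp D a a b f u)"
    and "\<And>b f. b \<in> dg_obj D \<Longrightarrow> f \<in> cocycles D b a \<Longrightarrow> cohomologous D b a f (dg_comp D b a a u f)"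
    and "\<And>b f. b \<in> dg_obj D \<Longrightarrow> f \<in> cocycles I b a \<Longrightarrow> cohomologous I b a f (dg_comp D b a a u f)"
proof -
  interpret M: abelian_group "dg_hom D a a" using hom_abelian_group assms by blast
  have uc: "u \<in> carrier (dg_hom D a a)" and gc: "g \<in> carrier (dg_hom D a a)"
    using assms deg_carrier by blast+
  have dg: "dg_diff D a a g \<in> carrier (dg_hom D a a)" using diff_carrier gc assms by blast
  \<comment> \<open>Since \<open>d(dg) = 0\<close>, \<open>u\<close> inherits closedness from
    \<open>e\<close>.\<close>
  have "dg_diff D a a e = dg_diff D a a u"
    unfolding assms(5) using uc dg gc assms(1) diff_carrier[OF assms(1,1) uc]
    by (simp add: diff_add diff_diff)
  then show "u \<in> cocycles I a a"
    using strict_identity_closed[OF assms(1,2)] assms uc unfolding cocycles_I[OF assms(1,1)]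
    by (simp add: cocycles_def)
  fix b assume b: "b \<in> dg_obj D"
  interpret N: abelian_group "dg_hom D a b" using hom_abelian_group assms b by blast
  { fix f assume f: "f \<in> cocycles D a b"
    obtain f0 f1 where f01: "f0 \<in> dg_deg D a b 0" "f1 \<in> dg_deg D a b 1" "f = f0 \<oplus>\<^bsub>dg_hom D a b\<^esub> f1"
      using deg_parts assms b f unfolding cocycles_def by blast
    let ?h = "dg_comp D a a b f0 g \<oplus>\<^bsub>dg_hom D a b\<^esub> \<ominus>\<^bsub>dg_hom D a b\<^esub> dg_comp D a a b f1 g"
    have eq: "f = dg_comp D a a b f u \<oplus>\<^bsub>dg_hom D a b\<^esub> dg_diff D a b ?h"
      using right_unit_up_to_homotopy[OF assms(1) b assms(2) uc gc assms(5) f01 f] by blast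
    have "?h \<in> carrier (dg_hom D a b)"
      using f01 comp_carrier[OF assms(1,1) b gc] deg_carrier[OF assms(1) b] by blast
    then have 1: "cohomologous D a b f (dg_comp D a a b f u)"
      using eq unfolding cohomologous_def by blast
    have "cohomologous I a b f (dg_comp D a a b f u)" if "f \<in> S a b"
    proof -
    from that have "f0 \<in> S a b \<and> f1 \<in> S a b" using parts[OF assms(1) b f01(1,2)] f01(3) by blast
    then have "?h \<in> S a b"
      using comp_right[OF assms(1,1) b gc] sub_add[OF assms(1) b] sub_minus(1)[OF assms(1) b] by blast
    then show ?thesis using eq unfolding cohomologous_def I_simps by blast
    qed
    with 1 have "cohomologous D a b f (dg_comp D a a b f u) \<and>
        (f \<in> S a b \<longrightarrow> cohomologous I a b f (dg_comp D a a b f u))" by blast }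
  note right = this
  show "\<And>f. f \<in> cocycles D a b \<Longrightarrow> cohomologous D a b f (dg_comp D a a b f u)"
    using right by blast
  show "\<And>f. f \<in> cocycles I a b \<Longrightarrow> cohomologous I a b f (dg_comp D a a b f u)"
    using right cocycles_I[OF assms(1) b] by auto
  { fix f assume f: "f \<in> cocycles D b a"
    let ?h = "dg_comp D b a a g f"
    have eq: "f = dg_comp D b a a u f \<oplus>\<^bsub>dg_hom D b a\<^esub> dg_diff D b a ?h"
      using left_unit_up_to_homotopy[OF b assms(1,2) uc assms(4,5) f] by blast
    have "?h \<in> carrier (dg_hom D b a)"
      using comp_carrier[OF b assms(1,1)] gc f unfolding cocycles_def by blast
    then have 1: "cohomologous D b a f (dg_comp D b a a u f)"
      using eq unfolding cohomologous_def by blast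
    have "cohomologous I b a f (dg_comp D b a a u f)" if "f \<in> S b a"
    proof -
    from that have "?h \<in> S b a"
      using comp_left[OF b assms(1,1)] gc by blast
    then show ?thesis using eq unfolding cohomologous_def I_simps by blast
    qed
    with 1 have "cohomologous D b a f (dg_comp D b a a u f) \<and>
        (f \<in> S b a \<longrightarrow> cohomologous I b a f (dg_comp D b a a u f))" by blast }
  note left = this
  show "\<And>f. f \<in> cocycles D b a \<Longrightarrow> cohomologous D b a f (dg_comp D b a a u f)"
    using left by blast
  show "\<And>f. f \<in> cocycles I b a \<Longrightarrow> cohomologous I b a f (dg_comp D b a a u f)"
    using left cocycles_I[OF b assms(1)] by auto
qed

lemma unit_coh_identity:
  assumes "a \<in> dg_obj D" "strict_identity a e" "u \<in> dg_deg D a a 0 \<inter> S a a"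
    "g \<in> dg_deg D a a 1" "e = u \<oplus>\<^bsub>dg_hom D a a\<^esub> dg_diff D a a g"
  shows "\<And>b f. b \<in> dg_obj D \<Longrightarrow> f \<in> cocycles I a b \<Longrightarrow> cohomologous I a b (dg_comp D a a b f u) f"
    and "\<And>b f. b \<in> dg_obj D \<Longrightarrow> f \<in> cocycles I b a \<Longrightarrow> cohomologous I b a (dg_comp D b a a u f) f"
proof -
  \<comment> \<open>Symmetry is proved by hand: \<open>cohomologous_sym\<close> would require
    \<open>I\<close> to be a dg-category, and this lemma supplies the cohomological units for
    that.\<close>
  have *: "cohomologous I b c f' f"
    if ff: "cohomologous I b c f f'" and "b \<in> dg_obj D" "c \<in> dg_obj D" "f \<in> S b c" "f' \<in> S b c" for b c f f'
  proof -
    interpret M: abelian_group "dg_hom D b c" using hom_abelian_group that by blast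
    obtain h where h: "h \<in> S b c" "f = f' \<oplus>\<^bsub>dg_hom D b c\<^esub> dg_diff D b c h"
      using ff unfolding cohomologous_def I_simps by blast
    then have c: "h \<in> carrier (dg_hom D b c)" "f' \<in> carrier (dg_hom D b c)"
      "dg_diff D b c h \<in> carrier (dg_hom D b c)"
      using that sub_carrier diff_carrier by blast+
    then have "f' = f \<oplus>\<^bsub>dg_hom D b c\<^esub> dg_diff D b c (\<ominus>\<^bsub>dg_hom D b c\<^esub> h)"
      using h that by (simp add: diff_minus M.a_assoc M.r_neg)
    then show ?thesis
      unfolding cohomologous_def I_simps using sub_minus(1) h that by blast
  qed
  have uS: "u \<in> S a a" using assms by blast
  fix b f assume b: "b \<in> dg_obj D"
  { assume f: "f \<in> cocycles I a b"
    then have "f \<in> S a b" "dg_comp D a a b f u \<in> S a b"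
      using comp_left[OF assms(1,1) b uS] sub_carrier[OF assms(1) b] unfolding cocycles_def I_simps by auto
    with unit_homotopies(3)[OF assms b f] show "cohomologous I a b (dg_comp D a a b f u) f"
      using * assms(1) b by blast }
  { assume f: "f \<in> cocycles I b a"
    then have "f \<in> S b a" "dg_comp D b a a u f \<in> S b a"
      using comp_right[OF b assms(1,1) _ uS] sub_carrier[OF b assms(1)] unfolding cocycles_def I_simps by auto
    with unit_homotopies(5)[OF assms b f] show "cohomologous I b a (dg_comp D b a a u f) f"
      using * assms(1) b by blast }
qed

text \<open>Goals come in the order of the axioms of \<open>dg_category\<close>. The identities are
  inherited; the work is closure under the operations and, in case 15, a cohomological unit in place
  of a strict one.\<close>

lemma restrict_dg_category: "dg_category R I"
proof (intro dg_category.intro, goal_cases)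
  case (1 a b)
  then have o: "a \<in> dg_obj D" "b \<in> dg_obj D" by (auto simp: I_simps)
  show ?case
    using submodule.submodule_is_module[OF sub[OF o] hom_module[OF o]] by (simp add: dg_restrict_def)
next
  case (2 a b s)
  then have o: "a \<in> dg_obj D" "b \<in> dg_obj D" by (auto simp: I_simps)
  interpret M: abelian_group "dg_hom D a b" using hom_abelian_group o by blast
  have s: "submodule (dg_deg D a b s) R (dg_hom D a b)" "submodule (S a b) R (dg_hom D a b)"
    using sub deg_submodule o by auto
  then have "subgroup (dg_deg D a b s \<inter> S a b) (add_monoid (dg_hom D a b))"
    using group.subgroups_Inter_pair[OF M.a_group] by (simp add: submodule_def)
  then have "subgroup (dg_deg D a b s \<inter> S a b) ((add_monoid (dg_hom D a b))\<lparr>carrier := S a b\<rparr>)"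
    using group.subgroup_incl[OF M.a_group] s by (simp add: submodule_def)
  then show ?case
    using s by (auto simp: submodule_def submodule_axioms_def dg_restrict_def)
next
  case (3 a b f)
  then have o: "a \<in> dg_obj D" "b \<in> dg_obj D" "f \<in> S a b" by (auto simp: I_simps)
  obtain f0 f1 where f: "f0 \<in> dg_deg D a b 0" "f1 \<in> dg_deg D a b 1" "f = f0 \<oplus>\<^bsub>dg_hom D a b\<^esub> f1"
    using deg_parts[OF o(1,2) sub_carrier[OF o]] by blast
  then have "f0 \<in> S a b \<and> f1 \<in> S a b" using parts o by metis
  then show ?case
    unfolding I_simps using f deg_parts_unique[OF o(1,2)] by (intro ex1I[of _ "(f0, f1)"]) auto
next
  case (4 a b f s)
  then show ?case using diff_deg[of a b f s] diff_closed by (simp add: I_simps)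
next
  case (8 a b c f s g t)
  then show ?case using comp_deg[of a b c f s g t] comp_left sub_carrier by (simp add: I_simps)
next
  case (13 a b c d f g h)
  then show ?case using sub_carrier by (simp add: I_simps comp_assoc)
next
  case (14 a b c f g s)
  then have o: "a \<in> dg_obj D" "b \<in> dg_obj D" "c \<in> dg_obj D" "f \<in> S a b" "g \<in> dg_deg D b c s" "g \<in> S b c"
    by (auto simp: I_simps)
  then have "dg_comp D a b c g (dg_diff D a b f) \<in> S a c"
    using comp_left diff_closed sub_carrier by meson
  then show ?case using leibniz[of a b c f g s] o sub_carrier by (simp add: I_simps)
next
  case (15 a)
  then have a: "a \<in> dg_obj D" by (simp add: I_simps)
  obtain e u g where eug: "strict_identity a e" "u \<in> dg_deg D a a 0 \<inter> S a a"
    "g \<in> dg_deg D a a 1" "e = u \<oplus>\<^bsub>dg_hom D a a\<^esub> dg_diff D a a g"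
    using unit[OF a] by blast
  have "coh_identity I a u"
    using unit_coh_identity[OF a eug] unit_homotopies(1)[OF a eug] eug(2)
    unfolding coh_identity_def by (simp add: I_simps)
  then show ?case by blast
qed (use sub_carrier comp_left comp_right diff_closed in
    \<open>auto simp: I_simps diff_add diff_smult diff_diff comp_add_right comp_add_left
      comp_smult_right comp_smult_left\<close>)

text \<open>As a unit, \<open>w\<close> is known only against cocycles of the ideal, while the claim
  tests it against all of \<open>D\<close>. In cohomology \<open>w = w u = u = e\<close>, so
  \<open>w\<close> differs from a strict identity by a boundary and the homotopy lemmas apply to
  it.\<close>

lemma coh_identity_restrict:
  assumes a: "a \<in> dg_obj D" and w: "coh_identity I a w"
  shows "coh_identity D a w"
proof -
  interpret I: dg_category R I by (rule restrict_dg_category)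
  interpret M: abelian_group "dg_hom D a a" using hom_abelian_group a by blast
  obtain e u g where eug: "strict_identity a e" "u \<in> dg_deg D a a 0 \<inter> S a a"
    "g \<in> dg_deg D a a 1" "e = u \<oplus>\<^bsub>dg_hom D a a\<^esub> dg_diff D a a g"
    using unit[OF a] by blast
  have wS: "w \<in> S a a" "w \<in> cocycles I a a" "w \<in> dg_deg D a a 0"
    using w unfolding coh_identity_def cocycles_def I_simps by auto
  have wD: "w \<in> cocycles D a a" using wS cocycles_I a by blast
  have u: "u \<in> cocycles I a a" by (rule unit_homotopies(1)[OF a eug])
  then have uS: "u \<in> S a a" "u \<in> carrier (dg_hom D a a)" using a eug sub_carrier by blast+
  have wu: "dg_comp D a a a w u \<in> S a a" using comp_left[OF a a a uS(1)] wS sub_carrier a by blast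
  have "cohomologous I a a w (dg_comp D a a a w u)" using unit_homotopies(3)[OF a eug a wS(2)] .
  moreover have "cohomologous I a a (dg_comp D a a a w u) u"
    using w u a unfolding coh_identity_def I_simps by blast
  ultimately have "cohomologous I a a w u"
    using I.cohomologous_trans[of a a u] a uS by (simp add: I_simps)
  then have wu: "cohomologous D a a w u" using cohomologous_I a by blast
  have ec: "e \<in> carrier (dg_hom D a a)" using eug(1) a deg_carrier unfolding strict_identity_def by blast
  have "cohomologous D a a e u"
    unfolding cohomologous_def using eug deg_carrier a by blast
  then have "cohomologous D a a u e" using cohomologous_sym a uS by blast
  with wu have "cohomologous D a a w e" using cohomologous_trans[OF a a ec] by blast
  then have "cohomologous D a a e w" using cohomologous_sym[OF a a ec] by blast
  then obtain k where k: "k \<in> carrier (dg_hom D a a)" "e = w \<oplus>\<^bsub>dg_hom D a a\<^esub> dg_diff D a a k"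
    unfolding cohomologous_def by blast
  \<comment> \<open>The even part of \<open>e = w + dk\<close> involves only \<open>dk1\<close>, so
    the primitive may be taken odd, as \<open>left_unit_up_to_homotopy\<close> requires.\<close>
  obtain k0 k1 where kk: "k0 \<in> dg_deg D a a 0" "k1 \<in> dg_deg D a a 1" "k = k0 \<oplus>\<^bsub>dg_hom D a a\<^esub> k1"
    using deg_parts[OF a a k(1)] by blast
  have kc: "k0 \<in> carrier (dg_hom D a a)" "k1 \<in> carrier (dg_hom D a a)"
    using kk deg_carrier a by blast+
  have dk: "dg_diff D a a k0 \<in> dg_deg D a a 1" "dg_diff D a a k1 \<in> dg_deg D a a 0"
    using diff_deg[OF a a kk(1)] diff_deg[OF a a kk(2)] by simp_all
  have cc: "dg_diff D a a k0 \<in> carrier (dg_hom D a a)" "dg_diff D a a k1 \<in> carrier (dg_hom D a a)"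
    "w \<in> carrier (dg_hom D a a)"
    using dk deg_carrier a wS by blast+
  have 1: "w \<oplus>\<^bsub>dg_hom D a a\<^esub> dg_diff D a a k1 \<in> dg_deg D a a 0"
    using deg_submodule[OF a a, of 0] dk wS unfolding submodule_def
    by (metis monoid.simps(1) subgroup.m_closed)
  have "e \<oplus>\<^bsub>dg_hom D a a\<^esub> \<zero>\<^bsub>dg_hom D a a\<^esub>
      = (w \<oplus>\<^bsub>dg_hom D a a\<^esub> dg_diff D a a k1) \<oplus>\<^bsub>dg_hom D a a\<^esub> dg_diff D a a k0"
    unfolding k(2) kk(3) using cc kc a by (simp add: diff_add M.a_ac)
  moreover have "e \<in> dg_deg D a a 0" using eug(1) unfolding strict_identity_def by blast
  ultimately have ek: "e = w \<oplus>\<^bsub>dg_hom D a a\<^esub> dg_diff D a a k1"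
    using deg_parts_unique(1)[OF a a _ deg_zero[OF a a] 1 dk(1)] by blast
  have "cohomologous D a b (dg_comp D a a b f w) f" if b: "b \<in> dg_obj D" and "f \<in> cocycles D a b" for b f
  proof -
    have f: "f \<in> carrier (dg_hom D a b)" using that unfolding cocycles_def by blast
    obtain f0 f1 where f01: "f0 \<in> dg_deg D a b 0" "f1 \<in> dg_deg D a b 1" "f = f0 \<oplus>\<^bsub>dg_hom D a b\<^esub> f1"
      using deg_parts[OF a b f] by blast
    interpret N: abelian_group "dg_hom D a b" using hom_abelian_group a that by blast
    let ?h = "dg_comp D a a b f0 k1 \<oplus>\<^bsub>dg_hom D a b\<^esub> \<ominus>\<^bsub>dg_hom D a b\<^esub> dg_comp D a a b f1 k1"
    have "?h \<in> carrier (dg_hom D a b)"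
      using f01 comp_carrier[OF a a that(1) kc(2)] deg_carrier[OF a that(1)] by blast
    moreover have "f = dg_comp D a a b f w \<oplus>\<^bsub>dg_hom D a b\<^esub> dg_diff D a b ?h"
      using right_unit_up_to_homotopy[OF a that(1) eug(1) cc(3) kc(2) ek f01 that(2) refl] .
    ultimately have "cohomologous D a b f (dg_comp D a a b f w)" unfolding cohomologous_def by blast
    then show ?thesis
      using cohomologous_sym[OF a that(1) comp_carrier[OF a a that(1) cc(3) f]] by blast
  qed
  moreover have "cohomologous D b a (dg_comp D b a a w f) f" if "b \<in> dg_obj D" "f \<in> cocycles D b a" for b f
  proof -
    have f: "f \<in> carrier (dg_hom D b a)" using that unfolding cocycles_def by blast
    have "f = dg_comp D b a a w f \<oplus>\<^bsub>dg_hom D b a\<^esub> dg_diff D b a (dg_comp D b a a k1 f)"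
      using left_unit_up_to_homotopy[OF that(1) a eug(1) cc(3) kk(2) ek that(2)] .
    then have "cohomologous D b a f (dg_comp D b a a w f)"
      using comp_carrier[OF that(1) a a f kc(2)] unfolding cohomologous_def by blast
    then show ?thesis
      using cohomologous_sym[OF that(1) a comp_carrier[OF that(1) a a f cc(3)]] by blast
  qed
  ultimately show ?thesis using wD wS unfolding coh_identity_def by blast
qed

text \<open>Provides a representative inside the ideal for any class. Both terms of the Leibniz rule
  vanish on each parity part of \<open>f\<close>.\<close>

lemma comp_unit_cocycle:
  assumes "a \<in> dg_obj D" "b \<in> dg_obj D" "u \<in> cocycles I a a" "f \<in> cocycles D a b"
  shows "dg_comp D a a b f u \<in> cocycles I a b"
proof -
  interpret M: abelian_group "dg_hom D a b" using hom_abelian_group assms by blast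
  interpret N: abelian_group "dg_hom D a a" using hom_abelian_group assms by blast
  have f: "f \<in> carrier (dg_hom D a b)" "dg_diff D a b f = \<zero>\<^bsub>dg_hom D a b\<^esub>"
    using assms unfolding cocycles_def by auto
  have u: "u \<in> S a a" "u \<in> carrier (dg_hom D a a)" "dg_diff D a a u = \<zero>\<^bsub>dg_hom D a a\<^esub>"
    using assms sub_carrier unfolding cocycles_def I_simps by auto
  obtain f0 f1 where f01: "f0 \<in> dg_deg D a b 0" "f1 \<in> dg_deg D a b 1" "f = f0 \<oplus>\<^bsub>dg_hom D a b\<^esub> f1"
    using deg_parts assms f by blast
  have c: "f0 \<in> carrier (dg_hom D a b)" "f1 \<in> carrier (dg_hom D a b)"
    using f01 deg_carrier assms by blast+
  have z: "dg_diff D a b f0 = \<zero>\<^bsub>dg_hom D a b\<^esub>" "dg_diff D a b f1 = \<zero>\<^bsub>dg_hom D a b\<^esub>"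
    using cocycle_parts[OF assms(1,2) f01(1,2)] assms(4) f01(3) by auto
  have "dg_diff D a b (dg_comp D a a b f0 u) = \<zero>\<^bsub>dg_hom D a b\<^esub>"
    "dg_diff D a b (dg_comp D a a b f1 u) = \<zero>\<^bsub>dg_hom D a b\<^esub>"
    using leibniz[OF assms(1,1,2) u(2) f01(1)] leibniz[OF assms(1,1,2) u(2) f01(2)] z u c assms
    by (auto simp: comp_zero_left comp_zero_right)
  then have "dg_diff D a b (dg_comp D a a b f u) = \<zero>\<^bsub>dg_hom D a b\<^esub>"
    unfolding f01(3) using c u assms comp_carrier[OF assms(1,1,2) u(2)]
    by (simp add: comp_add_left diff_add)
  moreover have "dg_comp D a a b f u \<in> S a b" using comp_left[OF assms(1,1,2) u(1) f(1)] .
  ultimately show ?thesis unfolding cocycles_def I_simps by blast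
qed

text \<open>Composition with \<open>u\<close> on the right is a homotopy inverse of the inclusion on
  each morphism space.\<close>

lemma inclusion_quasi_equivalence: "quasi_equivalence R I D (\<lambda>a. a) (\<lambda>a b f. f)"
proof -
  interpret I: dg_category R I by (rule restrict_dg_category)
  interpret F: dg_functor R I D "\<lambda>a. a" "\<lambda>a b f. f"
  proof (intro dg_functor.intro dg_functor_axioms.intro, goal_cases)
    case 1 show ?case by (rule restrict_dg_category)
  next
    case 2 show ?case by (rule dg_category_axioms)
  next
    case (9 a u) then show ?case using coh_identity_restrict by (simp add: I_simps)
  qed (simp_all add: I_simps)
  show ?thesis
  proof (intro quasi_equivalence.intro quasi_equivalence_axioms.intro F.dg_functor_axioms, goal_cases)
    case (1 a b)
    then have o: "a \<in> dg_obj D" "b \<in> dg_obj D" by (auto simp: I_simps)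
    obtain e u g where eug: "strict_identity a e" "u \<in> dg_deg D a a 0 \<inter> S a a"
      "g \<in> dg_deg D a a 1" "e = u \<oplus>\<^bsub>dg_hom D a a\<^esub> dg_diff D a a g"
      using unit[OF o(1)] by blast
    have u: "u \<in> cocycles I a a" by (rule unit_homotopies(1)[OF o(1) eug])
    have uS: "u \<in> S a a" "u \<in> carrier (dg_hom D a a)" using o eug sub_carrier by blast+
    let ?\<Phi> = "\<lambda>K. \<Union>f\<in>K. coh_class D a b f"
    \<comment> \<open>The union collapses to one class: representatives cohomologous in the ideal
      are cohomologous in \<open>D\<close>.\<close>
    have \<Phi>: "?\<Phi> (coh_class I a b f) = coh_class D a b f" if f: "f \<in> cocycles I a b" for f
    proof -
      have "f \<in> coh_class I a b f"
        using f I.cohomologous_refl[of a b f] 1 by (auto simp: coh_class_def cocycles_def)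
      moreover have "coh_class D a b f' = coh_class D a b f" if "f' \<in> coh_class I a b f" for f'
        using that f cocycles_I[OF o] cohomologous_I[OF o] coh_class_eqI[OF o]
        unfolding coh_class_def by (metis (no_types, lifting) IntD1 mem_Collect_eq)
      ultimately show ?thesis by (intro SUP_eq_const) blast+
    qed
    show ?case
      unfolding bij_betw_def
    proof
      show "inj_on ?\<Phi> (cohomology I a b)"
      proof (rule inj_onI)
        fix K K' assume "K \<in> cohomology I a b" "K' \<in> cohomology I a b" and eq: "?\<Phi> K = ?\<Phi> K'"
        then obtain f f' where f: "f \<in> cocycles I a b" "K = coh_class I a b f"
          "f' \<in> cocycles I a b" "K' = coh_class I a b f'"
          unfolding cohomology_def by blast
        then have "coh_class D a b f = coh_class D a b f'" using eq \<Phi> by simp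
        then have "cohomologous D a b f f'"
          using cohomologous_if_coh_class_eq[OF o] f cocycles_I[OF o] by blast
        then obtain h where h: "h \<in> carrier (dg_hom D a b)" "f = f' \<oplus>\<^bsub>dg_hom D a b\<^esub> dg_diff D a b h"
          unfolding cohomologous_def by blast
        have c: "f \<in> carrier (dg_hom D a b)" "f' \<in> carrier (dg_hom D a b)"
          using f sub_carrier[OF o] unfolding cocycles_def I_simps by auto
        obtain h0 h1 where h01: "h0 \<in> dg_deg D a b 0" "h1 \<in> dg_deg D a b 1" "h = h0 \<oplus>\<^bsub>dg_hom D a b\<^esub> h1"
          using deg_parts[OF o h(1)] by blast
        interpret M: abelian_group "dg_hom D a b" using hom_abelian_group o by blast
        interpret N: abelian_group "dg_hom D a a" using hom_abelian_group o by blast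
        have hc: "h0 \<in> carrier (dg_hom D a b)" "h1 \<in> carrier (dg_hom D a b)"
          using h01 deg_carrier o by blast+
        have uz: "dg_diff D a a u = \<zero>\<^bsub>dg_hom D a a\<^esub>"
          using u unfolding cocycles_def I_simps by simp
        have dh: "dg_diff D a b h \<in> carrier (dg_hom D a b)" using diff_carrier o h by blast
        have cc: "dg_comp D a a b (dg_diff D a b h0) u \<in> carrier (dg_hom D a b)"
          "dg_comp D a a b (dg_diff D a b h1) u \<in> carrier (dg_hom D a b)"
          "dg_comp D a a b h0 u \<in> carrier (dg_hom D a b)"
          "dg_comp D a a b h1 u \<in> carrier (dg_hom D a b)"
          using comp_carrier[OF o(1,1,2) uS(2)] diff_carrier[OF o] hc by blast+
        have "dg_diff D a b (dg_comp D a a b h0 u) = dg_comp D a a b (dg_diff D a b h0) u"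
          "dg_diff D a b (dg_comp D a a b h1 u) = dg_comp D a a b (dg_diff D a b h1) u"
          using leibniz[OF o(1,1,2) uS(2) h01(1)] leibniz[OF o(1,1,2) uS(2) h01(2)] uz hc o cc
          by (auto simp: comp_zero_right)
        then have "dg_diff D a b (dg_comp D a a b h u) = dg_comp D a a b (dg_diff D a b h) u"
          unfolding h01(3) using hc o cc diff_carrier[OF o] uS
          by (simp add: comp_add_left diff_add)
        then have "dg_comp D a a b f u = dg_comp D a a b f' u \<oplus>\<^bsub>dg_hom D a b\<^esub>
            dg_diff D a b (dg_comp D a a b h u)"
          using h(2) comp_add_left[OF o(1,1,2) uS(2) c(2) dh] by simp
        \<comment> \<open>The primitive \<open>h\<close> need not lie in the ideal, but
          \<open>h \<circ> u\<close> does.\<close>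
        moreover have "dg_comp D a a b h u \<in> S a b" using comp_left[OF o(1,1,2) uS(1) h(1)] .
        ultimately have 2: "cohomologous I a b (dg_comp D a a b f u) (dg_comp D a a b f' u)"
          unfolding cohomologous_def I_simps by blast
        have S: "f' \<in> S a b" "dg_comp D a a b f' u \<in> S a b"
          using f comp_left[OF o(1,1,2) uS(1) c(2)] unfolding cocycles_def I_simps by auto
        note 3 = unit_homotopies(3)[OF o(1) eug o(2) f(1)] unit_coh_identity(1)[OF o(1) eug o(2) f(3)]
        have "cohomologous I a b f (dg_comp D a a b f' u)"
          using I.cohomologous_trans[OF 1 _ 3(1) 2] S by (simp add: I_simps)
        then have "cohomologous I a b f f'"
          using I.cohomologous_trans[OF 1 _ _ 3(2)] S by (simp add: I_simps)
        then show "K = K'" using I.coh_class_eqI[OF 1 f(1,3)] f by simp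
      qed
      have "coh_class D a b f \<in> ?\<Phi> ` cohomology I a b" if f: "f \<in> cocycles D a b" for f
      proof -
        let ?f = "dg_comp D a a b f u"
        have fu: "?f \<in> cocycles I a b" using comp_unit_cocycle[OF o u f] .
        have "coh_class D a b f = coh_class D a b ?f"
          using coh_class_eqI[OF o f _ unit_homotopies(2)[OF o(1) eug o(2) f]] fu cocycles_I[OF o] by blast
        then show ?thesis using \<Phi>[OF fu] fu unfolding cohomology_def by blast
      qed
      then show "?\<Phi> ` cohomology I a b = cohomology D a b"
        using \<Phi> cocycles_I[OF o] unfolding cohomology_def by fastforce
    qed
  next
    case (2 b)
    \<comment> \<open>The inclusion is the identity on objects, so \<open>b\<close> is its own
      preimage and the strict identity serves as the isomorphism.\<close>
    obtain e where e: "strict_identity b e" using unit[OF 2] by blast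
    then have "e \<in> cocycles D b b \<inter> dg_deg D b b 0" "dg_comp D b b b e e = e"
      using strict_identity_coh_identity[OF 2 e] 2 deg_carrier[OF 2 2]
      unfolding coh_identity_def strict_identity_def by auto
    moreover have "coh_identity D b e" by (rule strict_identity_coh_identity[OF 2 e])
    ultimately have "coh_isomorphic D b b" unfolding coh_isomorphic_def by metis
    then show ?case using 2 by (intro bexI[of _ b]) (auto simp: I_simps)
  qed
qed

end

section \<open>Alternating forms as functions on lists\<close>

text \<open>The signed sum over all ways to move one entry to the front, as in the invariant formula
  for an exterior derivative. Recursion on the first entry turns sign rules into inductions;
  \<open>altsum_explicit\<close> gives the indexed form that \<open>dolbeault\<close> uses.\<close>

fun altsum :: "('v \<Rightarrow> 'v list \<Rightarrow> complex) \<Rightarrow> 'v list \<Rightarrow> complex" where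
  "altsum g [] = 0"
| "altsum g (v # vs) = g v vs - altsum (\<lambda>w ws. g w (v # ws)) vs"

lemma altsum_explicit:
  "altsum g vs = (\<Sum>k<length vs. (-1) ^ k * g (vs ! k) (take k vs @ drop (Suc k) vs))"
proof (induction vs arbitrary: g)
  case (Cons v vs)
  show ?case
    by (simp add: Cons.IH sum.lessThan_Suc_shift sum_negf del: sum.lessThan_Suc)
qed simp

lemma altsum_add: "altsum (\<lambda>w ws. g w ws + h w ws) vs = altsum g vs + altsum h vs"
  by (induction vs arbitrary: g h) simp_all

lemma altsum_diff: "altsum (\<lambda>w ws. g w ws - h w ws) vs = altsum g vs - altsum h vs"
  by (induction vs arbitrary: g h) simp_all

lemma altsum_mult: "altsum (\<lambda>w ws. c * g w ws) vs = c * altsum g vs"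
  by (induction vs arbitrary: g) (simp_all add: algebra_simps)

lemma altsum_zero: "(\<And>w ws. g w ws = 0) \<Longrightarrow> altsum g vs = 0"
  by (induction vs arbitrary: g) simp_all

lemma altsum_sum: "altsum (\<lambda>w ws. \<Sum>k\<in>K. g k w ws) vs = (\<Sum>k\<in>K. altsum (g k) vs)"
  by (induction vs arbitrary: g) (simp_all add: sum_subtractf)

lemma altsum_map: "altsum (\<lambda>v ws. g (f v) (map f ws)) vs = altsum g (map f vs)"
proof (induction vs arbitrary: g)
  case (Cons v vs)
  show ?case using Cons.IH[of "\<lambda>w ws. g w (f v # ws)"] by simp
qed simp

text \<open>Alternation is demanded only for adjacent equal arguments, the case that inductions over
  a prefix produce; \<open>antialt_repeated\<close> gives the rest. One function on all lists
  carries every form degree, each being the restriction to one length.\<close>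

definition antialt :: "((complex ^ 'd::finite) list \<Rightarrow> complex) \<Rightarrow> bool" where
  "antialt \<theta> \<longleftrightarrow>
     (\<forall>xs u v ys. \<theta> (xs @ (u + v) # ys) = \<theta> (xs @ u # ys) + \<theta> (xs @ v # ys)) \<and>
     (\<forall>xs a v ys. \<theta> (xs @ (a *s v) # ys) = cnj a * \<theta> (xs @ v # ys)) \<and>
     (\<forall>xs v ys. \<theta> (xs @ v # v # ys) = 0)"

lemma antialt_Cons: "antialt \<theta> \<Longrightarrow> antialt (\<lambda>vs. \<theta> (v # vs))"
  unfolding antialt_def
  by (intro conjI allI) (metis append_Cons)+

lemma antialt_add_at: "antialt \<theta> \<Longrightarrow> \<theta> (xs @ (u + v) # ys) = \<theta> (xs @ u # ys) + \<theta> (xs @ v # ys)"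
  and antialt_scale_at: "antialt \<theta> \<Longrightarrow> \<theta> (xs @ (a *s v) # ys) = cnj a * \<theta> (xs @ v # ys)"
  and antialt_adjacent_at: "antialt \<theta> \<Longrightarrow> \<theta> (xs @ v # v # ys) = 0"
  unfolding antialt_def by blast+

lemmas antialt_add_hd = antialt_add_at[where xs = "[]", simplified]
  and antialt_scale_hd = antialt_scale_at[where xs = "[]", simplified]
  and antialt_adjacent_hd = antialt_adjacent_at[where xs = "[]", simplified]

lemma antialt_swap:
  assumes "antialt \<theta>"
  shows "\<theta> (xs @ u # v # ys) = - \<theta> (xs @ v # u # ys)"
proof -
  have "0 = \<theta> (xs @ (u + v) # (u + v) # ys)"
    using assms by (simp add: antialt_adjacent_at)
  also have "\<dots> = \<theta> (xs @ u # (u + v) # ys) + \<theta> (xs @ v # (u + v) # ys)"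
    by (rule antialt_add_at[OF assms])
  also have "\<dots> = \<theta> (xs @ u # v # ys) + \<theta> (xs @ v # u # ys)"
    using antialt_add_at[OF assms, of "xs @ [u]" u v ys] antialt_add_at[OF assms, of "xs @ [v]" u v ys]
    by (simp add: antialt_adjacent_at[OF assms])
  finally show ?thesis by (simp add: eq_neg_iff_add_eq_0)
qed

lemma antialt_swap_hd: "antialt \<theta> \<Longrightarrow> \<theta> (u # v # ys) = - \<theta> (v # u # ys)"
  using antialt_swap[of \<theta> "[]" u v ys] by simp

text \<open>Swap one copy past the intervening entries until the two copies are adjacent.\<close>

lemma antialt_repeated:
  assumes "antialt \<theta>"
  shows "\<theta> (xs @ v # ys @ v # zs) = 0"
proof (induction ys arbitrary: xs)
  case Nil
  then show ?case using assms by (simp add: antialt_adjacent_at)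
next
  case (Cons y ys)
  have "\<theta> (xs @ v # (y # ys) @ v # zs) = - \<theta> ((xs @ [y]) @ v # ys @ v # zs)"
    using antialt_swap[OF assms, of xs v y] by simp
  then show ?case using Cons[of "xs @ [y]"] by simp
qed

lemma antialt_not_distinct:
  assumes "antialt \<theta>" "\<not> distinct vs"
  shows "\<theta> vs = 0"
  using not_distinct_decomp[OF assms(2)] antialt_repeated[OF assms(1)] by fastforce

lemma antialt_zero_at: "antialt \<theta> \<Longrightarrow> \<theta> (xs @ 0 # ys) = 0"
  using antialt_scale_at[of \<theta> xs 0 0 ys] by simp

lemma antialt_sum_at:
  assumes "antialt \<theta>" "finite K"
  shows "\<theta> (xs @ (\<Sum>k\<in>K. f k) # ys) = (\<Sum>k\<in>K. \<theta> (xs @ f k # ys))"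
  using assms(2) by induction (simp_all add: antialt_zero_at[OF assms(1)] antialt_add_at[OF assms(1)])

lemma antialt_basis_at:
  assumes "antialt \<theta>"
  shows "\<theta> (xs @ (v :: complex ^ 'd::finite) # ys) = (\<Sum>k\<in>UNIV. cnj (v $ k) * \<theta> (xs @ axis k 1 # ys))"
proof -
  have "\<theta> (xs @ v # ys) = \<theta> (xs @ (\<Sum>k\<in>UNIV. (v $ k) *s axis k 1) # ys)"
    by (simp add: basis_expansion)
  also have "\<dots> = (\<Sum>k\<in>UNIV. cnj (v $ k) * \<theta> (xs @ axis k 1 # ys))"
    using assms by (simp add: antialt_sum_at antialt_scale_at)
  finally show ?thesis .
qed

text \<open>Expanding every argument in the standard basis leaves more than d basis vectors, of
  which two agree.\<close>

lemma antialt_top_degree: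
  fixes \<theta> :: "(complex ^ 'd::finite) list \<Rightarrow> complex"
  assumes "antialt \<theta>" "length vs > CARD('d)"
  shows "\<theta> vs = 0"
proof -
  \<comment> \<open>The arguments already expanded form a prefix of basis vectors, so that each
    induction step expands one more.\<close>
  have "\<theta> (map (\<lambda>k. axis k 1) ks @ vs) = 0" if "length ks + length vs > CARD('d)" for ks :: "'d list"
    using that
  proof (induction vs arbitrary: ks)
    case Nil
    have "\<not> distinct ks"
    proof
      assume "distinct ks"
      then have "length ks \<le> CARD('d)"
        using card_mono[of UNIV "set ks"] by (simp add: distinct_card)
      with Nil show False by simp
    qed
    then have "\<not> distinct (map (\<lambda>k. axis k (1::complex)) ks :: (complex ^ 'd) list)"
      by (auto simp: distinct_map)
    then show ?case using antialt_not_distinct[OF assms(1)] by simp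
  next
    case (Cons v vs)
    have "\<theta> (map (\<lambda>k. axis k 1) ks @ axis k 1 # vs) = 0" for k
      using Cons.IH[of "ks @ [k]"] Cons.prems by simp
    then show ?case
      by (subst antialt_basis_at[OF assms(1)]) simp
  qed
  from this[of "[]"] show ?thesis using assms by simp
qed

text \<open>For a repeated argument, the two terms that move one of its copies to the front cancel;
  the others vanish because \<open>g w\<close> is alternating.\<close>

lemma antialt_altsum:
  assumes "\<And>v. antialt (g v)" "\<And>u v ws. g (u + v) ws = g u ws + g v ws"
    "\<And>a v ws. g (a *s v) ws = cnj a * g v ws"
  shows "antialt (altsum g)"
proof -
  have "altsum g (xs @ (u + v) # ys) = altsum g (xs @ u # ys) + altsum g (xs @ v # ys)" for xs u v ys
    using assms
  proof (induction xs arbitrary: g)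
    case Nil
    then show ?case by (simp add: antialt_add_hd altsum_add)
  next
    case (Cons x xs)
    have "altsum (\<lambda>w ws. g w (x # ws)) (xs @ (u + v) # ys)
        = altsum (\<lambda>w ws. g w (x # ws)) (xs @ u # ys) + altsum (\<lambda>w ws. g w (x # ws)) (xs @ v # ys)"
      by (rule Cons.IH) (use antialt_Cons[OF Cons.prems(1)] Cons.prems in simp_all)
    then show ?case using antialt_add_at[OF Cons.prems(1)] by simp
  qed
  moreover have "altsum g (xs @ (a *s v) # ys) = cnj a * altsum g (xs @ v # ys)" for xs a v ys
    using assms
  proof (induction xs arbitrary: g)
    case Nil
    then show ?case by (simp add: antialt_scale_hd altsum_mult algebra_simps)
  next
    case (Cons x xs)
    have "altsum (\<lambda>w ws. g w (x # ws)) (xs @ (a *s v) # ys)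
        = cnj a * altsum (\<lambda>w ws. g w (x # ws)) (xs @ v # ys)"
      by (rule Cons.IH) (use antialt_Cons[OF Cons.prems(1)] Cons.prems in simp_all)
    then show ?case using antialt_scale_at[OF Cons.prems(1)] by (simp add: algebra_simps)
  qed
  moreover have "altsum g (xs @ v # v # ys) = 0" for xs v ys
    using assms
  proof (induction xs arbitrary: g)
    case Nil
    then show ?case by (simp add: antialt_adjacent_hd altsum_zero)
  next
    case (Cons x xs)
    have "altsum (\<lambda>w ws. g w (x # ws)) (xs @ v # v # ys) = 0"
      by (rule Cons.IH) (use antialt_Cons[OF Cons.prems(1)] Cons.prems in simp_all)
    then show ?case using antialt_adjacent_at[OF Cons.prems(1)] by simp
  qed
  ultimately show ?thesis unfolding antialt_def by blast
qed

text \<open>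
  The derivative of \<open>\<theta> (map J ws)\<close> when each \<open>J w\<close> varies with velocity \<open>B w\<close>.
\<close>

fun slot_sum :: "('u \<Rightarrow> 'v) \<Rightarrow> ('u \<Rightarrow> 'v) \<Rightarrow> ('v list \<Rightarrow> complex) \<Rightarrow> 'u list \<Rightarrow> complex" where
  "slot_sum J B \<theta> [] = 0"
| "slot_sum J B \<theta> (w # ws) = \<theta> (B w # map J ws) + slot_sum J B (\<lambda>us. \<theta> (J w # us)) ws"

lemma altsum_uminus: "altsum (\<lambda>w ws. - g w ws) vs = - altsum g vs"
  using altsum_mult[of "-1" g] by simp

text \<open>Bringing the varied slot to the front costs one sign per argument passed, and these are
  exactly the signs of \<open>altsum\<close>.\<close>

lemma slot_sum_altsum:
  assumes "antialt \<theta>"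
  shows "slot_sum J B \<theta> vs = altsum (\<lambda>v ws. \<theta> (B v # map J ws)) vs"
  using assms
proof (induction vs arbitrary: \<theta>)
  case (Cons v vs)
  have "altsum (\<lambda>w ws. \<theta> (J v # B w # map J ws)) vs = - altsum (\<lambda>w ws. \<theta> (B w # J v # map J ws)) vs"
    by (subst antialt_swap_hd[OF Cons.prems]) (simp add: altsum_uminus)
  then show ?case using Cons.IH[OF antialt_Cons[OF Cons.prems]] by simp
qed simp

text \<open>Second derivatives of a coordinate change cancel out of the exterior derivative.\<close>

lemma altsum_slot_sum_symmetric:
  assumes "antialt \<theta>" "\<And>u v. H u v = H v u"
  shows "altsum (\<lambda>v ws. slot_sum J (H v) \<theta> ws) vs = 0"
  using assms(1)
proof (induction vs arbitrary: \<theta>)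
  case (Cons v vs)
  have "altsum (\<lambda>w ws. slot_sum J (H w) \<theta> (v # ws)) vs
      = altsum (\<lambda>w ws. \<theta> (H v w # map J ws)) vs + altsum (\<lambda>w ws. slot_sum J (H w) (\<lambda>us. \<theta> (J v # us)) ws) vs"
    using assms(2) by (simp add: altsum_add)
  also have "\<dots> = altsum (\<lambda>w ws. \<theta> (H v w # map J ws)) vs"
    using Cons.IH[OF antialt_Cons[OF Cons.prems]] by simp
  finally show ?case using slot_sum_altsum[OF Cons.prems, of J "H v" vs] by simp
qed simp

subsection \<open>The graded product of matrix-valued forms\<close>

text \<open>
  Matrix-valued forms are functions \<open>'v list \<Rightarrow> nat \<Rightarrow> nat \<Rightarrow> complex\<close> (argument list, row,
  column). The sign functions \<open>s\<close> encode the \<open>\<int>\<^sub>2\<close>-gradings of the bundles, and \<open>invol\<close> is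
  multiplication by \<open>(-1)\<^bsup>deg\<^esup>\<close>. Contraction with a vector is an odd derivation of the product,
  and this is taken as its recursive definition.
\<close>

definition invol ::
    "(nat \<Rightarrow> complex) \<Rightarrow> (nat \<Rightarrow> complex) \<Rightarrow> ('v list \<Rightarrow> nat \<Rightarrow> nat \<Rightarrow> complex) \<Rightarrow>
     'v list \<Rightarrow> nat \<Rightarrow> nat \<Rightarrow> complex" where
  "invol sc sb \<beta> = (\<lambda>ws i k. (-1) ^ length ws * (sc i * sb k) * \<beta> ws i k)"

fun wedge ::
    "nat \<Rightarrow> (nat \<Rightarrow> complex) \<Rightarrow> (nat \<Rightarrow> complex) \<Rightarrow> ('v list \<Rightarrow> nat \<Rightarrow> nat \<Rightarrow> complex) \<Rightarrow>
     ('v list \<Rightarrow> nat \<Rightarrow> nat \<Rightarrow> complex) \<Rightarrow> 'v list \<Rightarrow> nat \<Rightarrow> nat \<Rightarrow> complex" where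
  "wedge r sc sb \<beta> \<alpha> [] i j = (\<Sum>k<r. \<beta> [] i k * \<alpha> [] k j)"
| "wedge r sc sb \<beta> \<alpha> (v # vs) i j =
     wedge r sc sb (\<lambda>ws. \<beta> (v # ws)) \<alpha> vs i j + wedge r sc sb (invol sc sb \<beta>) (\<lambda>ws. \<alpha> (v # ws)) vs i j"

lemma wedge_Cons: "(\<lambda>ws. wedge r sc sb \<beta> \<alpha> (v # ws)) = (\<lambda>ws i j.
     wedge r sc sb (\<lambda>ws. \<beta> (v # ws)) \<alpha> ws i j + wedge r sc sb (invol sc sb \<beta>) (\<lambda>ws. \<alpha> (v # ws)) ws i j)"
  by (intro ext) simp

lemma wedge_cong:
  assumes "\<And>ws k. k < r \<Longrightarrow> \<beta> ws i k = \<beta>' ws i k" "\<And>ws k. k < r \<Longrightarrow> \<alpha> ws k j = \<alpha>' ws k j"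
  shows "wedge r sc sb \<beta> \<alpha> vs i j = wedge r sc sb \<beta>' \<alpha>' vs i j"
  using assms
proof (induction vs arbitrary: \<beta> \<alpha> \<beta>' \<alpha>')
  case (Cons v vs)
  have "wedge r sc sb (\<lambda>ws. \<beta> (v # ws)) \<alpha> vs i j = wedge r sc sb (\<lambda>ws. \<beta>' (v # ws)) \<alpha>' vs i j"
    by (rule Cons.IH) (use Cons.prems in auto)
  moreover have "wedge r sc sb (invol sc sb \<beta>) (\<lambda>ws. \<alpha> (v # ws)) vs i j
      = wedge r sc sb (invol sc sb \<beta>') (\<lambda>ws. \<alpha>' (v # ws)) vs i j"
    by (rule Cons.IH) (use Cons.prems in \<open>auto simp: invol_def\<close>)
  ultimately show ?case by simp
qed simp

lemma wedge_map:
  "wedge r sc sb \<beta> \<alpha> (map f vs) i j = wedge r sc sb (\<lambda>ws. \<beta> (map f ws)) (\<lambda>ws. \<alpha> (map f ws)) vs i j"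
proof (induction vs arbitrary: \<beta> \<alpha>)
  case (Cons v vs)
  show ?case
    using Cons.IH[of "\<lambda>ws. \<beta> (f v # ws)" \<alpha>] Cons.IH[of "invol sc sb \<beta>" "\<lambda>ws. \<alpha> (f v # ws)"]
    by (simp add: invol_def)
qed simp

lemma invol_add: "invol sc sb (\<lambda>ws i k. \<beta> ws i k + \<beta>' ws i k) = (\<lambda>ws i k. invol sc sb \<beta> ws i k + invol sc sb \<beta>' ws i k)"
  by (simp add: invol_def algebra_simps fun_eq_iff)

lemma invol_mult: "invol sc sb (\<lambda>ws i k. c * \<beta> ws i k) = (\<lambda>ws i k. c * invol sc sb \<beta> ws i k)"
  by (simp add: invol_def algebra_simps fun_eq_iff)

lemma invol_Cons: "invol sc sb \<beta> (v # ws) i k = - invol sc sb (\<lambda>ws. \<beta> (v # ws)) ws i k"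
  by (simp add: invol_def)

lemma wedge_add_left:
  "wedge r sc sb (\<lambda>ws i k. \<beta> ws i k + \<beta>' ws i k) \<alpha> vs i j = wedge r sc sb \<beta> \<alpha> vs i j + wedge r sc sb \<beta>' \<alpha> vs i j"
  by (induction vs arbitrary: \<beta> \<beta>' \<alpha>) (simp_all add: algebra_simps sum.distrib invol_add)

lemma wedge_add_right:
  "wedge r sc sb \<beta> (\<lambda>ws i k. \<alpha> ws i k + \<alpha>' ws i k) vs i j = wedge r sc sb \<beta> \<alpha> vs i j + wedge r sc sb \<beta> \<alpha>' vs i j"
  by (induction vs arbitrary: \<beta> \<alpha> \<alpha>') (simp_all add: algebra_simps sum.distrib)

lemma wedge_mult_left:
  "wedge r sc sb (\<lambda>ws i k. c * \<beta> ws i k) \<alpha> vs i j = c * wedge r sc sb \<beta> \<alpha> vs i j"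
  by (induction vs arbitrary: \<beta> \<alpha>) (simp_all add: algebra_simps sum_distrib_left invol_mult)

lemma wedge_mult_right:
  "wedge r sc sb \<beta> (\<lambda>ws i k. c * \<alpha> ws i k) vs i j = c * wedge r sc sb \<beta> \<alpha> vs i j"
  by (induction vs arbitrary: \<beta> \<alpha>) (simp_all add: algebra_simps sum_distrib_left)

lemma wedge_minus_left:
  "wedge r sc sb (\<lambda>ws i k. - \<beta> ws i k) \<alpha> vs i j = - wedge r sc sb \<beta> \<alpha> vs i j"
  using wedge_mult_left[where c = "-1"] by simp

lemma wedge_minus_right:
  "wedge r sc sb \<beta> (\<lambda>ws i k. - \<alpha> ws i k) vs i j = - wedge r sc sb \<beta> \<alpha> vs i j"
  using wedge_mult_right[where c = "-1"] by simp

lemma wedge_diff_left: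
  "wedge r sc sb (\<lambda>ws i k. \<beta> ws i k - \<beta>' ws i k) \<alpha> vs i j = wedge r sc sb \<beta> \<alpha> vs i j - wedge r sc sb \<beta>' \<alpha> vs i j"
  using wedge_add_left[where \<beta>' = "\<lambda>ws i k. - \<beta>' ws i k"] by (simp add: wedge_minus_left)

lemma wedge_diff_right:
  "wedge r sc sb \<beta> (\<lambda>ws i k. \<alpha> ws i k - \<alpha>' ws i k) vs i j = wedge r sc sb \<beta> \<alpha> vs i j - wedge r sc sb \<beta> \<alpha>' vs i j"
  using wedge_add_right[where \<alpha>' = "\<lambda>ws i k. - \<alpha>' ws i k"] by (simp add: wedge_minus_right)

lemma wedge_zero_left: "wedge r sc sb (\<lambda>ws i k. 0) \<alpha> vs i j = 0"
  using wedge_mult_left[where c = 0] by simp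

lemma wedge_zero_right: "wedge r sc sb \<beta> (\<lambda>ws i k. 0) vs i j = 0"
  using wedge_mult_right[where c = 0] by simp

lemma invol_invol:
  assumes "\<And>k. sc k * sc k = 1" "\<And>k. sb k * sb k = 1"
  shows "invol sc sb (invol sc sb \<beta>) = \<beta>"
proof (intro ext)
  fix ws i k
  have "invol sc sb (invol sc sb \<beta>) ws i k
      = ((-1) ^ length ws * (-1) ^ length ws) * (sc i * sc i) * (sb k * sb k) * \<beta> ws i k"
    by (simp only: invol_def mult_ac)
  then show "invol sc sb (invol sc sb \<beta>) ws i k = \<beta> ws i k"
    using assms by (simp flip: power_mult_distrib)
qed

text \<open>Total parity is additive under the product: the sign of the middle bundle occurs twice
  and squares to 1, and a contraction flips the sign on both sides.\<close>

lemma invol_wedge: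
  assumes "\<And>k. sb k * sb k = 1"
  shows "invol sc sa (wedge r sc sb \<beta> \<alpha>) vs i j = wedge r sc sb (invol sc sb \<beta>) (invol sb sa \<alpha>) vs i j"
proof (induction vs arbitrary: \<beta> \<alpha>)
  case Nil
  have "sc i * sa j * (\<beta> [] i k * \<alpha> [] k j) = sc i * sb k * \<beta> [] i k * (sb k * sa j * \<alpha> [] k j)" for k
    using assms[of k] by (simp add: mult_ac)
  then show ?case
    by (simp only: invol_def wedge.simps list.size power_0 mult_1 sum_distrib_left)
next
  case (Cons v vs)
  have "invol sc sa (wedge r sc sb \<beta> \<alpha>) (v # vs) i j
     = - invol sc sa (wedge r sc sb (\<lambda>ws. \<beta> (v # ws)) \<alpha>) vs i j
       - invol sc sa (wedge r sc sb (invol sc sb \<beta>) (\<lambda>ws. \<alpha> (v # ws))) vs i j"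
    by (simp add: invol_def algebra_simps)
  also have "\<dots> = - wedge r sc sb (invol sc sb (\<lambda>ws. \<beta> (v # ws))) (invol sb sa \<alpha>) vs i j
       - wedge r sc sb (invol sc sb (invol sc sb \<beta>)) (invol sb sa (\<lambda>ws. \<alpha> (v # ws))) vs i j"
    by (simp only: Cons.IH)
  also have "\<dots> = wedge r sc sb (invol sc sb \<beta>) (invol sb sa \<alpha>) (v # vs) i j"
    by (simp add: invol_Cons[abs_def] wedge_minus_left wedge_minus_right)
  finally show ?case .
qed

text \<open>Both sides obey the same contraction rule: \<open>v\<close> enters one of three factors
  after the involution has acted on the factors to its left. \<open>invol_wedge\<close> lets the
  involution pass through a product.\<close>

lemma wedge_assoc:
  assumes "\<And>k. sc k * sc k = 1"
  shows "wedge r' sd sc \<gamma> (wedge r sc sb \<beta> \<alpha>) vs i j = wedge r sd sb (wedge r' sd sc \<gamma> \<beta>) \<alpha> vs i j"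
proof (induction vs arbitrary: \<gamma> \<beta> \<alpha>)
  case Nil
  have "(\<Sum>k<r'. \<gamma> [] i k * (\<Sum>l<r. \<beta> [] k l * \<alpha> [] l j)) = (\<Sum>k<r'. \<Sum>l<r. \<gamma> [] i k * \<beta> [] k l * \<alpha> [] l j)"
    by (simp add: sum_distrib_left mult_ac)
  also have "\<dots> = (\<Sum>l<r. \<Sum>k<r'. \<gamma> [] i k * \<beta> [] k l * \<alpha> [] l j)"
    by (rule sum.swap)
  finally show ?case by (simp add: sum_distrib_right)
next
  case (Cons v vs)
  have "invol sd sb (wedge r' sd sc \<gamma> \<beta>) = wedge r' sd sc (invol sd sc \<gamma>) (invol sc sb \<beta>)"
    by (intro ext) (rule invol_wedge[where sb = sc, OF assms])
  then show ?case
    by (simp add: wedge_Cons wedge_add_left wedge_add_right Cons.IH)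
qed

definition form0 :: "(nat \<Rightarrow> nat \<Rightarrow> complex) \<Rightarrow> 'v list \<Rightarrow> nat \<Rightarrow> nat \<Rightarrow> complex" where
  "form0 M vs i j = (if vs = [] then M i j else 0)"

text \<open>All form arguments belong to \<alpha> and have to pass the bundle degree of
  \<open>M\<close>, whence the power of the sign. In \<open>wedge_form0_right\<close> nothing is
  passed.\<close>

lemma wedge_form0_left:
  "wedge r sc sb (form0 M) \<alpha> vs i j = (\<Sum>k<r. (sc i * sb k) ^ length vs * M i k * \<alpha> vs k j)"
proof (induction vs arbitrary: M \<alpha>)
  case (Cons v vs)
  have 1: "(\<lambda>ws. form0 M (v # ws)) = (\<lambda>ws i k. 0)" by (intro ext) (simp add: form0_def)
  have 2: "invol sc sb (form0 M) = (form0 (\<lambda>i k. sc i * sb k * M i k) :: 'a list \<Rightarrow> _)"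
    by (auto simp: form0_def invol_def fun_eq_iff)
  show ?case by (simp add: 1 2 wedge_zero_left Cons.IH mult_ac)
qed (simp add: form0_def)

lemma wedge_form0_right:
  "wedge r sc sb \<beta> (form0 M) vs i j = (\<Sum>k<r. \<beta> vs i k * M k j)"
proof (induction vs arbitrary: \<beta>)
  case (Cons v vs)
  have 1: "(\<lambda>ws. form0 M (v # ws)) = (\<lambda>ws i k. 0)" by (intro ext) (simp add: form0_def)
  show ?case by (simp add: 1 wedge_zero_right Cons.IH)
qed (simp add: form0_def)

text \<open>Form degrees add under the product, and with them the orders below which the factors
  vanish. Iterated, this pushes powers of \<open>T\<close> into high degree.\<close>

lemma wedge_low_degree:
  assumes "\<And>ws i k. length ws < m \<Longrightarrow> \<beta> ws i k = 0" "\<And>ws i k. length ws < n \<Longrightarrow> \<alpha> ws i k = 0"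
    "length vs < m + n"
  shows "wedge r sc sb \<beta> \<alpha> vs i j = 0"
  using assms
proof (induction vs arbitrary: \<beta> \<alpha> m n)
  case Nil
  then show ?case by (cases "0 < m") auto
next
  case (Cons v vs)
  have "wedge r sc sb (\<lambda>ws. \<beta> (v # ws)) \<alpha> vs i j = 0"
  proof (cases m)
    case 0
    then show ?thesis using Cons.IH[of 0 "\<lambda>ws. \<beta> (v # ws)" n \<alpha>] Cons.prems by simp
  next
    case (Suc m')
    then show ?thesis using Cons.IH[of m' "\<lambda>ws. \<beta> (v # ws)" n \<alpha>] Cons.prems by simp
  qed
  moreover have "wedge r sc sb (invol sc sb \<beta>) (\<lambda>ws. \<alpha> (v # ws)) vs i j = 0"
  proof (cases n)
    case 0
    then show ?thesis
      using Cons.IH[of m "invol sc sb \<beta>" 0 "\<lambda>ws. \<alpha> (v # ws)"] Cons.prems by (simp add: invol_def)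
  next
    case (Suc n')
    then show ?thesis
      using Cons.IH[of m "invol sc sb \<beta>" n' "\<lambda>ws. \<alpha> (v # ws)"] Cons.prems by (simp add: invol_def)
  qed
  ultimately show ?case by simp
qed

lemma antialt_mult: "antialt \<theta> \<Longrightarrow> antialt (\<lambda>ws. c * \<theta> ws)"
  by (simp add: antialt_def algebra_simps)

lemma antialt_add: "antialt \<theta> \<Longrightarrow> antialt \<theta>' \<Longrightarrow> antialt (\<lambda>ws. \<theta> ws + \<theta>' ws)"
  by (simp add: antialt_def algebra_simps)

lemma antialt_zero: "antialt (\<lambda>ws. 0)"
  by (simp add: antialt_def)

lemma antialt_sum: "finite K \<Longrightarrow> (\<And>k. k \<in> K \<Longrightarrow> antialt (\<theta> k)) \<Longrightarrow> antialt (\<lambda>ws. \<Sum>k\<in>K. \<theta> k ws)"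
  by (induction K rule: finite_induct) (simp_all add: antialt_zero antialt_add)

lemma antialt_length_sign: "antialt \<theta> \<Longrightarrow> antialt (\<lambda>ws. (-1) ^ length ws * c * \<theta> ws)"
  by (simp add: antialt_def algebra_simps)

lemma antialt_form0: "antialt (\<lambda>ws. form0 M ws i j)"
  by (simp add: antialt_def form0_def)

text \<open>For two adjacent equal arguments, the terms with both in one factor vanish, and the two
  mixed terms cancel because contraction anticommutes with the involution.\<close>

lemma antialt_wedge:
  fixes \<beta> \<alpha> :: "(complex ^ 'd::finite) list \<Rightarrow> nat \<Rightarrow> nat \<Rightarrow> complex"
  assumes "\<And>k. k < r \<Longrightarrow> antialt (\<lambda>ws. \<beta> ws i k)" "\<And>k. k < r \<Longrightarrow> antialt (\<lambda>ws. \<alpha> ws k j)"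
  shows "antialt (\<lambda>ws. wedge r sc sb \<beta> \<alpha> ws i j)"
proof -
  let ?W = "\<lambda>\<beta> \<alpha>. wedge r sc sb \<beta> \<alpha>"
  have I: "antialt (\<lambda>ws. invol sc sb \<beta> ws i k)" if "antialt (\<lambda>ws. \<beta> ws i k)"
    for k and \<beta> :: "(complex ^ 'd) list \<Rightarrow> nat \<Rightarrow> nat \<Rightarrow> complex"
    using antialt_length_sign[OF that] by (simp add: invol_def)
  have "?W \<beta> \<alpha> (xs @ (u + v) # ys) i j = ?W \<beta> \<alpha> (xs @ u # ys) i j + ?W \<beta> \<alpha> (xs @ v # ys) i j" for xs u v ys
    using assms
  proof (induction xs arbitrary: \<beta> \<alpha>)
    case Nil
    have "?W (\<lambda>ws. \<beta> ((u + v) # ws)) \<alpha> ys i j = ?W (\<lambda>ws i k. \<beta> (u # ws) i k + \<beta> (v # ws) i k) \<alpha> ys i j"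
      by (rule wedge_cong) (use antialt_add_hd[OF Nil(1)] antialt_add_hd[OF Nil(2)] in simp_all)
    moreover have "?W (invol sc sb \<beta>) (\<lambda>ws. \<alpha> ((u + v) # ws)) ys i j
        = ?W (invol sc sb \<beta>) (\<lambda>ws i k. \<alpha> (u # ws) i k + \<alpha> (v # ws) i k) ys i j"
      by (rule wedge_cong) (use antialt_add_hd[OF Nil(1)] antialt_add_hd[OF Nil(2)] in simp_all)
    ultimately show ?case by (simp add: wedge_add_left wedge_add_right)
  next
    case (Cons x xs)
    have "?W (\<lambda>ws. \<beta> (x # ws)) \<alpha> (xs @ (u + v) # ys) i j
        = ?W (\<lambda>ws. \<beta> (x # ws)) \<alpha> (xs @ u # ys) i j + ?W (\<lambda>ws. \<beta> (x # ws)) \<alpha> (xs @ v # ys) i j"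
      by (rule Cons.IH) (use antialt_Cons[OF Cons.prems(1)] Cons.prems in simp_all)
    moreover have "?W (invol sc sb \<beta>) (\<lambda>ws. \<alpha> (x # ws)) (xs @ (u + v) # ys) i j
        = ?W (invol sc sb \<beta>) (\<lambda>ws. \<alpha> (x # ws)) (xs @ u # ys) i j
          + ?W (invol sc sb \<beta>) (\<lambda>ws. \<alpha> (x # ws)) (xs @ v # ys) i j"
      by (rule Cons.IH) (use antialt_Cons[OF Cons.prems(2)] Cons.prems I in simp_all)
    ultimately show ?case by simp
  qed
  moreover have "?W \<beta> \<alpha> (xs @ (c *s v) # ys) i j = cnj c * ?W \<beta> \<alpha> (xs @ v # ys) i j" for xs c v ys
    using assms
  proof (induction xs arbitrary: \<beta> \<alpha>)
    case Nil
    have "?W (\<lambda>ws. \<beta> ((c *s v) # ws)) \<alpha> ys i j = ?W (\<lambda>ws i k. cnj c * \<beta> (v # ws) i k) \<alpha> ys i j"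
      by (rule wedge_cong) (use antialt_scale_hd[OF Nil(1)] antialt_scale_hd[OF Nil(2)] in simp_all)
    moreover have "?W (invol sc sb \<beta>) (\<lambda>ws. \<alpha> ((c *s v) # ws)) ys i j
        = ?W (invol sc sb \<beta>) (\<lambda>ws i k. cnj c * \<alpha> (v # ws) i k) ys i j"
      by (rule wedge_cong) (use antialt_scale_hd[OF Nil(1)] antialt_scale_hd[OF Nil(2)] in simp_all)
    ultimately show ?case by (simp add: wedge_mult_left wedge_mult_right algebra_simps)
  next
    case (Cons x xs)
    have "?W (\<lambda>ws. \<beta> (x # ws)) \<alpha> (xs @ (c *s v) # ys) i j
        = cnj c * ?W (\<lambda>ws. \<beta> (x # ws)) \<alpha> (xs @ v # ys) i j"
      by (rule Cons.IH) (use antialt_Cons[OF Cons.prems(1)] Cons.prems in simp_all)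
    moreover have "?W (invol sc sb \<beta>) (\<lambda>ws. \<alpha> (x # ws)) (xs @ (c *s v) # ys) i j
        = cnj c * ?W (invol sc sb \<beta>) (\<lambda>ws. \<alpha> (x # ws)) (xs @ v # ys) i j"
      by (rule Cons.IH) (use antialt_Cons[OF Cons.prems(2)] Cons.prems I in simp_all)
    ultimately show ?case by (simp add: algebra_simps)
  qed
  moreover have "?W \<beta> \<alpha> (xs @ v # v # ys) i j = 0" for xs v ys
    using assms
  proof (induction xs arbitrary: \<beta> \<alpha>)
    case Nil
    have "?W (\<lambda>ws. \<beta> (v # v # ws)) \<alpha> ys i j = ?W (\<lambda>ws i k. 0) \<alpha> ys i j"
      by (rule wedge_cong) (use antialt_adjacent_hd[OF Nil(1)] antialt_adjacent_hd[OF Nil(2)] in simp_all)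
    moreover have "?W (invol sc sb (invol sc sb \<beta>)) (\<lambda>ws. \<alpha> (v # v # ws)) ys i j
        = ?W (invol sc sb (invol sc sb \<beta>)) (\<lambda>ws i k. 0) ys i j"
      by (rule wedge_cong) (use antialt_adjacent_hd[OF Nil(1)] antialt_adjacent_hd[OF Nil(2)] in simp_all)
    ultimately show ?case
      by (simp add: wedge_zero_left wedge_zero_right invol_Cons[abs_def] wedge_minus_left)
  next
    case (Cons x xs)
    have "?W (\<lambda>ws. \<beta> (x # ws)) \<alpha> (xs @ v # v # ys) i j = 0"
      by (rule Cons.IH) (use antialt_Cons[OF Cons.prems(1)] Cons.prems in simp_all)
    moreover have "?W (invol sc sb \<beta>) (\<lambda>ws. \<alpha> (x # ws)) (xs @ v # v # ys) i j = 0"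
      by (rule Cons.IH) (use antialt_Cons[OF Cons.prems(2)] Cons.prems I in simp_all)
    ultimately show ?case by simp
  qed
  ultimately show ?thesis unfolding antialt_def by blast
qed

text \<open>The sign counts inversions. Position 0 creates none when it goes to the left factor;
  when it goes to the right factor, it is inverted with each of the \<open>card T\<close> positions
  of the left one.\<close>

lemma shuffle_sign_Suc:
  assumes "T \<subseteq> {..<n}"
  shows "shuffle_sign (Suc n) (insert 0 (Suc ` T)) = shuffle_sign n T"
    and "shuffle_sign (Suc n) (Suc ` T) = (-1) ^ card T * shuffle_sign n T"
proof -
  let ?A = "{(i, j). i \<in> T \<and> j \<in> {..<n} - T \<and> j < i}"
  have fin: "finite ?A" "finite T"
    using assms finite_subset[of ?A "T \<times> {..<n}"] finite_subset[of T "{..<n}"] by auto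
  let ?S = "\<lambda>(i, j). (Suc i, Suc j)"
  have "{(i, j). i \<in> insert 0 (Suc ` T) \<and> j \<in> {..<Suc n} - insert 0 (Suc ` T) \<and> j < i} = ?S ` ?A" (is "?L = _")
  proof (intro equalityI subsetI)
    fix x assume "x \<in> ?L"
    then obtain i j where "x = (Suc i, j)" "i \<in> T" "j < Suc n" "j \<noteq> 0" "j \<notin> Suc ` T" "j < Suc i" by auto
    then show "x \<in> ?S ` ?A" by (cases j) (auto intro!: image_eqI[of _ _ "(i, j - 1)"])
  qed auto
  then show "shuffle_sign (Suc n) (insert 0 (Suc ` T)) = shuffle_sign n T"
    unfolding shuffle_sign_def by (simp add: card_image inj_on_def)
  have "{(i, j). i \<in> Suc ` T \<and> j \<in> {..<Suc n} - Suc ` T \<and> j < i} = ?S ` ?A \<union> (\<lambda>i. (Suc i, 0)) ` T" (is "?L = _")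
  proof (intro equalityI subsetI)
    fix x assume "x \<in> ?L"
    then obtain i j where "x = (Suc i, j)" "i \<in> T" "j < Suc n" "j \<notin> Suc ` T" "j < Suc i" by auto
    then show "x \<in> ?S ` ?A \<union> (\<lambda>i. (Suc i, 0)) ` T"
      by (cases j) (auto intro!: image_eqI[of _ _ "(i, j - 1)"])
  qed auto
  moreover have "card (?S ` ?A \<union> (\<lambda>i. (Suc i, 0)) ` T) = card (?S ` ?A) + card ((\<lambda>i. (Suc i, 0::nat)) ` T)"
    using fin by (intro card_Un_disjoint) auto
  ultimately show "shuffle_sign (Suc n) (Suc ` T) = (-1) ^ card T * shuffle_sign n T"
    unfolding shuffle_sign_def by (simp add: card_image inj_on_def power_add mult.commute)
qed

text \<open>Subsets split according to which factor receives the first argument, matching the two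
  summands in the recursion of \<open>wedge\<close>.\<close>

lemma sum_Pow_Suc:
  "(\<Sum>S\<in>Pow {..<Suc n}. f S) = (\<Sum>T\<in>Pow {..<n}. f (insert 0 (Suc ` T)) + f (Suc ` T) :: complex)"
proof -
  have "Pow {..<Suc n} = (\<lambda>T. insert 0 (Suc ` T)) ` Pow {..<n} \<union> (`) Suc ` Pow {..<n}"
    unfolding lessThan_Suc_eq_insert_0 Pow_insert image_Pow_surj[OF refl, symmetric]
    by (simp add: image_image Un_commute)
  moreover have "inj_on (\<lambda>T. insert 0 (Suc ` T)) (Pow {..<n})" "inj_on ((`) Suc) (Pow {..<n})"
    by (auto intro!: inj_on_inverseI[where g = "\<lambda>S. {j. Suc j \<in> S}"])
  moreover have "(\<lambda>T. insert 0 (Suc ` T)) ` Pow {..<n} \<inter> (`) Suc ` Pow {..<n} = {}"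
    by auto
  ultimately show ?thesis
    by (simp add: sum.union_disjoint sum.reindex sum.distrib)
qed

text \<open>Identifies the contraction recursion with the shuffle sum of \<open>DF_comp\<close>. The
  exponent \<open>length vs - card S\<close> is the form degree of the right factor, which has to
  pass the bundle degree of the left one.\<close>

lemma wedge_explicit:
  "wedge r sc sb \<beta> \<alpha> vs i j =
     (\<Sum>S\<in>Pow {..<length vs}. shuffle_sign (length vs) S *
        (\<Sum>k<r. (sc i * sb k) ^ (length vs - card S) * \<beta> (nths vs S) i k * \<alpha> (nths vs (- S)) k j))"
proof (induction vs arbitrary: \<beta> \<alpha>)
  case Nil
  then show ?case by (simp add: shuffle_sign_def)
next
  case (Cons v vs)
  let ?n = "length vs"
  let ?s = "\<lambda>k. sc i * sb k"
  have T: "shuffle_sign (Suc ?n) (insert 0 (Suc ` T)) *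
        (\<Sum>k<r. ?s k ^ (Suc ?n - card (insert 0 (Suc ` T))) * \<beta> (nths (v # vs) (insert 0 (Suc ` T))) i k *
           \<alpha> (nths (v # vs) (- insert 0 (Suc ` T))) k j)
      = shuffle_sign ?n T * (\<Sum>k<r. ?s k ^ (?n - card T) * \<beta> (v # nths vs T) i k * \<alpha> (nths vs (- T)) k j)"
    "shuffle_sign (Suc ?n) (Suc ` T) *
        (\<Sum>k<r. ?s k ^ (Suc ?n - card (Suc ` T)) * \<beta> (nths (v # vs) (Suc ` T)) i k *
           \<alpha> (nths (v # vs) (- (Suc ` T))) k j)
      = shuffle_sign ?n T * (\<Sum>k<r. ?s k ^ (?n - card T) * invol sc sb \<beta> (nths vs T) i k * \<alpha> (v # nths vs (- T)) k j)"
    if TS: "T \<subseteq> {..<?n}" for T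
  proof -
    have f: "finite T" "card T \<le> ?n"
      using TS finite_subset card_mono[OF _ TS] by auto
    have c: "card (insert 0 (Suc ` T)) = Suc (card T)" "card (Suc ` T) = card T"
      using f by (auto simp: card_image)
    have l: "length (nths vs T) = card T"
      using TS by (simp add: length_nths) (metis (no_types, lifting) Collect_cong Collect_mem_eq lessThan_iff subsetD)
    have n: "nths (v # vs) (insert 0 (Suc ` T)) = v # nths vs T"
      "nths (v # vs) (- insert 0 (Suc ` T)) = nths vs (- T)"
      "nths (v # vs) (Suc ` T) = nths vs T" "nths (v # vs) (- (Suc ` T)) = v # nths vs (- T)"
      by (simp_all add: nths_Cons inj_image_mem_iff Compl_eq)
    show "shuffle_sign (Suc ?n) (insert 0 (Suc ` T)) *
        (\<Sum>k<r. ?s k ^ (Suc ?n - card (insert 0 (Suc ` T))) * \<beta> (nths (v # vs) (insert 0 (Suc ` T))) i k *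
           \<alpha> (nths (v # vs) (- insert 0 (Suc ` T))) k j)
      = shuffle_sign ?n T * (\<Sum>k<r. ?s k ^ (?n - card T) * \<beta> (v # nths vs T) i k * \<alpha> (nths vs (- T)) k j)"
      unfolding n c shuffle_sign_Suc[OF TS] by simp
    \<comment> \<open>When \<open>v\<close> goes to the right factor, the new inversions and one
      more bundle sign combine into \<open>invol\<close>.\<close>
    have "(-1) ^ card T * (\<Sum>k<r. ?s k ^ (Suc ?n - card T) * \<beta> (nths vs T) i k * \<alpha> (v # nths vs (- T)) k j)
        = (\<Sum>k<r. ?s k ^ (?n - card T) * invol sc sb \<beta> (nths vs T) i k * \<alpha> (v # nths vs (- T)) k j)"
      unfolding sum_distrib_left using f
      by (intro sum.cong refl) (simp add: invol_def l Suc_diff_le mult_ac)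
    then show "shuffle_sign (Suc ?n) (Suc ` T) *
        (\<Sum>k<r. ?s k ^ (Suc ?n - card (Suc ` T)) * \<beta> (nths (v # vs) (Suc ` T)) i k *
           \<alpha> (nths (v # vs) (- (Suc ` T))) k j)
      = shuffle_sign ?n T * (\<Sum>k<r. ?s k ^ (?n - card T) * invol sc sb \<beta> (nths vs T) i k * \<alpha> (v # nths vs (- T)) k j)"
      unfolding n c shuffle_sign_Suc[OF TS] by (simp add: mult_ac)
  qed
  show ?case
    unfolding list.size(4) add_Suc_right add_0_right sum_Pow_Suc wedge.simps Cons.IH sum.distrib[symmetric]
    by (intro sum.cong refl) (simp only: T Pow_iff)
qed

section \<open>Calculus of smooth functions\<close>

lemma frechet_derivative_cong_open:
  assumes "open S" "x \<in> S" "\<And>y. y \<in> S \<Longrightarrow> f y = g y"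
  shows "frechet_derivative f (at x) = frechet_derivative g (at x)"
    and "f differentiable (at x) \<longleftrightarrow> g differentiable (at x)"
proof -
  have "(f has_derivative f') (at x) \<longleftrightarrow> (g has_derivative f') (at x)" for f'
    using has_derivative_transform_within_open[OF _ assms(1,2)] assms(3) by metis
  then show "frechet_derivative f (at x) = frechet_derivative g (at x)"
    "f differentiable (at x) \<longleftrightarrow> g differentiable (at x)"
    unfolding frechet_derivative_def differentiable_def by simp_all
qed

lemma has_derivative_frechetD:
  "(f has_derivative f') (at z) \<Longrightarrow> f differentiable (at z) \<and> frechet_derivative f (at z) = f'"
  using frechet_derivative_at unfolding differentiable_def by metis

lemma Ck_on_subset: "Ck_on k f S \<Longrightarrow> T \<subseteq> S \<Longrightarrow> Ck_on k f T"
  by (induction k arbitrary: f) (auto intro: continuous_on_subset)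

lemma Ck_on_cong:
  assumes "open S" "\<And>z. z \<in> S \<Longrightarrow> f z = g z"
  shows "Ck_on k f S \<longleftrightarrow> Ck_on k g S"
  using assms(2)
proof (induction k arbitrary: f g)
  case 0
  then show ?case by (simp cong: continuous_on_cong)
next
  case (Suc k)
  have "Ck_on k (\<lambda>z. frechet_derivative f (at z) v) S \<longleftrightarrow> Ck_on k (\<lambda>z. frechet_derivative g (at z) v) S" for v
    using frechet_derivative_cong_open(1)[OF assms(1) _ Suc.prems] by (intro Suc.IH) simp
  then show ?case using frechet_derivative_cong_open(2)[OF assms(1) _ Suc.prems] by simp
qed

lemma Ck_on_Suc_imp: "Ck_on (Suc k) f S \<Longrightarrow> Ck_on k f S"
proof (induction k arbitrary: f)
  case 0
  then show ?case
    by (auto intro!: continuous_at_imp_continuous_on differentiable_imp_continuous_within)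
next
  case (Suc k)
  have "Ck_on k (\<lambda>z. frechet_derivative f (at z) v) S" for v
    using Suc.prems by (intro Suc.IH) (metis Ck_on.simps(2))
  then show ?case using Suc.prems by (metis Ck_on.simps(2))
qed

lemma Ck_on_local:
  assumes "\<And>z. z \<in> S \<Longrightarrow> \<exists>T. open T \<and> z \<in> T \<and> Ck_on k f T"
  shows "Ck_on k f S"
  using assms
proof (induction k arbitrary: f)
  case 0
  show ?case
    unfolding Ck_on.simps
    by (intro continuous_at_imp_continuous_on ballI)
      (metis 0 Ck_on.simps(1) continuous_on_eq_continuous_at)
next
  case (Suc k)
  have "Ck_on k (\<lambda>z. frechet_derivative f (at z) v) S" for v
    using Suc.prems by (intro Suc.IH) (metis Ck_on.simps(2))
  then show ?case using Suc.prems by (simp, metis)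
qed

lemma Ck_on_const: "Ck_on k (\<lambda>z. c) S"
  by (induction k arbitrary: c) (simp_all add: frechet_derivative_const)

lemma Ck_on_bounded_linear:
  assumes "bounded_linear L"
  shows "Ck_on k L S"
proof (cases k)
  case 0
  then show ?thesis using assms by (simp add: linear_continuous_on)
next
  case (Suc k')
  have d: "(L has_derivative L) (at z)" for z using assms by (rule bounded_linear_imp_has_derivative)
  then have "frechet_derivative L (at z) = L" for z by (metis frechet_derivative_at)
  then show ?thesis using d Suc by (auto simp: Ck_on_const differentiable_def)
qed

lemma Ck_on_add:
  assumes "open S" "Ck_on k f S" "Ck_on k g S"
  shows "Ck_on k (\<lambda>z. f z + g z) S"
  using assms(2,3)
proof (induction k arbitrary: f g)
  case 0
  then show ?case by (simp add: continuous_on_add)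
next
  case (Suc k)
  have d: "(\<lambda>z. f z + g z) differentiable (at z) \<and> frechet_derivative (\<lambda>z. f z + g z) (at z)
      = (\<lambda>v. frechet_derivative f (at z) v + frechet_derivative g (at z) v)" if z: "z \<in> S" for z
  proof -
    have "((\<lambda>z. f z + g z) has_derivative
        (\<lambda>v. frechet_derivative f (at z) v + frechet_derivative g (at z) v)) (at z)"
      using Suc.prems z by (intro has_derivative_add) (auto simp: frechet_derivative_works)
    then show ?thesis by (rule has_derivative_frechetD)
  qed
  have "Ck_on k (\<lambda>z. frechet_derivative (\<lambda>z. f z + g z) (at z) v) S" for v
    by (subst Ck_on_cong[OF assms(1), where g = "\<lambda>z. frechet_derivative f (at z) v + frechet_derivative g (at z) v"])
      (use d Suc in auto)
  then show ?case using d by simp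
qed

lemma Ck_on_mult:
  assumes "open S" "Ck_on k f S" "Ck_on k g S"
  shows "Ck_on k (\<lambda>z. f z * g z) S"
  using assms(2,3)
proof (induction k arbitrary: f g)
  case 0
  then show ?case by (simp add: continuous_on_mult)
next
  case (Suc k)
  have d: "(\<lambda>z. f z * g z) differentiable (at z) \<and> frechet_derivative (\<lambda>z. f z * g z) (at z)
      = (\<lambda>v. f z * frechet_derivative g (at z) v + frechet_derivative f (at z) v * g z)" if z: "z \<in> S" for z
  proof -
    have "((\<lambda>z. f z * g z) has_derivative
        (\<lambda>v. f z * frechet_derivative g (at z) v + frechet_derivative f (at z) v * g z)) (at z)"
      using Suc.prems z by (intro has_derivative_mult) (auto simp: frechet_derivative_works)
    then show ?thesis by (rule has_derivative_frechetD)
  qed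
  \<comment> \<open>The product rule also contains the undifferentiated factors, one order below
    their assumed regularity.\<close>
  have fg: "Ck_on k f S" "Ck_on k g S" using Suc.prems Ck_on_Suc_imp by blast+
  have "Ck_on k (\<lambda>z. frechet_derivative (\<lambda>z. f z * g z) (at z) v) S" for v
    by (subst Ck_on_cong[OF assms(1),
          where g = "\<lambda>z. f z * frechet_derivative g (at z) v + frechet_derivative f (at z) v * g z"])
      (use d Suc fg assms(1) in \<open>auto intro!: Ck_on_add\<close>)
  then show ?case using d by simp
qed

lemma Ck_on_inverse:
  assumes "open S" "Ck_on k f S" "\<And>z. z \<in> S \<Longrightarrow> f z \<noteq> 0"
  shows "Ck_on k (\<lambda>z. inverse (f z)) S"
  using assms(2)
proof (induction k)
  case 0
  then show ?case using assms by (simp add: continuous_on_inverse)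
next
  case (Suc k)
  have d: "(\<lambda>z. inverse (f z)) differentiable (at z) \<and> frechet_derivative (\<lambda>z. inverse (f z)) (at z)
      = (\<lambda>v. - (inverse (f z) * frechet_derivative f (at z) v * inverse (f z)))" if z: "z \<in> S" for z
  proof -
    have "((\<lambda>z. inverse (f z)) has_derivative
        (\<lambda>v. - (inverse (f z) * frechet_derivative f (at z) v * inverse (f z)))) (at z)"
      using Suc.prems z assms(3) by (intro Deriv.has_derivative_inverse) (auto simp: frechet_derivative_works)
    then show ?thesis by (rule has_derivative_frechetD)
  qed
  have fg: "Ck_on k (\<lambda>z. inverse (f z)) S" using Suc Ck_on_Suc_imp by blast
  have "Ck_on k (\<lambda>z. frechet_derivative (\<lambda>z. inverse (f z)) (at z) v) S" for v
  proof (subst Ck_on_cong[OF assms(1)])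
    show "frechet_derivative (\<lambda>z. inverse (f z)) (at z) v
        = (-1) * (inverse (f z) * frechet_derivative f (at z) v * inverse (f z))" if "z \<in> S" for z
      using d[OF that] by simp
    show "Ck_on k (\<lambda>z. (-1) * (inverse (f z) * frechet_derivative f (at z) v * inverse (f z))) S"
      using Suc.prems fg assms(1) by (intro Ck_on_mult Ck_on_const) auto
  qed
  then show ?case using d by simp
qed

lemma Ck_on_linear_comp:
  assumes "open S" "bounded_linear L" "Ck_on k f S"
  shows "Ck_on k (\<lambda>z. L (f z)) S"
  using assms(3)
proof (induction k arbitrary: f)
  case 0
  then show ?case using bounded_linear.continuous_on[OF assms(2)] by simp
next
  case (Suc k)
  have d: "(\<lambda>z. L (f z)) differentiable (at z) \<and> frechet_derivative (\<lambda>z. L (f z)) (at z)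
      = (\<lambda>v. L (frechet_derivative f (at z) v))" if z: "z \<in> S" for z
  proof -
    have "((\<lambda>z. L (f z)) has_derivative (\<lambda>v. L (frechet_derivative f (at z) v))) (at z)"
      using Suc.prems z by (intro bounded_linear.has_derivative[OF assms(2)]) (auto simp: frechet_derivative_works)
    then show ?thesis by (rule has_derivative_frechetD)
  qed
  have "Ck_on k (\<lambda>z. frechet_derivative (\<lambda>z. L (f z)) (at z) v) S" for v
    by (subst Ck_on_cong[OF assms(1), where g = "\<lambda>z. L (frechet_derivative f (at z) v)"])
      (use d Suc in auto)
  then show ?case using d by simp
qed

lemma smooth_on_subset: "smooth_on f S \<Longrightarrow> T \<subseteq> S \<Longrightarrow> smooth_on f T"
  unfolding smooth_on_def using Ck_on_subset by blast

lemma smooth_on_cong: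
  assumes "open S" "\<And>z. z \<in> S \<Longrightarrow> f z = g z"
  shows "smooth_on f S \<longleftrightarrow> smooth_on g S"
  unfolding smooth_on_def by (intro all_cong1 Ck_on_cong assms)

lemma smooth_on_local:
  assumes "\<And>z. z \<in> S \<Longrightarrow> \<exists>T. open T \<and> z \<in> T \<and> smooth_on f T"
  shows "smooth_on f S"
  unfolding smooth_on_def using Ck_on_local assms unfolding smooth_on_def by meson

lemma smooth_on_const: "smooth_on (\<lambda>z. c) S"
  by (simp add: smooth_on_def Ck_on_const)

lemma smooth_on_bounded_linear: "bounded_linear L \<Longrightarrow> smooth_on L S"
  by (simp add: smooth_on_def Ck_on_bounded_linear)

lemma smooth_on_add: "open S \<Longrightarrow> smooth_on f S \<Longrightarrow> smooth_on g S \<Longrightarrow> smooth_on (\<lambda>z. f z + g z) S"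
  by (simp add: smooth_on_def Ck_on_add)

lemma smooth_on_mult: "open S \<Longrightarrow> smooth_on f S \<Longrightarrow> smooth_on g S \<Longrightarrow> smooth_on (\<lambda>z. f z * g z) S"
  by (simp add: smooth_on_def Ck_on_mult)

lemma smooth_on_uminus: "open S \<Longrightarrow> smooth_on f S \<Longrightarrow> smooth_on (\<lambda>z. - f z) S"
  using smooth_on_mult[OF _ smooth_on_const[of "-1"]] by simp

lemma smooth_on_diff: "open S \<Longrightarrow> smooth_on f S \<Longrightarrow> smooth_on g S \<Longrightarrow> smooth_on (\<lambda>z. f z - g z) S"
  using smooth_on_add[OF _ _ smooth_on_uminus] by simp

lemma smooth_on_sum:
  assumes "open S" "\<And>i. i \<in> I \<Longrightarrow> smooth_on (f i) S"
  shows "smooth_on (\<lambda>z. \<Sum>i\<in>I. f i z) S"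
  using assms(2)
  by (induction I rule: infinite_finite_induct) (simp_all add: smooth_on_const smooth_on_add assms(1))

lemma smooth_on_inverse:
  "open S \<Longrightarrow> smooth_on f S \<Longrightarrow> (\<And>z. z \<in> S \<Longrightarrow> f z \<noteq> 0) \<Longrightarrow> smooth_on (\<lambda>z. inverse (f z)) S"
  by (simp add: smooth_on_def Ck_on_inverse)

lemma smooth_on_linear_comp: "open S \<Longrightarrow> bounded_linear L \<Longrightarrow> smooth_on f S \<Longrightarrow> smooth_on (\<lambda>z. L (f z)) S"
  by (simp add: smooth_on_def Ck_on_linear_comp)

lemma smooth_on_cnj: "open S \<Longrightarrow> smooth_on f S \<Longrightarrow> smooth_on (\<lambda>z. cnj (f z)) S"
  by (rule smooth_on_linear_comp[OF _ bounded_linear_cnj])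

lemma smooth_on_differentiable: "smooth_on f S \<Longrightarrow> z \<in> S \<Longrightarrow> f differentiable (at z)"
  unfolding smooth_on_def using Ck_on.simps(2)[of 0] by blast

lemma smooth_on_has_derivative:
  "smooth_on f S \<Longrightarrow> z \<in> S \<Longrightarrow> (f has_derivative frechet_derivative f (at z)) (at z)"
  using smooth_on_differentiable frechet_derivative_works by blast

lemma smooth_on_frechet_derivative: "smooth_on f S \<Longrightarrow> smooth_on (\<lambda>z. frechet_derivative f (at z) v) S"
  unfolding smooth_on_def using Ck_on.simps(2) by blast

lemma smooth_on_continuous: "smooth_on f S \<Longrightarrow> continuous_on S f"
  unfolding smooth_on_def using Ck_on.simps(1) by blast

lemma smooth_on_delbar_at:
  assumes "open S" "smooth_on f S"
  shows "smooth_on (\<lambda>z. delbar_at f z v) S"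
  unfolding delbar_at_def divide_inverse
  by (intro smooth_on_mult smooth_on_add smooth_on_const smooth_on_frechet_derivative assms)

lemma has_derivative_vec_componentwise:
  fixes f :: "'a::real_normed_vector \<Rightarrow> complex ^ 'd::finite"
  shows "(f has_derivative f') F \<longleftrightarrow> (\<forall>k. ((\<lambda>x. f x $ k) has_derivative (\<lambda>v. f' v $ k)) F)"
proof
  assume "(f has_derivative f') F"
  then show "\<forall>k. ((\<lambda>x. f x $ k) has_derivative (\<lambda>v. f' v $ k)) F"
    using bounded_linear.has_derivative[OF bounded_linear_vec_nth] by blast
next
  assume *: "\<forall>k. ((\<lambda>x. f x $ k) has_derivative (\<lambda>v. f' v $ k)) F"
  have bl: "bounded_linear (\<lambda>x. axis k x :: complex ^ 'd)" for k
  proof -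
    have "linear (\<lambda>x::complex. axis k x :: complex ^ 'd)"
      by (rule linearI) (auto simp: axis_def Finite_Cartesian_Product.vec_eq_iff)
    then show ?thesis by (simp add: linear_conv_bounded_linear)
  qed
  have eq: "(\<Sum>k\<in>UNIV. axis k (u $ k)) = u" for u :: "complex ^ 'd"
    by (simp add: Finite_Cartesian_Product.vec_eq_iff axis_def if_distrib cong: if_cong)
  have "((\<lambda>x. \<Sum>k\<in>UNIV. axis k (f x $ k)) has_derivative (\<lambda>v. \<Sum>k\<in>UNIV. axis k (f' v $ k))) F"
    by (intro has_derivative_sum bounded_linear.has_derivative[OF bl]) (use * in blast)
  then show "(f has_derivative f') F" by (simp add: eq)
qed

text \<open>\<open>Ck_on\<close> controls a derivative only in a fixed direction. Expanding a moving
  direction separates its varying coordinates from derivatives in fixed directions, as the chain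
  rule needs.\<close>

lemma real_linear_expand:
  fixes L :: "complex ^ 'd::finite \<Rightarrow> complex"
  assumes "linear L"
  shows "L u = (\<Sum>k\<in>UNIV. u $ k * ((L (axis k 1) - \<i> * L (\<i> *s axis k 1)) / 2)
                        + cnj (u $ k) * ((L (axis k 1) + \<i> * L (\<i> *s axis k 1)) / 2))"
proof -
  have u: "u = (\<Sum>k\<in>UNIV. Re (u $ k) *\<^sub>R axis k 1 + Im (u $ k) *\<^sub>R (\<i> *s axis k 1))"
    by (simp add: Finite_Cartesian_Product.vec_eq_iff axis_def if_distrib if_distribR complex_eq_iff cong: if_cong)
  have "L u = (\<Sum>k\<in>UNIV. Re (u $ k) *\<^sub>R L (axis k 1) + Im (u $ k) *\<^sub>R L (\<i> *s axis k 1))"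
    by (subst u) (simp add: linear_sum[OF assms] linear_add[OF assms] linear_scale[OF assms])
  also have "\<dots> = (\<Sum>k\<in>UNIV. u $ k * ((L (axis k 1) - \<i> * L (\<i> *s axis k 1)) / 2)
                        + cnj (u $ k) * ((L (axis k 1) + \<i> * L (\<i> *s axis k 1)) / 2))"
    by (intro sum.cong refl) (simp add: complex_eq_iff field_simps)
  finally show ?thesis .
qed

text \<open>The derivative of the composite is a sum of coordinates of the derivative of \<phi>
  times composites of directional derivatives of \<open>f\<close> with \<phi>; the induction
  hypothesis covers the latter.\<close>

lemma Ck_on_compose:
  fixes \<phi> :: "complex ^ 'c::finite \<Rightarrow> complex ^ 'd::finite"
  assumes "open S" "open T" "\<And>k. smooth_on (\<lambda>z. \<phi> z $ k) S" "\<phi> ` S \<subseteq> T" "Ck_on n f T"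
  shows "Ck_on n (\<lambda>z. f (\<phi> z)) S"
  using assms(5)
proof (induction n arbitrary: f)
  case 0
  have "continuous_on S \<phi>"
    using smooth_on_continuous[OF assms(3)] continuous_on_vec_lambda[of S "\<lambda>k z. \<phi> z $ k"] by simp
  then show ?case using continuous_on_compose2[of T f S \<phi>] 0 assms(4) by simp
next
  case (Suc n)
  define \<phi>' where "\<phi>' z v = (\<chi> k. frechet_derivative (\<lambda>z. \<phi> z $ k) (at z) v)" for z v
  define A where "A k w = (frechet_derivative f (at w) (axis k 1) - \<i> * frechet_derivative f (at w) (\<i> *s axis k 1)) / 2" for k w
  define B where "B k w = (frechet_derivative f (at w) (axis k 1) + \<i> * frechet_derivative f (at w) (\<i> *s axis k 1)) / 2" for k w
  have d: "(\<lambda>z. f (\<phi> z)) differentiable (at z) \<and> frechet_derivative (\<lambda>z. f (\<phi> z)) (at z)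
      = (\<lambda>v. frechet_derivative f (at (\<phi> z)) (\<phi>' z v))" if z: "z \<in> S" for z
  proof -
    have "(\<phi> has_derivative \<phi>' z) (at z)"
      unfolding has_derivative_vec_componentwise using smooth_on_has_derivative[OF assms(3) z] by (simp add: \<phi>'_def)
    moreover have "(f has_derivative frechet_derivative f (at (\<phi> z))) (at (\<phi> z))"
      using Suc.prems z assms(4) by (auto simp: frechet_derivative_works)
    ultimately have "((\<lambda>z. f (\<phi> z)) has_derivative (\<lambda>v. frechet_derivative f (at (\<phi> z)) (\<phi>' z v))) (at z)"
      using diff_chain_at[of \<phi> "\<phi>' z" z f] by (simp add: o_def)
    then show ?thesis by (rule has_derivative_frechetD)
  qed
  have lin: "linear (frechet_derivative f (at w))" if "w \<in> T" for w
    using Suc.prems that by (auto simp: linear_frechet_derivative)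
  have AB: "Ck_on n (\<lambda>z. A k (\<phi> z)) S" "Ck_on n (\<lambda>z. B k (\<phi> z)) S" for k
  proof -
    have "Ck_on n (\<lambda>w. inverse 2 * (frechet_derivative f (at w) (axis k 1) + (- \<i>) * frechet_derivative f (at w) (\<i> *s axis k 1))) T"
      "Ck_on n (\<lambda>w. inverse 2 * (frechet_derivative f (at w) (axis k 1) + \<i> * frechet_derivative f (at w) (\<i> *s axis k 1))) T"
      using Suc.prems assms(2) by (intro Ck_on_mult Ck_on_add Ck_on_const; simp)+
    moreover have "A k = (\<lambda>w. inverse 2 * (frechet_derivative f (at w) (axis k 1) + (- \<i>) * frechet_derivative f (at w) (\<i> *s axis k 1)))"
      "B k = (\<lambda>w. inverse 2 * (frechet_derivative f (at w) (axis k 1) + \<i> * frechet_derivative f (at w) (\<i> *s axis k 1)))"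
      by (simp_all add: A_def B_def fun_eq_iff field_simps)
    ultimately have "Ck_on n (A k) T" "Ck_on n (B k) T" by (simp_all only:)
    then show "Ck_on n (\<lambda>z. A k (\<phi> z)) S" "Ck_on n (\<lambda>z. B k (\<phi> z)) S" by (auto intro: Suc.IH)
  qed
  have ph: "Ck_on n (\<lambda>z. \<phi>' z v $ k) S" "Ck_on n (\<lambda>z. cnj (\<phi>' z v $ k)) S" for v k
    using smooth_on_frechet_derivative[OF assms(3)] smooth_on_cnj[OF assms(1) smooth_on_frechet_derivative[OF assms(3)]]
    unfolding \<phi>'_def smooth_on_def by simp_all
  have sum: "Ck_on n (\<lambda>z. \<Sum>k\<in>K. g k z) S" if "\<And>k. Ck_on n (g k) S" "finite K" for g and K :: "'d set"
    using that(2,1) by (induction K rule: finite_induct) (auto simp: Ck_on_const intro!: Ck_on_add assms(1))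
  have "Ck_on n (\<lambda>z. frechet_derivative (\<lambda>z. f (\<phi> z)) (at z) v) S" for v
  proof (subst Ck_on_cong[OF assms(1)])
    show "frechet_derivative (\<lambda>z. f (\<phi> z)) (at z) v
        = (\<Sum>k\<in>UNIV. \<phi>' z v $ k * A k (\<phi> z) + cnj (\<phi>' z v $ k) * B k (\<phi> z))" if "z \<in> S" for z
      using d[OF that] real_linear_expand[OF lin, of "\<phi> z" "\<phi>' z v"] that assms(4)
      by (auto simp: A_def B_def)
    show "Ck_on n (\<lambda>z. \<Sum>k\<in>UNIV. \<phi>' z v $ k * A k (\<phi> z) + cnj (\<phi>' z v $ k) * B k (\<phi> z)) S"
      by (intro sum Ck_on_add Ck_on_mult assms(1) AB ph finite)
  qed
  then show ?case using d by simp
qed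

lemma smooth_on_compose:
  fixes \<phi> :: "complex ^ 'c::finite \<Rightarrow> complex ^ 'd::finite"
  assumes "open S" "open T" "\<And>k. smooth_on (\<lambda>z. \<phi> z $ k) S" "\<phi> ` S \<subseteq> T" "smooth_on f T"
  shows "smooth_on (\<lambda>z. f (\<phi> z)) S"
  using Ck_on_compose[OF assms(1-4)] assms(5) unfolding smooth_on_def by blast

section \<open>Symmetry of second derivatives\<close>

lemma second_difference_mvt:
  fixes g :: "'a::real_normed_vector \<Rightarrow> real"
  assumes g': "\<And>x. x \<in> S \<Longrightarrow> (g has_derivative g' x) (at x)"
    and g'': "\<And>x. x \<in> S \<Longrightarrow> ((\<lambda>x. g' x u) has_derivative g'' x) (at x)"
    and S: "\<And>s t. \<lbrakk>0 \<le> s; s \<le> h; 0 \<le> t; t \<le> h\<rbrakk> \<Longrightarrow> z + s *\<^sub>R u + t *\<^sub>R v \<in> S" and h: "h > 0"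
  shows "\<exists>s t. 0 \<le> s \<and> s \<le> h \<and> 0 \<le> t \<and> t \<le> h \<and>
    g (z + h *\<^sub>R u + h *\<^sub>R v) - g (z + h *\<^sub>R u) - g (z + h *\<^sub>R v) + g z = h * (h * g'' (z + s *\<^sub>R u + t *\<^sub>R v) v)"
proof -
  let ?p = "\<lambda>s. g (z + s *\<^sub>R u + h *\<^sub>R v) - g (z + s *\<^sub>R u)"
  have "(?p has_real_derivative g' (z + s *\<^sub>R u + h *\<^sub>R v) u - g' (z + s *\<^sub>R u) u) (at s)"
    if s: "0 \<le> s" "s \<le> h" for s
  proof -
    have 1: "(g has_derivative g' (z + s *\<^sub>R u + h *\<^sub>R v)) (at (z + s *\<^sub>R u + h *\<^sub>R v))"
      using g' S[of s h] s h by simp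
    have 2: "(g has_derivative g' (z + s *\<^sub>R u)) (at (z + s *\<^sub>R u))"
      using g' S[of s 0] s h by simp
    have 3: "((\<lambda>s. z + s *\<^sub>R u + h *\<^sub>R v) has_derivative (\<lambda>x. x *\<^sub>R u)) (at s)"
      "((\<lambda>s. z + s *\<^sub>R u) has_derivative (\<lambda>x. x *\<^sub>R u)) (at s)"
      by (auto intro!: derivative_eq_intros)
    have "(?p has_derivative (\<lambda>x. g' (z + s *\<^sub>R u + h *\<^sub>R v) (x *\<^sub>R u) - g' (z + s *\<^sub>R u) (x *\<^sub>R u))) (at s)"
      using has_derivative_diff[OF diff_chain_at[OF 3(1) 1] diff_chain_at[OF 3(2) 2]] by (simp add: o_def)
    moreover have "g' (z + s *\<^sub>R u + h *\<^sub>R v) (x *\<^sub>R u) - g' (z + s *\<^sub>R u) (x *\<^sub>R u)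
        = (g' (z + s *\<^sub>R u + h *\<^sub>R v) u - g' (z + s *\<^sub>R u) u) * x" for x
      using linear_scale[OF has_derivative_linear[OF 1]] linear_scale[OF has_derivative_linear[OF 2]]
      by (simp add: algebra_simps)
    ultimately show ?thesis by (simp add: has_field_derivative_def)
  qed
  then obtain s where s: "0 < s" "s < h"
    "?p h - ?p 0 = (h - 0) * (g' (z + s *\<^sub>R u + h *\<^sub>R v) u - g' (z + s *\<^sub>R u) u)"
    using MVT2[OF h, of ?p "\<lambda>s. g' (z + s *\<^sub>R u + h *\<^sub>R v) u - g' (z + s *\<^sub>R u) u"] by auto
  let ?q = "\<lambda>t. g' (z + s *\<^sub>R u + t *\<^sub>R v) u"
  have "(?q has_real_derivative g'' (z + s *\<^sub>R u + t *\<^sub>R v) v) (at t)" if t: "0 \<le> t" "t \<le> h" for t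
  proof -
    have 1: "((\<lambda>x. g' x u) has_derivative g'' (z + s *\<^sub>R u + t *\<^sub>R v)) (at (z + s *\<^sub>R u + t *\<^sub>R v))"
      using g'' S[of s t] s t by simp
    have 3: "((\<lambda>t. z + s *\<^sub>R u + t *\<^sub>R v) has_derivative (\<lambda>x. x *\<^sub>R v)) (at t)"
      by (auto intro!: derivative_eq_intros)
    have "(?q has_derivative (\<lambda>x. g'' (z + s *\<^sub>R u + t *\<^sub>R v) (x *\<^sub>R v))) (at t)"
      using diff_chain_at[OF 3 1] by (simp add: o_def)
    moreover have "(\<lambda>x. g'' (z + s *\<^sub>R u + t *\<^sub>R v) (x *\<^sub>R v)) = (*) (g'' (z + s *\<^sub>R u + t *\<^sub>R v) v)"
      using linear_scale[OF has_derivative_linear[OF 1]] by (simp add: fun_eq_iff mult.commute)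
    ultimately show ?thesis by (simp add: has_field_derivative_def)
  qed
  then obtain t where t: "0 < t" "t < h" "?q h - ?q 0 = (h - 0) * g'' (z + s *\<^sub>R u + t *\<^sub>R v) v"
    using MVT2[OF h, of ?q "\<lambda>t. g'' (z + s *\<^sub>R u + t *\<^sub>R v) v"] by auto
  show ?thesis
    using s t by (intro exI[of _ s] exI[of _ t]) auto
qed

text \<open>The second difference over a parallelogram does not depend on the order of its sides,
  and the mean value theorem computes it as either mixed derivative near \<open>z\<close>.
  Continuity then excludes two different values at \<open>z\<close>.\<close>

lemma symmetric_second_derivative_real:
  fixes g :: "'a::real_normed_vector \<Rightarrow> real"
  assumes S: "open S" "z \<in> S"
    and g': "\<And>x. x \<in> S \<Longrightarrow> (g has_derivative g' x) (at x)"
    and g'': "\<And>x w. x \<in> S \<Longrightarrow> ((\<lambda>x. g' x w) has_derivative g'' x w) (at x)"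
    and cont: "continuous_on S (\<lambda>x. g'' x u v)" "continuous_on S (\<lambda>x. g'' x v u)"
  shows "g'' z u v = g'' z v u"
proof (rule ccontr)
  assume "g'' z u v \<noteq> g'' z v u"
  then have "dist (g'' z u v) (g'' z v u) / 2 > 0" (is "?e > 0") by simp
  obtain d1 where d1: "d1 > 0" "\<And>x. x \<in> S \<Longrightarrow> dist x z < d1 \<Longrightarrow> dist (g'' x u v) (g'' z u v) < ?e"
    using cont(1) S(2) \<open>?e > 0\<close> unfolding continuous_on_iff by meson
  obtain d2 where d2: "d2 > 0" "\<And>x. x \<in> S \<Longrightarrow> dist x z < d2 \<Longrightarrow> dist (g'' x v u) (g'' z v u) < ?e"
    using cont(2) S(2) \<open>?e > 0\<close> unfolding continuous_on_iff by meson
  obtain d3 where d3: "d3 > 0" "ball z d3 \<subseteq> S" using S open_contains_ball by blast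
  define d where "d = min d1 (min d2 d3)"
  have d: "d > 0" "d \<le> d1" "d \<le> d2" "d \<le> d3" using d1 d2 d3 by (auto simp: d_def)
  define h where "h = d / (norm u + norm v + 1)"
  have pos: "norm u + norm v + 1 > 0" by (simp add: add_nonneg_pos)
  have h: "h > 0" using d(1) pos by (simp add: h_def)
  have hd: "h * (norm u + norm v) < d"
    using h pos d(1) by (simp add: h_def field_simps)
  have near: "dist (z + s *\<^sub>R a + t *\<^sub>R b) z < d"
    if "0 \<le> s" "s \<le> h" "0 \<le> t" "t \<le> h" "norm a + norm b = norm u + norm v" for s t a b
  proof -
    have "dist (z + s *\<^sub>R a + t *\<^sub>R b) z = norm (s *\<^sub>R a + t *\<^sub>R b)" by (simp add: dist_norm algebra_simps)
    also have "\<dots> \<le> s * norm a + t * norm b" using that norm_triangle_ineq[of "s *\<^sub>R a" "t *\<^sub>R b"] by simp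
    also have "\<dots> \<le> h * norm a + h * norm b" using that by (intro add_mono mult_right_mono) auto
    also have "\<dots> = h * (norm u + norm v)" using that(5) by (simp flip: distrib_left)
    finally show ?thesis using hd by simp
  qed
  have inS: "z + s *\<^sub>R a + t *\<^sub>R b \<in> S"
    if "0 \<le> s" "s \<le> h" "0 \<le> t" "t \<le> h" "norm a + norm b = norm u + norm v" for s t a b
    using near[OF that] d d3 by (auto simp: dist_commute mem_ball)
  obtain s t where st: "0 \<le> s" "s \<le> h" "0 \<le> t" "t \<le> h"
    "g (z + h *\<^sub>R u + h *\<^sub>R v) - g (z + h *\<^sub>R u) - g (z + h *\<^sub>R v) + g z = h * (h * g'' (z + s *\<^sub>R u + t *\<^sub>R v) u v)"
    using second_difference_mvt[of S g g' u "\<lambda>x. g'' x u" h z v] g' g'' inS h by auto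
  obtain s' t' where st': "0 \<le> s'" "s' \<le> h" "0 \<le> t'" "t' \<le> h"
    "g (z + h *\<^sub>R v + h *\<^sub>R u) - g (z + h *\<^sub>R v) - g (z + h *\<^sub>R u) + g z = h * (h * g'' (z + s' *\<^sub>R v + t' *\<^sub>R u) v u)"
    using second_difference_mvt[of S g g' v "\<lambda>x. g'' x v" h z u] g' g'' inS h by (auto simp: add.commute[of "norm v"])
  have "h * (h * g'' (z + s *\<^sub>R u + t *\<^sub>R v) u v) = h * (h * g'' (z + s' *\<^sub>R v + t' *\<^sub>R u) v u)"
  proof -
    have "z + h *\<^sub>R v + h *\<^sub>R u = z + h *\<^sub>R u + h *\<^sub>R v" by simp
    from st'(5)[unfolded this] st(5) show ?thesis by linarith
  qed
  then have eq: "g'' (z + s *\<^sub>R u + t *\<^sub>R v) u v = g'' (z + s' *\<^sub>R v + t' *\<^sub>R u) v u" using h by simp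
  have "dist (g'' (z + s *\<^sub>R u + t *\<^sub>R v) u v) (g'' z u v) < ?e"
    using d1(2)[OF inS[OF st(1-4) refl]] near[OF st(1-4) refl] d by simp
  moreover have "dist (g'' (z + s' *\<^sub>R v + t' *\<^sub>R u) v u) (g'' z v u) < ?e"
    using d2(2)[OF inS[OF st'(1-4) add.commute]] near[OF st'(1-4) add.commute] d by simp
  ultimately have "dist (g'' z u v) (g'' z v u) < ?e + ?e"
    unfolding eq by (metis dist_commute dist_triangle_less_add)
  then show False by simp
qed

lemma smooth_on_symmetric_derivative:
  fixes f :: "complex ^ 'd::finite \<Rightarrow> complex"
  assumes "open S" "smooth_on f S" "z \<in> S"
  shows "frechet_derivative (\<lambda>x. frechet_derivative f (at x) u) (at z) v
       = frechet_derivative (\<lambda>x. frechet_derivative f (at x) v) (at z) u"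
proof -
  let ?f' = "\<lambda>x. frechet_derivative f (at x)"
  let ?f'' = "\<lambda>x u. frechet_derivative (\<lambda>x. ?f' x u) (at x)"
  have f': "(f has_derivative ?f' x) (at x)" and f'': "((\<lambda>x. ?f' x w) has_derivative ?f'' x w) (at x)"
    if "x \<in> S" for x w
    using smooth_on_has_derivative assms(2) smooth_on_frechet_derivative that by blast+
  have c: "continuous_on S (\<lambda>x. ?f'' x u v)" for u v
    by (intro smooth_on_continuous smooth_on_frechet_derivative assms)
  \<comment> \<open>The mean value theorem is about real values, so real and imaginary parts are
    treated separately.\<close>
  have "L (?f'' z u v) = L (?f'' z v u)" if L: "bounded_linear L" for L :: "complex \<Rightarrow> real"
    by (rule symmetric_second_derivative_real[OF assms(1,3),
          where g = "\<lambda>x. L (f x)" and g' = "\<lambda>x v. L (?f' x v)" and g'' = "\<lambda>x u v. L (?f'' x u v)"])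
      (auto intro!: bounded_linear.has_derivative[OF L] f' f'' bounded_linear.continuous_on[OF L] c)
  from this[OF bounded_linear_Re] this[OF bounded_linear_Im] show ?thesis
    by (simp add: complex_eq_iff)
qed

section \<open>Holomorphic functions of several variables\<close>

lemma cholomorphic_onD:
  assumes "cholomorphic_on f S" "z \<in> S"
  shows "(f has_derivative frechet_derivative f (at z)) (at z)"
    and "frechet_derivative f (at z) (c *s v) = c * frechet_derivative f (at z) v"
proof -
  obtain f' where f': "(f has_derivative f') (at z)" "\<forall>c v. f' (c *s v) = c * f' v"
    using assms unfolding cholomorphic_on_def by blast
  then have "f' = frechet_derivative f (at z)" using frechet_derivative_at by blast
  with f' show "(f has_derivative frechet_derivative f (at z)) (at z)"
    "frechet_derivative f (at z) (c *s v) = c * frechet_derivative f (at z) v" by auto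
qed

lemma cholomorphic_on_subset: "cholomorphic_on f S \<Longrightarrow> T \<subseteq> S \<Longrightarrow> cholomorphic_on f T"
  unfolding cholomorphic_on_def by blast

lemma cholomorphic_on_cong:
  assumes "open S" "\<And>z. z \<in> S \<Longrightarrow> f z = g z"
  shows "cholomorphic_on f S \<longleftrightarrow> cholomorphic_on g S"
proof -
  have "(f has_derivative f') (at x) \<longleftrightarrow> (g has_derivative f') (at x)" if "x \<in> S" for f' x
    using has_derivative_transform_within_open[OF _ assms(1) that] assms(2) by metis
  then show ?thesis unfolding cholomorphic_on_def by simp
qed

text \<open>Cauchy's formula on the complex line through \<open>z\<close> in direction \<open>v\<close>.\<close>

lemma cholomorphic_Cauchy:
  fixes f :: "complex ^ 'd::finite \<Rightarrow> complex"
  assumes f: "cholomorphic_on f S" and S: "\<And>\<zeta>. norm \<zeta> \<le> r \<Longrightarrow> z + \<zeta> *s v \<in> S" and r: "r > 0"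
  shows "frechet_derivative f (at z) v
       = integral {0..1} (\<lambda>t. inverse (of_real r * exp (2 * of_real pi * \<i> * of_real t))
            * f (z + (of_real r * exp (2 * of_real pi * \<i> * of_real t)) *s v))"
proof -
  define g where "g \<zeta> = f (z + \<zeta> *s v)" for \<zeta>
  have lin: "((\<lambda>\<zeta>. z + \<zeta> *s v) has_derivative (\<lambda>x. x *s v)) (at \<zeta>)" for \<zeta>
    unfolding has_derivative_vec_componentwise by (auto intro!: derivative_eq_intros)
  have g: "(g has_field_derivative frechet_derivative f (at (z + \<zeta> *s v)) v) (at \<zeta>)" if "norm \<zeta> \<le> r" for \<zeta>
  proof -
    have "(g has_derivative (\<lambda>x. frechet_derivative f (at (z + \<zeta> *s v)) (x *s v))) (at \<zeta>)"
      using diff_chain_at[OF lin cholomorphic_onD(1)[OF f S[OF that]]] by (simp add: g_def[abs_def] o_def)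
    moreover have "(\<lambda>x. frechet_derivative f (at (z + \<zeta> *s v)) (x *s v)) = (*) (frechet_derivative f (at (z + \<zeta> *s v)) v)"
      using cholomorphic_onD(2)[OF f S[OF that]] by (simp add: fun_eq_iff mult.commute)
    ultimately show ?thesis by (simp add: has_field_derivative_def)
  qed
  have "continuous_on (cball 0 r) g"
    using DERIV_isCont[OF g] by (intro continuous_at_imp_continuous_on) simp
  moreover have "g holomorphic_on ball 0 r"
    unfolding holomorphic_on_open[OF open_ball] by (intro ballI exI, rule g) simp
  ultimately have "(g has_field_derivative (1 / (2 * of_real pi * \<i>) *
      contour_integral (circlepath 0 r) (\<lambda>u. g u / (u - 0)\<^sup>2))) (at 0)"
    using Cauchy_derivative_integral_circlepath(2)[of 0 r g 0] r by simp
  moreover have "(g has_field_derivative frechet_derivative f (at z) v) (at 0)"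
    using g[of 0] r by simp
  ultimately have "frechet_derivative f (at z) v
      = 1 / (2 * of_real pi * \<i>) * contour_integral (circlepath 0 r) (\<lambda>u. g u / (u - 0)\<^sup>2)"
    using DERIV_unique by blast
  also have "\<dots> = 1 / (2 * of_real pi * \<i>) * integral {0..1} (\<lambda>t. g (circlepath 0 r t) / (circlepath 0 r t)\<^sup>2 *
      (2 * of_real pi * \<i> * of_real r * exp (2 * of_real pi * \<i> * of_real t)))"
    by (simp add: contour_integral_integral vector_derivative_circlepath)
  also have "\<dots> = integral {0..1} (\<lambda>t. 1 / (2 * of_real pi * \<i>) * (g (circlepath 0 r t) / (circlepath 0 r t)\<^sup>2 *
      (2 * of_real pi * \<i> * of_real r * exp (2 * of_real pi * \<i> * of_real t))))"
    by (rule integral_mult_right[symmetric])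
  also have "\<dots> = integral {0..1} (\<lambda>t. inverse (of_real r * exp (2 * of_real pi * \<i> * of_real t))
            * f (z + (of_real r * exp (2 * of_real pi * \<i> * of_real t)) *s v))"
    using r by (intro integral_cong) (simp add: circlepath g_def field_simps power2_eq_square)
  finally show ?thesis .
qed

text \<open>One radius works for all centres near \<open>z0\<close>, so that the Cauchy integral can
  be studied as a function of the centre.\<close>

lemma cholomorphic_local_Cauchy:
  fixes f :: "complex ^ 'd::finite \<Rightarrow> complex"
  assumes f: "cholomorphic_on f S" and S: "open S" "z0 \<in> S"
  obtains \<epsilon> r where "\<epsilon> > 0" "r > 0" "\<And>z \<zeta>. z \<in> ball z0 \<epsilon> \<Longrightarrow> norm \<zeta> \<le> r \<Longrightarrow> z + \<zeta> *s v \<in> S"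
proof -
  obtain e where e: "e > 0" "ball z0 e \<subseteq> S" using S open_contains_ball by blast
  define r where "r = e / 2 / (norm v + 1)"
  have p: "norm v + 1 > 0" by (simp add: add_nonneg_pos)
  have "z + \<zeta> *s v \<in> S" if "z \<in> ball z0 (e / 2)" "norm \<zeta> \<le> r" for z \<zeta>
  proof -
    have "norm (\<zeta> *s v) = norm \<zeta> * norm v"
      by (simp add: norm_vec_def L2_set_def norm_mult power_mult_distrib real_sqrt_mult flip: sum_distrib_left)
    also have "\<dots> \<le> r * norm v" using that by (intro mult_right_mono) auto
    also have "\<dots> \<le> e / 2" using p e by (simp add: r_def field_simps)
    finally have "norm (\<zeta> *s v) \<le> e / 2" .
    moreover have "dist z0 (z + \<zeta> *s v) \<le> dist z0 z + norm (\<zeta> *s v)"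
      using norm_triangle_ineq4[of "z0 - z" "\<zeta> *s v"] by (simp add: dist_norm algebra_simps)
    ultimately have "z + \<zeta> *s v \<in> ball z0 e" using that by simp
    then show ?thesis using e by blast
  qed
  then show thesis using that[of "e / 2" r] e p by (simp add: r_def)
qed

lemma continuous_on_vector_scalar_mult:
  fixes v :: "complex ^ 'd::finite"
  assumes "continuous_on S f"
  shows "continuous_on S (\<lambda>x. f x *s v)"
proof -
  have "(\<lambda>x. f x *s v) = (\<lambda>x. \<chi> k. f x * v $ k)" by (simp add: Finite_Cartesian_Product.vec_eq_iff fun_eq_iff)
  then show ?thesis
    by (simp only:) (intro continuous_on_vec_lambda continuous_on_mult assms continuous_on_const)
qed

text \<open>Cauchy's formula expresses the derivative by values of \<open>f\<close> alone, so
  continuity of \<open>f\<close> suffices.\<close>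

lemma cholomorphic_continuous_derivative:
  fixes f :: "complex ^ 'd::finite \<Rightarrow> complex"
  assumes f: "cholomorphic_on f S" and S: "open S"
  shows "continuous_on S (\<lambda>z. frechet_derivative f (at z) v)"
proof (intro continuous_at_imp_continuous_on ballI)
  fix z0 assume z0: "z0 \<in> S"
  obtain \<epsilon> r where er: "\<epsilon> > 0" "r > 0" "\<And>z \<zeta>. z \<in> ball z0 \<epsilon> \<Longrightarrow> norm \<zeta> \<le> r \<Longrightarrow> z + \<zeta> *s v \<in> S"
    using cholomorphic_local_Cauchy[OF f S z0] by blast
  let ?\<gamma> = "\<lambda>t::real. of_real r * exp (2 * of_real pi * \<i> * of_real t) :: complex"
  have fc: "continuous_on S f"
    using cholomorphic_onD(1)[OF f] by (auto intro!: continuous_at_imp_continuous_on has_derivative_continuous)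
  have \<gamma>: "norm (?\<gamma> t) \<le> r" for t using er by (simp add: norm_mult)
  have "continuous_on (ball z0 \<epsilon> \<times> cbox 0 1) (\<lambda>(z, t). inverse (?\<gamma> t) * f (z + ?\<gamma> t *s v))"
    unfolding split_beta using er \<gamma>
    by (intro continuous_on_mult continuous_on_inverse continuous_on_compose2[OF fc]
        continuous_on_add continuous_on_vector_scalar_mult) (auto intro!: continuous_intros)
  then have "continuous_on (ball z0 \<epsilon>) (\<lambda>z. integral (cbox 0 1) (\<lambda>t. inverse (?\<gamma> t) * f (z + ?\<gamma> t *s v)))"
    by (rule integral_continuous_on_param)
  moreover have "integral (cbox 0 1) (\<lambda>t. inverse (?\<gamma> t) * f (z + ?\<gamma> t *s v)) = frechet_derivative f (at z) v"
    if "z \<in> ball z0 \<epsilon>" for z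
    using cholomorphic_Cauchy[OF f _ er(2)] er(3)[OF that] by simp
  ultimately have "continuous_on (ball z0 \<epsilon>) (\<lambda>z. frechet_derivative f (at z) v)"
    by (rule continuous_on_eq)
  moreover have "z0 \<in> ball z0 \<epsilon>" using er by simp
  ultimately show "isCont (\<lambda>z. frechet_derivative f (at z) v) z0"
    using continuous_on_eq_continuous_at[OF open_ball] by blast
qed

text \<open>Differentiation of Cauchy's formula under the integral sign. The continuity of the
  differentiated integrand comes from \<open>cholomorphic_continuous_derivative\<close>, and complex
  linearity passes through the integral.\<close>

lemma cholomorphic_on_frechet_derivative:
  fixes f :: "complex ^ 'd::finite \<Rightarrow> complex"
  assumes f: "cholomorphic_on f S" and S: "open S"
  shows "cholomorphic_on (\<lambda>z. frechet_derivative f (at z) v) S"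
  unfolding cholomorphic_on_def
proof
  fix z0 assume z0: "z0 \<in> S"
  obtain \<epsilon> r where er: "\<epsilon> > 0" "r > 0" "\<And>z \<zeta>. z \<in> ball z0 \<epsilon> \<Longrightarrow> norm \<zeta> \<le> r \<Longrightarrow> z + \<zeta> *s v \<in> S"
    using cholomorphic_local_Cauchy[OF f S z0] by blast
  let ?\<gamma> = "\<lambda>t::real. of_real r * exp (2 * of_real pi * \<i> * of_real t) :: complex"
  let ?f' = "\<lambda>z. frechet_derivative f (at z)"
  define F where "F z t = inverse (?\<gamma> t) * f (z + ?\<gamma> t *s v)" for z t
  \<comment> \<open>\<open>leibniz_rule\<close> takes the derivative as a bundled bounded linear
    map, hence \<open>Blinfun\<close>.\<close>
  define F' where "F' z t = Blinfun (\<lambda>w. inverse (?\<gamma> t) * ?f' (z + ?\<gamma> t *s v) w)" for z t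
  have \<gamma>: "norm (?\<gamma> t) \<le> r" for t using er by (simp add: norm_mult)
  have fd: "(f has_derivative ?f' (z + ?\<gamma> t *s v)) (at (z + ?\<gamma> t *s v))" if "z \<in> ball z0 \<epsilon>" for z t
    using cholomorphic_onD(1)[OF f] er(3)[OF that \<gamma>] by blast
  have F'_apply: "blinfun_apply (F' z t) = (\<lambda>w. inverse (?\<gamma> t) * ?f' (z + ?\<gamma> t *s v) w)" if "z \<in> ball z0 \<epsilon>" for z t
    unfolding F'_def
    by (intro bounded_linear_Blinfun_apply bounded_linear_const_mult has_derivative_bounded_linear[OF fd[OF that]])
  have cont: "continuous_on (ball z0 \<epsilon> \<times> cbox 0 1) (\<lambda>(z, t). inverse (?\<gamma> t) * h (z + ?\<gamma> t *s v))"
    if "continuous_on S h" for h :: "complex ^ 'd \<Rightarrow> complex"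
    unfolding split_beta using er \<gamma>
    by (intro continuous_on_mult continuous_on_inverse continuous_on_compose2[OF that]
        continuous_on_add continuous_on_vector_scalar_mult) (auto intro!: continuous_intros)
  have fc: "continuous_on S f"
    using cholomorphic_onD(1)[OF f] by (auto intro!: continuous_at_imp_continuous_on has_derivative_continuous)
  have cF': "continuous_on (ball z0 \<epsilon> \<times> cbox 0 1) (\<lambda>(z, t). F' z t)"
  proof (rule continuous_on_blinfun_componentwise)
    fix w :: "complex ^ 'd"
    show "continuous_on (ball z0 \<epsilon> \<times> cbox 0 1) (\<lambda>x. blinfun_apply (case x of (z, t) \<Rightarrow> F' z t) w)"
      using cont[OF cholomorphic_continuous_derivative[OF f S, of w]]
      by (rule continuous_on_eq) (auto simp: F'_apply)
  qed
  have z0': "z0 \<in> ball z0 \<epsilon>" using er by simp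
  have intF: "F z integrable_on cbox 0 1" if "z \<in> ball z0 \<epsilon>" for z
  proof (rule integrable_continuous)
    show "continuous_on (cbox 0 1) (F z)"
      unfolding F_def[abs_def] using er er(3)[OF that \<gamma>]
      by (intro continuous_on_mult continuous_on_inverse continuous_on_compose2[OF fc]
          continuous_on_add continuous_on_vector_scalar_mult) (auto intro!: continuous_intros)
  qed
  have "((\<lambda>z. integral (cbox 0 1) (F z)) has_derivative blinfun_apply (integral (cbox 0 1) (F' z0)))
      (at z0 within ball z0 \<epsilon>)"
  proof (rule leibniz_rule[OF _ intF cF' z0' convex_ball])
    fix z t assume z: "z \<in> ball z0 \<epsilon>"
    have "((\<lambda>z. z + ?\<gamma> t *s v) has_derivative (\<lambda>w. w)) (at z)" by (auto intro!: derivative_eq_intros)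
    from diff_chain_at[OF this fd[OF z]]
    have "((\<lambda>z. f (z + ?\<gamma> t *s v)) has_derivative ?f' (z + ?\<gamma> t *s v)) (at z)" by (simp add: o_def)
    then have "((\<lambda>z. F z t) has_derivative blinfun_apply (F' z t)) (at z)"
      unfolding F'_apply[OF z] F_def by (rule has_derivative_mult_right)
    then show "((\<lambda>z. F z t) has_derivative blinfun_apply (F' z t)) (at z within ball z0 \<epsilon>)"
      by (rule has_derivative_at_withinI)
  qed
  then have 1: "((\<lambda>z. integral (cbox 0 1) (F z)) has_derivative blinfun_apply (integral (cbox 0 1) (F' z0))) (at z0)"
    using er by (simp add: at_within_open[OF z0'])
  have "((\<lambda>z. ?f' z v) has_derivative blinfun_apply (integral (cbox 0 1) (F' z0))) (at z0)"
  proof (rule has_derivative_transform_within_open[OF 1 open_ball z0'])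
    fix z assume "z \<in> ball z0 \<epsilon>"
    then show "integral (cbox 0 1) (F z) = ?f' z v"
      using cholomorphic_Cauchy[OF f _ er(2)] er(3) by (simp add: F_def[abs_def])
  qed
  moreover have "blinfun_apply (integral (cbox 0 1) (F' z0)) (c *s w) = c * blinfun_apply (integral (cbox 0 1) (F' z0)) w" for c w
  proof -
    have i: "F' z0 integrable_on cbox 0 1"
    proof (rule integrable_continuous)
      have "continuous_on (cbox 0 1) (\<lambda>t. case (z0, t) of (z, t) \<Rightarrow> F' z t)"
        by (rule continuous_on_compose2[OF cF'])
          (use z0' in \<open>auto intro!: continuous_on_Pair continuous_on_const continuous_on_id\<close>)
      then show "continuous_on (cbox 0 1) (F' z0)" by simp
    qed
    have ap: "blinfun_apply (integral (cbox 0 1) (F' z0)) w = integral (cbox 0 1) (\<lambda>t. F' z0 t w)" for w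
      using integral_linear[OF i blinfun.bounded_linear_left, of w] by (simp add: o_def)
    have "F' z0 t (c *s w) = c * F' z0 t w" for t
      using cholomorphic_onD(2)[OF f er(3)[OF z0' \<gamma>]] by (simp add: F'_apply[OF z0'])
    then show ?thesis unfolding ap by simp
  qed
  ultimately show "\<exists>f'. ((\<lambda>z. ?f' z v) has_derivative f') (at z0) \<and> (\<forall>c v. f' (c *s v) = c * f' v)" by blast
qed

theorem cholomorphic_on_smooth:
  assumes "cholomorphic_on f S" "open S"
  shows "smooth_on f S"
proof -
  have "Ck_on k f S" for k
    using assms(1)
  proof (induction k arbitrary: f)
    case 0
    then show ?case
      using cholomorphic_onD(1) by (auto intro!: continuous_at_imp_continuous_on has_derivative_continuous)
  next
    case (Suc k)
    then show ?case
      using cholomorphic_onD(1) cholomorphic_on_frechet_derivative assms(2)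
      unfolding Ck_on.simps differentiable_def by blast
  qed
  then show ?thesis by (simp add: smooth_on_def)
qed

section \<open>The Dolbeault operator in a chart\<close>

lemma delbar_at_cong:
  assumes "open S" "z \<in> S" "\<And>z. z \<in> S \<Longrightarrow> f z = g z"
  shows "delbar_at f z v = delbar_at g z v"
  using frechet_derivative_cong_open(1)[OF assms] by (simp add: delbar_at_def)

lemma delbar_at_eqI: "(f has_derivative f') (at z) \<Longrightarrow> delbar_at f z v = (f' v + \<i> * f' (\<i> *s v)) / 2"
  using has_derivative_frechetD unfolding delbar_at_def by metis

lemma delbar_at_const: "delbar_at (\<lambda>z. c) z v = 0"
  by (simp add: delbar_at_def)

lemma delbar_at_add:
  assumes "f differentiable (at z)" "g differentiable (at z)"
  shows "delbar_at (\<lambda>z. f z + g z) z v = delbar_at f z v + delbar_at g z v"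
  unfolding delbar_at_eqI[OF has_derivative_add[OF assms[unfolded frechet_derivative_works]], of v]
  by (simp add: delbar_at_def field_simps)

lemma delbar_at_mult:
  assumes "f differentiable (at z)" "g differentiable (at z)"
  shows "delbar_at (\<lambda>z. f z * g z) z v = f z * delbar_at g z v + delbar_at f z v * g z"
  unfolding delbar_at_eqI[OF has_derivative_mult[OF assms[unfolded frechet_derivative_works]], of v]
  by (simp add: delbar_at_def field_simps)

lemma delbar_at_cmult:
  assumes "f differentiable (at z)"
  shows "delbar_at (\<lambda>z. c * f z) z v = c * delbar_at f z v"
  using delbar_at_mult[of "\<lambda>z. c" z f v] assms by (simp add: delbar_at_const)

lemma delbar_at_diff:
  assumes "f differentiable (at z)" "g differentiable (at z)"
  shows "delbar_at (\<lambda>z. f z - g z) z v = delbar_at f z v - delbar_at g z v"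
  unfolding delbar_at_eqI[OF has_derivative_diff[OF assms[unfolded frechet_derivative_works]], of v]
  by (simp add: delbar_at_def field_simps)

lemma delbar_at_sum:
  assumes "finite K" "\<And>k. k \<in> K \<Longrightarrow> f k differentiable (at z)"
  shows "delbar_at (\<lambda>z. \<Sum>k\<in>K. f k z) z v = (\<Sum>k\<in>K. delbar_at (f k) z v)"
  using assms
  by (induction K rule: finite_induct) (simp_all add: delbar_at_const delbar_at_add)

lemma delbar_at_vec_add:
  assumes "f differentiable (at z)"
  shows "delbar_at f z (u + v) = delbar_at f z u + delbar_at f z v"
  using linear_add[OF linear_frechet_derivative[OF assms]]
  by (simp add: delbar_at_def field_simps vector_add_ldistrib)

lemma delbar_at_vec_scale:
  assumes "f differentiable (at z)"
  shows "delbar_at f z (a *s v) = cnj a * delbar_at f z v"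
proof -
  let ?L = "frechet_derivative f (at z)"
  note lin = linear_frechet_derivative[OF assms]
  have 1: "a *s w = Re a *\<^sub>R w + Im a *\<^sub>R (\<i> *s w)" for a and w :: "complex ^ 'a"
    by (simp add: Finite_Cartesian_Product.vec_eq_iff complex_eq_iff)
  have 2: "\<i> *s (\<i> *s w) = (-1) *\<^sub>R w" for w :: "complex ^ 'a"
    by (simp add: Finite_Cartesian_Product.vec_eq_iff complex_eq_iff)
  have 3: "\<i> *s (a *s v) = Re a *\<^sub>R (\<i> *s v) + (- Im a) *\<^sub>R v"
    by (simp add: Finite_Cartesian_Product.vec_eq_iff complex_eq_iff)
  have "?L (a *s v) = Re a *\<^sub>R ?L v + Im a *\<^sub>R ?L (\<i> *s v)"
    by (subst 1) (simp only: linear_add[OF lin] linear_scale[OF lin])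
  moreover have "?L (\<i> *s (a *s v)) = Re a *\<^sub>R ?L (\<i> *s v) + (- Im a) *\<^sub>R ?L v"
    by (simp only: 3 linear_add[OF lin] linear_scale[OF lin])
  ultimately show ?thesis
    by (simp add: delbar_at_def complex_eq_iff field_simps)
qed

lemma delbar_at_holomorphic:
  assumes "cholomorphic_on h S" "z \<in> S"
  shows "delbar_at h z v = 0"
  using cholomorphic_onD(2)[OF assms, of \<i>] by (simp add: delbar_at_def)

lemma cholomorphic_on_differentiable: "cholomorphic_on h S \<Longrightarrow> z \<in> S \<Longrightarrow> h differentiable (at z)"
  using cholomorphic_onD(1) unfolding differentiable_def by blast

lemma delbar_at_holomorphic_mult:
  assumes "cholomorphic_on h S" "z \<in> S" "f differentiable (at z)"
  shows "delbar_at (\<lambda>z. h z * f z) z v = h z * delbar_at f z v"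
  using delbar_at_mult[OF cholomorphic_on_differentiable[OF assms(1,2)] assms(3)]
    delbar_at_holomorphic[OF assms(1,2)] by simp

lemma delbar_at_cnj_holomorphic:
  assumes "cholomorphic_on h S" "z \<in> S"
  shows "delbar_at (\<lambda>z. cnj (h z)) z v = cnj (frechet_derivative h (at z) v)"
  using delbar_at_eqI[OF bounded_linear.has_derivative[OF bounded_linear_cnj cholomorphic_onD(1)[OF assms]], of v]
    cholomorphic_onD(2)[OF assms, of \<i>] by simp

definition vec_deriv :: "(complex ^ 'c::finite \<Rightarrow> complex ^ 'd::finite) \<Rightarrow> complex ^ 'c \<Rightarrow> complex ^ 'c \<Rightarrow> complex ^ 'd" where
  "vec_deriv \<phi> z v = (\<chi> k. frechet_derivative (\<lambda>z. \<phi> z $ k) (at z) v)"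

lemma has_vec_deriv:
  fixes \<phi> :: "complex ^ 'c::finite \<Rightarrow> complex ^ 'd::finite"
  assumes "\<And>k. cholomorphic_on (\<lambda>z. \<phi> z $ k) S" "z \<in> S"
  shows "(\<phi> has_derivative vec_deriv \<phi> z) (at z)"
  unfolding has_derivative_vec_componentwise using cholomorphic_onD(1)[OF assms] by (simp add: vec_deriv_def)

lemma vec_deriv_scale:
  fixes \<phi> :: "complex ^ 'c::finite \<Rightarrow> complex ^ 'd::finite"
  assumes "\<And>k. cholomorphic_on (\<lambda>z. \<phi> z $ k) S" "z \<in> S"
  shows "vec_deriv \<phi> z (c *s v) = c *s vec_deriv \<phi> z v"
  using cholomorphic_onD(2)[OF assms] by (simp add: vec_deriv_def Finite_Cartesian_Product.vec_eq_iff)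

lemma cholomorphic_on_compose:
  fixes \<phi> :: "complex ^ 'c::finite \<Rightarrow> complex ^ 'd::finite"
  assumes "\<And>k. cholomorphic_on (\<lambda>z. \<phi> z $ k) S" "\<phi> ` S \<subseteq> T" "cholomorphic_on f T"
  shows "cholomorphic_on (\<lambda>z. f (\<phi> z)) S"
    and "z \<in> S \<Longrightarrow> frechet_derivative (\<lambda>z. f (\<phi> z)) (at z) v = frechet_derivative f (at (\<phi> z)) (vec_deriv \<phi> z v)"
proof -
  have 1: "((\<lambda>z. f (\<phi> z)) has_derivative (\<lambda>v. frechet_derivative f (at (\<phi> z)) (vec_deriv \<phi> z v))) (at z)"
    if "z \<in> S" for z
  proof -
    have "(f has_derivative frechet_derivative f (at (\<phi> z))) (at (\<phi> z))"
      using cholomorphic_onD(1)[OF assms(3)] assms(2) that by blast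
    then show ?thesis
      using diff_chain_at[OF has_vec_deriv[OF assms(1) that]] by (simp add: o_def)
  qed
  show "cholomorphic_on (\<lambda>z. f (\<phi> z)) S"
    unfolding cholomorphic_on_def
  proof
    fix z assume z: "z \<in> S"
    have "frechet_derivative f (at (\<phi> z)) (vec_deriv \<phi> z (c *s v)) = c * frechet_derivative f (at (\<phi> z)) (vec_deriv \<phi> z v)" for c v
      using cholomorphic_onD(2)[OF assms(3)] assms(2) z by (simp add: vec_deriv_scale[OF assms(1) z] image_subset_iff)
    then show "\<exists>f'. ((\<lambda>z. f (\<phi> z)) has_derivative f') (at z) \<and> (\<forall>c v. f' (c *s v) = c * f' v)"
      using 1[OF z] by (intro exI conjI allI)
  qed
  show "z \<in> S \<Longrightarrow> frechet_derivative (\<lambda>z. f (\<phi> z)) (at z) v = frechet_derivative f (at (\<phi> z)) (vec_deriv \<phi> z v)"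
    using 1 has_derivative_frechetD by metis
qed

text \<open>The derivative of a holomorphic map is complex-linear, so the chain rule respects the
  splitting into linear and antilinear parts.\<close>

lemma delbar_at_compose:
  fixes \<phi> :: "complex ^ 'c::finite \<Rightarrow> complex ^ 'd::finite"
  assumes "\<And>k. cholomorphic_on (\<lambda>z. \<phi> z $ k) S" "z \<in> S" "f differentiable (at (\<phi> z))"
  shows "delbar_at (\<lambda>z. f (\<phi> z)) z v = delbar_at f (\<phi> z) (vec_deriv \<phi> z v)"
proof -
  have "((\<lambda>z. f (\<phi> z)) has_derivative (\<lambda>v. frechet_derivative f (at (\<phi> z)) (vec_deriv \<phi> z v))) (at z)"
    using diff_chain_at[OF has_vec_deriv[OF assms(1,2)] assms(3)[unfolded frechet_derivative_works]]
    by (simp add: o_def)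
  from delbar_at_eqI[OF this, of v] show ?thesis
    by (simp add: vec_deriv_scale[OF assms(1,2)] delbar_at_def)
qed

text \<open>Each side is a combination of four real second derivatives, and symmetry matches
  them.\<close>

lemma delbar_at_commute:
  assumes "open S" "smooth_on f S" "z \<in> S"
  shows "delbar_at (\<lambda>z. delbar_at f z u) z v = delbar_at (\<lambda>z. delbar_at f z v) z u"
proof -
  let ?D = "\<lambda>f z v. frechet_derivative f (at z) v"
  have d: "delbar_at (\<lambda>z. delbar_at f z u) z v
      = (?D (\<lambda>z. ?D f z u) z v + \<i> * ?D (\<lambda>z. ?D f z (\<i> *s u)) z v
         + \<i> * (?D (\<lambda>z. ?D f z u) z (\<i> *s v) + \<i> * ?D (\<lambda>z. ?D f z (\<i> *s u)) z (\<i> *s v))) / 4" for u v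
  proof -
    have h: "((\<lambda>z. ?D f z w) has_derivative ?D (\<lambda>z. ?D f z w) z) (at z)" for w
      using smooth_on_has_derivative[OF smooth_on_frechet_derivative] assms by blast
    have d: "((\<lambda>z. delbar_at f z u) has_derivative
        (\<lambda>v. (?D (\<lambda>z. ?D f z u) z v + \<i> * ?D (\<lambda>z. ?D f z (\<i> *s u)) z v) / 2)) (at z)"
      unfolding delbar_at_def divide_inverse
      by (intro has_derivative_mult_left has_derivative_add has_derivative_mult_right h)
    show ?thesis unfolding delbar_at_eqI[OF d, of v] by (simp add: field_simps)
  qed
  note sym = smooth_on_symmetric_derivative[OF assms]
  show ?thesis
    unfolding d using sym[of u v] sym[of "\<i> *s u" v] sym[of u "\<i> *s v"] sym[of "\<i> *s u" "\<i> *s v"]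
    by (simp add: algebra_simps)
qed

section \<open>The operator \<open>dbar\<close> on forms over open subsets of coordinate
  space\<close>

definition dbar :: "(complex ^ 'd::finite \<Rightarrow> (complex ^ 'd) list \<Rightarrow> complex) \<Rightarrow> complex ^ 'd \<Rightarrow> (complex ^ 'd) list \<Rightarrow> complex" where
  "dbar \<omega> z vs = altsum (\<lambda>v ws. delbar_at (\<lambda>z. \<omega> z ws) z v) vs"

lemma dbar_Nil: "dbar \<omega> z [] = 0"
  by (simp add: dbar_def)

lemma dbar_Cons: "dbar \<omega> z (v # vs) = delbar_at (\<lambda>z. \<omega> z vs) z v - dbar (\<lambda>z ws. \<omega> z (v # ws)) z vs"
  by (simp add: dbar_def)

lemma dbar_cong:
  assumes "open S" "z \<in> S" "\<And>z vs. z \<in> S \<Longrightarrow> \<omega> z vs = \<omega>' z vs"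
  shows "dbar \<omega> z vs = dbar \<omega>' z vs"
proof -
  have "delbar_at (\<lambda>z. \<omega> z ws) z v = delbar_at (\<lambda>z. \<omega>' z ws) z v" for ws v
    by (rule delbar_at_cong[OF assms(1,2)]) (rule assms(3))
  then show ?thesis by (simp add: dbar_def)
qed

lemma dbar_add:
  assumes "\<And>ws. (\<lambda>z. \<omega> z ws) differentiable (at z)" "\<And>ws. (\<lambda>z. \<omega>' z ws) differentiable (at z)"
  shows "dbar (\<lambda>z ws. \<omega> z ws + \<omega>' z ws) z vs = dbar \<omega> z vs + dbar \<omega>' z vs"
  unfolding dbar_def by (simp add: delbar_at_add assms altsum_add)

lemma dbar_holomorphic_mult:
  assumes "cholomorphic_on h S" "z \<in> S" "\<And>ws. (\<lambda>z. \<omega> z ws) differentiable (at z)"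
  shows "dbar (\<lambda>z ws. h z * \<omega> z ws) z vs = h z * dbar \<omega> z vs"
  unfolding dbar_def by (simp add: delbar_at_holomorphic_mult[OF assms(1,2)] assms(3) altsum_mult)

lemma dbar_sum:
  assumes "finite K" "\<And>k ws. k \<in> K \<Longrightarrow> (\<lambda>z. \<omega> k z ws) differentiable (at z)"
  shows "dbar (\<lambda>z ws. \<Sum>k\<in>K. \<omega> k z ws) z vs = (\<Sum>k\<in>K. dbar (\<omega> k) z vs)"
  unfolding dbar_def by (simp add: delbar_at_sum assms altsum_sum)

lemma antialt_dbar:
  assumes S: "open S" "z \<in> S" and \<omega>: "\<And>z. z \<in> S \<Longrightarrow> antialt (\<omega> z)"
    and d: "\<And>ws. (\<lambda>z. \<omega> z ws) differentiable (at z)"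
  shows "antialt (dbar \<omega> z)"
proof -
  have "antialt (\<lambda>ws. delbar_at (\<lambda>z. \<omega> z ws) z v)" for v
    unfolding antialt_def
  proof (intro conjI allI)
    fix xs u w ys
    have "delbar_at (\<lambda>z. \<omega> z (xs @ (u + w) # ys)) z v = delbar_at (\<lambda>z. \<omega> z (xs @ u # ys) + \<omega> z (xs @ w # ys)) z v"
      using antialt_add_at[OF \<omega>] by (intro delbar_at_cong[OF S]) blast
    then show "delbar_at (\<lambda>z. \<omega> z (xs @ (u + w) # ys)) z v
        = delbar_at (\<lambda>z. \<omega> z (xs @ u # ys)) z v + delbar_at (\<lambda>z. \<omega> z (xs @ w # ys)) z v"
      by (simp add: delbar_at_add d)
  next
    fix xs a w ys
    have "delbar_at (\<lambda>z. \<omega> z (xs @ (a *s w) # ys)) z v = delbar_at (\<lambda>z. cnj a * \<omega> z (xs @ w # ys)) z v"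
      using antialt_scale_at[OF \<omega>] by (intro delbar_at_cong[OF S]) blast
    then show "delbar_at (\<lambda>z. \<omega> z (xs @ (a *s w) # ys)) z v = cnj a * delbar_at (\<lambda>z. \<omega> z (xs @ w # ys)) z v"
      by (simp add: delbar_at_cmult d)
  next
    fix xs w ys
    have "delbar_at (\<lambda>z. \<omega> z (xs @ w # w # ys)) z v = delbar_at (\<lambda>z. 0) z v"
      using antialt_adjacent_at[OF \<omega>] by (intro delbar_at_cong[OF S]) blast
    then show "delbar_at (\<lambda>z. \<omega> z (xs @ w # w # ys)) z v = 0" by (simp add: delbar_at_const)
  qed
  then show ?thesis
    unfolding dbar_def[abs_def]
    by (rule antialt_altsum) (simp_all add: delbar_at_vec_add delbar_at_vec_scale d)
qed

lemma smooth_on_altsum: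
  assumes "open S" "\<And>v ws. smooth_on (\<lambda>z. g z v ws) S"
  shows "smooth_on (\<lambda>z. altsum (g z) vs) S"
  using assms(2)
  by (induction vs arbitrary: g) (simp_all add: smooth_on_const smooth_on_diff assms(1))

lemma smooth_on_dbar:
  assumes "open S" "\<And>ws. smooth_on (\<lambda>z. \<omega> z ws) S"
  shows "smooth_on (\<lambda>z. dbar \<omega> z vs) S"
  unfolding dbar_def by (intro smooth_on_altsum smooth_on_delbar_at assms)

lemma delbar_at_altsum:
  assumes S: "open S" "z \<in> S" "\<And>v ws. smooth_on (\<lambda>z. g z v ws) S"
  shows "delbar_at (\<lambda>z. altsum (g z) vs) z u = altsum (\<lambda>v ws. delbar_at (\<lambda>z. g z v ws) z u) vs"
  using assms(3)
proof (induction vs arbitrary: g)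
  case (Cons v vs)
  show ?case
    using smooth_on_differentiable[OF Cons.prems S(2)]
      smooth_on_differentiable[OF smooth_on_altsum[OF S(1), of "\<lambda>z w ws. g z w (v # ws)"] S(2)] Cons.prems
    by (simp add: delbar_at_diff Cons.IH)
qed (simp add: delbar_at_const)

text \<open>Each pair of entries is moved to the front in both orders, with opposite signs.\<close>

lemma altsum_altsum_symmetric:
  assumes "\<And>u v ws. g u v ws = g v u ws"
  shows "altsum (\<lambda>u us. altsum (g u) us) vs = 0"
  using assms
proof (induction vs arbitrary: g)
  case (Cons x vs)
  have "altsum (\<lambda>u us. altsum (\<lambda>v ws. g u v (x # ws)) us) vs = 0"
    by (rule Cons.IH) (rule Cons.prems)
  moreover have "altsum (\<lambda>u us. g u x us) vs = altsum (g x) vs"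
    using Cons.prems[of _ x] by simp
  ultimately show ?case by (simp add: altsum_diff)
qed simp

lemma dbar_dbar:
  assumes "open S" "z \<in> S" "\<And>ws. smooth_on (\<lambda>z. \<omega> z ws) S"
  shows "dbar (dbar \<omega>) z vs = 0"
proof -
  have "dbar (dbar \<omega>) z vs
      = altsum (\<lambda>u us. altsum (\<lambda>v ws. delbar_at (\<lambda>z. delbar_at (\<lambda>z. \<omega> z ws) z v) z u) us) vs"
    unfolding dbar_def
    by (subst delbar_at_altsum[OF assms(1,2)]) (intro smooth_on_delbar_at assms refl)+
  also have "\<dots> = 0"
    by (rule altsum_altsum_symmetric) (rule delbar_at_commute[OF assms(1,3,2)])
  finally show ?thesis .
qed

text \<open>The rest of the list is shorter by one entry, which accounts for the minus sign. It
  makes \<open>dbar\<close> anticommute with \<open>invol\<close>.\<close>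

lemma altsum_sign: "altsum (\<lambda>v ws. (-1) ^ length ws * g v ws) vs = - ((-1) ^ length vs * altsum g vs)"
proof (induction vs arbitrary: g)
  case (Cons v vs)
  show ?case using Cons.IH[of "\<lambda>w ws. - g w (v # ws)"] by (simp add: algebra_simps altsum_uminus)
qed simp

definition dbar_mat ::
    "(complex ^ 'd::finite \<Rightarrow> (complex ^ 'd) list \<Rightarrow> nat \<Rightarrow> nat \<Rightarrow> complex) \<Rightarrow>
     complex ^ 'd \<Rightarrow> (complex ^ 'd) list \<Rightarrow> nat \<Rightarrow> nat \<Rightarrow> complex" where
  "dbar_mat \<beta> z vs i k = dbar (\<lambda>z ws. \<beta> z ws i k) z vs"

lemma dbar_mat_Cons:
  "dbar_mat \<beta> z (v # vs) = (\<lambda>i k. delbar_at (\<lambda>z. \<beta> z vs i k) z v - dbar_mat (\<lambda>z ws. \<beta> z (v # ws)) z vs i k)"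
  by (simp add: dbar_mat_def dbar_Cons fun_eq_iff)

lemma dbar_mat_invol:
  assumes "\<And>ws i k. (\<lambda>z. \<beta> z ws i k) differentiable (at z)"
  shows "dbar_mat (\<lambda>z. invol sc sb (\<beta> z)) z = (\<lambda>vs i k. - invol sc sb (dbar_mat \<beta> z) vs i k)"
proof (intro ext)
  fix vs i k
  have "delbar_at (\<lambda>z. (-1) ^ length ws * (sc i * sb k) * \<beta> z ws i k) z v
      = (-1) ^ length ws * (sc i * sb k * delbar_at (\<lambda>z. \<beta> z ws i k) z v)" for v ws
    by (subst delbar_at_cmult[OF assms]) (simp add: mult.assoc)
  then have "dbar_mat (\<lambda>z. invol sc sb (\<beta> z)) z vs i k
      = altsum (\<lambda>v ws. (-1) ^ length ws * (sc i * sb k * delbar_at (\<lambda>z. \<beta> z ws i k) z v)) vs"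
    unfolding dbar_mat_def dbar_def invol_def by (simp only:)
  also have "\<dots> = - invol sc sb (dbar_mat \<beta> z) vs i k"
    by (simp add: altsum_sign altsum_mult invol_def dbar_mat_def dbar_def)
  finally show "dbar_mat (\<lambda>z. invol sc sb (\<beta> z)) z vs i k = - invol sc sb (dbar_mat \<beta> z) vs i k" .
qed

lemma smooth_on_invol:
  "open S \<Longrightarrow> smooth_on (\<lambda>z. \<beta> z ws i k) S \<Longrightarrow> smooth_on (\<lambda>z. invol sc sb (\<beta> z) ws i k) S"
  unfolding invol_def by (intro smooth_on_mult smooth_on_const)

lemma smooth_on_wedge:
  assumes "open S" "\<And>ws i k. smooth_on (\<lambda>z. \<beta> z ws i k) S" "\<And>ws i k. smooth_on (\<lambda>z. \<alpha> z ws i k) S"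
  shows "smooth_on (\<lambda>z. wedge r sc sb (\<beta> z) (\<alpha> z) vs i j) S"
  using assms(2,3)
proof (induction vs arbitrary: \<beta> \<alpha>)
  case Nil
  then show ?case using assms(1) by (simp add: smooth_on_sum smooth_on_mult)
next
  case (Cons v vs)
  have "smooth_on (\<lambda>z. wedge r sc sb (\<lambda>ws. \<beta> z (v # ws)) (\<alpha> z) vs i j) S"
    by (rule Cons.IH) (use Cons.prems in auto)
  moreover have "smooth_on (\<lambda>z. wedge r sc sb (invol sc sb (\<beta> z)) (\<lambda>ws. \<alpha> z (v # ws)) vs i j) S"
    by (rule Cons.IH) (intro smooth_on_invol Cons.prems assms(1))+
  ultimately show ?case using assms(1) by (simp add: smooth_on_add)
qed

lemma delbar_at_invol:
  assumes "open S" "z \<in> S" "\<And>ws i k. smooth_on (\<lambda>z. \<beta> z ws i k) S"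
  shows "(\<lambda>ws i k. delbar_at (\<lambda>z. invol sc sb (\<beta> z) ws i k) z v)
       = invol sc sb (\<lambda>ws i k. delbar_at (\<lambda>z. \<beta> z ws i k) z v)"
  unfolding invol_def using delbar_at_cmult[OF smooth_on_differentiable[OF assms(3,2)]] by simp

lemma delbar_at_wedge:
  assumes S: "open S" "z \<in> S" and "\<And>ws i k. smooth_on (\<lambda>z. \<beta> z ws i k) S" "\<And>ws i k. smooth_on (\<lambda>z. \<alpha> z ws i k) S"
  shows "delbar_at (\<lambda>z. wedge r sc sb (\<beta> z) (\<alpha> z) vs i j) z v
       = wedge r sc sb (\<lambda>ws i k. delbar_at (\<lambda>z. \<beta> z ws i k) z v) (\<alpha> z) vs i j
       + wedge r sc sb (\<beta> z) (\<lambda>ws i k. delbar_at (\<lambda>z. \<alpha> z ws i k) z v) vs i j"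
  using assms(3,4)
proof (induction vs arbitrary: \<beta> \<alpha>)
  case Nil
  note d = smooth_on_differentiable[OF Nil(1) S(2)] smooth_on_differentiable[OF Nil(2) S(2)]
  show ?case
    by (simp add: delbar_at_sum delbar_at_mult d sum.distrib add.commute)
next
  case (Cons w ws)
  have I: "smooth_on (\<lambda>z. invol sc sb (\<beta> z) ws i k) S" for ws i k
    by (intro smooth_on_invol Cons.prems S)
  have d: "(\<lambda>z. wedge r sc sb (\<lambda>ws. \<beta> z (w # ws)) (\<alpha> z) ws i j) differentiable (at z)"
    "(\<lambda>z. wedge r sc sb (invol sc sb (\<beta> z)) (\<lambda>ws. \<alpha> z (w # ws)) ws i j) differentiable (at z)"
    by (intro smooth_on_differentiable[OF smooth_on_wedge[OF S(1)] S(2)] Cons.prems I)+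
  have "delbar_at (\<lambda>z. wedge r sc sb (\<lambda>ws. \<beta> z (w # ws)) (\<alpha> z) ws i j) z v
      = wedge r sc sb (\<lambda>ws i k. delbar_at (\<lambda>z. \<beta> z (w # ws) i k) z v) (\<alpha> z) ws i j
      + wedge r sc sb (\<lambda>ws. \<beta> z (w # ws)) (\<lambda>ws i k. delbar_at (\<lambda>z. \<alpha> z ws i k) z v) ws i j"
    by (rule Cons.IH) (rule Cons.prems)+
  moreover have "delbar_at (\<lambda>z. wedge r sc sb (invol sc sb (\<beta> z)) (\<lambda>ws. \<alpha> z (w # ws)) ws i j) z v
      = wedge r sc sb (\<lambda>ws i k. delbar_at (\<lambda>z. invol sc sb (\<beta> z) ws i k) z v) (\<lambda>ws. \<alpha> z (w # ws)) ws i j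
      + wedge r sc sb (invol sc sb (\<beta> z)) (\<lambda>ws i k. delbar_at (\<lambda>z. \<alpha> z (w # ws) i k) z v) ws i j"
    by (rule Cons.IH) (rule Cons.prems I)+
  ultimately show ?case
    unfolding wedge.simps delbar_at_add[OF d] delbar_at_invol[OF S Cons.prems(1)] by simp
qed

text \<open>Contraction with \<open>v\<close> anticommutes with \<open>dbar\<close> up to the
  antiholomorphic derivative along \<open>v\<close> (\<open>dbar_mat_Cons\<close>), and that
  derivative obeys the ungraded product rule (\<open>delbar_at_wedge\<close>). With the contraction
  rule of \<open>wedge\<close>, both sides satisfy one recursion.\<close>

lemma dbar_mat_wedge:
  assumes S: "open S" "z \<in> S" and "\<And>ws i k. smooth_on (\<lambda>z. \<beta> z ws i k) S" "\<And>ws i k. smooth_on (\<lambda>z. \<alpha> z ws i k) S"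
    and sgn: "\<And>k. sc k * sc k = 1" "\<And>k. sb k * sb k = 1"
  shows "dbar_mat (\<lambda>z. wedge r sc sb (\<beta> z) (\<alpha> z)) z vs i j
       = wedge r sc sb (dbar_mat \<beta> z) (\<alpha> z) vs i j + wedge r sc sb (invol sc sb (\<beta> z)) (dbar_mat \<alpha> z) vs i j"
  using assms(3,4)
proof (induction vs arbitrary: \<beta> \<alpha>)
  case Nil
  then show ?case by (simp add: dbar_mat_def dbar_Nil)
next
  case (Cons v vs)
  let ?W = "wedge r sc sb" and ?s = "invol sc sb"
  let ?\<beta>v = "\<lambda>z ws. \<beta> z (v # ws)" and ?\<alpha>v = "\<lambda>z ws. \<alpha> z (v # ws)"
  let ?D\<beta> = "\<lambda>ws i k. delbar_at (\<lambda>z. \<beta> z ws i k) z v" and ?D\<alpha> = "\<lambda>ws i k. delbar_at (\<lambda>z. \<alpha> z ws i k) z v"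
  have I: "smooth_on (\<lambda>z. ?s (\<beta> z) ws i k) S" for ws i k
    by (intro smooth_on_invol Cons.prems S)
  note d\<beta> = smooth_on_differentiable[OF Cons.prems(1) S(2)]
  have "dbar_mat (\<lambda>z. ?W (\<beta> z) (\<alpha> z)) z (v # vs) i j
      = delbar_at (\<lambda>z. ?W (\<beta> z) (\<alpha> z) vs i j) z v
        - dbar (\<lambda>z ws. ?W (?\<beta>v z) (\<alpha> z) ws i j + ?W (?s (\<beta> z)) (?\<alpha>v z) ws i j) z vs"
    by (simp add: dbar_mat_def dbar_Cons)
  also have "dbar (\<lambda>z ws. ?W (?\<beta>v z) (\<alpha> z) ws i j + ?W (?s (\<beta> z)) (?\<alpha>v z) ws i j) z vs
      = dbar_mat (\<lambda>z. ?W (?\<beta>v z) (\<alpha> z)) z vs i j + dbar_mat (\<lambda>z. ?W (?s (\<beta> z)) (?\<alpha>v z)) z vs i j"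
    unfolding dbar_mat_def
    by (intro dbar_add smooth_on_differentiable[OF smooth_on_wedge[OF S(1)] S(2)] Cons.prems I)
  also have "dbar_mat (\<lambda>z. ?W (?\<beta>v z) (\<alpha> z)) z vs i j
      = ?W (dbar_mat ?\<beta>v z) (\<alpha> z) vs i j + ?W (?s (?\<beta>v z)) (dbar_mat \<alpha> z) vs i j"
    by (rule Cons.IH) (rule Cons.prems)+
  also have "dbar_mat (\<lambda>z. ?W (?s (\<beta> z)) (?\<alpha>v z)) z vs i j
      = ?W (dbar_mat (\<lambda>z. ?s (\<beta> z)) z) (?\<alpha>v z) vs i j + ?W (?s (?s (\<beta> z))) (dbar_mat ?\<alpha>v z) vs i j"
    by (rule Cons.IH) (rule Cons.prems I)+
  also have "?s (?s (\<beta> z)) = \<beta> z" by (rule invol_invol[OF sgn])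
  also have "dbar_mat (\<lambda>z. ?s (\<beta> z)) z = (\<lambda>vs i k. - ?s (dbar_mat \<beta> z) vs i k)"
    by (rule dbar_mat_invol[OF d\<beta>])
  also have "delbar_at (\<lambda>z. ?W (\<beta> z) (\<alpha> z) vs i j) z v = ?W ?D\<beta> (\<alpha> z) vs i j + ?W (\<beta> z) ?D\<alpha> vs i j"
    by (rule delbar_at_wedge[OF S Cons.prems])
  finally have L: "dbar_mat (\<lambda>z. ?W (\<beta> z) (\<alpha> z)) z (v # vs) i j
      = ?W ?D\<beta> (\<alpha> z) vs i j + ?W (\<beta> z) ?D\<alpha> vs i j - (?W (dbar_mat ?\<beta>v z) (\<alpha> z) vs i j
        + ?W (?s (?\<beta>v z)) (dbar_mat \<alpha> z) vs i j - ?W (?s (dbar_mat \<beta> z)) (?\<alpha>v z) vs i j + ?W (\<beta> z) (dbar_mat ?\<alpha>v z) vs i j)"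
    by (simp add: wedge_minus_left)
  have c: "(\<lambda>ws. dbar_mat \<gamma> z (v # ws))
      = (\<lambda>ws i k. delbar_at (\<lambda>z. \<gamma> z ws i k) z v - dbar_mat (\<lambda>z ws. \<gamma> z (v # ws)) z ws i k)" for \<gamma>
    by (simp add: dbar_mat_Cons)
  have s: "(\<lambda>ws. ?s (\<beta> z) (v # ws)) = (\<lambda>ws i k. - ?s (?\<beta>v z) ws i k)"
    by (simp add: invol_Cons fun_eq_iff)
  show ?case
    unfolding L wedge.simps c s
    by (simp add: wedge_diff_left wedge_diff_right wedge_minus_left invol_invol[OF sgn])
qed

lemma slot_sum_mult: "slot_sum J B (\<lambda>us. c * \<theta> us) ws = c * slot_sum J B \<theta> ws"
  by (induction ws arbitrary: \<theta>) (simp_all add: algebra_simps)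

lemma slot_sum_sum: "slot_sum J B (\<lambda>us. \<Sum>k\<in>K. \<theta> k us) ws = (\<Sum>k\<in>K. slot_sum J B (\<theta> k) ws)"
  by (induction ws arbitrary: \<theta>) (simp_all add: sum.distrib)

lemma antialt_basis_hd:
  assumes "antialt \<theta>"
  shows "\<theta> ((v :: complex ^ 'd::finite) # ys) = (\<Sum>k\<in>UNIV. cnj (v $ k) * \<theta> (axis k 1 # ys))"
  using antialt_basis_at[OF assms, of "[]" v ys] by (simp only: append_Nil)

text \<open>The arguments move with the point. Antilinearity expands the first one into basis
  vectors with conjugated holomorphic coefficients; their antiholomorphic derivative is the
  conjugate of the holomorphic one and yields the next term of \<open>slot_sum\<close>.\<close>

lemma delbar_at_moving_arguments:
  fixes \<phi> :: "complex ^ 'c::finite \<Rightarrow> complex ^ 'd::finite" and J :: "complex ^ 'c \<Rightarrow> 'u \<Rightarrow> complex ^ 'd"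
  assumes S: "open S" "open T" "z \<in> S" and \<phi>: "\<And>k. cholomorphic_on (\<lambda>z. \<phi> z $ k) S" "\<phi> ` S \<subseteq> T"
    and J: "\<And>w k. cholomorphic_on (\<lambda>z. J z w $ k) S"
    and "\<And>w. w \<in> T \<Longrightarrow> antialt (\<theta> w)" "\<And>ws. smooth_on (\<lambda>w. \<theta> w ws) T"
  shows "smooth_on (\<lambda>z. \<theta> (\<phi> z) (map (J z) ws)) S \<and>
    delbar_at (\<lambda>z. \<theta> (\<phi> z) (map (J z) ws)) z v
     = delbar_at (\<lambda>w. \<theta> w (map (J z) ws)) (\<phi> z) (vec_deriv \<phi> z v)
       + slot_sum (J z) (\<lambda>w. vec_deriv (\<lambda>z. J z w) z v) (\<theta> (\<phi> z)) ws"
  using assms(7,8)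
proof (induction ws arbitrary: \<theta>)
  case Nil
  have "\<phi> z \<in> T" using S(3) \<phi>(2) by blast
  then show ?case
    using smooth_on_compose[OF S(1,2) cholomorphic_on_smooth[OF \<phi>(1) S(1)] \<phi>(2) Nil(2)]
      delbar_at_compose[OF \<phi>(1) S(3) smooth_on_differentiable[OF Nil(2)]] by simp
next
  case (Cons w ws)
  have pz: "\<phi> z \<in> T" using S(3) \<phi>(2) by blast
  define \<theta>' where "\<theta>' k = (\<lambda>x us. \<theta> x (axis k 1 # us))" for k
  have IH: "smooth_on (\<lambda>z. \<theta>' k (\<phi> z) (map (J z) ws)) S"
    "delbar_at (\<lambda>z. \<theta>' k (\<phi> z) (map (J z) ws)) z v
     = delbar_at (\<lambda>w. \<theta>' k w (map (J z) ws)) (\<phi> z) (vec_deriv \<phi> z v)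
       + slot_sum (J z) (\<lambda>w. vec_deriv (\<lambda>z. J z w) z v) (\<theta>' k (\<phi> z)) ws" for k
  proof -
    have 1: "antialt (\<theta>' k w)" if "w \<in> T" for w
      unfolding \<theta>'_def by (rule antialt_Cons[OF Cons.prems(1)[OF that]])
    have 2: "smooth_on (\<lambda>w. \<theta>' k w ws) T" for ws
      unfolding \<theta>'_def by (rule Cons.prems(2))
    show "smooth_on (\<lambda>z. \<theta>' k (\<phi> z) (map (J z) ws)) S"
      "delbar_at (\<lambda>z. \<theta>' k (\<phi> z) (map (J z) ws)) z v
       = delbar_at (\<lambda>w. \<theta>' k w (map (J z) ws)) (\<phi> z) (vec_deriv \<phi> z v)
         + slot_sum (J z) (\<lambda>w. vec_deriv (\<lambda>z. J z w) z v) (\<theta>' k (\<phi> z)) ws"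
      using Cons.IH[OF 1 2] by simp_all
  qed
  have ex: "\<theta> x (u # us) = (\<Sum>k\<in>UNIV. cnj (u $ k) * \<theta>' k x us)" if "x \<in> T" for x u us
    unfolding \<theta>'_def by (rule antialt_basis_hd[OF Cons.prems(1)[OF that]])
  have eq: "\<theta> (\<phi> x) (map (J x) (w # ws)) = (\<Sum>k\<in>UNIV. cnj (J x w $ k) * \<theta>' k (\<phi> x) (map (J x) ws))"
    if "x \<in> S" for x
  proof -
    have "\<phi> x \<in> T" using that \<phi>(2) by blast
    from ex[OF this, of "J x w" "map (J x) ws"] show ?thesis by (simp only: list.map)
  qed
  have Jc: "smooth_on (\<lambda>z. cnj (J z w $ k)) S" for k
    by (intro smooth_on_cnj cholomorphic_on_smooth J S)
  have sm: "smooth_on (\<lambda>x. \<Sum>k\<in>UNIV. cnj (J x w $ k) * \<theta>' k (\<phi> x) (map (J x) ws)) S"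
    by (intro smooth_on_sum smooth_on_mult Jc IH S)
  have 1: "smooth_on (\<lambda>z. \<theta> (\<phi> z) (map (J z) (w # ws))) S"
  proof -
    have "smooth_on (\<lambda>z. \<theta> (\<phi> z) (map (J z) (w # ws))) S
        \<longleftrightarrow> smooth_on (\<lambda>x. \<Sum>k\<in>UNIV. cnj (J x w $ k) * \<theta>' k (\<phi> x) (map (J x) ws)) S"
      by (rule smooth_on_cong[OF S(1) eq])
    with sm show ?thesis by blast
  qed
  note d = smooth_on_differentiable[OF IH(1) S(3)] smooth_on_differentiable[OF Jc S(3)]
  have d\<theta>: "(\<lambda>x. \<theta>' k x us) differentiable (at (\<phi> z))" for k us
    using smooth_on_differentiable[OF Cons.prems(2) pz] by (simp add: \<theta>'_def)
  have "delbar_at (\<lambda>z. \<theta> (\<phi> z) (map (J z) (w # ws))) z v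
      = delbar_at (\<lambda>x. \<Sum>k\<in>UNIV. cnj (J x w $ k) * \<theta>' k (\<phi> x) (map (J x) ws)) z v"
    by (rule delbar_at_cong[OF S(1,3) eq])
  also have "\<dots> = (\<Sum>k\<in>UNIV. cnj (J z w $ k) * (delbar_at (\<lambda>x. \<theta>' k x (map (J z) ws)) (\<phi> z) (vec_deriv \<phi> z v)
       + slot_sum (J z) (\<lambda>w. vec_deriv (\<lambda>z. J z w) z v) (\<theta>' k (\<phi> z)) ws)
       + cnj (frechet_derivative (\<lambda>z. J z w $ k) (at z) v) * \<theta>' k (\<phi> z) (map (J z) ws))"
    using d by (simp add: delbar_at_sum delbar_at_mult IH(2) delbar_at_cnj_holomorphic[OF J S(3)])
  also have "\<dots> = (\<Sum>k\<in>UNIV. cnj (J z w $ k) * delbar_at (\<lambda>x. \<theta>' k x (map (J z) ws)) (\<phi> z) (vec_deriv \<phi> z v))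
      + (\<Sum>k\<in>UNIV. cnj (J z w $ k) * slot_sum (J z) (\<lambda>w. vec_deriv (\<lambda>z. J z w) z v) (\<theta>' k (\<phi> z)) ws)
      + (\<Sum>k\<in>UNIV. cnj (vec_deriv (\<lambda>z. J z w) z v $ k) * \<theta>' k (\<phi> z) (map (J z) ws))"
    by (simp add: sum.distrib distrib_left vec_deriv_def)
  also have "(\<Sum>k\<in>UNIV. cnj (vec_deriv (\<lambda>z. J z w) z v $ k) * \<theta>' k (\<phi> z) (map (J z) ws))
      = \<theta> (\<phi> z) (vec_deriv (\<lambda>z. J z w) z v # map (J z) ws)"
    by (rule ex[OF pz, symmetric])
  also have "(\<Sum>k\<in>UNIV. cnj (J z w $ k) * slot_sum (J z) (\<lambda>w. vec_deriv (\<lambda>z. J z w) z v) (\<theta>' k (\<phi> z)) ws)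
      = slot_sum (J z) (\<lambda>w. vec_deriv (\<lambda>z. J z w) z v) (\<lambda>us. \<theta> (\<phi> z) (J z w # us)) ws"
    by (simp only: ex[OF pz] slot_sum_sum slot_sum_mult)
  also have "(\<Sum>k\<in>UNIV. cnj (J z w $ k) * delbar_at (\<lambda>x. \<theta>' k x (map (J z) ws)) (\<phi> z) (vec_deriv \<phi> z v))
      = delbar_at (\<lambda>x. \<Sum>k\<in>UNIV. cnj (J z w $ k) * \<theta>' k x (map (J z) ws)) (\<phi> z) (vec_deriv \<phi> z v)"
    using d\<theta> by (simp add: delbar_at_sum delbar_at_cmult)
  also have "\<dots> = delbar_at (\<lambda>x. \<theta> x (map (J z) (w # ws))) (\<phi> z) (vec_deriv \<phi> z v)"
    by (rule delbar_at_cong[OF S(2) pz]) (simp only: list.map ex)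
  finally show ?case using 1 by (simp add: add.assoc add.commute)
qed

text \<open>Besides the pullback of \<open>dbar \<theta>\<close>, the product rule leaves terms with
  the second derivative \<open>H\<close> of \<phi>. It is symmetric, so alternation removes
  them.\<close>

lemma dbar_pullback:
  fixes \<phi> :: "complex ^ 'c::finite \<Rightarrow> complex ^ 'd::finite"
  assumes S: "open S" "open T" "z \<in> S" and \<phi>: "\<And>k. cholomorphic_on (\<lambda>z. \<phi> z $ k) S" "\<phi> ` S \<subseteq> T"
    and \<theta>: "\<And>w. w \<in> T \<Longrightarrow> antialt (\<theta> w)" "\<And>ws. smooth_on (\<lambda>w. \<theta> w ws) T"
    and \<omega>: "\<And>z vs. z \<in> S \<Longrightarrow> \<omega> z vs = \<theta> (\<phi> z) (map (vec_deriv \<phi> z) vs)"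
  shows "dbar \<omega> z vs = dbar \<theta> (\<phi> z) (map (vec_deriv \<phi> z) vs)"
proof -
  define H where "H v w = vec_deriv (\<lambda>z. vec_deriv \<phi> z w) z v" for v w
  have J: "cholomorphic_on (\<lambda>z. vec_deriv \<phi> z w $ k) S" for w k
    using cholomorphic_on_frechet_derivative[OF \<phi>(1) S(1)] by (simp add: vec_deriv_def)
  have sym: "H v w = H w v" for v w
    using smooth_on_symmetric_derivative[OF S(1) cholomorphic_on_smooth[OF \<phi>(1) S(1)] S(3)]
    by (simp add: H_def vec_deriv_def)
  have pz: "\<phi> z \<in> T" using S(3) \<phi>(2) by blast
  have "delbar_at (\<lambda>z. \<omega> z ws) z v = delbar_at (\<lambda>w. \<theta> w (map (vec_deriv \<phi> z) ws)) (\<phi> z) (vec_deriv \<phi> z v)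
       + slot_sum (vec_deriv \<phi> z) (H v) (\<theta> (\<phi> z)) ws" for v ws
  proof -
    have "delbar_at (\<lambda>z. \<omega> z ws) z v = delbar_at (\<lambda>z. \<theta> (\<phi> z) (map (vec_deriv \<phi> z) ws)) z v"
      by (rule delbar_at_cong[OF S(1,3) \<omega>])
    then show ?thesis
      using delbar_at_moving_arguments[where J = "vec_deriv \<phi>" and \<theta> = \<theta> and ws = ws and v = v, OF S \<phi> J \<theta>]
      by (simp add: H_def[abs_def])
  qed
  then have "dbar \<omega> z vs = altsum (\<lambda>v ws. delbar_at (\<lambda>w. \<theta> w (map (vec_deriv \<phi> z) ws)) (\<phi> z) (vec_deriv \<phi> z v)) vs
      + altsum (\<lambda>v ws. slot_sum (vec_deriv \<phi> z) (H v) (\<theta> (\<phi> z)) ws) vs"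
    unfolding dbar_def by (simp add: altsum_add)
  also have "altsum (\<lambda>v ws. slot_sum (vec_deriv \<phi> z) (H v) (\<theta> (\<phi> z)) ws) vs = 0"
    by (rule altsum_slot_sum_symmetric[OF \<theta>(1)[OF pz] sym])
  also have "altsum (\<lambda>v ws. delbar_at (\<lambda>w. \<theta> w (map (vec_deriv \<phi> z) ws)) (\<phi> z) (vec_deriv \<phi> z v)) vs
      = dbar \<theta> (\<phi> z) (map (vec_deriv \<phi> z) vs)"
    unfolding dbar_def by (rule altsum_map)
  finally show ?thesis by simp
qed

section \<open>Charts, bundles and local forms\<close>

lemma smooth_on_transform:
  assumes "open S" "smooth_on g S" "\<And>z. z \<in> S \<Longrightarrow> f z = g z"
  shows "smooth_on f S"
  using smooth_on_cong[of S f g, OF assms(1,3)] assms(2) by simp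

lemma cholomorphic_on_const: "cholomorphic_on (\<lambda>z. k) S"
  unfolding cholomorphic_on_def by (intro ballI exI[of _ "\<lambda>v. 0"]) simp

lemma cholomorphic_on_transform:
  assumes "open S" "cholomorphic_on g S" "\<And>z. z \<in> S \<Longrightarrow> f z = g z"
  shows "cholomorphic_on f S"
  using cholomorphic_on_cong[of S f g, OF assms(1,3)] assms(2) by simp

text \<open>Padding by zero makes matrix entries functions on all index pairs, so sums and pointwise
  identities carry no bounds on the indices.\<close>

definition ent :: "nat \<Rightarrow> nat \<Rightarrow> complex mat \<Rightarrow> nat \<Rightarrow> nat \<Rightarrow> complex" where
  "ent m n M i j = (if i < m \<and> j < n then M $$ (i, j) else 0)"

lemma ent_eqI:
  assumes "M \<in> carrier_mat m n" "N \<in> carrier_mat m n" "\<And>i j. ent m n M i j = ent m n N i j"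
  shows "M = N"
  using assms(3)[unfolded ent_def] assms(1,2) by (intro eq_matI) (metis carrier_matD)+

lemma dbar_mat_zero: "(\<And>z vs. \<beta> z vs i k = 0) \<Longrightarrow> dbar_mat \<beta> z vs i k = 0"
  by (simp add: dbar_mat_def dbar_def delbar_at_const altsum_zero)

lemma mult_mat_regroup:
  fixes P :: "complex mat"
  assumes "P \<in> carrier_mat m m" "P' \<in> carrier_mat m m" "X \<in> carrier_mat m n"
    "Q' \<in> carrier_mat n n" "Q \<in> carrier_mat n n"
  shows "P * (P' * X * Q') * Q = P * P' * X * (Q' * Q)"
proof -
  have c: "P' * X \<in> carrier_mat m n" "P' * X * Q' \<in> carrier_mat m n" "Q' * Q \<in> carrier_mat n n"
    using assms by (metis mult_carrier_mat)+
  have "P * (P' * X * Q') * Q = P * (P' * X * Q' * Q)" by (rule assoc_mult_mat[OF assms(1) c(2) assms(5)])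
  also have "P' * X * Q' * Q = P' * X * (Q' * Q)" by (rule assoc_mult_mat[OF c(1) assms(4,5)])
  also have "P * (P' * X * (Q' * Q)) = P * (P' * X) * (Q' * Q)" by (rule assoc_mult_mat[OF assms(1) c(1,3), symmetric])
  also have "P * (P' * X) = P * P' * X" by (rule assoc_mult_mat[OF assms(1-3), symmetric])
  finally show ?thesis .
qed

lemma ent_mult:
  assumes "M \<in> carrier_mat m k" "N \<in> carrier_mat k n"
  shows "ent m n (M * N) i j = (\<Sum>l<k. ent m k M i l * ent k n N l j)"
  using assms by (auto simp: ent_def scalar_prod_def atLeast0LessThan)

lemma ent_add:
  assumes "M \<in> carrier_mat m n" "N \<in> carrier_mat m n"
  shows "ent m n (M + N) i j = ent m n M i j + ent m n N i j"
  using assms by (simp add: ent_def)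

lemma ent_zero: "ent m n (0\<^sub>m m n) i j = 0"
  by (simp add: ent_def)

lemma ent_smult: "M \<in> carrier_mat m n \<Longrightarrow> ent m n (c \<cdot>\<^sub>m M) i j = c * ent m n M i j"
  by (auto simp: ent_def)

lemma ent_one: "ent n n (1\<^sub>m n) i j = (if i = j \<and> i < n then 1 else 0)"
  by (simp add: ent_def)

lemma ent_mat: "ent m n (mat m n f) i j = (if i < m \<and> j < n then f (i, j) else 0)"
  by (simp add: ent_def)

text \<open>\<open>mat_inverse\<close> is specified through the units of a matrix ring;
  invertibility has to be turned into membership in those units.\<close>

lemma mat_inv:
  assumes M: "M \<in> carrier_mat n n" "invertible_mat M"
  shows "mat_inv M \<in> carrier_mat n n" "M * mat_inv M = 1\<^sub>m n" "mat_inv M * M = 1\<^sub>m n"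
proof -
  obtain B where B: "M * B = 1\<^sub>m n" "B * M = 1\<^sub>m (dim_row B)"
    using M unfolding invertible_mat_def inverts_mat_def by auto
  have "dim_col B = n" using arg_cong[OF B(1), of dim_col] by simp
  moreover have "dim_row B = n" using arg_cong[OF B(2), of dim_col] M(1) by simp
  ultimately have "B \<in> carrier_mat n n" by auto
  then have "M \<in> Units (ring_mat TYPE(complex) n ())"
    using M(1) B by (auto simp: Units_def ring_mat_def)
  then obtain B' where "mat_inverse M = Some B'"
    using mat_inverse(1)[OF M(1), of "()"] by (cases "mat_inverse M") auto
  with mat_inverse(2)[OF M(1) this]
  show "mat_inv M \<in> carrier_mat n n" "M * mat_inv M = 1\<^sub>m n" "mat_inv M * M = 1\<^sub>m n" by auto
qed

text \<open>The matrix product \<open>P X Q\<close> on the level of entries, so that it also applies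
  to coefficient functions such as \<open>dbar_mat\<close> that are not given as matrices.\<close>

definition sandwich ::
    "nat \<Rightarrow> nat \<Rightarrow> (nat \<Rightarrow> nat \<Rightarrow> complex) \<Rightarrow> (nat \<Rightarrow> nat \<Rightarrow> complex) \<Rightarrow> (nat \<Rightarrow> nat \<Rightarrow> complex) \<Rightarrow>
     nat \<Rightarrow> nat \<Rightarrow> complex" where
  "sandwich m n P X Q i j = (\<Sum>l<n. (\<Sum>k<m. P i k * X k l) * Q l j)"

lemma ent_sandwich:
  assumes "P \<in> carrier_mat m m" "X \<in> carrier_mat m n" "Q \<in> carrier_mat n n"
  shows "ent m n (P * X * Q) i j = sandwich m n (ent m m P) (ent m n X) (ent n n Q) i j"
  unfolding sandwich_def using assms by (subst ent_mult[of _ m n]) (simp_all add: ent_mult[of _ m m])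

lemma antialt_sandwich:
  assumes "\<And>k l. antialt (\<lambda>vs. X vs k l)"
  shows "antialt (\<lambda>vs. sandwich m n P (X vs) Q i j)"
proof -
  have "sandwich m n P (X vs) Q i j = (\<Sum>l<n. Q l j * (\<Sum>k<m. P i k * X vs k l))" for vs
    by (simp add: sandwich_def mult.commute)
  then show ?thesis by (simp add: antialt_sum antialt_mult assms)
qed

text \<open>Holomorphic factors pass through \<open>dbar\<close>. This is why the Dolbeault operator
  of a holomorphic bundle does not depend on the frame.\<close>

lemma dbar_mat_sandwich:
  assumes S: "open S" "z \<in> S" and P: "\<And>k l. cholomorphic_on (\<lambda>z. P z k l) S"
    and X: "\<And>vs k l. smooth_on (\<lambda>z. X z vs k l) S" and Q: "\<And>k l. cholomorphic_on (\<lambda>z. Q z k l) S"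
  shows "dbar_mat (\<lambda>z vs. sandwich m n (P z) (X z vs) (Q z)) z vs i j
       = sandwich m n (P z) (dbar_mat X z vs) (Q z) i j"
proof -
  have eq: "sandwich m n (P z) (Y vs) (Q z) i j = (\<Sum>l<n. Q z l j * (\<Sum>k<m. P z i k * Y vs k l))" for z vs Y
    by (simp add: sandwich_def mult.commute)
  have dX: "(\<lambda>z. X z vs k l) differentiable (at z)" for vs k l
    by (rule smooth_on_differentiable[OF X S(2)])
  have sPX: "smooth_on (\<lambda>z. P z i k * X z vs k l) S" for vs k l
    by (intro smooth_on_mult cholomorphic_on_smooth P X S(1))
  have "dbar_mat (\<lambda>z vs. sandwich m n (P z) (X z vs) (Q z)) z vs i j
      = (\<Sum>l<n. dbar (\<lambda>z vs. Q z l j * (\<Sum>k<m. P z i k * X z vs k l)) z vs)"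
    unfolding dbar_mat_def eq
    by (intro dbar_sum finite_lessThan smooth_on_differentiable[OF _ S(2)] smooth_on_mult
        smooth_on_sum cholomorphic_on_smooth P X Q S(1))
  also have "\<dots> = (\<Sum>l<n. Q z l j * dbar (\<lambda>z vs. \<Sum>k<m. P z i k * X z vs k l) z vs)"
    by (intro sum.cong refl dbar_holomorphic_mult[OF Q S(2)] smooth_on_differentiable[OF _ S(2)]
        smooth_on_sum S(1) sPX)
  also have "\<dots> = (\<Sum>l<n. Q z l j * (\<Sum>k<m. dbar (\<lambda>z vs. P z i k * X z vs k l) z vs))"
    using smooth_on_differentiable[OF sPX S(2)] by (simp add: dbar_sum)
  also have "\<dots> = (\<Sum>l<n. Q z l j * (\<Sum>k<m. P z i k * dbar_mat X z vs k l))"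
    by (simp add: dbar_holomorphic_mult[OF P S(2) dX] dbar_mat_def)
  finally show ?thesis by (simp add: eq)
qed

section \<open>Charts, transition maps and smooth functions\<close>

definition transition :: "('x, 'd::finite) chart \<Rightarrow> ('x, 'd) chart \<Rightarrow> complex ^ 'd \<Rightarrow> complex ^ 'd" where
  "transition c c' z = snd c' (chart_inv c z)"

definition smooth_fun :: "('x, 'd::finite) chart set \<Rightarrow> 'x set \<Rightarrow> ('x \<Rightarrow> complex) \<Rightarrow> bool" where
  "smooth_fun A S f \<longleftrightarrow> (\<forall>c\<in>A. smooth_on (\<lambda>z. f (chart_inv c z)) (chart_image c S))"

locale complex_manifold =
  fixes A :: "('x::t2_space, 'd::finite) chart set"
  assumes atlas: "complex_atlas A"
begin

lemma chart_homeomorphism: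
  "c \<in> A \<Longrightarrow> homeomorphism (fst c) (chart_image c UNIV) (snd c) (chart_inv c)"
  and chart_open: "c \<in> A \<Longrightarrow> open (fst c)"
  and chart_image_UNIV_open: "c \<in> A \<Longrightarrow> open (chart_image c UNIV)"
  using atlas unfolding complex_atlas_def by blast+

lemma chart_inv_snd: "c \<in> A \<Longrightarrow> p \<in> fst c \<Longrightarrow> chart_inv c (snd c p) = p"
  using chart_homeomorphism unfolding homeomorphism_def by blast

lemma chart_imageE:
  assumes "c \<in> A" "z \<in> chart_image c S"
  shows "chart_inv c z \<in> fst c" "chart_inv c z \<in> S" "snd c (chart_inv c z) = z"
proof -
  obtain p where "p \<in> fst c" "p \<in> S" "z = snd c p" using assms(2) unfolding chart_image_def by blast
  then show "chart_inv c z \<in> fst c" "chart_inv c z \<in> S" "snd c (chart_inv c z) = z"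
    using chart_inv_snd[OF assms(1)] by auto
qed

lemma chart_imageI: "p \<in> fst c \<Longrightarrow> p \<in> S \<Longrightarrow> snd c p \<in> chart_image c S"
  unfolding chart_image_def by blast

lemma chart_image_iff:
  assumes "c \<in> A" shows "z \<in> chart_image c S \<longleftrightarrow> z \<in> chart_image c UNIV \<and> chart_inv c z \<in> S"
proof
  assume "z \<in> chart_image c S"
  then show "z \<in> chart_image c UNIV \<and> chart_inv c z \<in> S"
    using chart_imageE[OF assms] unfolding chart_image_def by blast
next
  assume *: "z \<in> chart_image c UNIV \<and> chart_inv c z \<in> S"
  then show "z \<in> chart_image c S"
    using chart_imageI[of "chart_inv c z" c S] chart_imageE[OF assms, of z UNIV] by simp
qed

lemma chart_image_mono: "S \<subseteq> T \<Longrightarrow> chart_image c S \<subseteq> chart_image c T"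
  unfolding chart_image_def by blast

lemma chart_image_open:
  assumes "c \<in> A" "open S"
  shows "open (chart_image c S)"
proof -
  have "openin (top_of_set (fst c)) (fst c \<inter> S)" using assms(2) by (simp add: openin_open_Int)
  then have "openin (top_of_set (chart_image c UNIV)) (chart_image c S)"
    using homeomorphism_imp_open_map[OF chart_homeomorphism[OF assms(1)]] unfolding chart_image_def by blast
  then show ?thesis using openin_open_trans chart_image_UNIV_open[OF assms(1)] by blast
qed

lemma chart_at: "chart_at A p \<in> A" "p \<in> fst (chart_at A p)"
proof -
  have "\<exists>c. c \<in> A \<and> p \<in> fst c" using atlas unfolding complex_atlas_def by blast
  then have "chart_at A p \<in> A \<and> p \<in> fst (chart_at A p)" unfolding chart_at_def by (rule someI_ex)
  then show "chart_at A p \<in> A" "p \<in> fst (chart_at A p)" by auto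
qed

lemma transition_holomorphic:
  assumes "c \<in> A" "c' \<in> A"
  shows "cholomorphic_on (\<lambda>z. transition c c' z $ k) (chart_image c (fst c'))"
  using assms atlas unfolding complex_atlas_def transition_def by blast

lemma transition_image:
  assumes "c \<in> A" "c' \<in> A"
  shows "transition c c' ` chart_image c (fst c' \<inter> S) \<subseteq> chart_image c' (fst c \<inter> S)"
  using chart_imageE[OF assms(1)] unfolding transition_def
  by (auto intro!: chart_imageI)

lemma chart_inv_transition:
  assumes "c \<in> A" "c' \<in> A" "z \<in> chart_image c (fst c')"
  shows "chart_inv c' (transition c c' z) = chart_inv c z"
  using chart_imageE[OF assms(1,3)] chart_inv_snd[OF assms(2)] by (simp add: transition_def)

lemma chart_vec_eq:
  assumes "c \<in> A" "p \<in> fst c"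
  shows "chart_vec A c p = vec_deriv (transition c (chart_at A p)) (snd c p)"
proof -
  have "snd c p \<in> chart_image c (fst (chart_at A p))" by (rule chart_imageI[OF assms(2) chart_at(2)])
  from has_derivative_frechetD[OF has_vec_deriv[OF transition_holomorphic[OF assms(1) chart_at(1)] this]]
  show ?thesis unfolding chart_vec_def transition_def[abs_def] by simp
qed

lemma chart_vec_linear:
  assumes "c \<in> A" "p \<in> fst c"
  shows "chart_vec A c p (u + v) = chart_vec A c p u + chart_vec A c p v"
    "chart_vec A c p (a *s v) = a *s chart_vec A c p v"
proof -
  have z: "snd c p \<in> chart_image c (fst (chart_at A p))" by (rule chart_imageI[OF assms(2) chart_at(2)])
  note h = transition_holomorphic[OF assms(1) chart_at(1)]
  show "chart_vec A c p (u + v) = chart_vec A c p u + chart_vec A c p v"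
    unfolding chart_vec_eq[OF assms] using linear_add[OF has_derivative_linear[OF has_vec_deriv[OF h z]]] .
  show "chart_vec A c p (a *s v) = a *s chart_vec A c p v"
    unfolding chart_vec_eq[OF assms] by (rule vec_deriv_scale[OF h z])
qed

lemma chart_vec_chart_at: "chart_vec A (chart_at A p) p v = v"
proof -
  let ?c = "chart_at A p"
  have "((\<lambda>z. z) has_derivative (\<lambda>v. v)) (at (snd ?c p))" by (rule has_derivative_ident)
  then have "((\<lambda>z. snd ?c (chart_inv ?c z)) has_derivative (\<lambda>v. v)) (at (snd ?c p))"
    by (rule has_derivative_transform_within_open[OF _ chart_image_UNIV_open[OF chart_at(1)]])
      (auto intro!: chart_imageI chart_at simp: chart_imageE(3)[OF chart_at(1)])
  then show ?thesis unfolding chart_vec_def using has_derivative_frechetD by metis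
qed

text \<open>The chain rule through the preferred chart at \<open>p\<close>. The identity is one at
  the single point \<open>p\<close>, since the preferred chart may jump from point to point.\<close>

lemma chart_vec_transition:
  assumes "c \<in> A" "c' \<in> A" "p \<in> fst c" "p \<in> fst c'"
  shows "chart_vec A c p v = chart_vec A c' p (vec_deriv (transition c c') (snd c p) v)"
proof -
  let ?c0 = "chart_at A p"
  let ?S = "chart_image c (fst c' \<inter> fst ?c0)"
  have S: "open ?S" "snd c p \<in> ?S"
    by (intro chart_image_open assms open_Int chart_open chart_at(1))
      (intro chart_imageI IntI assms chart_at(2))
  have h: "cholomorphic_on (\<lambda>z. transition c c' z $ k) ?S" for k
    by (rule cholomorphic_on_subset[OF transition_holomorphic[OF assms(1,2)]])
      (rule chart_image_mono, blast)
  have h': "cholomorphic_on (\<lambda>z. transition c' ?c0 z $ k) (chart_image c' (fst ?c0))" for k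
    by (rule transition_holomorphic[OF assms(2) chart_at(1)])
  have im: "transition c c' ` ?S \<subseteq> chart_image c' (fst ?c0)"
    by (rule subset_trans[OF transition_image[OF assms(1,2)] chart_image_mono]) (rule Int_lower2)
  have eq: "transition c ?c0 z = transition c' ?c0 (transition c c' z)" if "z \<in> ?S" for z
    using chart_inv_transition[OF assms(1,2) subsetD[OF chart_image_mono[OF Int_lower1] that]]
    unfolding transition_def by simp
  have tp: "transition c c' (snd c p) = snd c' p"
    using chart_inv_snd assms by (simp add: transition_def)
  have "frechet_derivative (\<lambda>z. transition c ?c0 z $ k) (at (snd c p)) v
      = frechet_derivative (\<lambda>z. transition c' ?c0 z $ k) (at (snd c' p)) (vec_deriv (transition c c') (snd c p) v)" for k
    using frechet_derivative_cong_open(1)[OF S, of "\<lambda>z. transition c ?c0 z $ k" "\<lambda>z. transition c' ?c0 (transition c c' z) $ k"]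
      cholomorphic_on_compose(2)[OF h im h' S(2)] eq by (simp add: tp)
  then show ?thesis
    unfolding chart_vec_eq[OF assms(1,3)] chart_vec_eq[OF assms(2,4)] by (simp add: vec_deriv_def)
qed

text \<open>One chart suffices on its domain: every other chart differs from it by a holomorphic,
  hence smooth, transition map.\<close>

lemma smooth_fun_chartI:
  assumes "c \<in> A" "open S" "S \<subseteq> fst c" "smooth_on (\<lambda>z. f (chart_inv c z)) (chart_image c S)"
  shows "smooth_fun A S f"
  unfolding smooth_fun_def
proof
  fix c' assume c': "c' \<in> A"
  have sub: "chart_image c' S \<subseteq> chart_image c' (fst c)" by (rule chart_image_mono[OF assms(3)])
  have im: "transition c' c ` chart_image c' S \<subseteq> chart_image c S"
    using subset_trans[OF transition_image[OF c' assms(1), of S] chart_image_mono[OF Int_lower2]]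
    unfolding Int_absorb1[OF assms(3)] .
  note o = chart_image_open[OF c' assms(2)] chart_image_open[OF assms(1,2)]
  have "smooth_on (\<lambda>z. f (chart_inv c (transition c' c z))) (chart_image c' S)"
    by (rule smooth_on_compose[OF o cholomorphic_on_smooth[OF
            cholomorphic_on_subset[OF transition_holomorphic[OF c' assms(1)] sub] o(1)] im assms(4)])
  moreover have "f (chart_inv c' z) = f (chart_inv c (transition c' c z))" if "z \<in> chart_image c' S" for z
    using chart_inv_transition[OF c' assms(1) subsetD[OF sub that]] by simp
  ultimately show "smooth_on (\<lambda>z. f (chart_inv c' z)) (chart_image c' S)"
    by (rule smooth_on_transform[OF o(1)])
qed

lemma holomorphic_fun_smooth: "open S \<Longrightarrow> holomorphic_fun A S f \<Longrightarrow> smooth_fun A S f"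
  by (simp add: holomorphic_fun_def smooth_fun_def cholomorphic_on_smooth chart_image_open)

lemma smooth_fun_local:
  assumes "\<And>p. p \<in> S \<Longrightarrow> \<exists>T. open T \<and> p \<in> T \<and> smooth_fun A T f"
  shows "smooth_fun A S f"
  unfolding smooth_fun_def
proof (intro ballI smooth_on_local)
  fix c z assume c: "c \<in> A" and z: "z \<in> chart_image c S"
  obtain T where T: "open T" "chart_inv c z \<in> T" "smooth_fun A T f"
    using assms[OF chart_imageE(2)[OF c z]] by blast
  have "z \<in> chart_image c T"
    using T(2) z chart_image_iff[OF c, of z S] chart_image_iff[OF c, of z T] by blast
  then show "\<exists>T. open T \<and> z \<in> T \<and> smooth_on (\<lambda>z. f (chart_inv c z)) T"
    using T(3) c chart_image_open[OF c T(1)] unfolding smooth_fun_def by (intro exI[of _ "chart_image c T"]) simp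
qed

lemma smooth_fun_cong:
  assumes "open S" "\<And>p. p \<in> S \<Longrightarrow> f p = g p"
  shows "smooth_fun A S f \<longleftrightarrow> smooth_fun A S g"
proof -
  have "smooth_on (\<lambda>z. f (chart_inv c z)) (chart_image c S) \<longleftrightarrow> smooth_on (\<lambda>z. g (chart_inv c z)) (chart_image c S)"
    if "c \<in> A" for c
    by (rule smooth_on_cong[OF chart_image_open[OF that assms(1)]]) (rule assms(2)[OF chart_imageE(2)[OF that]])
  then show ?thesis unfolding smooth_fun_def by simp
qed

lemma smooth_fun_subset: "smooth_fun A S f \<Longrightarrow> T \<subseteq> S \<Longrightarrow> smooth_fun A T f"
  by (auto simp: smooth_fun_def intro: smooth_on_subset[OF _ chart_image_mono])

lemma smooth_fun_const: "smooth_fun A S (\<lambda>p. k)"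
  unfolding smooth_fun_def by (simp add: smooth_on_const)

lemma smooth_fun_mult: "open S \<Longrightarrow> smooth_fun A S f \<Longrightarrow> smooth_fun A S g \<Longrightarrow> smooth_fun A S (\<lambda>p. f p * g p)"
  unfolding smooth_fun_def by (simp add: smooth_on_mult chart_image_open)

lemma smooth_fun_sum:
  "open S \<Longrightarrow> (\<And>i. i \<in> I \<Longrightarrow> smooth_fun A S (f i)) \<Longrightarrow> smooth_fun A S (\<lambda>p. \<Sum>i\<in>I. f i p)"
  unfolding smooth_fun_def by (simp add: smooth_on_sum chart_image_open)

lemma smooth_fun_inverse:
  "open S \<Longrightarrow> smooth_fun A S f \<Longrightarrow> (\<And>p. p \<in> S \<Longrightarrow> f p \<noteq> 0) \<Longrightarrow> smooth_fun A S (\<lambda>p. inverse (f p))"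
  unfolding smooth_fun_def using chart_imageE(2) by (simp add: smooth_on_inverse chart_image_open)

lemma bundle_triv:
  assumes "holomorphic_bundle A E" "t \<in> bundle_trivs E" "p \<in> fst t"
  shows "snd t p \<in> carrier_mat (bundle_rank E) (bundle_rank E)"
    "mat_inv (snd t p) \<in> carrier_mat (bundle_rank E) (bundle_rank E)"
    "snd t p * mat_inv (snd t p) = 1\<^sub>m (bundle_rank E)"
    "mat_inv (snd t p) * snd t p = 1\<^sub>m (bundle_rank E)"
    "open (fst t)"
proof -
  have *: "snd t p \<in> carrier_mat (bundle_rank E) (bundle_rank E)" "invertible_mat (snd t p)" "open (fst t)"
    using assms unfolding holomorphic_bundle_def by blast+
  then show "snd t p \<in> carrier_mat (bundle_rank E) (bundle_rank E)"
    "mat_inv (snd t p) \<in> carrier_mat (bundle_rank E) (bundle_rank E)"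
    "snd t p * mat_inv (snd t p) = 1\<^sub>m (bundle_rank E)"
    "mat_inv (snd t p) * snd t p = 1\<^sub>m (bundle_rank E)"
    "open (fst t)"
    using mat_inv[OF *(1,2)] by simp_all
qed

lemma triv_open: "holomorphic_bundle A E \<Longrightarrow> t \<in> bundle_trivs E \<Longrightarrow> open (fst t)"
  unfolding holomorphic_bundle_def by blast

lemma triv_at:
  assumes "holomorphic_bundle A E"
  shows "triv_at E p \<in> bundle_trivs E" "p \<in> fst (triv_at E p)"
proof -
  have "\<exists>t. t \<in> bundle_trivs E \<and> p \<in> fst t" using assms unfolding holomorphic_bundle_def by blast
  then have "triv_at E p \<in> bundle_trivs E \<and> p \<in> fst (triv_at E p)" unfolding triv_at_def by (rule someI_ex)
  then show "triv_at E p \<in> bundle_trivs E" "p \<in> fst (triv_at E p)" by auto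
qed

lemma bundle_transition_holomorphic:
  assumes "holomorphic_bundle A E" "t \<in> bundle_trivs E" "t' \<in> bundle_trivs E" "c \<in> A"
  shows "cholomorphic_on (\<lambda>z. ent (bundle_rank E) (bundle_rank E)
      (snd t' (chart_inv c z) * mat_inv (snd t (chart_inv c z))) i j) (chart_image c (fst t \<inter> fst t'))"
proof (cases "i < bundle_rank E \<and> j < bundle_rank E")
  case True
  then have "holomorphic_fun A (fst t \<inter> fst t') (\<lambda>p. (snd t' p * mat_inv (snd t p)) $$ (i, j))"
    using assms unfolding holomorphic_bundle_def by blast
  then show ?thesis using assms(4) True unfolding holomorphic_fun_def ent_def by simp
next
  case False
  then show ?thesis unfolding ent_def if_not_P[OF False] by (intro cholomorphic_on_const)
qed

end

section \<open>Components of bundle-valued forms\<close>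

definition lform ::
    "('x, 'd::finite) chart set \<Rightarrow> 'x holo_bundle \<Rightarrow> 'x holo_bundle \<Rightarrow> ('x, 'd) chart \<Rightarrow> 'x triv \<Rightarrow> 'x triv \<Rightarrow>
     ('x, 'd) matform \<Rightarrow> complex ^ 'd \<Rightarrow> (complex ^ 'd) list \<Rightarrow> nat \<Rightarrow> nat \<Rightarrow> complex" where
  "lform A E F c t t' \<alpha> z vs i j = ent (bundle_rank F) (bundle_rank E) (local_form A c t t' \<alpha> z vs) i j"

text \<open>The definition of forms updates lists at a position and compares arbitrary positions,
  whereas \<open>antialt\<close> splits lists and compares neighbours.
  \<open>antialt_not_distinct\<close> bridges the two notions of alternation.\<close>

lemma antilinear_alternating_iff:
  "antilinear_alternating m n \<alpha> \<longleftrightarrow>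
     (\<forall>vs. \<alpha> vs \<in> carrier_mat m n) \<and> (\<forall>i j. antialt (\<lambda>vs. ent m n (\<alpha> vs) i j))"
proof (intro iffI conjI allI)
  fix i j
  assume *: "antilinear_alternating m n \<alpha>"
  have car: "\<alpha> vs \<in> carrier_mat m n" for vs
    using conjunct1[OF *[unfolded antilinear_alternating_def]] by (rule spec)
  have ax: "k < length vs \<Longrightarrow> \<alpha> (vs[k := u + v]) = \<alpha> (vs[k := u]) + \<alpha> (vs[k := v])"
    "k < length vs \<Longrightarrow> \<alpha> (vs[k := a *s v]) = cnj a \<cdot>\<^sub>m \<alpha> (vs[k := v])"
    "k < l \<Longrightarrow> l < length vs \<Longrightarrow> vs ! k = vs ! l \<Longrightarrow> \<alpha> vs = 0\<^sub>m m n" for vs k l u v a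
    using * unfolding antilinear_alternating_def by blast+
  show "antialt (\<lambda>vs. ent m n (\<alpha> vs) i j)"
    unfolding antialt_def
  proof (intro conjI allI)
    fix xs ys :: "(complex ^ 'a) list" and u v :: "complex ^ 'a" and a :: complex
    have len: "length xs < length (xs @ u # ys)" by simp
    have upd: "(xs @ u # ys)[length xs := w] = xs @ w # ys" for w by simp
    show "ent m n (\<alpha> (xs @ (u + v) # ys)) i j = ent m n (\<alpha> (xs @ u # ys)) i j + ent m n (\<alpha> (xs @ v # ys)) i j"
      using ax(1)[OF len, of u v] unfolding upd by (simp add: ent_add car)
    show "ent m n (\<alpha> (xs @ (a *s v) # ys)) i j = cnj a * ent m n (\<alpha> (xs @ v # ys)) i j"
      using ax(2)[OF len, of a v] unfolding upd by (simp add: ent_smult car)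
    have "\<alpha> (xs @ v # v # ys) = 0\<^sub>m m n"
      by (rule ax(3)[of "length xs" "Suc (length xs)"]) (simp_all add: nth_append)
    then show "ent m n (\<alpha> (xs @ v # v # ys)) i j = 0" by (simp add: ent_zero)
  qed
next
  assume *: "(\<forall>vs. \<alpha> vs \<in> carrier_mat m n) \<and> (\<forall>i j. antialt (\<lambda>vs. ent m n (\<alpha> vs) i j))"
  then have car: "\<alpha> vs \<in> carrier_mat m n" and alt: "antialt (\<lambda>vs. ent m n (\<alpha> vs) i j)" for vs i j by auto
  show "antilinear_alternating m n \<alpha>"
    unfolding antilinear_alternating_def
  proof (intro conjI allI impI)
    show "\<alpha> vs \<in> carrier_mat m n" for vs by (rule car)
    fix vs :: "(complex ^ 'a) list" and k u v a
    assume k: "k < length vs"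
    have upd: "vs[k := w] = take k vs @ w # drop (Suc k) vs" for w using k by (rule upd_conv_take_nth_drop)
    show "\<alpha> (vs[k := u + v]) = \<alpha> (vs[k := u]) + \<alpha> (vs[k := v])"
      by (rule ent_eqI[of _ m n]) (auto simp: car ent_add upd antialt_add_at[OF alt])
    show "\<alpha> (vs[k := a *s v]) = cnj a \<cdot>\<^sub>m \<alpha> (vs[k := v])"
      by (rule ent_eqI[of _ m n]) (auto simp: car ent_smult upd antialt_scale_at[OF alt])
  next
    fix vs :: "(complex ^ 'a) list" and k l
    assume "k < l \<and> l < length vs \<and> vs ! k = vs ! l"
    then have "\<not> distinct vs" by (metis distinct_conv_nth less_trans nat_neq_iff)
    then show "\<alpha> vs = 0\<^sub>m m n"
      by (intro ent_eqI[of _ m n]) (auto simp: car ent_zero antialt_not_distinct[OF alt])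
  qed
qed (auto simp: antilinear_alternating_def)

context complex_manifold
begin

lemma antialt_map:
  assumes "antialt \<theta>" "\<And>u v. L (u + v) = L u + L v" "\<And>a v. L (a *s v) = a *s L v"
  shows "antialt (\<lambda>vs. \<theta> (map L vs))"
  using assms by (simp add: antialt_def)

lemma lform_eq:
  assumes "holomorphic_bundle A E" "holomorphic_bundle A F" "t \<in> bundle_trivs E" "t' \<in> bundle_trivs F"
    and "chart_inv c z \<in> fst t" "chart_inv c z \<in> fst t'"
    and \<alpha>: "\<And>p vs. \<alpha> p vs \<in> carrier_mat (bundle_rank F) (bundle_rank E)"
  shows "lform A E F c t t' \<alpha> z vs i j = sandwich (bundle_rank F) (bundle_rank E)
      (ent (bundle_rank F) (bundle_rank F) (snd t' (chart_inv c z)))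
      (ent (bundle_rank F) (bundle_rank E) (\<alpha> (chart_inv c z) (map (chart_vec A c (chart_inv c z)) vs)))
      (ent (bundle_rank E) (bundle_rank E) (mat_inv (snd t (chart_inv c z)))) i j"
  unfolding lform_def local_form_def Let_def
  by (rule ent_sandwich) (use bundle_triv assms in blast)+

text \<open>Inserting inverse frames shows that a change of trivialisation multiplies the components
  by transition matrices, the shape to which \<open>dbar_mat_sandwich\<close> applies.\<close>

lemma lform_change_triv:
  assumes E: "holomorphic_bundle A E" and F: "holomorphic_bundle A F"
    and t: "t \<in> bundle_trivs E" "t1 \<in> bundle_trivs E" "t' \<in> bundle_trivs F" "t1' \<in> bundle_trivs F"
    and p: "chart_inv c z \<in> fst t \<inter> fst t1 \<inter> fst t' \<inter> fst t1'"
    and \<alpha>: "\<And>p vs. \<alpha> p vs \<in> carrier_mat (bundle_rank F) (bundle_rank E)"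
  shows "lform A E F c t t' \<alpha> z vs i j = sandwich (bundle_rank F) (bundle_rank E)
      (ent (bundle_rank F) (bundle_rank F) (snd t' (chart_inv c z) * mat_inv (snd t1' (chart_inv c z))))
      (lform A E F c t1 t1' \<alpha> z vs)
      (ent (bundle_rank E) (bundle_rank E) (snd t1 (chart_inv c z) * mat_inv (snd t (chart_inv c z)))) i j"
proof -
  let ?p = "chart_inv c z" and ?m = "bundle_rank F" and ?n = "bundle_rank E"
  let ?X = "\<alpha> ?p (map (chart_vec A c ?p) vs)"
  have c: "snd t ?p \<in> carrier_mat ?n ?n" "mat_inv (snd t ?p) \<in> carrier_mat ?n ?n"
    "snd t1 ?p \<in> carrier_mat ?n ?n" "mat_inv (snd t1 ?p) \<in> carrier_mat ?n ?n"
    "snd t' ?p \<in> carrier_mat ?m ?m" "mat_inv (snd t1' ?p) \<in> carrier_mat ?m ?m" "snd t1' ?p \<in> carrier_mat ?m ?m"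
    "?X \<in> carrier_mat ?m ?n"
    using bundle_triv(1,2)[OF E] bundle_triv(1,2)[OF F] t p \<alpha> by auto
  have "snd t' ?p * ?X * mat_inv (snd t ?p)
      = snd t' ?p * mat_inv (snd t1' ?p) * (snd t1' ?p * ?X * mat_inv (snd t1 ?p)) * (snd t1 ?p * mat_inv (snd t ?p))"
  proof -
    have "snd t' ?p * mat_inv (snd t1' ?p) * (snd t1' ?p * ?X * mat_inv (snd t1 ?p)) * (snd t1 ?p * mat_inv (snd t ?p))
        = snd t' ?p * mat_inv (snd t1' ?p) * snd t1' ?p * ?X * (mat_inv (snd t1 ?p) * (snd t1 ?p * mat_inv (snd t ?p)))"
      using c by (intro mult_mat_regroup) auto
    also have "snd t' ?p * mat_inv (snd t1' ?p) * snd t1' ?p = snd t' ?p"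
      using assoc_mult_mat[OF c(5-7)] bundle_triv(4)[OF F t(4), of ?p] p c(5) by simp
    also have "mat_inv (snd t1 ?p) * (snd t1 ?p * mat_inv (snd t ?p)) = mat_inv (snd t ?p)"
      using assoc_mult_mat[OF c(4,3,2)] bundle_triv(4)[OF E t(2), of ?p] p c(2) by simp
    finally show ?thesis by simp
  qed
  then show ?thesis
    unfolding lform_def[abs_def] local_form_def Let_def using c
    by (subst ent_sandwich[symmetric]) auto
qed

lemma hom_formsD:
  assumes "\<alpha> \<in> hom_forms A E F"
  shows "\<alpha> p vs \<in> carrier_mat (bundle_rank F) (bundle_rank E)"
    "antialt (\<lambda>vs. ent (bundle_rank F) (bundle_rank E) (\<alpha> p vs) i j)"
    "\<lbrakk>c \<in> A; t \<in> bundle_trivs E; t' \<in> bundle_trivs F\<rbrakk> \<Longrightarrow>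
       smooth_on (\<lambda>z. lform A E F c t t' \<alpha> z vs i j) (chart_image c (fst t \<inter> fst t'))"
proof -
  have "antilinear_alternating (bundle_rank F) (bundle_rank E) (\<alpha> p)"
    using assms unfolding hom_forms_def by blast
  then show "\<alpha> p vs \<in> carrier_mat (bundle_rank F) (bundle_rank E)"
    "antialt (\<lambda>vs. ent (bundle_rank F) (bundle_rank E) (\<alpha> p vs) i j)"
    unfolding antilinear_alternating_iff by blast+
  assume "c \<in> A" "t \<in> bundle_trivs E" "t' \<in> bundle_trivs F"
  then show "smooth_on (\<lambda>z. lform A E F c t t' \<alpha> z vs i j) (chart_image c (fst t \<inter> fst t'))"
    using assms unfolding hom_forms_def lform_def ent_def
    by (cases "i < bundle_rank F \<and> j < bundle_rank E") (auto simp: smooth_on_const)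
qed

lemma hom_formsI:
  assumes "\<And>p vs. \<alpha> p vs \<in> carrier_mat (bundle_rank F) (bundle_rank E)"
    "\<And>p i j. antialt (\<lambda>vs. ent (bundle_rank F) (bundle_rank E) (\<alpha> p vs) i j)"
    "\<And>c t t' vs i j. \<lbrakk>c \<in> A; t \<in> bundle_trivs E; t' \<in> bundle_trivs F\<rbrakk> \<Longrightarrow>
       smooth_on (\<lambda>z. lform A E F c t t' \<alpha> z vs i j) (chart_image c (fst t \<inter> fst t'))"
  shows "\<alpha> \<in> hom_forms A E F"
  unfolding hom_forms_def
proof (intro CollectI conjI allI ballI impI)
  show "antilinear_alternating (bundle_rank F) (bundle_rank E) (\<alpha> p)" for p
    unfolding antilinear_alternating_iff using assms(1,2) by blast
  fix c t t' vs i j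
  assume "c \<in> A" "t \<in> bundle_trivs E" "t' \<in> bundle_trivs F" "i < bundle_rank F" "j < bundle_rank E"
  then show "smooth_on (\<lambda>z. local_form A c t t' \<alpha> z vs $$ (i, j)) (chart_image c (fst t \<inter> fst t'))"
    using assms(3)[of c t t' vs i j] unfolding lform_def ent_def by simp
qed

lemma antialt_lform:
  assumes "holomorphic_bundle A E" "holomorphic_bundle A F" "t \<in> bundle_trivs E" "t' \<in> bundle_trivs F"
    and c: "c \<in> A" "z \<in> chart_image c (fst t \<inter> fst t')" and \<alpha>: "\<alpha> \<in> hom_forms A E F"
  shows "antialt (\<lambda>vs. lform A E F c t t' \<alpha> z vs i j)"
proof -
  have p: "chart_inv c z \<in> fst t" "chart_inv c z \<in> fst t'" "chart_inv c z \<in> fst c"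
    using chart_imageE[OF c] by auto
  show ?thesis
    unfolding lform_eq[OF assms(1-4) p(1,2) hom_formsD(1)[OF \<alpha>]]
    by (intro antialt_sandwich antialt_map[OF hom_formsD(2)[OF \<alpha>]] chart_vec_linear[OF c(1) p(3)])
qed

text \<open>Components in one chart are the pullback of those in the other under the transition map,
  as \<open>dbar_pullback\<close> requires.\<close>

lemma lform_change_chart:
  assumes "c \<in> A" "c' \<in> A" "z \<in> chart_image c (fst c')"
  shows "lform A E F c t t' \<alpha> z vs = lform A E F c' t t' \<alpha> (transition c c' z) (map (vec_deriv (transition c c') z) vs)"
proof -
  have p: "chart_inv c z \<in> fst c" "chart_inv c z \<in> fst c'" "snd c (chart_inv c z) = z"
    using chart_imageE[OF assms(1,3)] by auto
  have "chart_vec A c (chart_inv c z) v = chart_vec A c' (chart_inv c z) (vec_deriv (transition c c') z v)" for v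
    using chart_vec_transition[OF assms(1,2) p(1,2)] p(3) by simp
  then have "map (chart_vec A c (chart_inv c z)) vs
      = map (chart_vec A c' (chart_inv c z)) (map (vec_deriv (transition c c') z) vs)"
    unfolding map_map o_def by (intro map_cong refl)
  then show ?thesis
    unfolding lform_def[abs_def] local_form_def Let_def chart_inv_transition[OF assms] by (simp only:)
qed

lemma ent_dolbeault:
  assumes E: "holomorphic_bundle A E" and F: "holomorphic_bundle A F"
  shows "dolbeault A E F \<alpha> p vs \<in> carrier_mat (bundle_rank F) (bundle_rank E)"
    and "ent (bundle_rank F) (bundle_rank E) (dolbeault A E F \<alpha> p vs) i j =
      sandwich (bundle_rank F) (bundle_rank E) (ent (bundle_rank F) (bundle_rank F) (mat_inv (snd (triv_at F p) p)))
        (dbar_mat (lform A E F (chart_at A p) (triv_at E p) (triv_at F p) \<alpha>) (snd (chart_at A p) p) vs)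
        (ent (bundle_rank E) (bundle_rank E) (snd (triv_at E p) p)) i j"
proof -
  let ?m = "bundle_rank F" and ?n = "bundle_rank E" and ?c = "chart_at A p" and ?t = "triv_at E p" and ?t' = "triv_at F p"
  let ?D = "mat ?m ?n (\<lambda>(i, j). \<Sum>k<length vs. (-1) ^ k *
              delbar_at (\<lambda>z. local_form A ?c ?t ?t' \<alpha> z (take k vs @ drop (Suc k) vs) $$ (i, j))
                (snd ?c p) (vs ! k))"
  have d: "dolbeault A E F \<alpha> p vs = mat_inv (snd ?t' p) * ?D * snd ?t p"
    unfolding dolbeault_def Let_def ..
  have c: "mat_inv (snd ?t' p) \<in> carrier_mat ?m ?m" "snd ?t p \<in> carrier_mat ?n ?n" "?D \<in> carrier_mat ?m ?n"
    using bundle_triv(1,2)[OF E triv_at[OF E]] bundle_triv(1,2)[OF F triv_at[OF F]] by auto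
  show "dolbeault A E F \<alpha> p vs \<in> carrier_mat ?m ?n" unfolding d using c by (intro mult_carrier_mat)
  have "ent ?m ?n ?D = dbar_mat (lform A E F ?c ?t ?t' \<alpha>) (snd ?c p) vs"
  proof (intro ext)
    fix k l
    show "ent ?m ?n ?D k l = dbar_mat (lform A E F ?c ?t ?t' \<alpha>) (snd ?c p) vs k l"
    proof (cases "k < ?m \<and> l < ?n")
      case True
      then show ?thesis
        by (simp add: ent_mat dbar_mat_def dbar_def altsum_explicit lform_def ent_def)
    next
      case False
      then show ?thesis
        by (subst dbar_mat_zero) (auto simp: ent_mat lform_def ent_def)
    qed
  qed
  then show "ent ?m ?n (dolbeault A E F \<alpha> p vs) i j = sandwich ?m ?n (ent ?m ?m (mat_inv (snd ?t' p)))
        (dbar_mat (lform A E F ?c ?t ?t' \<alpha>) (snd ?c p) vs) (ent ?n ?n (snd ?t p)) i j"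
    unfolding d ent_sandwich[OF c(1,3,2)] by simp
qed

lemma sandwich_sandwich:
  assumes "P \<in> carrier_mat m m" "P' \<in> carrier_mat m m" "Q \<in> carrier_mat n n" "Q' \<in> carrier_mat n n"
    and X: "\<And>k l. k \<ge> m \<or> l \<ge> n \<Longrightarrow> X k l = 0"
  shows "sandwich m n (ent m m P) (sandwich m n (ent m m P') X (ent n n Q')) (ent n n Q) i j
       = sandwich m n (ent m m (P * P')) X (ent n n (Q' * Q)) i j"
proof -
  let ?X = "mat m n (\<lambda>(k, l). X k l)"
  have X': "X = ent m n ?X" using X by (auto simp: ent_mat fun_eq_iff not_less)
  have 1: "sandwich m n (ent m m P') X (ent n n Q') = ent m n (P' * ?X * Q')"
    by (subst X', intro ext, rule ent_sandwich[symmetric]) (use assms in auto)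
  have "P * (P' * ?X * Q') * Q = P * P' * ?X * (Q' * Q)"
    using assms(1-4) by (intro mult_mat_regroup) auto
  then show ?thesis
    unfolding 1 by (subst X', subst (1 2) ent_sandwich[symmetric]) (use assms in auto)
qed

text \<open>The Dolbeault operator does not depend on the chart and the trivialisations.\<close>

lemma lform_dolbeault:
  assumes E: "holomorphic_bundle A E" and F: "holomorphic_bundle A F"
    and t: "t \<in> bundle_trivs E" "t' \<in> bundle_trivs F"
    and c: "c \<in> A" "z \<in> chart_image c (fst t \<inter> fst t')" and \<alpha>: "\<alpha> \<in> hom_forms A E F"
  shows "lform A E F c t t' (dolbeault A E F \<alpha>) z vs i j = dbar_mat (lform A E F c t t' \<alpha>) z vs i j"
proof -
  define p where "p = chart_inv c z"
  let ?m = "bundle_rank F" and ?n = "bundle_rank E"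
  let ?c0 = "chart_at A p" and ?t0 = "triv_at E p" and ?t0' = "triv_at F p"
  have p: "p \<in> fst t" "p \<in> fst t'" "p \<in> fst c" "snd c p = z"
    using chart_imageE[OF c] by (auto simp: p_def)
  have p0: "p \<in> fst ?c0" "p \<in> fst ?t0" "p \<in> fst ?t0'" using chart_at triv_at E F by blast+
  note t0 = triv_at(1)[OF E, of p] triv_at(1)[OF F, of p]
  \<comment> \<open>The data with index 0 are the choices that \<open>dolbeault\<close> makes at the
    single point \<open>p\<close>; on \<open>U\<close> they are compared with the given chart and
    frames.\<close>
  define U where "U = fst t \<inter> fst ?t0 \<inter> fst t' \<inter> fst ?t0' \<inter> fst ?c0"
  have U: "open U" "p \<in> U"
    unfolding U_def
    by (intro open_Int triv_open[OF E] triv_open[OF F] t t0 chart_open chart_at(1)) (use p p0 in simp)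
  let ?S = "chart_image c U"
  have S: "open ?S" "z \<in> ?S"
    using chart_image_open[OF c(1) U(1)] chart_imageI[OF p(3) U(2)] p(4) by auto
  have SU: "chart_inv c x \<in> U" if "x \<in> ?S" for x using chart_imageE(2)[OF c(1) that] .
  define G' where "G' x = ent ?m ?m (snd t' (chart_inv c x) * mat_inv (snd ?t0' (chart_inv c x)))" for x
  define G where "G x = ent ?n ?n (snd ?t0 (chart_inv c x) * mat_inv (snd t (chart_inv c x)))" for x
  have hG': "cholomorphic_on (\<lambda>x. G' x k l) ?S" for k l
    unfolding G'_def
    by (rule cholomorphic_on_subset[OF bundle_transition_holomorphic[OF F t0(2) t(2) c(1)]])
      (rule chart_image_mono, auto simp: U_def)
  have hG: "cholomorphic_on (\<lambda>x. G x k l) ?S" for k l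
    unfolding G_def
    by (rule cholomorphic_on_subset[OF bundle_transition_holomorphic[OF E t(1) t0(1) c(1)]])
      (rule chart_image_mono, auto simp: U_def)
  let ?L = "lform A E F c ?t0 ?t0' \<alpha>" and ?M = "lform A E F ?c0 ?t0 ?t0' \<alpha>"
  let ?\<phi> = "transition c ?c0"
  have sL: "smooth_on (\<lambda>x. ?L x vs k l) ?S" for vs k l
    by (rule smooth_on_subset[OF hom_formsD(3)[OF \<alpha> c(1) t0]]) (rule chart_image_mono, auto simp: U_def)
  \<comment> \<open>Two changes in turn: first the frames, whose holomorphic matrices pass through
    \<open>dbar\<close>, then the chart, by naturality under pullback.\<close>
  have "dbar_mat (lform A E F c t t' \<alpha>) z vs i j = dbar_mat (\<lambda>x vs. sandwich ?m ?n (G' x) (?L x vs) (G x)) z vs i j"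
    unfolding dbar_mat_def
  proof (rule dbar_cong[OF S])
    fix x vs assume "x \<in> ?S"
    from SU[OF this] have "chart_inv c x \<in> fst t \<inter> fst ?t0 \<inter> fst t' \<inter> fst ?t0'"
      unfolding U_def by simp
    then show "lform A E F c t t' \<alpha> x vs i j = sandwich ?m ?n (G' x) (?L x vs) (G x) i j"
      unfolding G'_def G_def by (rule lform_change_triv[OF E F t(1) t0(1) t(2) t0(2) _ hom_formsD(1)[OF \<alpha>]])
  qed
  also have "\<dots> = sandwich ?m ?n (G' z) (dbar_mat ?L z vs) (G z) i j"
    by (rule dbar_mat_sandwich[OF S hG' sL hG])
  also have "dbar_mat ?L z vs = dbar_mat ?M (?\<phi> z) (map (vec_deriv ?\<phi> z) vs)"
  proof (intro ext)
    fix k l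
    have sub: "chart_image c U \<subseteq> chart_image c (fst ?c0)" by (rule chart_image_mono) (auto simp: U_def)
    let ?T = "chart_image ?c0 (fst ?t0 \<inter> fst ?t0')"
    have T: "open ?T"
      using chart_image_open[OF chart_at(1)] triv_open[OF E t0(1)] triv_open[OF F t0(2)] by blast
    have h: "cholomorphic_on (\<lambda>x. ?\<phi> x $ k) ?S" for k
      by (rule cholomorphic_on_subset[OF transition_holomorphic[OF c(1) chart_at(1)] sub])
    have im: "?\<phi> ` ?S \<subseteq> ?T"
    proof -
      have "?\<phi> ` chart_image c (fst ?c0 \<inter> U) \<subseteq> chart_image ?c0 (fst c \<inter> U)"
        by (rule transition_image[OF c(1) chart_at(1)])
      moreover have "fst ?c0 \<inter> U = U" by (auto simp: U_def)
      moreover have "chart_image ?c0 (fst c \<inter> U) \<subseteq> ?T" by (rule chart_image_mono) (auto simp: U_def)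
      ultimately show ?thesis by simp
    qed
    show "dbar_mat ?L z vs k l = dbar_mat ?M (?\<phi> z) (map (vec_deriv ?\<phi> z) vs) k l"
      unfolding dbar_mat_def
    proof (rule dbar_pullback[OF S(1) T S(2) h im])
      show "antialt (\<lambda>vs. ?M w vs k l)" if "w \<in> ?T" for w
        by (rule antialt_lform[OF E F t0 chart_at(1) that \<alpha>])
      show "smooth_on (\<lambda>w. ?M w ws k l) ?T" for ws
        by (rule hom_formsD(3)[OF \<alpha> chart_at(1) t0])
      show "?L x ws k l = ?M (?\<phi> x) (map (vec_deriv ?\<phi> x) ws) k l" if "x \<in> ?S" for x ws
      proof -
        have "x \<in> chart_image c (fst ?c0)" using sub that by blast
        then show ?thesis by (simp only: lform_change_chart[OF c(1) chart_at(1)])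
      qed
    qed
  qed
  also have "map (vec_deriv ?\<phi> z) vs = map (chart_vec A c p) vs"
    unfolding chart_vec_eq[OF c(1) p(3)] p(4) ..
  also have "?\<phi> z = snd ?c0 p" by (simp add: transition_def p_def)
  finally have 1: "dbar_mat (lform A E F c t t' \<alpha>) z vs i j
      = sandwich ?m ?n (G' z) (dbar_mat ?M (snd ?c0 p) (map (chart_vec A c p) vs)) (G z) i j" .
  have "lform A E F c t t' (dolbeault A E F \<alpha>) z vs i j
      = sandwich ?m ?n (ent ?m ?m (snd t' p)) (ent ?m ?n (dolbeault A E F \<alpha> p (map (chart_vec A c p) vs)))
          (ent ?n ?n (mat_inv (snd t p))) i j"
    using lform_eq[OF E F t, of c z "dolbeault A E F \<alpha>"] p ent_dolbeault(1)[OF E F] by (simp add: p_def)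
  also have "ent ?m ?n (dolbeault A E F \<alpha> p (map (chart_vec A c p) vs))
      = sandwich ?m ?n (ent ?m ?m (mat_inv (snd ?t0' p))) (dbar_mat ?M (snd ?c0 p) (map (chart_vec A c p) vs))
         (ent ?n ?n (snd ?t0 p))"
    by (intro ext) (rule ent_dolbeault(2)[OF E F])
  \<comment> \<open>The frames by which \<open>dolbeault\<close> returns to the fibre combine with
    \<open>t\<close> and \<open>t'\<close> into the transition matrices \<open>G\<close> and
    \<open>G'\<close> found above.\<close>
  also have "sandwich ?m ?n (ent ?m ?m (snd t' p)) \<dots> (ent ?n ?n (mat_inv (snd t p))) i j
      = sandwich ?m ?n (G' z) (dbar_mat ?M (snd ?c0 p) (map (chart_vec A c p) vs)) (G z) i j"
    unfolding G'_def G_def p_def[symmetric]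
  proof (rule sandwich_sandwich)
    show "dbar_mat ?M (snd ?c0 p) (map (chart_vec A c p) vs) k l = 0" if "?m \<le> k \<or> ?n \<le> l" for k l
      using that by (intro dbar_mat_zero) (auto simp: lform_def ent_def)
  qed (use bundle_triv(1,2)[OF E t(1) p(1)] bundle_triv(1,2)[OF F t(2) p(2)]
        bundle_triv(1,2)[OF E t0(1) p0(2)] bundle_triv(1,2)[OF F t0(2) p0(3)] in auto)
  finally show ?thesis using 1 by simp
qed

lemma antialt_dbar_lform:
  assumes E: "holomorphic_bundle A E" and F: "holomorphic_bundle A F"
    and t: "t \<in> bundle_trivs E" "t' \<in> bundle_trivs F"
    and c: "c \<in> A" "z \<in> chart_image c (fst t \<inter> fst t')" and \<alpha>: "\<alpha> \<in> hom_forms A E F"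
  shows "antialt (\<lambda>vs. dbar_mat (lform A E F c t t' \<alpha>) z vs k l)"
proof -
  have S: "open (chart_image c (fst t \<inter> fst t'))"
    using chart_image_open[OF c(1)] triv_open[OF E t(1)] triv_open[OF F t(2)] by blast
  show ?thesis
    unfolding dbar_mat_def
    by (rule antialt_dbar[OF S c(2) antialt_lform[OF E F t c(1) _ \<alpha>]
          smooth_on_differentiable[OF hom_formsD(3)[OF \<alpha> c(1) t] c(2)]])
qed

lemma dolbeault_hom_forms:
  assumes E: "holomorphic_bundle A E" and F: "holomorphic_bundle A F" and \<alpha>: "\<alpha> \<in> hom_forms A E F"
  shows "dolbeault A E F \<alpha> \<in> hom_forms A E F"
proof (rule hom_formsI)
  show "dolbeault A E F \<alpha> p vs \<in> carrier_mat (bundle_rank F) (bundle_rank E)" for p vs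
    by (rule ent_dolbeault(1)[OF E F])
  show "antialt (\<lambda>vs. ent (bundle_rank F) (bundle_rank E) (dolbeault A E F \<alpha> p vs) i j)" for p i j
  proof -
    have "snd (chart_at A p) p \<in> chart_image (chart_at A p) (fst (triv_at E p) \<inter> fst (triv_at F p))"
      using chart_at triv_at[OF E] triv_at[OF F] by (intro chart_imageI) auto
    from antialt_dbar_lform[OF E F triv_at(1)[OF E] triv_at(1)[OF F] chart_at(1) this \<alpha>]
    show ?thesis unfolding ent_dolbeault(2)[OF E F] by (rule antialt_sandwich)
  qed
  fix c t t' vs i j
  assume c: "c \<in> A" and t: "t \<in> bundle_trivs E" "t' \<in> bundle_trivs F"
  let ?S = "chart_image c (fst t \<inter> fst t')"
  have S: "open ?S"
    using chart_image_open[OF c(1)] triv_open[OF E t(1)] triv_open[OF F t(2)] by blast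
  have "smooth_on (\<lambda>z. dbar_mat (lform A E F c t t' \<alpha>) z vs i j) ?S"
    unfolding dbar_mat_def by (rule smooth_on_dbar[OF S hom_formsD(3)[OF \<alpha> c t]])
  then show "smooth_on (\<lambda>z. lform A E F c t t' (dolbeault A E F \<alpha>) z vs i j) ?S"
    by (rule smooth_on_transform[OF S]) (rule lform_dolbeault[OF E F t c _ \<alpha>])
qed

text \<open>Frames are invertible, so the value at \<open>p\<close> is recovered from the components
  in one chart and one pair of frames around \<open>p\<close>.\<close>

lemma hom_form_eqI:
  assumes E: "holomorphic_bundle A E" and F: "holomorphic_bundle A F"
    and \<alpha>: "\<And>p vs. \<alpha> p vs \<in> carrier_mat (bundle_rank F) (bundle_rank E)"
    and \<beta>: "\<And>p vs. \<beta> p vs \<in> carrier_mat (bundle_rank F) (bundle_rank E)"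
    and eq: "\<And>c t t' z vs i j. \<lbrakk>c \<in> A; t \<in> bundle_trivs E; t' \<in> bundle_trivs F; z \<in> chart_image c (fst t \<inter> fst t')\<rbrakk> \<Longrightarrow>
        lform A E F c t t' \<alpha> z vs i j = lform A E F c t t' \<beta> z vs i j"
  shows "\<alpha> = \<beta>"
proof (intro ext)
  fix p vs
  let ?m = "bundle_rank F" and ?n = "bundle_rank E"
  let ?c = "chart_at A p" and ?t = "triv_at E p" and ?t' = "triv_at F p"
  have z: "snd ?c p \<in> chart_image ?c (fst ?t \<inter> fst ?t')"
    using chart_at triv_at[OF E] triv_at[OF F] by (intro chart_imageI) auto
  have m: "map (chart_vec A ?c p) vs = vs" by (simp add: chart_vec_chart_at map_idI)
  have lf: "local_form A ?c ?t ?t' \<gamma> (snd ?c p) vs = snd ?t' p * \<gamma> p vs * mat_inv (snd ?t p)" for \<gamma>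
    unfolding local_form_def Let_def chart_inv_snd[OF chart_at] m ..
  note bt = bundle_triv[OF E triv_at[OF E], of p] bundle_triv[OF F triv_at[OF F], of p]
  have inv: "\<gamma> p vs = mat_inv (snd ?t' p) * (snd ?t' p * \<gamma> p vs * mat_inv (snd ?t p)) * snd ?t p"
    if g: "\<gamma> p vs \<in> carrier_mat ?m ?n" for \<gamma>
  proof -
    have "mat_inv (snd ?t' p) * (snd ?t' p * \<gamma> p vs * mat_inv (snd ?t p)) * snd ?t p
        = (mat_inv (snd ?t' p) * snd ?t' p) * \<gamma> p vs * (mat_inv (snd ?t p) * snd ?t p)"
      by (rule mult_mat_regroup[OF bt(7,6) g bt(2,1)])
    then show ?thesis unfolding bt(4,9) using g by simp
  qed
  have "snd ?t' p * \<alpha> p vs * mat_inv (snd ?t p) = snd ?t' p * \<beta> p vs * mat_inv (snd ?t p)"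
  proof (rule ent_eqI[of _ ?m ?n])
    show "ent ?m ?n (snd ?t' p * \<alpha> p vs * mat_inv (snd ?t p)) i j
        = ent ?m ?n (snd ?t' p * \<beta> p vs * mat_inv (snd ?t p)) i j" for i j
      using eq[OF chart_at(1) triv_at(1)[OF E] triv_at(1)[OF F] z, of vs i j] unfolding lform_def lf .
  qed (use bt \<alpha> \<beta> in \<open>auto intro!: mult_carrier_mat\<close>)
  then show "\<alpha> p vs = \<beta> p vs" using inv[of \<alpha>, OF \<alpha>] inv[of \<beta>, OF \<beta>] by simp
qed

end

section \<open>Forms with values in homomorphisms of factorizations\<close>

text \<open>A complex sign in place of a bit, so that grading signs multiply in the same ring as the
  entries.\<close>

definition parity_sign :: "'x factorization \<Rightarrow> nat \<Rightarrow> complex" where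
  "parity_sign a i = (if index_parity a i = 0 then 1 else -1)"

lemma parity_sign_square: "parity_sign a k * parity_sign a k = 1"
  by (simp add: parity_sign_def)

lemma parity_sign_power:
  "(if index_parity b i + index_parity a j = 0 then 1 else (-1) ^ k) = (parity_sign b i * parity_sign a j) ^ k"
  by (cases "index_parity b i"; cases "index_parity a j") (simp_all add: parity_sign_def)

definition ents :: "'x factorization \<Rightarrow> 'x factorization \<Rightarrow> ('x, 'd) matform \<Rightarrow> 'x \<Rightarrow> (complex ^ 'd) list \<Rightarrow> nat \<Rightarrow> nat \<Rightarrow> complex" where
  "ents a b \<alpha> p vs = ent (fact_rank b) (fact_rank a) (\<alpha> p vs)"

definition form_add :: "('x, 'd) matform \<Rightarrow> ('x, 'd) matform \<Rightarrow> ('x, 'd) matform" where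
  "form_add \<alpha> \<beta> p vs = \<alpha> p vs + \<beta> p vs"

definition form_scale :: "('x \<Rightarrow> complex) \<Rightarrow> ('x, 'd) matform \<Rightarrow> ('x, 'd) matform" where
  "form_scale f \<alpha> p vs = f p \<cdot>\<^sub>m \<alpha> p vs"

abbreviation form_uminus :: "('x, 'd) matform \<Rightarrow> ('x, 'd) matform" where
  "form_uminus \<equiv> form_scale (\<lambda>p. -1)"

definition form_invol :: "'x factorization \<Rightarrow> 'x factorization \<Rightarrow> ('x, 'd) matform \<Rightarrow> ('x, 'd) matform" where
  "form_invol a b \<alpha> p vs = (-1) ^ length vs \<cdot>\<^sub>m grading_sign a b 1 (\<alpha> p vs)"

definition section_form :: "nat \<Rightarrow> nat \<Rightarrow> ('x \<Rightarrow> complex mat) \<Rightarrow> ('x, 'd) matform" where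
  "section_form m n s p vs = (if vs = [] then s p else 0\<^sub>m m n)"

lemma ent_grading_sign:
  "ent (fact_rank b) (fact_rank a) (grading_sign a b k M) i j
     = (parity_sign b i * parity_sign a j) ^ k * ent (fact_rank b) (fact_rank a) M i j"
  by (auto simp: grading_sign_def ent_def simp flip: parity_sign_power)

lemma grading_sign_carrier: "grading_sign a b k M \<in> carrier_mat (fact_rank b) (fact_rank a)"
  by (simp add: grading_sign_def)

lemma ents_invol:
  "ents a b (form_invol a b \<alpha>) p = invol (parity_sign b) (parity_sign a) (ents a b \<alpha> p)"
  by (intro ext) (simp add: ents_def form_invol_def ent_smult[OF grading_sign_carrier] ent_grading_sign invol_def)

lemma ents_section:
  "ents a b (section_form (fact_rank b) (fact_rank a) s) p = form0 (ent (fact_rank b) (fact_rank a) (s p))"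
  by (intro ext) (simp add: ents_def section_form_def form0_def ent_zero)

lemma wedge_zero_row:
  assumes "\<And>ws k. \<beta> ws i k = 0"
  shows "wedge r sc sb \<beta> \<alpha> vs i j = 0"
  using wedge_cong[of r \<beta> i "\<lambda>ws i k. 0" \<alpha> j \<alpha>] assms by (simp add: wedge_zero_left)

lemma wedge_zero_col:
  assumes "\<And>ws k. \<alpha> ws k j = 0"
  shows "wedge r sc sb \<beta> \<alpha> vs i j = 0"
  using wedge_cong[of r \<beta> i \<beta> \<alpha> j "\<lambda>ws i k. 0"] assms by (simp add: wedge_zero_right)

lemma DF_comp_carrier: "DF_comp a b c \<beta> \<alpha> p vs \<in> carrier_mat (fact_rank c) (fact_rank a)"
  by (simp add: DF_comp_def)

text \<open>Makes the composition accessible to the product calculus: on entries,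
  \<open>DF_comp\<close> is \<open>wedge\<close> with the sign functions of the two bundle
  gradings.\<close>

lemma ents_DF_comp:
  assumes \<alpha>: "\<And>vs. \<alpha> p vs \<in> carrier_mat (fact_rank b) (fact_rank a)"
    and \<beta>: "\<And>vs. \<beta> p vs \<in> carrier_mat (fact_rank c) (fact_rank b)"
  shows "ents a c (DF_comp a b c \<beta> \<alpha>) p
       = wedge (fact_rank b) (parity_sign c) (parity_sign b) (ents b c \<beta> p) (ents a b \<alpha> p)"
proof (intro ext)
  fix vs i j
  let ?ra = "fact_rank a" and ?rb = "fact_rank b" and ?rc = "fact_rank c"
  consider "i \<ge> ?rc" | "j \<ge> ?ra" | "i < ?rc" "j < ?ra" by linarith
  then show "ents a c (DF_comp a b c \<beta> \<alpha>) p vs i j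
      = wedge ?rb (parity_sign c) (parity_sign b) (ents b c \<beta> p) (ents a b \<alpha> p) vs i j"
  proof cases
    case 1
    then show ?thesis by (subst wedge_zero_row) (auto simp: ents_def ent_def)
  next
    case 2
    then show ?thesis by (subst wedge_zero_col) (auto simp: ents_def ent_def)
  next
    case 3
    have "(grading_sign b c m (\<beta> p us) * \<alpha> p ws) $$ (i, j)
        = (\<Sum>k<?rb. (parity_sign c i * parity_sign b k) ^ m * ents b c \<beta> p us i k * ents a b \<alpha> p ws k j)" for m us ws
    proof -
      have "(grading_sign b c m (\<beta> p us) * \<alpha> p ws) $$ (i, j)
          = ent ?rc ?ra (grading_sign b c m (\<beta> p us) * \<alpha> p ws) i j"
        using 3 by (simp add: ent_def)
      then show ?thesis
        by (simp add: ent_mult[OF grading_sign_carrier \<alpha>] ent_grading_sign ents_def)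
    qed
    then show ?thesis
      using 3 by (simp add: ents_def ent_def[of ?rc ?ra] DF_comp_def wedge_explicit)
  qed
qed

text \<open>The defect is the graded commutator with \<open>D\<close>, regarded as a form of degree
  0. The sign \<open>(-1)^rk\<close> arises when the odd \<open>D\<close> passes the form arguments.
  Leibniz and the square then reduce to associativity.\<close>

lemma defect_diff_eq:
  fixes \<alpha> :: "('x, 'd::finite) matform"
  assumes "\<And>p vs. \<alpha> p vs \<in> carrier_mat (fact_rank b) (fact_rank a)"
    and "\<And>p. fact_map a p \<in> carrier_mat (fact_rank a) (fact_rank a)" "\<And>p. hom_homogeneous a a 1 (fact_map a p)"
    and "\<And>p. fact_map b p \<in> carrier_mat (fact_rank b) (fact_rank b)" "\<And>p. hom_homogeneous b b 1 (fact_map b p)"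
  shows "defect_diff a b \<alpha> = form_add (DF_comp a b b (section_form (fact_rank b) (fact_rank b) (fact_map b)) \<alpha>)
     (form_uminus (DF_comp a a b (form_invol a b \<alpha>) (section_form (fact_rank a) (fact_rank a) (fact_map a))))"
proof (intro ext)
  fix p vs
  let ?ra = "fact_rank a" and ?rb = "fact_rank b"
  let ?s = "section_form ?ra ?ra (fact_map a)" and ?s' = "section_form ?rb ?rb (fact_map b)"
  have sc: "?s p vs \<in> carrier_mat ?ra ?ra" "?s' p vs \<in> carrier_mat ?rb ?rb" for p vs
    using assms by (auto simp: section_form_def)
  have ic: "form_invol a b \<alpha> p vs \<in> carrier_mat ?rb ?ra" for p vs
    by (simp add: form_invol_def grading_sign_carrier)
  have gc: "grading_sign a b 1 (\<alpha> p vs) \<in> carrier_mat ?rb ?ra" by (rule grading_sign_carrier)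
  have odd: "(parity_sign b i * parity_sign b k) ^ length vs * ent ?rb ?rb (fact_map b p) i k
      = (-1) ^ length vs * ent ?rb ?rb (fact_map b p) i k" for i k
  proof (cases "ent ?rb ?rb (fact_map b p) i k = 0")
    case False
    then have "index_parity b i + index_parity b k = 1"
      using assms(5)[of p] unfolding hom_homogeneous_def ent_def by (metis (full_types))
    then have "parity_sign b i * parity_sign b k = -1"
      unfolding parity_sign_def by (cases "index_parity b i"; cases "index_parity b k") auto
    then show ?thesis by simp
  qed simp
  show "defect_diff a b \<alpha> p vs = form_add (DF_comp a b b ?s' \<alpha>) (form_uminus (DF_comp a a b (form_invol a b \<alpha>) ?s)) p vs"
  proof (rule ent_eqI[of _ ?rb ?ra])
    fix i j
    have "ent ?rb ?ra (DF_comp a b b ?s' \<alpha> p vs) i j = (\<Sum>k<?rb. (-1) ^ length vs * ent ?rb ?rb (fact_map b p) i k * ent ?rb ?ra (\<alpha> p vs) k j)"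
      using fun_cong[OF fun_cong[OF fun_cong[OF ents_DF_comp[of \<alpha> p b a ?s' b, OF assms(1) sc(2)]]], of vs i j]
      by (simp add: ents_section wedge_form0_left odd) (simp add: ents_def)
    moreover have "ent ?rb ?ra (DF_comp a a b (form_invol a b \<alpha>) ?s p vs) i j
        = (\<Sum>k<?ra. (-1) ^ length vs * (parity_sign b i * parity_sign a k) * ent ?rb ?ra (\<alpha> p vs) i k * ent ?ra ?ra (fact_map a p) k j)"
      using fun_cong[OF fun_cong[OF fun_cong[OF ents_DF_comp[of ?s p a a "form_invol a b \<alpha>" b, OF sc(1) ic]]], of vs i j]
      by (simp add: ents_section wedge_form0_right ents_invol invol_def) (simp add: ents_def)
    moreover have "ent ?rb ?ra (defect_diff a b \<alpha> p vs) i j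
      = (-1) ^ length vs * (\<Sum>k<?rb. ent ?rb ?rb (fact_map b p) i k * ent ?rb ?ra (\<alpha> p vs) k j)
        - (-1) ^ length vs * (\<Sum>k<?ra. (parity_sign b i * parity_sign a k) * ent ?rb ?ra (\<alpha> p vs) i k * ent ?ra ?ra (fact_map a p) k j)"
    proof -
      have "ent ?rb ?ra (defect_diff a b \<alpha> p vs) i j
        = ent ?rb ?ra ((-1) ^ length vs \<cdot>\<^sub>m (fact_map b p * \<alpha> p vs)) i j
          - ent ?rb ?ra ((-1) ^ length vs \<cdot>\<^sub>m (grading_sign a b 1 (\<alpha> p vs) * fact_map a p)) i j"
        using assms(1)[of p vs] assms(2)[of p] assms(4)[of p] gc by (simp add: defect_diff_def ent_def)
      then show ?thesis
        using ent_smult[OF mult_carrier_mat[OF assms(4) assms(1)]] ent_smult[OF mult_carrier_mat[OF gc assms(2)]]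
        by (simp only: ent_mult[OF assms(4) assms(1)] ent_mult[OF gc assms(2)] ent_grading_sign power_one_right)
    qed
    moreover have "ent ?rb ?ra (form_add (DF_comp a b b ?s' \<alpha>) (form_uminus (DF_comp a a b (form_invol a b \<alpha>) ?s)) p vs) i j
        = ent ?rb ?ra (DF_comp a b b ?s' \<alpha> p vs) i j - ent ?rb ?ra (DF_comp a a b (form_invol a b \<alpha>) ?s p vs) i j"
      unfolding form_add_def form_scale_def
      by (simp add: ent_add[OF DF_comp_carrier smult_carrier_mat[OF DF_comp_carrier]] ent_smult[OF DF_comp_carrier])
    ultimately show "ent ?rb ?ra (defect_diff a b \<alpha> p vs) i j
        = ent ?rb ?ra (form_add (DF_comp a b b ?s' \<alpha>) (form_uminus (DF_comp a a b (form_invol a b \<alpha>) ?s)) p vs) i j"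
      by (simp add: sum_distrib_left mult.assoc)
  next
    show "defect_diff a b \<alpha> p vs \<in> carrier_mat ?rb ?ra"
      unfolding defect_diff_def
      by (intro minus_carrier_mat smult_carrier_mat mult_carrier_mat[OF gc assms(2)])
    show "form_add (DF_comp a b b ?s' \<alpha>) (form_uminus (DF_comp a a b (form_invol a b \<alpha>) ?s)) p vs \<in> carrier_mat ?rb ?ra"
      unfolding form_add_def form_scale_def by (intro add_carrier_mat smult_carrier_mat DF_comp_carrier)
  qed
qed

section \<open>Direct sums of bundles and block matrices\<close>

lemma mat_inv_unique:
  assumes "M \<in> carrier_mat n n" "invertible_mat M" "N \<in> carrier_mat n n" "M * N = 1\<^sub>m n"
  shows "mat_inv M = N"
proof -
  note i = mat_inv[OF assms(1,2)]
  have "mat_inv M = mat_inv M * (M * N)" using assms i by simp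
  also have "\<dots> = mat_inv M * M * N" by (rule assoc_mult_mat[OF i(1) assms(1,3), symmetric])
  also have "\<dots> = N" using i assms by simp
  finally show ?thesis .
qed

lemma block_diag_mult:
  fixes S :: "complex mat"
  assumes "S \<in> carrier_mat m m" "S' \<in> carrier_mat m m" "T \<in> carrier_mat n n" "T' \<in> carrier_mat n n"
  shows "four_block_mat S (0\<^sub>m m n) (0\<^sub>m n m) T * four_block_mat S' (0\<^sub>m m n) (0\<^sub>m n m) T'
       = four_block_mat (S * S') (0\<^sub>m m n) (0\<^sub>m n m) (T * T')"
proof -
  have "S * S' \<in> carrier_mat m m" "T * T' \<in> carrier_mat n n" using assms by auto
  then show ?thesis
    using assms by (subst mult_four_block_mat[of _ m m _ n _ n _ _ m _ n]) simp_all
qed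

lemma block_diag_inverse:
  fixes S :: "complex mat"
  assumes "S \<in> carrier_mat m m" "invertible_mat S" "T \<in> carrier_mat n n" "invertible_mat T"
  defines "B \<equiv> four_block_mat S (0\<^sub>m m n) (0\<^sub>m n m) T"
  shows "invertible_mat B" "mat_inv B = four_block_mat (mat_inv S) (0\<^sub>m m n) (0\<^sub>m n m) (mat_inv T)"
proof -
  let ?C = "four_block_mat (mat_inv S) (0\<^sub>m m n) (0\<^sub>m n m) (mat_inv T)"
  note i = mat_inv[OF assms(1,2)] mat_inv[OF assms(3,4)]
  have c: "B \<in> carrier_mat (m + n) (m + n)" "?C \<in> carrier_mat (m + n) (m + n)"
    using assms i by (auto simp: B_def)
  have BC: "B * ?C = 1\<^sub>m (m + n)" "?C * B = 1\<^sub>m (m + n)"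
    using assms i by (simp_all add: B_def block_diag_mult)
  then show inv: "invertible_mat B"
    unfolding invertible_mat_def inverts_mat_def square_mat.simps
    using c by (intro conjI exI[of _ ?C]) (auto simp: carrier_matD)
  show "mat_inv B = ?C" by (rule mat_inv_unique[OF c(1) inv c(2) BC(1)])
qed

context complex_manifold
begin

lemma holomorphic_fun_subset: "holomorphic_fun A S f \<Longrightarrow> T \<subseteq> S \<Longrightarrow> holomorphic_fun A T f"
  by (auto simp: holomorphic_fun_def intro: cholomorphic_on_subset[OF _ chart_image_mono])

lemma bundle_invertible:
  assumes "holomorphic_bundle A E" "t \<in> bundle_trivs E" "p \<in> fst t"
  shows "snd t p \<in> carrier_mat (bundle_rank E) (bundle_rank E)" "invertible_mat (snd t p)"
  using assms unfolding holomorphic_bundle_def by blast+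

lemma bundle_transition_fun:
  assumes "holomorphic_bundle A E" "t \<in> bundle_trivs E" "t' \<in> bundle_trivs E"
    "i < bundle_rank E" "j < bundle_rank E"
  shows "holomorphic_fun A (fst t \<inter> fst t') (\<lambda>p. (snd t' p * mat_inv (snd t p)) $$ (i, j))"
  using assms unfolding holomorphic_bundle_def by blast

text \<open>The transition matrices are block diagonal, with the holomorphic transition matrices of
  the summands as blocks.\<close>

lemma direct_sum_bundle:
  assumes E: "holomorphic_bundle A E" and F: "holomorphic_bundle A F"
  shows "holomorphic_bundle A (direct_sum_bundle E F)"
proof -
  let ?m = "bundle_rank E" and ?n = "bundle_rank F"
  let ?B = "\<lambda>\<sigma> \<tau> p. four_block_mat (\<sigma> p) (0\<^sub>m ?m ?n) (0\<^sub>m ?n ?m) (\<tau> p)"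
  have trivs: "bundle_trivs (direct_sum_bundle E F) = {(U \<inter> V, ?B \<sigma> \<tau>) | U \<sigma> V \<tau>. (U, \<sigma>) \<in> bundle_trivs E \<and> (V, \<tau>) \<in> bundle_trivs F}"
    by (simp add: direct_sum_bundle_def)
  have rank: "bundle_rank (direct_sum_bundle E F) = ?m + ?n" by (simp add: direct_sum_bundle_def)
  have Ec: "\<sigma> p \<in> carrier_mat ?m ?m" "invertible_mat (\<sigma> p)" "open U" if "(U, \<sigma>) \<in> bundle_trivs E" "p \<in> U" for U \<sigma> p
    using bundle_invertible[OF E that(1)] triv_open[OF E that(1)] that(2) by simp_all
  have Fc: "\<tau> p \<in> carrier_mat ?n ?n" "invertible_mat (\<tau> p)" "open V" if "(V, \<tau>) \<in> bundle_trivs F" "p \<in> V" for V \<tau> p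
    using bundle_invertible[OF F that(1)] triv_open[OF F that(1)] that(2) by simp_all
  show ?thesis
    unfolding holomorphic_bundle_def rank
  proof (intro conjI ballI allI impI)
    show "(\<Union>t\<in>bundle_trivs (direct_sum_bundle E F). fst t) = UNIV"
    proof (intro equalityI subsetI)
      fix p :: 'x
      have "(fst (triv_at E p) \<inter> fst (triv_at F p), ?B (snd (triv_at E p)) (snd (triv_at F p))) \<in> bundle_trivs (direct_sum_bundle E F)"
        unfolding trivs using triv_at(1)[OF E, of p] triv_at(1)[OF F, of p]
        by (intro CollectI exI[of _ "fst (triv_at E p)"] exI[of _ "snd (triv_at E p)"]
            exI[of _ "fst (triv_at F p)"] exI[of _ "snd (triv_at F p)"] conjI) simp_all
      moreover have "p \<in> fst (fst (triv_at E p) \<inter> fst (triv_at F p), ?B (snd (triv_at E p)) (snd (triv_at F p)))"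
        using triv_at(2)[OF E, of p] triv_at(2)[OF F, of p] by simp
      ultimately show "p \<in> (\<Union>t\<in>bundle_trivs (direct_sum_bundle E F). fst t)"
        by (rule UN_I)
    qed simp
  next
    fix t assume "t \<in> bundle_trivs (direct_sum_bundle E F)"
    then obtain U \<sigma> V \<tau> where t: "t = (U \<inter> V, ?B \<sigma> \<tau>)" "(U, \<sigma>) \<in> bundle_trivs E" "(V, \<tau>) \<in> bundle_trivs F"
      unfolding trivs by blast
    show "open (fst t)"
      using triv_open[OF E t(2)] triv_open[OF F t(3)] t(1) by auto
    fix p assume "p \<in> fst t"
    then have p: "p \<in> U" "p \<in> V" using t(1) by auto
    show "snd t p \<in> carrier_mat (?m + ?n) (?m + ?n)"
      using Ec(1)[OF t(2) p(1)] Fc(1)[OF t(3) p(2)] by (simp add: t(1))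
    show "invertible_mat (snd t p)"
      using block_diag_inverse(1)[OF Ec(1,2)[OF t(2) p(1)] Fc(1,2)[OF t(3) p(2)]] by (simp add: t(1))
  next
    fix t t' i j
    assume "t \<in> bundle_trivs (direct_sum_bundle E F)" "t' \<in> bundle_trivs (direct_sum_bundle E F)"
      and ij: "i < ?m + ?n" "j < ?m + ?n"
    then obtain U \<sigma> V \<tau> U' \<sigma>' V' \<tau>' where t: "t = (U \<inter> V, ?B \<sigma> \<tau>)" "(U, \<sigma>) \<in> bundle_trivs E" "(V, \<tau>) \<in> bundle_trivs F"
      and t': "t' = (U' \<inter> V', ?B \<sigma>' \<tau>')" "(U', \<sigma>') \<in> bundle_trivs E" "(V', \<tau>') \<in> bundle_trivs F"
      unfolding trivs by blast
    let ?S = "fst t \<inter> fst t'"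
    have S: "open ?S"
      using triv_open[OF E t(2)] triv_open[OF F t(3)] triv_open[OF E t'(2)] triv_open[OF F t'(3)]
      by (simp add: t(1) t'(1) open_Int)
    define f where "f p = (if i < ?m then if j < ?m then (\<sigma>' p * mat_inv (\<sigma> p)) $$ (i, j) else 0
        else if j < ?m then 0 else (\<tau>' p * mat_inv (\<tau> p)) $$ (i - ?m, j - ?m))" for p
    have eq: "(snd t' p * mat_inv (snd t p)) $$ (i, j) = f p" if "p \<in> ?S" for p
    proof -
      have p: "p \<in> U" "p \<in> V" "p \<in> U'" "p \<in> V'" using that t(1) t'(1) by auto
      note e = Ec(1,2)[OF t(2) p(1)] Ec(1)[OF t'(2) p(3)] and f = Fc(1,2)[OF t(3) p(2)] Fc(1)[OF t'(3) p(4)]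
      have m: "\<sigma>' p * mat_inv (\<sigma> p) \<in> carrier_mat ?m ?m" "\<tau>' p * mat_inv (\<tau> p) \<in> carrier_mat ?n ?n"
        using e f mat_inv(1)[OF e(1,2)] mat_inv(1)[OF f(1,2)] by auto
      have "snd t' p * mat_inv (snd t p) = four_block_mat (\<sigma>' p * mat_inv (\<sigma> p)) (0\<^sub>m ?m ?n) (0\<^sub>m ?n ?m) (\<tau>' p * mat_inv (\<tau> p))"
        using block_diag_inverse(2)[OF e(1,2) f(1,2)] block_diag_mult[OF e(3) mat_inv(1)[OF e(1,2)] f(3) mat_inv(1)[OF f(1,2)]]
        by (simp add: t(1) t'(1))
      moreover have "four_block_mat X (0\<^sub>m ?m ?n) (0\<^sub>m ?n ?m) Y $$ (i, j)
          = (if i < ?m then if j < ?m then X $$ (i, j) else 0 else if j < ?m then 0 else Y $$ (i - ?m, j - ?m))"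
        if "X \<in> carrier_mat ?m ?m" "Y \<in> carrier_mat ?n ?n" for X Y :: "complex mat"
        using that ij by auto
      ultimately show ?thesis using m by (simp only: f_def)
    qed
    have hol: "holomorphic_fun A ?S f"
    proof -
      have 1: "holomorphic_fun A ?S (\<lambda>p. (\<sigma>' p * mat_inv (\<sigma> p)) $$ (i, j))" if "i < ?m" "j < ?m"
      proof (rule holomorphic_fun_subset)
        show "holomorphic_fun A (U \<inter> U') (\<lambda>p. (\<sigma>' p * mat_inv (\<sigma> p)) $$ (i, j))"
          using bundle_transition_fun[OF E t(2) t'(2) that] by simp
        show "?S \<subseteq> U \<inter> U'" using t(1) t'(1) by auto
      qed
      have 2: "holomorphic_fun A ?S (\<lambda>p. (\<tau>' p * mat_inv (\<tau> p)) $$ (i - ?m, j - ?m))" if "\<not> i < ?m" "\<not> j < ?m"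
      proof (rule holomorphic_fun_subset)
        have "i - ?m < ?n" "j - ?m < ?n" using ij that by auto
        then show "holomorphic_fun A (V \<inter> V') (\<lambda>p. (\<tau>' p * mat_inv (\<tau> p)) $$ (i - ?m, j - ?m))"
          using bundle_transition_fun[OF F t(3) t'(3)] by simp
        show "?S \<subseteq> V \<inter> V'" using t(1) t'(1) by auto
      qed
      have 3: "holomorphic_fun A ?S (\<lambda>p. 0)" by (simp add: holomorphic_fun_def cholomorphic_on_const)
      show ?thesis unfolding f_def[abs_def] using 1 2 3 by (cases "i < ?m"; cases "j < ?m") simp_all
    qed
    show "holomorphic_fun A ?S (\<lambda>p. (snd t' p * mat_inv (snd t p)) $$ (i, j))"
      unfolding holomorphic_fun_def
    proof
      fix c assume c: "c \<in> A"
      then have "cholomorphic_on (\<lambda>z. f (chart_inv c z)) (chart_image c ?S)"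
        using hol by (simp add: holomorphic_fun_def)
      then show "cholomorphic_on (\<lambda>z. (snd t' (chart_inv c z) * mat_inv (snd t (chart_inv c z))) $$ (i, j)) (chart_image c ?S)"
        by (rule cholomorphic_on_transform[OF chart_image_open[OF c S]]) (rule eq[OF chart_imageE(2)[OF c]])
    qed
  qed
qed

text \<open>Frames of a factorization are block diagonal, so a nonzero entry joins indices of equal
  parity. Conjugation by frames therefore preserves all grading signs.\<close>

lemma fact_triv_even:
  assumes E: "holomorphic_bundle A (fact_even a)" and F: "holomorphic_bundle A (fact_odd a)"
    and t: "t \<in> bundle_trivs (fact_bundle a)" "p \<in> fst t"
  shows "parity_sign a i * parity_sign a j * ent (fact_rank a) (fact_rank a) (snd t p) i j = ent (fact_rank a) (fact_rank a) (snd t p) i j"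
    "parity_sign a i * parity_sign a j * ent (fact_rank a) (fact_rank a) (mat_inv (snd t p)) i j = ent (fact_rank a) (fact_rank a) (mat_inv (snd t p)) i j"
proof -
  let ?m = "bundle_rank (fact_even a)" and ?n = "bundle_rank (fact_odd a)"
  have r: "fact_rank a = ?m + ?n" by (simp add: fact_bundle_def direct_sum_bundle_def)
  obtain U \<sigma> V \<tau> where *: "t = (U \<inter> V, \<lambda>p. four_block_mat (\<sigma> p) (0\<^sub>m ?m ?n) (0\<^sub>m ?n ?m) (\<tau> p))"
    "(U, \<sigma>) \<in> bundle_trivs (fact_even a)" "(V, \<tau>) \<in> bundle_trivs (fact_odd a)"
    using t(1) unfolding fact_bundle_def direct_sum_bundle_def by auto
  have p: "p \<in> U" "p \<in> V" using t(2) *(1) by auto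
  have e: "\<sigma> p \<in> carrier_mat ?m ?m" "invertible_mat (\<sigma> p)"
    using bundle_invertible[OF E *(2)] p by simp_all
  have f: "\<tau> p \<in> carrier_mat ?n ?n" "invertible_mat (\<tau> p)"
    using bundle_invertible[OF F *(3)] p by simp_all
  have "parity_sign a i * parity_sign a j * ent (?m + ?n) (?m + ?n) (four_block_mat S (0\<^sub>m ?m ?n) (0\<^sub>m ?n ?m) T) i j
      = ent (?m + ?n) (?m + ?n) (four_block_mat S (0\<^sub>m ?m ?n) (0\<^sub>m ?n ?m) T) i j"
    if "S \<in> carrier_mat ?m ?m" "T \<in> carrier_mat ?n ?n" for S T :: "complex mat"
    using that by (auto simp: ent_def parity_sign_def index_parity_def)
  from this[OF e(1) f(1)] this[OF mat_inv(1)[OF e] mat_inv(1)[OF f]]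
  show "parity_sign a i * parity_sign a j * ent (fact_rank a) (fact_rank a) (snd t p) i j = ent (fact_rank a) (fact_rank a) (snd t p) i j"
    "parity_sign a i * parity_sign a j * ent (fact_rank a) (fact_rank a) (mat_inv (snd t p)) i j = ent (fact_rank a) (fact_rank a) (mat_inv (snd t p)) i j"
    unfolding r *(1) by (simp_all add: block_diag_inverse(2)[OF e f])
qed

end

lemma wedge_assoc_fun:
  assumes "\<And>k. sc k * sc k = 1"
  shows "wedge r' sd sc \<gamma> (wedge r sc sb \<beta> \<alpha>) = wedge r sd sb (wedge r' sd sc \<gamma> \<beta>) \<alpha>"
  by (intro ext) (rule wedge_assoc[OF assms])

text \<open>An even matrix of form degree 0 passes form arguments without a sign. Conjugation by
  frames thus becomes a graded product, and associativity of \<open>wedge\<close> applies to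
  it.\<close>

lemma sandwich_wedge:
  assumes "\<And>i k. sb i * sb k * P i k = P i k"
  shows "(\<lambda>vs. sandwich m n P (X vs) Q) = wedge n sb sa (wedge m sb sb (form0 P) X) (form0 Q)"
proof -
  have "x ^ l * y = y" if "x * y = y" for x y :: complex and l
    using that by (induction l) auto
  from this[OF assms] show ?thesis
    by (intro ext) (simp only: sandwich_def wedge_form0_left wedge_form0_right)
qed

lemma wedge_form0_one_right:
  assumes "\<And>vs i j. j \<ge> r \<Longrightarrow> \<beta> vs i j = 0"
  shows "wedge r sc sb \<beta> (form0 (ent r r (1\<^sub>m r))) = \<beta>"
  using assms by (intro ext) (auto simp: wedge_form0_right ent_one if_distrib not_less cong: if_cong)

lemma invol_form0:
  assumes "\<And>i k. sb i * sa k * P i k = P i k"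
  shows "invol sb sa (form0 P) = form0 P"
  using assms by (auto simp: invol_def form0_def fun_eq_iff)

definition bit_sign :: "bit \<Rightarrow> complex" where
  "bit_sign s = (if s = 0 then 1 else -1)"

lemma bit_sign_add: "bit_sign (s + t) = bit_sign s * bit_sign t"
  by (cases s; cases t) (simp_all add: bit_sign_def)

lemma bit_sign_of_nat: "bit_sign (of_nat n) = (-1) ^ n"
proof (induction n)
  case (Suc n)
  show ?case
    by (simp only: of_nat_Suc bit_sign_add Suc.IH) (simp add: bit_sign_def)
qed (simp add: bit_sign_def)

lemma bit_sign_eq_iff: "bit_sign s = bit_sign t \<longleftrightarrow> s = t"
  by (cases s; cases t) (simp_all add: bit_sign_def)

text \<open>Degree \<open>s\<close> is an eigenspace of the involution. All degree statements become
  computations with \<open>invol\<close>.\<close>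

lemma form_deg_iff:
  "\<alpha> \<in> form_deg a b s \<longleftrightarrow>
     (\<forall>p vs i j. invol (parity_sign b) (parity_sign a) (ents a b \<alpha> p) vs i j = bit_sign s * ents a b \<alpha> p vs i j)"
proof -
  have ps: "parity_sign b i * parity_sign a j = bit_sign (index_parity b i + index_parity a j)" for i j
    unfolding bit_sign_add by (simp add: parity_sign_def bit_sign_def)
  have key: "(-1) ^ n * (parity_sign b i * parity_sign a j) * x = bit_sign s * x \<longleftrightarrow>
      (x \<noteq> 0 \<longrightarrow> index_parity b i + index_parity a j = s + of_nat n)" for n i j x
  proof -
    have "(-1) ^ n * (parity_sign b i * parity_sign a j) = bit_sign s \<longleftrightarrow>
        bit_sign (of_nat n + (index_parity b i + index_parity a j)) = bit_sign s"
      by (simp only: bit_sign_add ps bit_sign_of_nat)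
    also have "\<dots> \<longleftrightarrow> of_nat n + (index_parity b i + index_parity a j) = s"
      by (rule bit_sign_eq_iff)
    also have "\<dots> \<longleftrightarrow> index_parity b i + index_parity a j = s + of_nat n"
      by (cases "of_nat n :: bit"; cases "index_parity b i"; cases "index_parity a j"; cases s) simp_all
    finally show ?thesis by (cases "x = 0") simp_all
  qed
  show ?thesis
    unfolding form_deg_def hom_homogeneous_def invol_def key by (auto simp: ents_def ent_def)
qed

lemma ents_add:
  assumes "\<alpha> p vs \<in> carrier_mat (fact_rank b) (fact_rank a)" "\<beta> p vs \<in> carrier_mat (fact_rank b) (fact_rank a)"
  shows "ents a b (form_add \<alpha> \<beta>) p vs i j = ents a b \<alpha> p vs i j + ents a b \<beta> p vs i j"
  unfolding ents_def form_add_def by (rule ent_add[OF assms])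

lemma ents_scale:
  assumes "\<alpha> p vs \<in> carrier_mat (fact_rank b) (fact_rank a)"
  shows "ents a b (form_scale f \<alpha>) p vs i j = f p * ents a b \<alpha> p vs i j"
  unfolding ents_def form_scale_def by (rule ent_smult[OF assms])

lemma form_eqI:
  assumes "\<And>p vs. \<alpha> p vs \<in> carrier_mat (fact_rank b) (fact_rank a)" "\<And>p vs. \<beta> p vs \<in> carrier_mat (fact_rank b) (fact_rank a)"
    "\<And>p vs i j. ents a b \<alpha> p vs i j = ents a b \<beta> p vs i j"
  shows "\<alpha> = \<beta>"
  by (intro ext ent_eqI[OF assms(1,2)]) (use assms(3) in \<open>simp add: ents_def\<close>)

section \<open>Morphism spaces of factorizations and their components\<close>

locale landau_ginzburg = complex_manifold A
  for A :: "('x::t2_space, 'd::finite) chart set" +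
  fixes W :: "'x \<Rightarrow> complex"
  assumes W_holomorphic: "holomorphic_fun A UNIV W"
begin

abbreviation obj :: "'x factorization \<Rightarrow> bool" where
  "obj a \<equiv> holomorphic_factorization A W a"

abbreviation Hom :: "'x factorization \<Rightarrow> 'x factorization \<Rightarrow> ('x, 'd) matform set" where
  "Hom a b \<equiv> hom_forms A (fact_bundle a) (fact_bundle b)"

abbreviation dolb :: "'x factorization \<Rightarrow> 'x factorization \<Rightarrow> ('x, 'd) matform \<Rightarrow> ('x, 'd) matform" where
  "dolb a b \<equiv> dolbeault A (fact_bundle a) (fact_bundle b)"

abbreviation lf :: "'x factorization \<Rightarrow> 'x factorization \<Rightarrow> ('x, 'd) chart \<Rightarrow> 'x triv \<Rightarrow> 'x triv \<Rightarrow>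
     ('x, 'd) matform \<Rightarrow> complex ^ 'd \<Rightarrow> (complex ^ 'd) list \<Rightarrow> nat \<Rightarrow> nat \<Rightarrow> complex" where
  "lf a b \<equiv> lform A (fact_bundle a) (fact_bundle b)"

abbreviation fprod :: "'x factorization \<Rightarrow> 'x factorization \<Rightarrow> ('v list \<Rightarrow> nat \<Rightarrow> nat \<Rightarrow> complex) \<Rightarrow>
     ('v list \<Rightarrow> nat \<Rightarrow> nat \<Rightarrow> complex) \<Rightarrow> 'v list \<Rightarrow> nat \<Rightarrow> nat \<Rightarrow> complex" where
  "fprod c b \<equiv> wedge (fact_rank b) (parity_sign c) (parity_sign b)"

abbreviation finv :: "'x factorization \<Rightarrow> 'x factorization \<Rightarrow> ('v list \<Rightarrow> nat \<Rightarrow> nat \<Rightarrow> complex) \<Rightarrow>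
     'v list \<Rightarrow> nat \<Rightarrow> nat \<Rightarrow> complex" where
  "finv b a \<equiv> invol (parity_sign b) (parity_sign a)"

abbreviation mapf :: "'x factorization \<Rightarrow> ('x, 'd) matform" where
  "mapf a \<equiv> section_form (fact_rank a) (fact_rank a) (fact_map a)"

lemma obj_bundle:
  assumes "obj a"
  shows "holomorphic_bundle A (fact_bundle a)" "holomorphic_bundle A (fact_even a)" "holomorphic_bundle A (fact_odd a)"
  using assms direct_sum_bundle unfolding holomorphic_factorization_def fact_bundle_def by auto

lemma obj_map:
  assumes "obj a"
  shows "fact_map a p \<in> carrier_mat (fact_rank a) (fact_rank a)" "hom_homogeneous a a 1 (fact_map a p)"
    "fact_map a p * fact_map a p = W p \<cdot>\<^sub>m 1\<^sub>m (fact_rank a)"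
    "fact_map a \<in> holomorphic_homs A (fact_bundle a) (fact_bundle a)"
  using assms unfolding holomorphic_factorization_def holomorphic_homs_def by auto

lemma triv_even:
  assumes "obj a" "t \<in> bundle_trivs (fact_bundle a)" "p \<in> fst t"
  shows "parity_sign a i * parity_sign a j * ent (fact_rank a) (fact_rank a) (snd t p) i j = ent (fact_rank a) (fact_rank a) (snd t p) i j"
    "parity_sign a i * parity_sign a j * ent (fact_rank a) (fact_rank a) (mat_inv (snd t p)) i j = ent (fact_rank a) (fact_rank a) (mat_inv (snd t p)) i j"
  using fact_triv_even[OF obj_bundle(2,3)[OF assms(1)] assms(2,3)] by auto

lemma Hom_carrier: "\<alpha> \<in> Hom a b \<Longrightarrow> \<alpha> p vs \<in> carrier_mat (fact_rank b) (fact_rank a)"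
  by (rule hom_formsD(1))

lemma lf_eq_prod:
  assumes ab: "obj a" "obj b" and t: "ta \<in> bundle_trivs (fact_bundle a)" "tb \<in> bundle_trivs (fact_bundle b)"
    and p: "chart_inv c z \<in> fst ta" "chart_inv c z \<in> fst tb"
    and \<alpha>: "\<And>p vs. \<alpha> p vs \<in> carrier_mat (fact_rank b) (fact_rank a)"
  shows "lf a b c ta tb \<alpha> z
    = fprod b a (fprod b b (form0 (ent (fact_rank b) (fact_rank b) (snd tb (chart_inv c z))))
          (\<lambda>vs. ents a b \<alpha> (chart_inv c z) (map (chart_vec A c (chart_inv c z)) vs)))
        (form0 (ent (fact_rank a) (fact_rank a) (mat_inv (snd ta (chart_inv c z)))))"
proof -
  have "lf a b c ta tb \<alpha> z = (\<lambda>vs. sandwich (fact_rank b) (fact_rank a)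
      (ent (fact_rank b) (fact_rank b) (snd tb (chart_inv c z)))
      (ents a b \<alpha> (chart_inv c z) (map (chart_vec A c (chart_inv c z)) vs))
      (ent (fact_rank a) (fact_rank a) (mat_inv (snd ta (chart_inv c z)))))"
    unfolding ents_def by (intro ext) (rule lform_eq[OF obj_bundle(1)[OF ab(1)] obj_bundle(1)[OF ab(2)] t p \<alpha>])
  also have "\<dots> = fprod b a (fprod b b (form0 (ent (fact_rank b) (fact_rank b) (snd tb (chart_inv c z))))
          (\<lambda>vs. ents a b \<alpha> (chart_inv c z) (map (chart_vec A c (chart_inv c z)) vs)))
        (form0 (ent (fact_rank a) (fact_rank a) (mat_inv (snd ta (chart_inv c z)))))"
    by (rule sandwich_wedge) (rule triv_even(1)[OF ab(2) t(2) p(2)])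
  finally show ?thesis .
qed

text \<open>After reassociating, the frame of the middle bundle meets its inverse
  (\<open>QP\<close>) and drops out, so products may be computed in components.\<close>

lemma lf_DF_comp:
  assumes abc: "obj a" "obj b" "obj c"
    and t: "ta \<in> bundle_trivs (fact_bundle a)" "tb \<in> bundle_trivs (fact_bundle b)" "tc \<in> bundle_trivs (fact_bundle c)"
    and p: "chart_inv ch z \<in> fst ta" "chart_inv ch z \<in> fst tb" "chart_inv ch z \<in> fst tc"
    and \<alpha>: "\<And>p vs. \<alpha> p vs \<in> carrier_mat (fact_rank b) (fact_rank a)"
    and \<beta>: "\<And>p vs. \<beta> p vs \<in> carrier_mat (fact_rank c) (fact_rank b)"
  shows "lf a c ch ta tc (DF_comp a b c \<beta> \<alpha>) z = fprod c b (lf b c ch tb tc \<beta> z) (lf a b ch ta tb \<alpha> z)"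
proof -
  let ?p = "chart_inv ch z"
  let ?f = "map (chart_vec A ch ?p)"
  define Pb where "Pb = (form0 (ent (fact_rank b) (fact_rank b) (snd tb ?p)) :: (complex ^ 'd) list \<Rightarrow> nat \<Rightarrow> nat \<Rightarrow> complex)"
  define Pc where "Pc = (form0 (ent (fact_rank c) (fact_rank c) (snd tc ?p)) :: (complex ^ 'd) list \<Rightarrow> nat \<Rightarrow> nat \<Rightarrow> complex)"
  define Qa where "Qa = (form0 (ent (fact_rank a) (fact_rank a) (mat_inv (snd ta ?p))) :: (complex ^ 'd) list \<Rightarrow> nat \<Rightarrow> nat \<Rightarrow> complex)"
  define Qb where "Qb = (form0 (ent (fact_rank b) (fact_rank b) (mat_inv (snd tb ?p))) :: (complex ^ 'd) list \<Rightarrow> nat \<Rightarrow> nat \<Rightarrow> complex)"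
  define X where "X vs = ents a b \<alpha> ?p (?f vs)" for vs
  define Y where "Y vs = ents b c \<beta> ?p (?f vs)" for vs
  note [simp] = parity_sign_square
  note assoc = wedge_assoc_fun[OF parity_sign_square]
  have QP: "fprod b b Qb Pb = form0 (ent (fact_rank b) (fact_rank b) (1\<^sub>m (fact_rank b)))"
  proof (intro ext)
    fix vs i j
    note bt = bundle_triv[OF obj_bundle(1)[OF abc(2)] t(2) p(2)]
    have "fprod b b Qb Pb vs i j = (if vs = [] then ent (fact_rank b) (fact_rank b) (mat_inv (snd tb ?p) * snd tb ?p) i j else 0)"
      unfolding Qb_def Pb_def wedge_form0_right by (simp add: form0_def ent_mult[OF bt(2,1)])
    then show "fprod b b Qb Pb vs i j = form0 (ent (fact_rank b) (fact_rank b) (1\<^sub>m (fact_rank b))) vs i j"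
      unfolding bt(4) by (simp add: form0_def)
  qed
  have comp: "(\<lambda>vs. ents a c (DF_comp a b c \<beta> \<alpha>) ?p (?f vs)) = fprod c b Y X"
    unfolding ents_DF_comp[of \<alpha> ?p b a \<beta> c, OF \<alpha> \<beta>] X_def[abs_def] Y_def[abs_def]
    by (intro ext) (rule wedge_map)
  have zero: "fprod c c Pc Y vs i j = 0" if "j \<ge> fact_rank b" for vs i j
    by (rule wedge_zero_col) (use that in \<open>simp add: Y_def ents_def ent_def\<close>)
  have "fprod c b (lf b c ch tb tc \<beta> z) (lf a b ch ta tb \<alpha> z)
      = fprod c b (fprod c b (fprod c c Pc Y) Qb) (fprod b a (fprod b b Pb X) Qa)"
    unfolding lf_eq_prod[OF abc(2,3) t(2,3) p(2,3) \<beta>] lf_eq_prod[OF abc(1,2) t(1,2) p(1,2) \<alpha>]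
    by (simp add: Pb_def Pc_def Qa_def Qb_def X_def[abs_def] Y_def[abs_def])
  also have "\<dots> = fprod c a (fprod c b (fprod c b (fprod c b (fprod c c Pc Y) Qb) Pb) X) Qa"
    by (simp only: assoc)
  also have "fprod c b (fprod c b (fprod c c Pc Y) Qb) Pb = fprod c b (fprod c c Pc Y) (fprod b b Qb Pb)"
    by (rule assoc[symmetric])
  also have "\<dots> = fprod c c Pc Y"
    unfolding QP by (rule wedge_form0_one_right) (rule zero)
  also have "fprod c b (fprod c c Pc Y) X = fprod c c Pc (fprod c b Y X)"
    by (rule assoc[symmetric])
  also have "fprod c a \<dots> Qa = lf a c ch ta tc (DF_comp a b c \<beta> \<alpha>) z"
    unfolding lf_eq_prod[OF abc(1,3) t(1,3) p(1,3) DF_comp_carrier] comp Pc_def Qa_def ..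
  finally show ?thesis by simp
qed

lemma form_invol_carrier: "form_invol a b \<alpha> p vs \<in> carrier_mat (fact_rank b) (fact_rank a)"
  by (simp add: form_invol_def grading_sign_carrier)

text \<open>The involution is multiplicative and fixes the even frames on either side.\<close>

lemma lf_invol:
  assumes ab: "obj a" "obj b" and t: "ta \<in> bundle_trivs (fact_bundle a)" "tb \<in> bundle_trivs (fact_bundle b)"
    and p: "chart_inv c z \<in> fst ta" "chart_inv c z \<in> fst tb"
    and \<alpha>: "\<And>p vs. \<alpha> p vs \<in> carrier_mat (fact_rank b) (fact_rank a)"
  shows "lf a b c ta tb (form_invol a b \<alpha>) z = finv b a (lf a b c ta tb \<alpha> z)"
proof -
  let ?p = "chart_inv c z"
  let ?P = "form0 (ent (fact_rank b) (fact_rank b) (snd tb ?p))"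
  let ?Q = "form0 (ent (fact_rank a) (fact_rank a) (mat_inv (snd ta ?p)))"
  let ?X = "\<lambda>vs. ents a b \<alpha> ?p (map (chart_vec A c ?p) vs)"
  have w: "invol sb sd (wedge r sb sc \<beta> \<gamma>) = wedge r sb sc (invol sb sc \<beta>) (invol sc sd \<gamma>)"
    if "\<And>k. sc k * sc k = 1" for r and sb sc sd :: "nat \<Rightarrow> complex" and \<beta> \<gamma> :: "(complex ^ 'd) list \<Rightarrow> _"
    by (intro ext) (rule invol_wedge[OF that])
  have P: "finv b b ?P = ?P" by (rule invol_form0) (rule triv_even(1)[OF ab(2) t(2) p(2)])
  have Q: "finv a a ?Q = ?Q" by (rule invol_form0) (rule triv_even(2)[OF ab(1) t(1) p(1)])
  have X: "(\<lambda>vs. ents a b (form_invol a b \<alpha>) ?p (map (chart_vec A c ?p) vs)) = finv b a ?X"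
    unfolding ents_invol by (simp add: invol_def fun_eq_iff)
  show ?thesis
    unfolding lf_eq_prod[OF ab t p \<alpha>] lf_eq_prod[OF ab t p form_invol_carrier] X
    by (simp only: w[OF parity_sign_square] P Q)
qed

lemma lf_section:
  assumes ab: "obj a" "obj b" and t: "ta \<in> bundle_trivs (fact_bundle a)" "tb \<in> bundle_trivs (fact_bundle b)"
    and p: "chart_inv c z \<in> fst ta" "chart_inv c z \<in> fst tb"
    and s: "\<And>p. s p \<in> carrier_mat (fact_rank b) (fact_rank a)"
  shows "lf a b c ta tb (section_form (fact_rank b) (fact_rank a) s) z
      = form0 (ent (fact_rank b) (fact_rank a) (snd tb (chart_inv c z) * s (chart_inv c z) * mat_inv (snd ta (chart_inv c z))))"
proof (intro ext)
  fix vs i j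
  note bt = bundle_triv(1,2)[OF obj_bundle(1)[OF ab(1)] t(1) p(1)] bundle_triv(1,2)[OF obj_bundle(1)[OF ab(2)] t(2) p(2)]
  have "snd tb (chart_inv c z) * 0\<^sub>m (fact_rank b) (fact_rank a) * mat_inv (snd ta (chart_inv c z)) = 0\<^sub>m (fact_rank b) (fact_rank a)"
    using bt by simp
  then show "lf a b c ta tb (section_form (fact_rank b) (fact_rank a) s) z vs i j
      = form0 (ent (fact_rank b) (fact_rank a) (snd tb (chart_inv c z) * s (chart_inv c z) * mat_inv (snd ta (chart_inv c z)))) vs i j"
    by (simp add: lform_def local_form_def Let_def section_form_def form0_def ent_zero)
qed

lemma lf_add:
  assumes ab: "obj a" "obj b" and t: "ta \<in> bundle_trivs (fact_bundle a)" "tb \<in> bundle_trivs (fact_bundle b)"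
    and p: "chart_inv c z \<in> fst ta" "chart_inv c z \<in> fst tb"
    and \<alpha>: "\<And>p vs. \<alpha> p vs \<in> carrier_mat (fact_rank b) (fact_rank a)" "\<And>p vs. \<beta> p vs \<in> carrier_mat (fact_rank b) (fact_rank a)"
  shows "lf a b c ta tb (form_add \<alpha> \<beta>) z vs i j = lf a b c ta tb \<alpha> z vs i j + lf a b c ta tb \<beta> z vs i j"
proof -
  have c: "form_add \<alpha> \<beta> p vs \<in> carrier_mat (fact_rank b) (fact_rank a)" for p vs
    unfolding form_add_def by (intro add_carrier_mat \<alpha>)
  have e: "(\<lambda>vs. ents a b (form_add \<alpha> \<beta>) p (f vs)) = (\<lambda>vs i j. ents a b \<alpha> p (f vs) i j + ents a b \<beta> p (f vs) i j)" for p and f :: "_ \<Rightarrow> (complex ^ 'd) list"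
    by (intro ext) (rule ents_add[OF \<alpha>])
  have l: "wedge r sc sb (form0 P) (\<lambda>ws i k. X ws i k + Y ws i k)
      = (\<lambda>ws i k. wedge r sc sb (form0 P) X ws i k + wedge r sc sb (form0 P) Y ws i k)" for r sc sb P and X Y :: "(complex ^ 'd) list \<Rightarrow> _"
    by (intro ext) (rule wedge_add_right)
  show ?thesis
    unfolding lf_eq_prod[OF ab t p \<alpha>(1)] lf_eq_prod[OF ab t p \<alpha>(2)] lf_eq_prod[OF ab t p c] e l
    by (rule wedge_add_left)
qed

lemma lf_scale:
  assumes ab: "obj a" "obj b" and t: "ta \<in> bundle_trivs (fact_bundle a)" "tb \<in> bundle_trivs (fact_bundle b)"
    and p: "chart_inv c z \<in> fst ta" "chart_inv c z \<in> fst tb"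
    and \<alpha>: "\<And>p vs. \<alpha> p vs \<in> carrier_mat (fact_rank b) (fact_rank a)"
  shows "lf a b c ta tb (form_scale f \<alpha>) z vs i j = f (chart_inv c z) * lf a b c ta tb \<alpha> z vs i j"
proof -
  have c: "form_scale f \<alpha> p vs \<in> carrier_mat (fact_rank b) (fact_rank a)" for p vs
    unfolding form_scale_def by (intro smult_carrier_mat \<alpha>)
  have e: "(\<lambda>vs. ents a b (form_scale f \<alpha>) p (g vs)) = (\<lambda>vs i j. f p * ents a b \<alpha> p (g vs) i j)" for p and g :: "_ \<Rightarrow> (complex ^ 'd) list"
    by (intro ext) (rule ents_scale[OF \<alpha>])
  have l: "wedge r sc sb (form0 P) (\<lambda>ws i k. x * X ws i k) = (\<lambda>ws i k. x * wedge r sc sb (form0 P) X ws i k)"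
    for r sc sb P x and X :: "(complex ^ 'd) list \<Rightarrow> _"
    by (intro ext) (rule wedge_mult_right)
  show ?thesis
    unfolding lf_eq_prod[OF ab t p \<alpha>] lf_eq_prod[OF ab t p c] e l by (rule wedge_mult_left)
qed

lemma triv_overlap_open:
  assumes "obj a" "obj b" "ta \<in> bundle_trivs (fact_bundle a)" "tb \<in> bundle_trivs (fact_bundle b)" "c \<in> A"
  shows "open (chart_image c (fst ta \<inter> fst tb))"
  by (intro chart_image_open[OF assms(5)] open_Int triv_open[OF obj_bundle(1)[OF assms(1)] assms(3)]
      triv_open[OF obj_bundle(1)[OF assms(2)] assms(4)])

lemma Hom_add:
  assumes ab: "obj a" "obj b" and \<alpha>: "\<alpha> \<in> Hom a b" "\<beta> \<in> Hom a b"
  shows "form_add \<alpha> \<beta> \<in> Hom a b"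
proof (rule hom_formsI)
  note car = Hom_carrier[OF \<alpha>(1)] Hom_carrier[OF \<alpha>(2)]
  show "form_add \<alpha> \<beta> p vs \<in> carrier_mat (fact_rank b) (fact_rank a)" for p vs
    unfolding form_add_def by (intro add_carrier_mat car)
  show "antialt (\<lambda>vs. ent (fact_rank b) (fact_rank a) (form_add \<alpha> \<beta> p vs) i j)" for p i j
    unfolding form_add_def ent_add[OF car] by (intro antialt_add hom_formsD(2)[OF \<alpha>(1)] hom_formsD(2)[OF \<alpha>(2)])
  fix c t t' vs i j
  assume c: "c \<in> A" and t: "t \<in> bundle_trivs (fact_bundle a)" "t' \<in> bundle_trivs (fact_bundle b)"
  note S = triv_overlap_open[OF ab t c]
  show "smooth_on (\<lambda>z. lf a b c t t' (form_add \<alpha> \<beta>) z vs i j) (chart_image c (fst t \<inter> fst t'))"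
  proof (rule smooth_on_transform[OF S])
    show "smooth_on (\<lambda>z. lf a b c t t' \<alpha> z vs i j + lf a b c t t' \<beta> z vs i j) (chart_image c (fst t \<inter> fst t'))"
      by (intro smooth_on_add S hom_formsD(3)[OF \<alpha>(1) c t] hom_formsD(3)[OF \<alpha>(2) c t])
    fix z assume "z \<in> chart_image c (fst t \<inter> fst t')"
    from chart_imageE(2)[OF c this] show "lf a b c t t' (form_add \<alpha> \<beta>) z vs i j = lf a b c t t' \<alpha> z vs i j + lf a b c t t' \<beta> z vs i j"
      by (intro lf_add[OF ab t _ _ car]) auto
  qed
qed

lemma Hom_scale:
  assumes ab: "obj a" "obj b" and \<alpha>: "\<alpha> \<in> Hom a b" and f: "smooth_fun A UNIV f"
  shows "form_scale f \<alpha> \<in> Hom a b"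
proof (rule hom_formsI)
  note car = Hom_carrier[OF \<alpha>]
  show "form_scale f \<alpha> p vs \<in> carrier_mat (fact_rank b) (fact_rank a)" for p vs
    unfolding form_scale_def by (intro smult_carrier_mat car)
  show "antialt (\<lambda>vs. ent (fact_rank b) (fact_rank a) (form_scale f \<alpha> p vs) i j)" for p i j
    unfolding form_scale_def ent_smult[OF car] by (intro antialt_mult hom_formsD(2)[OF \<alpha>])
  fix c t t' vs i j
  assume c: "c \<in> A" and t: "t \<in> bundle_trivs (fact_bundle a)" "t' \<in> bundle_trivs (fact_bundle b)"
  note S = triv_overlap_open[OF ab t c]
  have sf: "smooth_on (\<lambda>z. f (chart_inv c z)) (chart_image c (fst t \<inter> fst t'))"
    using f c chart_image_mono[of "fst t \<inter> fst t'" UNIV c] smooth_on_subset unfolding smooth_fun_def by blast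
  show "smooth_on (\<lambda>z. lf a b c t t' (form_scale f \<alpha>) z vs i j) (chart_image c (fst t \<inter> fst t'))"
  proof (rule smooth_on_transform[OF S])
    show "smooth_on (\<lambda>z. f (chart_inv c z) * lf a b c t t' \<alpha> z vs i j) (chart_image c (fst t \<inter> fst t'))"
      by (intro smooth_on_mult S sf hom_formsD(3)[OF \<alpha> c t])
    fix z assume "z \<in> chart_image c (fst t \<inter> fst t')"
    from chart_imageE(2)[OF c this] show "lf a b c t t' (form_scale f \<alpha>) z vs i j = f (chart_inv c z) * lf a b c t t' \<alpha> z vs i j"
      by (intro lf_scale[OF ab t _ _ car]) auto
  qed
qed

lemma Hom_uminus: "obj a \<Longrightarrow> obj b \<Longrightarrow> \<alpha> \<in> Hom a b \<Longrightarrow> form_uminus \<alpha> \<in> Hom a b"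
  by (rule Hom_scale) (simp_all add: smooth_fun_const)

lemma Hom_invol:
  assumes ab: "obj a" "obj b" and \<alpha>: "\<alpha> \<in> Hom a b"
  shows "form_invol a b \<alpha> \<in> Hom a b"
proof (rule hom_formsI)
  note car = Hom_carrier[OF \<alpha>]
  show "form_invol a b \<alpha> p vs \<in> carrier_mat (fact_rank b) (fact_rank a)" for p vs
    by (rule form_invol_carrier)
  show "antialt (\<lambda>vs. ent (fact_rank b) (fact_rank a) (form_invol a b \<alpha> p vs) i j)" for p i j
  proof -
    have "(\<lambda>vs. ent (fact_rank b) (fact_rank a) (form_invol a b \<alpha> p vs) i j)
        = (\<lambda>vs. (-1) ^ length vs * (parity_sign b i * parity_sign a j) * ent (fact_rank b) (fact_rank a) (\<alpha> p vs) i j)"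
      using ents_invol[of a b \<alpha> p] by (simp add: ents_def invol_def fun_eq_iff)
    then show ?thesis using antialt_length_sign[OF hom_formsD(2)[OF \<alpha>]] by (simp only:)
  qed
  fix c t t' vs i j
  assume c: "c \<in> A" and t: "t \<in> bundle_trivs (fact_bundle a)" "t' \<in> bundle_trivs (fact_bundle b)"
  note S = triv_overlap_open[OF ab t c]
  show "smooth_on (\<lambda>z. lf a b c t t' (form_invol a b \<alpha>) z vs i j) (chart_image c (fst t \<inter> fst t'))"
  proof (rule smooth_on_transform[OF S])
    show "smooth_on (\<lambda>z. finv b a (lf a b c t t' \<alpha> z) vs i j) (chart_image c (fst t \<inter> fst t'))"
      by (intro smooth_on_invol S hom_formsD(3)[OF \<alpha> c t])
    fix z assume "z \<in> chart_image c (fst t \<inter> fst t')"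
    from chart_imageE(2)[OF c this] lf_invol[OF ab t _ _ car, of c z]
    show "lf a b c t t' (form_invol a b \<alpha>) z vs i j = finv b a (lf a b c t t' \<alpha> z) vs i j" by simp
  qed
qed

lemma Hom_section:
  assumes ab: "obj a" "obj b" and s: "\<And>p. s p \<in> carrier_mat (fact_rank b) (fact_rank a)"
    and sm: "\<And>c t t' i j. \<lbrakk>c \<in> A; t \<in> bundle_trivs (fact_bundle a); t' \<in> bundle_trivs (fact_bundle b)\<rbrakk> \<Longrightarrow>
      smooth_on (\<lambda>z. ent (fact_rank b) (fact_rank a) (snd t' (chart_inv c z) * s (chart_inv c z) * mat_inv (snd t (chart_inv c z))) i j)
        (chart_image c (fst t \<inter> fst t'))"
  shows "section_form (fact_rank b) (fact_rank a) s \<in> Hom a b"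
proof (rule hom_formsI)
  show "section_form (fact_rank b) (fact_rank a) s p vs \<in> carrier_mat (fact_rank b) (fact_rank a)" for p vs
    using s by (simp add: section_form_def)
  show "antialt (\<lambda>vs :: (complex ^ 'd) list. ent (fact_rank b) (fact_rank a) (section_form (fact_rank b) (fact_rank a) s p vs) i j)" for p i j
  proof -
    have "(\<lambda>vs :: (complex ^ 'd) list. ent (fact_rank b) (fact_rank a) (section_form (fact_rank b) (fact_rank a) s p vs) i j)
        = (\<lambda>vs. form0 (ent (fact_rank b) (fact_rank a) (s p)) vs i j)"
      by (simp add: section_form_def form0_def ent_zero fun_eq_iff)
    then show ?thesis by (simp only: antialt_form0)
  qed
  fix c t t' vs i j
  assume c: "c \<in> A" and t: "t \<in> bundle_trivs (fact_bundle a)" "t' \<in> bundle_trivs (fact_bundle b)"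
  note S = triv_overlap_open[OF ab t c]
  show "smooth_on (\<lambda>z. lf a b c t t' (section_form (fact_rank b) (fact_rank a) s) z vs i j) (chart_image c (fst t \<inter> fst t'))"
  proof (rule smooth_on_transform[OF S])
    show "smooth_on (\<lambda>z. form0 (ent (fact_rank b) (fact_rank a)
        (snd t' (chart_inv c z) * s (chart_inv c z) * mat_inv (snd t (chart_inv c z)))) vs i j) (chart_image c (fst t \<inter> fst t'))"
      unfolding form0_def using sm[OF c t] by (cases "vs = []") (simp_all add: smooth_on_const)
    fix z assume "z \<in> chart_image c (fst t \<inter> fst t')"
    from chart_imageE(2)[OF c this] lf_section[OF ab t _ _ s, of c z]
    show "lf a b c t t' (section_form (fact_rank b) (fact_rank a) s) z vs i j
      = form0 (ent (fact_rank b) (fact_rank a) (snd t' (chart_inv c z) * s (chart_inv c z) * mat_inv (snd t (chart_inv c z)))) vs i j"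
      by simp
  qed
qed

lemma Hom_comp:
  assumes abc: "obj a" "obj b" "obj c" and \<alpha>: "\<alpha> \<in> Hom a b" and \<beta>: "\<beta> \<in> Hom b c"
  shows "DF_comp a b c \<beta> \<alpha> \<in> Hom a c"
proof (rule hom_formsI)
  note car = Hom_carrier[OF \<alpha>] Hom_carrier[OF \<beta>]
  show "DF_comp a b c \<beta> \<alpha> p vs \<in> carrier_mat (fact_rank c) (fact_rank a)" for p vs
    by (rule DF_comp_carrier)
  show "antialt (\<lambda>vs. ent (fact_rank c) (fact_rank a) (DF_comp a b c \<beta> \<alpha> p vs) i j)" for p i j
  proof -
    have "(\<lambda>vs. ent (fact_rank c) (fact_rank a) (DF_comp a b c \<beta> \<alpha> p vs) i j)
        = (\<lambda>vs. fprod c b (ents b c \<beta> p) (ents a b \<alpha> p) vs i j)"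
      using ents_DF_comp[of \<alpha> p b a \<beta> c, OF car] by (simp add: ents_def fun_eq_iff)
    moreover have "antialt (\<lambda>vs. fprod c b (ents b c \<beta> p) (ents a b \<alpha> p) vs i j)"
      by (rule antialt_wedge) (simp_all add: ents_def hom_formsD(2)[OF \<alpha>] hom_formsD(2)[OF \<beta>])
    ultimately show ?thesis by (simp only:)
  qed
  fix ch t t' vs i j
  assume c: "ch \<in> A" and t: "t \<in> bundle_trivs (fact_bundle a)" "t' \<in> bundle_trivs (fact_bundle c)"
  show "smooth_on (\<lambda>z. lf a c ch t t' (DF_comp a b c \<beta> \<alpha>) z vs i j) (chart_image ch (fst t \<inter> fst t'))"
  proof (rule smooth_on_local)
    fix z assume z: "z \<in> chart_image ch (fst t \<inter> fst t')"
    \<comment> \<open>A trivialisation of the middle bundle is available only near the point, so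
      smoothness is checked locally.\<close>
    let ?tb = "triv_at (fact_bundle b) (chart_inv ch z)"
    note tb = triv_at[OF obj_bundle(1)[OF abc(2)], of "chart_inv ch z"]
    let ?S = "chart_image ch (fst t \<inter> fst ?tb \<inter> fst t')"
    have S: "open ?S"
      by (intro chart_image_open[OF c] open_Int triv_open[OF obj_bundle(1)[OF abc(1)] t(1)]
          triv_open[OF obj_bundle(1)[OF abc(2)] tb(1)] triv_open[OF obj_bundle(1)[OF abc(3)] t(2)])
    have zS: "z \<in> ?S"
      using chart_image_iff[OF c, of z "fst t \<inter> fst t'"] chart_image_iff[OF c, of z "fst t \<inter> fst ?tb \<inter> fst t'"] z tb(2) by simp
    have "smooth_on (\<lambda>z. lf a c ch t t' (DF_comp a b c \<beta> \<alpha>) z vs i j) ?S"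
    proof (rule smooth_on_transform[OF S])
      show "smooth_on (\<lambda>z. fprod c b (lf b c ch ?tb t' \<beta> z) (lf a b ch t ?tb \<alpha> z) vs i j) ?S"
        by (intro smooth_on_wedge S smooth_on_subset[OF hom_formsD(3)[OF \<beta> c tb(1) t(2)]]
            smooth_on_subset[OF hom_formsD(3)[OF \<alpha> c t(1) tb(1)]] chart_image_mono) auto
      fix x assume "x \<in> ?S"
      from chart_imageE(2)[OF c this] lf_DF_comp[OF abc t(1) tb(1) t(2) _ _ _ car, of ch x]
      show "lf a c ch t t' (DF_comp a b c \<beta> \<alpha>) x vs i j = fprod c b (lf b c ch ?tb t' \<beta> x) (lf a b ch t ?tb \<alpha> x) vs i j"
        by simp
    qed
    then show "\<exists>T. open T \<and> z \<in> T \<and> smooth_on (\<lambda>z. lf a c ch t t' (DF_comp a b c \<beta> \<alpha>) z vs i j) T"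
      using S zS by blast
  qed
qed

lemma Hom_dolb: "obj a \<Longrightarrow> obj b \<Longrightarrow> \<alpha> \<in> Hom a b \<Longrightarrow> dolb a b \<alpha> \<in> Hom a b"
  by (rule dolbeault_hom_forms[OF obj_bundle(1) obj_bundle(1)])

lemma section_triv_holomorphic:
  assumes a: "obj a" and c: "c \<in> A" and t: "t \<in> bundle_trivs (fact_bundle a)" "t' \<in> bundle_trivs (fact_bundle a)"
  shows "cholomorphic_on (\<lambda>z. ent (fact_rank a) (fact_rank a)
      (snd t' (chart_inv c z) * fact_map a (chart_inv c z) * mat_inv (snd t (chart_inv c z))) i j) (chart_image c (fst t \<inter> fst t'))"
proof (cases "i < fact_rank a \<and> j < fact_rank a")
  case True
  then have "holomorphic_fun A (fst t \<inter> fst t') (\<lambda>p. (snd t' p * fact_map a p * mat_inv (snd t p)) $$ (i, j))"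
    using obj_map(4)[OF a] t unfolding holomorphic_homs_def by blast
  then show ?thesis using True c by (simp add: holomorphic_fun_def ent_def)
next
  case False
  show ?thesis unfolding ent_def if_not_P[OF False] by (rule cholomorphic_on_const)
qed

lemma Hom_mapf:
  assumes "obj a" shows "mapf a \<in> Hom a a"
  by (rule Hom_section[OF assms assms obj_map(1)[OF assms]])
    (rule cholomorphic_on_smooth[OF section_triv_holomorphic[OF assms] triv_overlap_open[OF assms assms]], assumption+)

lemma DF_diff_eq:
  assumes ab: "obj a" "obj b" and \<alpha>: "\<alpha> \<in> Hom a b"
  shows "DF_diff A a b \<alpha> = form_add (dolb a b \<alpha>) (form_add (DF_comp a b b (mapf b) \<alpha>) (form_uminus (DF_comp a a b (form_invol a b \<alpha>) (mapf a))))"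
proof -
  have "defect_diff a b \<alpha> = form_add (DF_comp a b b (mapf b) \<alpha>) (form_uminus (DF_comp a a b (form_invol a b \<alpha>) (mapf a)))"
    by (rule defect_diff_eq[OF Hom_carrier[OF \<alpha>] obj_map(1,2)[OF ab(1)] obj_map(1,2)[OF ab(2)]])
  then show ?thesis by (intro ext) (simp add: DF_diff_def form_add_def)
qed

lemma Hom_DF_diff:
  assumes ab: "obj a" "obj b" and \<alpha>: "\<alpha> \<in> Hom a b"
  shows "DF_diff A a b \<alpha> \<in> Hom a b"
  unfolding DF_diff_eq[OF assms]
  by (intro Hom_add Hom_uminus Hom_dolb Hom_comp Hom_invol Hom_mapf assms)

end

section \<open>The dg-category of holomorphic factorizations\<close>

lemma cholomorphic_on_add:
  assumes "cholomorphic_on f S" "cholomorphic_on g S" shows "cholomorphic_on (\<lambda>z. f z + g z) S"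
  unfolding cholomorphic_on_def
proof
  fix z assume z: "z \<in> S"
  show "\<exists>f'. ((\<lambda>z. f z + g z) has_derivative f') (at z) \<and> (\<forall>c v. f' (c *s v) = c * f' v)"
    using has_derivative_add[OF cholomorphic_onD(1)[OF assms(1) z] cholomorphic_onD(1)[OF assms(2) z]]
      cholomorphic_onD(2)[OF assms(1) z] cholomorphic_onD(2)[OF assms(2) z]
    by (intro exI conjI) (assumption, simp add: distrib_left)
qed

lemma cholomorphic_on_mult:
  assumes "cholomorphic_on f S" "cholomorphic_on g S" shows "cholomorphic_on (\<lambda>z. f z * g z) S"
  unfolding cholomorphic_on_def
proof
  fix z assume z: "z \<in> S"
  show "\<exists>f'. ((\<lambda>z. f z * g z) has_derivative f') (at z) \<and> (\<forall>c v. f' (c *s v) = c * f' v)"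
    using has_derivative_mult[OF cholomorphic_onD(1)[OF assms(1) z] cholomorphic_onD(1)[OF assms(2) z]]
      cholomorphic_onD(2)[OF assms(1) z] cholomorphic_onD(2)[OF assms(2) z]
    by (intro exI conjI) (assumption, simp add: algebra_simps)
qed

lemma holomorphic_fun_const: "holomorphic_fun A S (\<lambda>p. k)"
  by (simp add: holomorphic_fun_def cholomorphic_on_const)

lemma holomorphic_fun_add: "holomorphic_fun A S f \<Longrightarrow> holomorphic_fun A S g \<Longrightarrow> holomorphic_fun A S (\<lambda>p. f p + g p)"
  by (simp add: holomorphic_fun_def cholomorphic_on_add)

lemma holomorphic_fun_mult: "holomorphic_fun A S f \<Longrightarrow> holomorphic_fun A S g \<Longrightarrow> holomorphic_fun A S (\<lambda>p. f p * g p)"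
  by (simp add: holomorphic_fun_def cholomorphic_on_mult)

lemma cring_holomorphic_ring: "cring (holomorphic_ring A)"
proof (rule cringI)
  show "abelian_group (holomorphic_ring A)"
  proof (rule abelian_groupI)
    fix f assume "f \<in> carrier (holomorphic_ring A)"
    then have "(\<lambda>p. -1 * f p) \<in> carrier (holomorphic_ring A)"
      unfolding holomorphic_ring_def by (simp only: partial_object.simps mem_Collect_eq holomorphic_fun_mult holomorphic_fun_const)
    then show "\<exists>g\<in>carrier (holomorphic_ring A). g \<oplus>\<^bsub>holomorphic_ring A\<^esub> f = \<zero>\<^bsub>holomorphic_ring A\<^esub>"
      by (rule bexI[rotated]) (simp add: holomorphic_ring_def)
  qed (simp_all add: holomorphic_ring_def holomorphic_fun_add holomorphic_fun_const algebra_simps)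
  show "comm_monoid (holomorphic_ring A)"
    by (rule comm_monoidI) (simp_all add: holomorphic_ring_def holomorphic_fun_mult holomorphic_fun_const algebra_simps)
qed (simp add: holomorphic_ring_def algebra_simps)

lemma form_module_simps:
  "carrier (form_module a b S) = S" "\<zero>\<^bsub>form_module a b S\<^esub> = (\<lambda>p vs. 0\<^sub>m (fact_rank b) (fact_rank a))"
  "\<alpha> \<oplus>\<^bsub>form_module a b S\<^esub> \<beta> = form_add \<alpha> \<beta>" "f \<odot>\<^bsub>form_module a b S\<^esub> \<alpha> = form_scale f \<alpha>"
  by (simp_all add: form_module_def form_add_def form_scale_def fun_eq_iff)

section \<open>The Dolbeault operator on morphism spaces\<close>

context landau_ginzburg
begin

text \<open>Here and below, forms are compared through their components, where
  \<open>lform_dolbeault\<close> turns \<open>dolb\<close> into \<open>dbar\<close>.\<close>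

lemma dolb_add:
  assumes ab: "obj a" "obj b" and \<alpha>: "\<alpha> \<in> Hom a b" "\<beta> \<in> Hom a b"
  shows "dolb a b (form_add \<alpha> \<beta>) = form_add (dolb a b \<alpha>) (dolb a b \<beta>)"
proof (rule hom_form_eqI[OF obj_bundle(1)[OF ab(1)] obj_bundle(1)[OF ab(2)]])
  note E = obj_bundle(1)[OF ab(1)] obj_bundle(1)[OF ab(2)]
  note d = Hom_dolb[OF ab \<alpha>(1)] Hom_dolb[OF ab \<alpha>(2)]
  show "dolb a b (form_add \<alpha> \<beta>) p vs \<in> carrier_mat (fact_rank b) (fact_rank a)" for p vs
    by (rule Hom_carrier[OF Hom_dolb[OF ab Hom_add[OF ab \<alpha>]]])
  show "form_add (dolb a b \<alpha>) (dolb a b \<beta>) p vs \<in> carrier_mat (fact_rank b) (fact_rank a)" for p vs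
    by (rule Hom_carrier[OF Hom_add[OF ab d]])
  fix c t t' z vs i j
  assume c: "c \<in> A" and t: "t \<in> bundle_trivs (fact_bundle a)" "t' \<in> bundle_trivs (fact_bundle b)"
    and z: "z \<in> chart_image c (fst t \<inter> fst t')"
  note S = triv_overlap_open[OF ab t c]
  have p: "chart_inv c x \<in> fst t" "chart_inv c x \<in> fst t'" if "x \<in> chart_image c (fst t \<inter> fst t')" for x
    using chart_imageE(2)[OF c that] by auto
  have "lf a b c t t' (dolb a b (form_add \<alpha> \<beta>)) z vs i j = dbar (\<lambda>z vs. lf a b c t t' \<alpha> z vs i j + lf a b c t t' \<beta> z vs i j) z vs"
    unfolding lform_dolbeault[OF E t c z Hom_add[OF ab \<alpha>]] dbar_mat_def
    by (rule dbar_cong[OF S z], rule lf_add[OF ab t p Hom_carrier[OF \<alpha>(1)] Hom_carrier[OF \<alpha>(2)]])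
  also have "\<dots> = dbar_mat (lf a b c t t' \<alpha>) z vs i j + dbar_mat (lf a b c t t' \<beta>) z vs i j"
    unfolding dbar_mat_def
    by (intro dbar_add smooth_on_differentiable[OF hom_formsD(3)[OF \<alpha>(1) c t] z] smooth_on_differentiable[OF hom_formsD(3)[OF \<alpha>(2) c t] z])
  finally show "lf a b c t t' (dolb a b (form_add \<alpha> \<beta>)) z vs i j = lf a b c t t' (form_add (dolb a b \<alpha>) (dolb a b \<beta>)) z vs i j"
    by (simp add: lf_add[OF ab t p[OF z] Hom_carrier[OF d(1)] Hom_carrier[OF d(2)]]
        lform_dolbeault[OF E t c z \<alpha>(1)] lform_dolbeault[OF E t c z \<alpha>(2)])
qed

lemma dolb_scale:
  assumes ab: "obj a" "obj b" and \<alpha>: "\<alpha> \<in> Hom a b" and f: "holomorphic_fun A UNIV f"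
  shows "dolb a b (form_scale f \<alpha>) = form_scale f (dolb a b \<alpha>)"
proof (rule hom_form_eqI[OF obj_bundle(1)[OF ab(1)] obj_bundle(1)[OF ab(2)]])
  note E = obj_bundle(1)[OF ab(1)] obj_bundle(1)[OF ab(2)]
  note d = Hom_dolb[OF ab \<alpha>]
  have sf: "smooth_fun A UNIV f" by (rule holomorphic_fun_smooth[OF open_UNIV f])
  show "dolb a b (form_scale f \<alpha>) p vs \<in> carrier_mat (fact_rank b) (fact_rank a)" for p vs
    by (rule Hom_carrier[OF Hom_dolb[OF ab Hom_scale[OF ab \<alpha> sf]]])
  show "form_scale f (dolb a b \<alpha>) p vs \<in> carrier_mat (fact_rank b) (fact_rank a)" for p vs
    by (rule Hom_carrier[OF Hom_scale[OF ab d sf]])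
  fix c t t' z vs i j
  assume c: "c \<in> A" and t: "t \<in> bundle_trivs (fact_bundle a)" "t' \<in> bundle_trivs (fact_bundle b)"
    and z: "z \<in> chart_image c (fst t \<inter> fst t')"
  note S = triv_overlap_open[OF ab t c]
  have p: "chart_inv c x \<in> fst t" "chart_inv c x \<in> fst t'" if "x \<in> chart_image c (fst t \<inter> fst t')" for x
    using chart_imageE(2)[OF c that] by auto
  have fh: "cholomorphic_on (\<lambda>z. f (chart_inv c z)) (chart_image c UNIV)"
    using f c unfolding holomorphic_fun_def by simp
  have "lf a b c t t' (dolb a b (form_scale f \<alpha>)) z vs i j = dbar (\<lambda>z vs. f (chart_inv c z) * lf a b c t t' \<alpha> z vs i j) z vs"
    unfolding lform_dolbeault[OF E t c z Hom_scale[OF ab \<alpha> sf]] dbar_mat_def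
    by (rule dbar_cong[OF S z], rule lf_scale[OF ab t p Hom_carrier[OF \<alpha>]])
  also have "\<dots> = f (chart_inv c z) * dbar_mat (lf a b c t t' \<alpha>) z vs i j"
    unfolding dbar_mat_def
    by (rule dbar_holomorphic_mult[OF cholomorphic_on_subset[OF fh chart_image_mono[OF subset_UNIV]] z
          smooth_on_differentiable[OF hom_formsD(3)[OF \<alpha> c t] z]])
  finally show "lf a b c t t' (dolb a b (form_scale f \<alpha>)) z vs i j = lf a b c t t' (form_scale f (dolb a b \<alpha>)) z vs i j"
    by (simp add: lf_scale[OF ab t p[OF z] Hom_carrier[OF d]] lform_dolbeault[OF E t c z \<alpha>])
qed

lemma dolb_invol:
  assumes ab: "obj a" "obj b" and \<alpha>: "\<alpha> \<in> Hom a b"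
  shows "dolb a b (form_invol a b \<alpha>) = form_uminus (form_invol a b (dolb a b \<alpha>))"
proof (rule hom_form_eqI[OF obj_bundle(1)[OF ab(1)] obj_bundle(1)[OF ab(2)]])
  note E = obj_bundle(1)[OF ab(1)] obj_bundle(1)[OF ab(2)]
  note d = Hom_dolb[OF ab \<alpha>]
  show "dolb a b (form_invol a b \<alpha>) p vs \<in> carrier_mat (fact_rank b) (fact_rank a)" for p vs
    by (rule Hom_carrier[OF Hom_dolb[OF ab Hom_invol[OF ab \<alpha>]]])
  show "form_uminus (form_invol a b (dolb a b \<alpha>)) p vs \<in> carrier_mat (fact_rank b) (fact_rank a)" for p vs
    by (rule Hom_carrier[OF Hom_uminus[OF ab Hom_invol[OF ab d]]])
  fix c t t' z vs i j
  assume c: "c \<in> A" and t: "t \<in> bundle_trivs (fact_bundle a)" "t' \<in> bundle_trivs (fact_bundle b)"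
    and z: "z \<in> chart_image c (fst t \<inter> fst t')"
  note S = triv_overlap_open[OF ab t c]
  have p: "chart_inv c x \<in> fst t" "chart_inv c x \<in> fst t'" if "x \<in> chart_image c (fst t \<inter> fst t')" for x
    using chart_imageE(2)[OF c that] by auto
  have "lf a b c t t' (dolb a b (form_invol a b \<alpha>)) z vs i j = dbar_mat (\<lambda>z. finv b a (lf a b c t t' \<alpha> z)) z vs i j"
    unfolding lform_dolbeault[OF E t c z Hom_invol[OF ab \<alpha>]] dbar_mat_def
    by (rule dbar_cong[OF S z]) (simp add: lf_invol[OF ab t p Hom_carrier[OF \<alpha>]])
  also have "\<dots> = - finv b a (dbar_mat (lf a b c t t' \<alpha>) z) vs i j"
    by (subst dbar_mat_invol[OF smooth_on_differentiable[OF hom_formsD(3)[OF \<alpha> c t] z]]) (rule refl)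
  also have "dbar_mat (lf a b c t t' \<alpha>) z = lf a b c t t' (dolb a b \<alpha>) z"
    by (intro ext) (rule lform_dolbeault[OF E t c z \<alpha>, symmetric])
  finally show "lf a b c t t' (dolb a b (form_invol a b \<alpha>)) z vs i j = lf a b c t t' (form_uminus (form_invol a b (dolb a b \<alpha>))) z vs i j"
    by (simp add: lf_scale[OF ab t p[OF z] form_invol_carrier] lf_invol[OF ab t p[OF z] Hom_carrier[OF d]])
qed

lemma dolb_dolb:
  assumes ab: "obj a" "obj b" and \<alpha>: "\<alpha> \<in> Hom a b"
  shows "ents a b (dolb a b (dolb a b \<alpha>)) p vs i j = 0"
proof -
  note E = obj_bundle(1)[OF ab(1)] obj_bundle(1)[OF ab(2)]
  note d = Hom_dolb[OF ab \<alpha>]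
  \<comment> \<open>Zero is written as a multiple of a form, so that \<open>lf_scale\<close>
    computes its components.\<close>
  have "dolb a b (dolb a b \<alpha>) = form_scale (\<lambda>p. 0) (dolb a b \<alpha>)"
  proof (rule hom_form_eqI[OF E])
    show "dolb a b (dolb a b \<alpha>) p vs \<in> carrier_mat (fact_rank b) (fact_rank a)" for p vs
      by (rule Hom_carrier[OF Hom_dolb[OF ab d]])
    show "form_scale (\<lambda>p. 0) (dolb a b \<alpha>) p vs \<in> carrier_mat (fact_rank b) (fact_rank a)" for p vs
      by (rule Hom_carrier[OF Hom_scale[OF ab d smooth_fun_const]])
    fix c t t' z vs i j
    assume c: "c \<in> A" and t: "t \<in> bundle_trivs (fact_bundle a)" "t' \<in> bundle_trivs (fact_bundle b)"
      and z: "z \<in> chart_image c (fst t \<inter> fst t')"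
    note S = triv_overlap_open[OF ab t c]
    have p: "chart_inv c z \<in> fst t" "chart_inv c z \<in> fst t'" using chart_imageE(2)[OF c z] by auto
    have "lf a b c t t' (dolb a b (dolb a b \<alpha>)) z vs i j = dbar (dbar (\<lambda>z vs. lf a b c t t' \<alpha> z vs i j)) z vs"
      unfolding lform_dolbeault[OF E t c z d] dbar_mat_def
      by (rule dbar_cong[OF S z]) (simp add: lform_dolbeault[OF E t c _ \<alpha>] dbar_mat_def)
    also have "\<dots> = 0" by (rule dbar_dbar[OF S z hom_formsD(3)[OF \<alpha> c t]])
    finally show "lf a b c t t' (dolb a b (dolb a b \<alpha>)) z vs i j = lf a b c t t' (form_scale (\<lambda>p. 0) (dolb a b \<alpha>)) z vs i j"
      by (simp add: lf_scale[OF ab t p Hom_carrier[OF d]])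
  qed
  then show ?thesis by (simp add: ents_scale[OF Hom_carrier[OF d]])
qed

lemma dolb_mapf:
  assumes a: "obj a"
  shows "ents a a (dolb a a (mapf a)) p vs i j = 0"
proof -
  note E = obj_bundle(1)[OF a]
  note m = Hom_mapf[OF a]
  have "dolb a a (mapf a) = form_scale (\<lambda>p. 0) (mapf a)"
  proof (rule hom_form_eqI[OF E E])
    show "dolb a a (mapf a) p vs \<in> carrier_mat (fact_rank a) (fact_rank a)" for p vs
      by (rule Hom_carrier[OF Hom_dolb[OF a a m]])
    show "form_scale (\<lambda>p. 0) (mapf a) p vs \<in> carrier_mat (fact_rank a) (fact_rank a)" for p vs
      by (rule Hom_carrier[OF Hom_scale[OF a a m smooth_fun_const]])
    fix c t t' z vs i j
    assume c: "c \<in> A" and t: "t \<in> bundle_trivs (fact_bundle a)" "t' \<in> bundle_trivs (fact_bundle a)"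
      and z: "z \<in> chart_image c (fst t \<inter> fst t')"
    note S = triv_overlap_open[OF a a t c]
    have p: "chart_inv c x \<in> fst t" "chart_inv c x \<in> fst t'" if "x \<in> chart_image c (fst t \<inter> fst t')" for x
      using chart_imageE(2)[OF c that] by auto
    let ?f = "\<lambda>z. ent (fact_rank a) (fact_rank a) (snd t' (chart_inv c z) * fact_map a (chart_inv c z) * mat_inv (snd t (chart_inv c z))) i j"
    have "lf a a c t t' (dolb a a (mapf a)) z vs i j = dbar (\<lambda>z vs. if vs = [] then ?f z else 0) z vs"
      unfolding lform_dolbeault[OF E E t c z m] dbar_mat_def
      by (rule dbar_cong[OF S z]) (simp add: lf_section[OF a a t p obj_map(1)[OF a]] form0_def)
    also have "\<dots> = 0"
      unfolding dbar_def
    proof (rule altsum_zero)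
      show "delbar_at (\<lambda>z. if ws = [] then ?f z else 0) z w = 0" for w ws
        using delbar_at_holomorphic[OF section_triv_holomorphic[OF a c t] z] by (cases "ws = []") (simp_all add: delbar_at_const)
    qed
    finally show "lf a a c t t' (dolb a a (mapf a)) z vs i j = lf a a c t t' (form_scale (\<lambda>p. 0) (mapf a)) z vs i j"
      by (simp add: lf_scale[OF a a t p[OF z] Hom_carrier[OF m]])
  qed
  then show ?thesis by (simp add: ents_scale[OF Hom_carrier[OF m]])
qed

text \<open>Near a given point a frame of the middle bundle exists, and the product rule
  \<open>dbar_mat_wedge\<close> applies to the components.\<close>

lemma dolb_comp:
  assumes abc: "obj a" "obj b" "obj c" and \<alpha>: "\<alpha> \<in> Hom a b" and \<beta>: "\<beta> \<in> Hom b c"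
  shows "dolb a c (DF_comp a b c \<beta> \<alpha>)
    = form_add (DF_comp a b c (dolb b c \<beta>) \<alpha>) (DF_comp a b c (form_invol b c \<beta>) (dolb a b \<alpha>))"
proof (rule hom_form_eqI[OF obj_bundle(1)[OF abc(1)] obj_bundle(1)[OF abc(3)]])
  note E = obj_bundle(1)[OF abc(1)] obj_bundle(1)[OF abc(2)] obj_bundle(1)[OF abc(3)]
  note d = Hom_dolb[OF abc(1,2) \<alpha>] Hom_dolb[OF abc(2,3) \<beta>]
  note car = Hom_carrier[OF \<alpha>] Hom_carrier[OF \<beta>]
  show "dolb a c (DF_comp a b c \<beta> \<alpha>) p vs \<in> carrier_mat (fact_rank c) (fact_rank a)" for p vs
    by (rule Hom_carrier[OF Hom_dolb[OF abc(1,3) Hom_comp[OF abc \<alpha> \<beta>]]])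
  show "form_add (DF_comp a b c (dolb b c \<beta>) \<alpha>) (DF_comp a b c (form_invol b c \<beta>) (dolb a b \<alpha>)) p vs \<in> carrier_mat (fact_rank c) (fact_rank a)" for p vs
    unfolding form_add_def by (intro add_carrier_mat DF_comp_carrier)
  fix ch ta tc z vs i j
  assume c: "ch \<in> A" and t: "ta \<in> bundle_trivs (fact_bundle a)" "tc \<in> bundle_trivs (fact_bundle c)"
    and z: "z \<in> chart_image ch (fst ta \<inter> fst tc)"
  let ?tb = "triv_at (fact_bundle b) (chart_inv ch z)"
  note tb = triv_at[OF E(2), of "chart_inv ch z"]
  let ?S = "chart_image ch (fst ta \<inter> fst ?tb \<inter> fst tc)"
  have S: "open ?S"
    by (intro chart_image_open[OF c] open_Int triv_open[OF E(1) t(1)] triv_open[OF E(2) tb(1)] triv_open[OF E(3) t(2)])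
  have zS: "z \<in> ?S"
    using chart_image_iff[OF c, of z "fst ta \<inter> fst tc"] chart_image_iff[OF c, of z "fst ta \<inter> fst ?tb \<inter> fst tc"] z tb(2) by simp
  have p: "chart_inv ch x \<in> fst ta" "chart_inv ch x \<in> fst ?tb" "chart_inv ch x \<in> fst tc" if "x \<in> ?S" for x
    using chart_imageE(2)[OF c that] by auto
  have sub: "?S \<subseteq> chart_image ch (fst ?tb \<inter> fst tc)" "?S \<subseteq> chart_image ch (fst ta \<inter> fst ?tb)"
    by (rule chart_image_mono, blast)+
  let ?B = "lf b c ch ?tb tc \<beta>" and ?A = "lf a b ch ta ?tb \<alpha>"
  have "lf a c ch ta tc (dolb a c (DF_comp a b c \<beta> \<alpha>)) z vs i j = dbar_mat (\<lambda>z. fprod c b (?B z) (?A z)) z vs i j"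
    unfolding lform_dolbeault[OF E(1,3) t c z Hom_comp[OF abc \<alpha> \<beta>]] dbar_mat_def
    by (rule dbar_cong[OF S zS]) (simp add: lf_DF_comp[OF abc t(1) tb(1) t(2) p car])
  also have "\<dots> = fprod c b (dbar_mat ?B z) (?A z) vs i j + fprod c b (finv c b (?B z)) (dbar_mat ?A z) vs i j"
    by (rule dbar_mat_wedge[OF S zS smooth_on_subset[OF hom_formsD(3)[OF \<beta> c tb(1) t(2)] sub(1)]
          smooth_on_subset[OF hom_formsD(3)[OF \<alpha> c t(1) tb(1)] sub(2)] parity_sign_square parity_sign_square])
  also have "dbar_mat ?B z = lf b c ch ?tb tc (dolb b c \<beta>) z"
    by (intro ext) (rule lform_dolbeault[OF E(2,3) tb(1) t(2) c subsetD[OF sub(1) zS] \<beta>, symmetric])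
  also have "dbar_mat ?A z = lf a b ch ta ?tb (dolb a b \<alpha>) z"
    by (intro ext) (rule lform_dolbeault[OF E(1,2) t(1) tb(1) c subsetD[OF sub(2) zS] \<alpha>, symmetric])
  finally show "lf a c ch ta tc (dolb a c (DF_comp a b c \<beta> \<alpha>)) z vs i j
      = lf a c ch ta tc (form_add (DF_comp a b c (dolb b c \<beta>) \<alpha>) (DF_comp a b c (form_invol b c \<beta>) (dolb a b \<alpha>))) z vs i j"
    by (simp add: lf_add[OF abc(1,3) t p(1,3)[OF zS] DF_comp_carrier DF_comp_carrier]
        lf_DF_comp[OF abc t(1) tb(1) t(2) p[OF zS] car(1) Hom_carrier[OF d(2)]]
        lf_DF_comp[OF abc t(1) tb(1) t(2) p[OF zS] Hom_carrier[OF d(1)] form_invol_carrier]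
        lf_invol[OF abc(2,3) tb(1) t(2) p(2,3)[OF zS] car(2)])
qed

section \<open>Leibniz rule and square of the total differential\<close>

abbreviation Fm :: "'x factorization \<Rightarrow> 'x \<Rightarrow> (complex ^ 'd) list \<Rightarrow> nat \<Rightarrow> nat \<Rightarrow> complex" where
  "Fm a p \<equiv> form0 (ent (fact_rank a) (fact_rank a) (fact_map a p))"

lemma invol_Fm:
  assumes "obj a" shows "finv a a (Fm a p) = (\<lambda>vs i j. - Fm a p vs i j)"
proof (intro ext)
  fix vs i j
  have "parity_sign a i * parity_sign a j * ent (fact_rank a) (fact_rank a) (fact_map a p) i j
      = - ent (fact_rank a) (fact_rank a) (fact_map a p) i j"
  proof (cases "ent (fact_rank a) (fact_rank a) (fact_map a p) i j = 0")
    case False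
    then have "index_parity a i + index_parity a j = 1"
      using obj_map(2)[OF assms, of p] unfolding hom_homogeneous_def ent_def by (metis (full_types))
    then have "parity_sign a i * parity_sign a j = -1"
      unfolding parity_sign_def by (cases "index_parity a i"; cases "index_parity a j") auto
    then show ?thesis by simp
  qed simp
  then show "finv a a (Fm a p) vs i j = - Fm a p vs i j"
    by (simp add: invol_def form0_def)
qed

lemma Fm_Fm:
  assumes "obj a" shows "fprod a a (Fm a p) (Fm a p) = form0 (\<lambda>i j. W p * ent (fact_rank a) (fact_rank a) (1\<^sub>m (fact_rank a)) i j)"
proof (intro ext)
  fix vs i j
  note m = obj_map(1)[OF assms, of p]
  have "fprod a a (Fm a p) (Fm a p) vs i j = (if vs = [] then ent (fact_rank a) (fact_rank a) (fact_map a p * fact_map a p) i j else 0)"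
    unfolding wedge_form0_right by (simp add: form0_def ent_mult[OF m m])
  then show "fprod a a (Fm a p) (Fm a p) vs i j = form0 (\<lambda>i j. W p * ent (fact_rank a) (fact_rank a) (1\<^sub>m (fact_rank a)) i j) vs i j"
    unfolding obj_map(3)[OF assms] by (simp add: form0_def ent_smult[OF one_carrier_mat])
qed

lemma ents_zero_out: "i \<ge> fact_rank b \<or> j \<ge> fact_rank a \<Longrightarrow> ents a b \<alpha> p vs i j = 0"
  by (auto simp: ents_def ent_def)

lemma prod_scalar_left:
  "fprod b b (form0 (\<lambda>i j. w * ent (fact_rank b) (fact_rank b) (1\<^sub>m (fact_rank b)) i j)) (ents a b \<alpha> p) = (\<lambda>vs i j. w * ents a b \<alpha> p vs i j)"
proof (intro ext)
  fix vs i j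
  have "(parity_sign b i * parity_sign b k) ^ length vs * (w * ent (fact_rank b) (fact_rank b) (1\<^sub>m (fact_rank b)) i k) * ents a b \<alpha> p vs k j
     = (if k = i then w * ents a b \<alpha> p vs i j else 0)" if "k < fact_rank b" for k
    using that by (auto simp: ent_one parity_sign_square)
  then show "fprod b b (form0 (\<lambda>i j. w * ent (fact_rank b) (fact_rank b) (1\<^sub>m (fact_rank b)) i j)) (ents a b \<alpha> p) vs i j = w * ents a b \<alpha> p vs i j"
    by (simp add: wedge_form0_left) (simp add: ents_zero_out not_less)
qed

lemma prod_scalar_right:
  "fprod b a (ents a b \<alpha> p) (form0 (\<lambda>i j. w * ent (fact_rank a) (fact_rank a) (1\<^sub>m (fact_rank a)) i j)) = (\<lambda>vs i j. w * ents a b \<alpha> p vs i j)"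
proof (intro ext)
  fix vs i j
  have "ents a b \<alpha> p vs i k * (w * ent (fact_rank a) (fact_rank a) (1\<^sub>m (fact_rank a)) k j)
     = (if k = j then w * ents a b \<alpha> p vs i j else 0)" if "k < fact_rank a" for k
    using that by (auto simp: ent_one)
  then show "fprod b a (ents a b \<alpha> p) (form0 (\<lambda>i j. w * ent (fact_rank a) (fact_rank a) (1\<^sub>m (fact_rank a)) i j)) vs i j = w * ents a b \<alpha> p vs i j"
    by (simp add: wedge_form0_right) (simp add: ents_zero_out not_less)
qed

lemma ents_Hom_add:
  assumes "\<alpha> \<in> Hom a b" "\<beta> \<in> Hom a b"
  shows "ents a b (form_add \<alpha> \<beta>) p vs i j = ents a b \<alpha> p vs i j + ents a b \<beta> p vs i j"
  by (rule ents_add) (rule Hom_carrier[OF assms(1)], rule Hom_carrier[OF assms(2)])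

lemma ents_Hom_scale:
  assumes "\<alpha> \<in> Hom a b" shows "ents a b (form_scale f \<alpha>) p vs i j = f p * ents a b \<alpha> p vs i j"
  by (rule ents_scale) (rule Hom_carrier[OF assms])

lemma ents_comp:
  assumes \<alpha>: "\<alpha> \<in> Hom a b" and \<beta>: "\<beta> \<in> Hom b c"
  shows "ents a c (DF_comp a b c \<beta> \<alpha>) p = fprod c b (ents b c \<beta> p) (ents a b \<alpha> p)"
  by (rule ents_DF_comp[of \<alpha> p b a \<beta> c, OF Hom_carrier[OF \<alpha>] Hom_carrier[OF \<beta>]])

lemma ents_diff:
  assumes ab: "obj a" "obj b" and \<alpha>: "\<alpha> \<in> Hom a b"
  shows "ents a b (DF_diff A a b \<alpha>) p = (\<lambda>vs i j. ents a b (dolb a b \<alpha>) p vs i j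
      + (fprod b b (Fm b p) (ents a b \<alpha> p) vs i j - fprod b a (finv b a (ents a b \<alpha> p)) (Fm a p) vs i j))"
proof (intro ext)
  fix vs i j
  note h = Hom_dolb[OF ab \<alpha>] Hom_comp[OF ab(1,2,2) \<alpha> Hom_mapf[OF ab(2)]]
    Hom_comp[OF ab(1,1,2) Hom_mapf[OF ab(1)] Hom_invol[OF ab \<alpha>]]
  show "ents a b (DF_diff A a b \<alpha>) p vs i j = ents a b (dolb a b \<alpha>) p vs i j
      + (fprod b b (Fm b p) (ents a b \<alpha> p) vs i j - fprod b a (finv b a (ents a b \<alpha> p)) (Fm a p) vs i j)"
    unfolding DF_diff_eq[OF ab \<alpha>]
    by (simp only: ents_Hom_add[OF h(1) Hom_add[OF ab h(2) Hom_uminus[OF ab h(3)]]]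
        ents_Hom_add[OF h(2) Hom_uminus[OF ab h(3)]] ents_Hom_scale[OF h(3)]
        ents_comp[OF \<alpha> Hom_mapf[OF ab(2)]] ents_comp[OF Hom_mapf[OF ab(1)] Hom_invol[OF ab \<alpha>]]
        ents_invol ents_section) simp
qed

lemma ents_dolb_comp:
  assumes abc: "obj a" "obj b" "obj c" and \<alpha>: "\<alpha> \<in> Hom a b" and \<beta>: "\<beta> \<in> Hom b c"
  shows "ents a c (dolb a c (DF_comp a b c \<beta> \<alpha>)) p vs i j
     = fprod c b (ents b c (dolb b c \<beta>) p) (ents a b \<alpha> p) vs i j + fprod c b (finv c b (ents b c \<beta> p)) (ents a b (dolb a b \<alpha>) p) vs i j"
  unfolding dolb_comp[OF assms]
    ents_Hom_add[OF Hom_comp[OF abc \<alpha> Hom_dolb[OF abc(2,3) \<beta>]] Hom_comp[OF abc Hom_dolb[OF abc(1,2) \<alpha>] Hom_invol[OF abc(2,3) \<beta>]]]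
    ents_comp[OF \<alpha> Hom_dolb[OF abc(2,3) \<beta>]]
    ents_comp[OF Hom_dolb[OF abc(1,2) \<alpha>] Hom_invol[OF abc(2,3) \<beta>]] ents_invol ..

lemma fprod_assoc:
  "wedge r' sd (parity_sign c) \<gamma> (wedge r (parity_sign c) sb \<beta> \<alpha>) = wedge r sd sb (wedge r' sd (parity_sign c) \<gamma> \<beta>) \<alpha>"
  by (rule wedge_assoc_fun) (rule parity_sign_square)

lemma finv_fprod:
  "invol sc sa (wedge r sc (parity_sign b) \<beta> \<alpha>) = wedge r sc (parity_sign b) (invol sc (parity_sign b) \<beta>) (invol (parity_sign b) sa \<alpha>)"
  by (intro ext, rule invol_wedge) (rule parity_sign_square)

lemma finv_finv: "invol (parity_sign b) (parity_sign a) (invol (parity_sign b) (parity_sign a) \<alpha>) = \<alpha>"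
  by (rule invol_invol) (rule parity_sign_square)+

lemmas prod_rules = wedge_add_left wedge_add_right wedge_diff_left wedge_diff_right
  wedge_minus_left wedge_minus_right wedge_mult_left wedge_mult_right

text \<open>The commutator part is a derivation by associativity: the terms with \<open>D\<close>
  between the two factors cancel. Using the involution instead of a sign avoids assuming the left
  factor homogeneous.\<close>

lemma DF_leibniz:
  assumes abc: "obj a" "obj b" "obj c" and \<alpha>: "\<alpha> \<in> Hom a b" and \<beta>: "\<beta> \<in> Hom b c"
  shows "DF_diff A a c (DF_comp a b c \<beta> \<alpha>)
    = form_add (DF_comp a b c (DF_diff A b c \<beta>) \<alpha>) (DF_comp a b c (form_invol b c \<beta>) (DF_diff A a b \<alpha>))"
proof (rule form_eqI[of _ c a])
  note h = Hom_comp[OF abc \<alpha> \<beta>] Hom_DF_diff[OF abc(1,2) \<alpha>] Hom_DF_diff[OF abc(2,3) \<beta>] Hom_invol[OF abc(2,3) \<beta>]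
  show "DF_diff A a c (DF_comp a b c \<beta> \<alpha>) p vs \<in> carrier_mat (fact_rank c) (fact_rank a)" for p vs
    by (rule Hom_carrier[OF Hom_DF_diff[OF abc(1,3) h(1)]])
  show "form_add (DF_comp a b c (DF_diff A b c \<beta>) \<alpha>) (DF_comp a b c (form_invol b c \<beta>) (DF_diff A a b \<alpha>)) p vs \<in> carrier_mat (fact_rank c) (fact_rank a)" for p vs
    unfolding form_add_def by (intro add_carrier_mat DF_comp_carrier)
  fix p vs i j
  let ?G = "ents b c \<beta> p" and ?F = "ents a b \<alpha> p"
  have L: "ents a c (DF_diff A a c (DF_comp a b c \<beta> \<alpha>)) p vs i j
      = fprod c b (ents b c (dolb b c \<beta>) p) ?F vs i j + fprod c b (finv c b ?G) (ents a b (dolb a b \<alpha>) p) vs i j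
        + (fprod c b (fprod c c (Fm c p) ?G) ?F vs i j - fprod c b (finv c b ?G) (fprod b a (finv b a ?F) (Fm a p)) vs i j)"
    unfolding ents_diff[OF abc(1,3) h(1)] ents_dolb_comp[OF abc \<alpha> \<beta>] ents_comp[OF \<alpha> \<beta>] finv_fprod
      fprod_assoc ..
  have R: "ents a c (form_add (DF_comp a b c (DF_diff A b c \<beta>) \<alpha>) (DF_comp a b c (form_invol b c \<beta>) (DF_diff A a b \<alpha>))) p vs i j
      = fprod c b (ents b c (DF_diff A b c \<beta>) p) ?F vs i j + fprod c b (finv c b ?G) (ents a b (DF_diff A a b \<alpha>) p) vs i j"
    unfolding ents_Hom_add[OF Hom_comp[OF abc \<alpha> h(3)] Hom_comp[OF abc h(2,4)]] ents_comp[OF \<alpha> h(3)] ents_comp[OF h(2,4)] ents_invol ..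
  show "ents a c (DF_diff A a c (DF_comp a b c \<beta> \<alpha>)) p vs i j
      = ents a c (form_add (DF_comp a b c (DF_diff A b c \<beta>) \<alpha>) (DF_comp a b c (form_invol b c \<beta>) (DF_diff A a b \<alpha>))) p vs i j"
    unfolding L R ents_diff[OF abc(2,3) \<beta>] ents_diff[OF abc(1,2) \<alpha>]
    unfolding prod_rules fprod_assoc
    by (simp add: algebra_simps)
qed

text \<open>The Dolbeault part squares to zero, and the mixed terms cancel because \<open>D\<close>
  is holomorphic and odd. The squared commutator leaves multiplication by \<open>W\<close> from the
  two ends with opposite signs; here it matters that both factorizations have the same
  \<open>W\<close>.\<close>

lemma DF_diff_square:
  assumes ab: "obj a" "obj b" and \<alpha>: "\<alpha> \<in> Hom a b"
  shows "ents a b (DF_diff A a b (DF_diff A a b \<alpha>)) p vs i j = 0"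
proof -
  note h = Hom_dolb[OF ab \<alpha>] Hom_comp[OF ab(1,2,2) \<alpha> Hom_mapf[OF ab(2)]]
    Hom_comp[OF ab(1,1,2) Hom_mapf[OF ab(1)] Hom_invol[OF ab \<alpha>]]
  note u = Hom_uminus[OF ab h(3)]
  let ?F = "ents a b \<alpha> p" and ?D = "ents a b (dolb a b \<alpha>) p"
  note m1 = holomorphic_fun_const[of A UNIV "-1"]
  have "ents a b (dolb a b (DF_diff A a b \<alpha>)) p vs i j
      = ents a b (dolb a b (DF_comp a b b (mapf b) \<alpha>)) p vs i j
        - ents a b (dolb a b (DF_comp a a b (form_invol a b \<alpha>) (mapf a))) p vs i j"
    unfolding DF_diff_eq[OF ab \<alpha>] dolb_add[OF ab h(1) Hom_add[OF ab h(2) u]] dolb_add[OF ab h(2) u]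
      dolb_scale[OF ab h(3) m1]
      ents_Hom_add[OF Hom_dolb[OF ab h(1)] Hom_add[OF ab Hom_dolb[OF ab h(2)] Hom_uminus[OF ab Hom_dolb[OF ab h(3)]]]]
      ents_Hom_add[OF Hom_dolb[OF ab h(2)] Hom_uminus[OF ab Hom_dolb[OF ab h(3)]]]
      ents_Hom_scale[OF Hom_dolb[OF ab h(3)]] dolb_dolb[OF ab \<alpha>]
    by (simp only: add_0_left mult_minus1 diff_conv_add_uminus)
  also have "\<dots> = - fprod b b (Fm b p) ?D vs i j + fprod b a (finv b a ?D) (Fm a p) vs i j"
  proof -
    have z: "ents c c (dolb c c (mapf c)) p = (\<lambda>vs i j. 0)" if "obj c" for c
      by (intro ext) (rule dolb_mapf[OF that])
    have i: "ents a b (dolb a b (form_invol a b \<alpha>)) p = (\<lambda>vs i j. - finv b a ?D vs i j)"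
      unfolding dolb_invol[OF ab \<alpha>] by (intro ext) (simp only: ents_Hom_scale[OF Hom_invol[OF ab Hom_dolb[OF ab \<alpha>]]] ents_invol mult_minus1)
    show ?thesis
      unfolding ents_dolb_comp[OF ab(1,2,2) \<alpha> Hom_mapf[OF ab(2)]]
          ents_dolb_comp[OF ab(1,1,2) Hom_mapf[OF ab(1)] Hom_invol[OF ab \<alpha>]] z[OF ab(1)] z[OF ab(2)] i
          wedge_zero_left wedge_zero_right wedge_minus_left ents_section invol_Fm[OF ab(2)] by simp
  qed
  finally have 1: "ents a b (dolb a b (DF_diff A a b \<alpha>)) p vs i j
      = - fprod b b (Fm b p) ?D vs i j + fprod b a (finv b a ?D) (Fm a p) vs i j" .
  have iF: "finv b a (finv b a ?F) = ?F" by (rule finv_finv)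
  have inv_sum: "finv b a (\<lambda>vs i j. X vs i j + (Y vs i j - Z vs i j))
      = (\<lambda>vs i j. finv b a X vs i j + (finv b a Y vs i j - finv b a Z vs i j))" for X Y Z :: "(complex ^ 'd) list \<Rightarrow> _"
    by (simp add: invol_def fun_eq_iff algebra_simps)
  have 2: "fprod b b (Fm b p) (fprod b b (Fm b p) ?F) = (\<lambda>vs i j. W p * ?F vs i j)"
    unfolding fprod_assoc Fm_Fm[OF ab(2)] by (rule prod_scalar_left)
  have 3: "fprod b a (finv b a (fprod b a (finv b a ?F) (Fm a p))) (Fm a p) = (\<lambda>vs i j. - (W p * ?F vs i j))"
  proof -
    have "fprod b a (finv b a (fprod b a (finv b a ?F) (Fm a p))) (Fm a p) = fprod b a (fprod b a ?F (\<lambda>vs i j. - Fm a p vs i j)) (Fm a p)"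
      by (simp only: finv_fprod iF invol_Fm[OF ab(1)])
    also have "\<dots> = (\<lambda>vs i j. - fprod b a (fprod b a ?F (Fm a p)) (Fm a p) vs i j)"
      by (intro ext) (simp add: wedge_minus_right[abs_def] wedge_minus_left)
    also have "fprod b a (fprod b a ?F (Fm a p)) (Fm a p) = fprod b a ?F (fprod a a (Fm a p) (Fm a p))"
      by (rule fprod_assoc[symmetric])
    finally show ?thesis unfolding Fm_Fm[OF ab(1)] prod_scalar_right .
  qed
  have 4: "fprod b a (finv b a (fprod b b (Fm b p) ?F)) (Fm a p) = (\<lambda>vs i j. - fprod b b (Fm b p) (fprod b a (finv b a ?F) (Fm a p)) vs i j)"
  proof -
    have "fprod b a (finv b a (fprod b b (Fm b p) ?F)) (Fm a p) = fprod b a (fprod b b (\<lambda>vs i j. - Fm b p vs i j) (finv b a ?F)) (Fm a p)"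
      by (simp only: finv_fprod invol_Fm[OF ab(2)])
    also have "\<dots> = (\<lambda>vs i j. - fprod b a (fprod b b (Fm b p) (finv b a ?F)) (Fm a p) vs i j)"
      by (intro ext) (simp add: wedge_minus_left[abs_def] wedge_minus_left)
    finally show ?thesis by (simp only: fprod_assoc)
  qed
  show ?thesis
    unfolding ents_diff[OF ab Hom_DF_diff[OF ab \<alpha>]] 1
    unfolding ents_diff[OF ab \<alpha>] inv_sum prod_rules 2 3 4 by simp
qed

section \<open>Morphism spaces as modules over the holomorphic functions\<close>

abbreviation form_zero :: "'x factorization \<Rightarrow> 'x factorization \<Rightarrow> ('x, 'd) matform" where
  "form_zero a b \<equiv> \<lambda>p vs. 0\<^sub>m (fact_rank b) (fact_rank a)"

lemma ents_form_zero: "ents a b (form_zero a b) p vs i j = 0"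
  by (simp add: ents_def ent_zero)

lemma form_scale_one: "form_scale (\<lambda>p. 1) \<alpha> = \<alpha>"
  by (intro ext eq_matI) (simp_all add: form_scale_def)

lemma Hom_zero:
  assumes ab: "obj a" "obj b" shows "form_zero a b \<in> Hom a b"
proof (rule hom_formsI)
  show "antialt (\<lambda>vs :: (complex ^ 'd) list. ent (fact_rank b) (fact_rank a) (form_zero a b p vs) i j)" for p i j
    unfolding ent_zero using antialt_mult[OF antialt_form0, of 0] by simp
  fix c t t' vs i j
  assume c: "c \<in> A" and t: "t \<in> bundle_trivs (fact_bundle a)" "t' \<in> bundle_trivs (fact_bundle b)"
  have z: "form_scale (\<lambda>p. 0) (form_zero a b) = form_zero a b"
    by (simp add: form_scale_def fun_eq_iff)
  show "smooth_on (\<lambda>z. lf a b c t t' (form_zero a b) z vs i j) (chart_image c (fst t \<inter> fst t'))"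
  proof (rule smooth_on_transform[OF triv_overlap_open[OF ab t c]])
    show "smooth_on (\<lambda>z. 0) (chart_image c (fst t \<inter> fst t'))" by (rule smooth_on_const)
    fix z assume "z \<in> chart_image c (fst t \<inter> fst t')"
    from chart_imageE(2)[OF c this] lf_scale[OF ab t _ _ zero_carrier_mat, of c z "\<lambda>p. 0" vs i j]
    show "lf a b c t t' (form_zero a b) z vs i j = 0" unfolding z by simp
  qed
qed simp

lemma Hom_eqI:
  assumes "\<alpha> \<in> Hom a b" "\<beta> \<in> Hom a b" "\<And>p vs i j. ents a b \<alpha> p vs i j = ents a b \<beta> p vs i j"
  shows "\<alpha> = \<beta>"
  by (rule form_eqI[OF Hom_carrier[OF assms(1)] Hom_carrier[OF assms(2)] assms(3)])

lemma Hom_hscale: "obj a \<Longrightarrow> obj b \<Longrightarrow> \<alpha> \<in> Hom a b \<Longrightarrow> holomorphic_fun A UNIV f \<Longrightarrow> form_scale f \<alpha> \<in> Hom a b"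
  by (intro Hom_scale holomorphic_fun_smooth[OF open_UNIV])

lemmas ents_simps = ents_Hom_add ents_Hom_scale ents_form_zero ents_invol

lemma holomorphic_ring_simps:
  "f \<in> carrier (holomorphic_ring A) \<longleftrightarrow> holomorphic_fun A UNIV f" "f \<oplus>\<^bsub>holomorphic_ring A\<^esub> g = (\<lambda>p. f p + g p)"
  "f \<otimes>\<^bsub>holomorphic_ring A\<^esub> g = (\<lambda>p. f p * g p)" "\<one>\<^bsub>holomorphic_ring A\<^esub> = (\<lambda>p. 1)"
  by (simp_all add: holomorphic_ring_def)

lemma Hom_add_assoc:
  assumes ab: "obj a" "obj b" and h: "\<alpha> \<in> Hom a b" "\<beta> \<in> Hom a b" "\<gamma> \<in> Hom a b"
  shows "form_add (form_add \<alpha> \<beta>) \<gamma> = form_add \<alpha> (form_add \<beta> \<gamma>)"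
  by (rule Hom_eqI[of _ a b]) (simp_all add: assms Hom_add ents_simps)

lemma Hom_add_comm:
  assumes ab: "obj a" "obj b" and h: "\<alpha> \<in> Hom a b" "\<beta> \<in> Hom a b"
  shows "form_add \<alpha> \<beta> = form_add \<beta> \<alpha>"
  by (rule Hom_eqI[of _ a b]) (simp_all add: assms Hom_add ents_simps)

lemma Hom_add_zero:
  assumes ab: "obj a" "obj b" and h: "\<alpha> \<in> Hom a b"
  shows "form_add (form_zero a b) \<alpha> = \<alpha>"
  by (rule Hom_eqI[of _ a b]) (simp_all add: assms Hom_add Hom_zero ents_simps)

lemma Hom_add_uminus:
  assumes ab: "obj a" "obj b" and h: "\<alpha> \<in> Hom a b"
  shows "form_add (form_uminus \<alpha>) \<alpha> = form_zero a b"
  by (rule Hom_eqI[of _ a b]) (simp_all add: assms Hom_add Hom_uminus Hom_zero ents_simps)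

lemma Hom_abelian_group:
  assumes ab: "obj a" "obj b" shows "abelian_group (form_module a b (Hom a b))"
proof (rule abelian_groupI)
  fix \<alpha> assume "\<alpha> \<in> carrier (form_module a b (Hom a b))"
  then show "\<exists>\<beta>\<in>carrier (form_module a b (Hom a b)). \<beta> \<oplus>\<^bsub>form_module a b (Hom a b)\<^esub> \<alpha> = \<zero>\<^bsub>form_module a b (Hom a b)\<^esub>"
    unfolding form_module_simps by (intro bexI[of _ "form_uminus \<alpha>"] Hom_add_uminus Hom_uminus ab)
qed (unfold form_module_simps, (rule Hom_add[OF ab] Hom_zero[OF ab] Hom_add_assoc[OF ab] Hom_add_comm[OF ab] Hom_add_zero[OF ab]; assumption)+)

lemma Hom_a_inv:
  assumes ab: "obj a" "obj b" and h: "\<alpha> \<in> Hom a b"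
  shows "\<ominus>\<^bsub>form_module a b (Hom a b)\<^esub> \<alpha> = form_uminus \<alpha>"
proof -
  interpret M: abelian_group "form_module a b (Hom a b)" by (rule Hom_abelian_group[OF ab])
  show ?thesis
    by (rule M.minus_equality) (simp_all only: form_module_simps Hom_add_uminus[OF ab h] h Hom_uminus[OF ab h])
qed

lemma Hom_module:
  assumes ab: "obj a" "obj b" shows "Module.module (holomorphic_ring A) (form_module a b (Hom a b))"
proof (rule moduleI[OF cring_holomorphic_ring Hom_abelian_group[OF ab]], unfold form_module_simps holomorphic_ring_simps)
  fix \<alpha> \<beta> f g
  assume h: "\<alpha> \<in> Hom a b" and f: "holomorphic_fun A UNIV f"
  show "form_scale f \<alpha> \<in> Hom a b" by (rule Hom_hscale[OF ab h f])
  show "form_scale f (form_add \<alpha> \<beta>) = form_add (form_scale f \<alpha>) (form_scale f \<beta>)" if k: "\<beta> \<in> Hom a b"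
    by (rule Hom_eqI[of _ a b]) (simp_all add: ab h k f Hom_add Hom_hscale ents_simps algebra_simps)
  show "form_scale (\<lambda>p. f p + g p) \<alpha> = form_add (form_scale f \<alpha>) (form_scale g \<alpha>)" if g: "holomorphic_fun A UNIV g"
    by (rule Hom_eqI[of _ a b]) (simp_all add: ab h g f Hom_add Hom_hscale holomorphic_fun_add ents_simps algebra_simps)
  show "form_scale (\<lambda>p. f p * g p) \<alpha> = form_scale f (form_scale g \<alpha>)" if g: "holomorphic_fun A UNIV g"
    by (rule Hom_eqI[of _ a b]) (simp_all add: ab h g f Hom_add Hom_hscale holomorphic_fun_mult ents_simps)
next
  fix \<alpha> assume h: "\<alpha> \<in> Hom a b"
  show "form_scale (\<lambda>p. 1) \<alpha> = \<alpha>"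
    by (rule Hom_eqI[of _ a b]) (simp_all add: ab h Hom_hscale holomorphic_fun_const ents_simps)
qed

lemma form_submoduleI:
  assumes ab: "obj a" "obj b" and S: "S \<subseteq> Hom a b" "form_zero a b \<in> S"
    "\<And>\<alpha> \<beta>. \<alpha> \<in> S \<Longrightarrow> \<beta> \<in> S \<Longrightarrow> form_add \<alpha> \<beta> \<in> S"
    "\<And>f \<alpha>. holomorphic_fun A UNIV f \<Longrightarrow> \<alpha> \<in> S \<Longrightarrow> form_scale f \<alpha> \<in> S"
  shows "submodule S (holomorphic_ring A) (form_module a b (Hom a b))"
proof (rule module.submoduleI[OF Hom_module[OF ab]], unfold form_module_simps holomorphic_ring_simps)
  fix \<alpha> assume "\<alpha> \<in> S"
  then show "\<ominus>\<^bsub>form_module a b (Hom a b)\<^esub> \<alpha> \<in> S"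
    using Hom_a_inv[OF ab] S(1) S(4)[OF holomorphic_fun_const] by auto
qed (use S in auto)

section \<open>The parity decomposition\<close>

lemma Hom_degD:
  assumes "\<alpha> \<in> form_deg a b s"
  shows "finv b a (ents a b \<alpha> p) = (\<lambda>vs i j. bit_sign s * ents a b \<alpha> p vs i j)"
  using assms unfolding form_deg_iff by (intro ext) blast

lemma Hom_degI:
  assumes "\<And>p. finv b a (ents a b \<alpha> p) = (\<lambda>vs i j. bit_sign s * ents a b \<alpha> p vs i j)"
  shows "\<alpha> \<in> form_deg a b s"
  unfolding form_deg_iff assms by simp

lemma form_invol_homogeneous:
  assumes ab: "obj a" "obj b" and h: "\<alpha> \<in> Hom a b" "\<alpha> \<in> form_deg a b s"
  shows "form_invol a b \<alpha> = form_scale (\<lambda>p. bit_sign s) \<alpha>"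
  by (rule Hom_eqI[of _ a b])
    (simp_all add: ab h(1) Hom_invol Hom_hscale holomorphic_fun_const ents_invol Hom_degD[OF h(2)] ents_Hom_scale)

lemma deg_add:
  assumes "obj a" "obj b" "\<alpha> \<in> Hom a b" "\<beta> \<in> Hom a b" "\<alpha> \<in> form_deg a b s" "\<beta> \<in> form_deg a b s"
  shows "form_add \<alpha> \<beta> \<in> form_deg a b s"
  using assms(5,6) unfolding form_deg_iff invol_def ents_Hom_add[OF assms(3,4)] by (simp only: distrib_left simp_thms)

lemma deg_scale:
  assumes "\<alpha> \<in> Hom a b" "\<alpha> \<in> form_deg a b s"
  shows "form_scale f \<alpha> \<in> form_deg a b s"
  using assms(2) unfolding form_deg_iff invol_def ents_Hom_scale[OF assms(1)]
  by (simp add: mult.left_commute[of _ "f _"])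

lemma deg_zero: "form_zero a b \<in> form_deg a b s"
  unfolding form_deg_iff invol_def ents_form_zero by simp

lemma deg_comp:
  assumes "\<alpha> \<in> Hom a b" "\<beta> \<in> Hom b c" "\<alpha> \<in> form_deg a b s" "\<beta> \<in> form_deg b c t"
  shows "DF_comp a b c \<beta> \<alpha> \<in> form_deg a c (t + s)"
proof (rule Hom_degI)
  fix p
  show "finv c a (ents a c (DF_comp a b c \<beta> \<alpha>) p) = (\<lambda>vs i j. bit_sign (t + s) * ents a c (DF_comp a b c \<beta> \<alpha>) p vs i j)"
    unfolding ents_comp[OF assms(1,2)] finv_fprod Hom_degD[OF assms(3)] Hom_degD[OF assms(4)] bit_sign_add
    by (intro ext) (simp only: wedge_mult_left wedge_mult_right mult.assoc mult.left_commute)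
qed

text \<open>The Dolbeault operator anticommutes with the involution, and \<open>D\<close> is odd, so
  both parts of the differential change the parity.\<close>

lemma deg_diff:
  assumes ab: "obj a" "obj b" and h: "\<alpha> \<in> Hom a b" "\<alpha> \<in> form_deg a b s"
  shows "DF_diff A a b \<alpha> \<in> form_deg a b (s + 1)"
proof (rule Hom_degI)
  fix p
  let ?F = "ents a b \<alpha> p" and ?D = "ents a b (dolb a b \<alpha>) p" and ?s = "bit_sign s"
  have "form_uminus (form_invol a b (dolb a b \<alpha>)) = form_scale (\<lambda>p. ?s) (dolb a b \<alpha>)"
    using dolb_invol[OF ab h(1)] unfolding form_invol_homogeneous[OF ab h] dolb_scale[OF ab h(1) holomorphic_fun_const] by (rule sym)
  then have "ents a b (form_uminus (form_invol a b (dolb a b \<alpha>))) p vs i j = ents a b (form_scale (\<lambda>p. ?s) (dolb a b \<alpha>)) p vs i j" for vs i j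
    by (simp only:)
  then have D: "finv b a ?D vs i j = - (?s * ?D vs i j)" for vs i j
    unfolding ents_Hom_scale[OF Hom_invol[OF ab Hom_dolb[OF ab h(1)]]] ents_Hom_scale[OF Hom_dolb[OF ab h(1)]] ents_invol
    by (simp add: minus_equation_iff)
  have i: "finv b a (\<lambda>vs i j. X vs i j + (Y vs i j - Z vs i j)) vs i j
      = finv b a X vs i j + (finv b a Y vs i j - finv b a Z vs i j)" for X Y Z :: "(complex ^ 'd) list \<Rightarrow> _" and vs i j
    by (simp add: invol_def algebra_simps)
  have s1: "bit_sign (s + 1) = - ?s" unfolding bit_sign_add by (simp add: bit_sign_def)
  show "finv b a (ents a b (DF_diff A a b \<alpha>) p) = (\<lambda>vs i j. bit_sign (s + 1) * ents a b (DF_diff A a b \<alpha>) p vs i j)"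
    unfolding ents_diff[OF ab h(1)] Hom_degD[OF h(2)]
    by (intro ext) (simp only: i D finv_fprod invol_Fm[OF ab(1)] invol_Fm[OF ab(2)] Hom_degD[OF h(2)] invol_mult
      wedge_mult_left wedge_mult_right wedge_minus_left wedge_minus_right s1, simp add: bit_sign_def)
qed

text \<open>Homogeneous parts are eigenprojections of the involution. This yields their uniqueness
  and shows later that they keep a compact support.\<close>

lemma deg_parts:
  assumes ab: "obj a" "obj b" and h: "\<alpha> \<in> Hom a b" "\<beta> \<in> Hom a b" "\<alpha> \<in> form_deg a b 0" "\<beta> \<in> form_deg a b 1"
    and \<gamma>: "\<gamma> = form_add \<alpha> \<beta>"
  shows "\<alpha> = form_scale (\<lambda>p. 1 / 2) (form_add \<gamma> (form_invol a b \<gamma>))"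
    "\<beta> = form_scale (\<lambda>p. 1 / 2) (form_add \<gamma> (form_uminus (form_invol a b \<gamma>)))"
proof -
  have g: "\<gamma> \<in> Hom a b" unfolding \<gamma> by (rule Hom_add[OF ab h(1,2)])
  have e: "ents a b \<gamma> p vs i j = ents a b \<alpha> p vs i j + ents a b \<beta> p vs i j" for p vs i j
    unfolding \<gamma> by (rule ents_Hom_add[OF h(1,2)])
  have i: "finv b a (ents a b \<gamma> p) vs i j = ents a b \<alpha> p vs i j - ents a b \<beta> p vs i j" for p vs i j
  proof -
    have "finv b a (ents a b \<gamma> p) vs i j = finv b a (ents a b \<alpha> p) vs i j + finv b a (ents a b \<beta> p) vs i j"
      by (simp add: invol_def e distrib_left)
    then show ?thesis unfolding Hom_degD[OF h(3)] Hom_degD[OF h(4)] by (simp add: bit_sign_def)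
  qed
  note c = Hom_hscale[OF ab _ holomorphic_fun_const] Hom_add[OF ab] Hom_invol[OF ab g] Hom_uminus[OF ab] g
  show "\<alpha> = form_scale (\<lambda>p. 1 / 2) (form_add \<gamma> (form_invol a b \<gamma>))"
    by (rule Hom_eqI[OF h(1)]) (simp_all add: c ents_Hom_scale ents_Hom_add ents_invol i e)
  show "\<beta> = form_scale (\<lambda>p. 1 / 2) (form_add \<gamma> (form_uminus (form_invol a b \<gamma>)))"
    by (rule Hom_eqI[OF h(2)]) (simp_all add: c ents_Hom_scale ents_Hom_add ents_invol i e)
qed

lemma deg_decomposition_ex:
  assumes ab: "obj a" "obj b" and g: "\<gamma> \<in> Hom a b"
  shows "form_scale (\<lambda>p. 1 / 2) (form_add \<gamma> (form_invol a b \<gamma>)) \<in> Hom a b \<inter> form_deg a b 0"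
    "form_scale (\<lambda>p. 1 / 2) (form_add \<gamma> (form_uminus (form_invol a b \<gamma>))) \<in> Hom a b \<inter> form_deg a b 1"
    "\<gamma> = form_add (form_scale (\<lambda>p. 1 / 2) (form_add \<gamma> (form_invol a b \<gamma>)))
      (form_scale (\<lambda>p. 1 / 2) (form_add \<gamma> (form_uminus (form_invol a b \<gamma>))))"
proof -
  note i = Hom_invol[OF ab g]
  note m = Hom_uminus[OF ab i]
  note p = Hom_add[OF ab g i] Hom_add[OF ab g m]
  note h = Hom_hscale[OF ab p(1) holomorphic_fun_const[of A UNIV "1/2"]] Hom_hscale[OF ab p(2) holomorphic_fun_const[of A UNIV "1/2"]]
  \<comment> \<open>The choices \<open>x = 1\<close> and \<open>x = -1\<close> treat both
    eigenvalues at once.\<close>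
  have s: "finv b a (\<lambda>vs i j. 1 / 2 * (ents a b \<gamma> p vs i j + x * finv b a (ents a b \<gamma> p) vs i j)) vs i j
      = x * (1 / 2 * (ents a b \<gamma> p vs i j + x * finv b a (ents a b \<gamma> p) vs i j))" if x: "x * x = 1" for x p vs i j
  proof -
    have "finv b a (\<lambda>vs i j. 1 / 2 * (ents a b \<gamma> p vs i j + x * finv b a (ents a b \<gamma> p) vs i j)) vs i j
      = 1 / 2 * (finv b a (ents a b \<gamma> p) vs i j + x * finv b a (finv b a (ents a b \<gamma> p)) vs i j)"
      by (simp add: invol_def algebra_simps)
    also have "\<dots> = 1 / 2 * ((x * x) * finv b a (ents a b \<gamma> p) vs i j + x * ents a b \<gamma> p vs i j)"
      unfolding finv_finv x by simp
    finally show ?thesis by (simp add: algebra_simps)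
  qed
  have "form_scale (\<lambda>p. 1 / 2) (form_add \<gamma> (form_invol a b \<gamma>)) \<in> form_deg a b 0"
    unfolding form_deg_iff using s[of 1]
    by (simp add: ents_Hom_scale[OF p(1), abs_def] ents_Hom_add[OF g i, abs_def] ents_invol bit_sign_def)
  then show "form_scale (\<lambda>p. 1 / 2) (form_add \<gamma> (form_invol a b \<gamma>)) \<in> Hom a b \<inter> form_deg a b 0"
    using h(1) by blast
  have "form_scale (\<lambda>p. 1 / 2) (form_add \<gamma> (form_uminus (form_invol a b \<gamma>))) \<in> form_deg a b 1"
    unfolding form_deg_iff using s[of "-1"]
    by (simp add: ents_Hom_scale[OF p(2), abs_def] ents_Hom_add[OF g m, abs_def] ents_Hom_scale[OF i, abs_def] ents_invol bit_sign_def)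
  then show "form_scale (\<lambda>p. 1 / 2) (form_add \<gamma> (form_uminus (form_invol a b \<gamma>))) \<in> Hom a b \<inter> form_deg a b 1"
    using h(2) by blast
  show "\<gamma> = form_add (form_scale (\<lambda>p. 1 / 2) (form_add \<gamma> (form_invol a b \<gamma>)))
      (form_scale (\<lambda>p. 1 / 2) (form_add \<gamma> (form_uminus (form_invol a b \<gamma>))))"
    by (rule Hom_eqI[OF g Hom_add[OF ab h]])
      (simp add: ents_Hom_add[OF h] ents_Hom_scale[OF p(1)] ents_Hom_scale[OF p(2)] ents_Hom_add[OF g i] ents_Hom_add[OF g m] ents_Hom_scale[OF i] add_divide_distrib diff_divide_distrib)
qed

lemma diff_add_form:
  assumes ab: "obj a" "obj b" and h: "\<alpha> \<in> Hom a b" "\<beta> \<in> Hom a b"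
  shows "DF_diff A a b (form_add \<alpha> \<beta>) = form_add (DF_diff A a b \<alpha>) (DF_diff A a b \<beta>)"
proof (rule Hom_eqI[OF Hom_DF_diff[OF ab Hom_add[OF ab h]] Hom_add[OF ab Hom_DF_diff[OF ab h(1)] Hom_DF_diff[OF ab h(2)]]])
  fix p vs i j
  have e: "ents a b (form_add \<alpha> \<beta>) p = (\<lambda>vs i j. ents a b \<alpha> p vs i j + ents a b \<beta> p vs i j)"
    by (intro ext) (rule ents_Hom_add[OF h])
  have v: "finv b a (\<lambda>vs i j. X vs i j + Y vs i j) = (\<lambda>vs i j. finv b a X vs i j + finv b a Y vs i j)"
    for X Y :: "(complex ^ 'd) list \<Rightarrow> _"
    by (simp add: invol_def algebra_simps)
  show "ents a b (DF_diff A a b (form_add \<alpha> \<beta>)) p vs i j = ents a b (form_add (DF_diff A a b \<alpha>) (DF_diff A a b \<beta>)) p vs i j"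
    unfolding ents_Hom_add[OF Hom_DF_diff[OF ab h(1)] Hom_DF_diff[OF ab h(2)]] ents_diff[OF ab h(1)] ents_diff[OF ab h(2)]
      ents_diff[OF ab Hom_add[OF ab h]] e v dolb_add[OF ab h] ents_Hom_add[OF Hom_dolb[OF ab h(1)] Hom_dolb[OF ab h(2)]]
      wedge_add_left wedge_add_right
    by simp
qed

lemma diff_scale_form:
  assumes ab: "obj a" "obj b" and h: "\<alpha> \<in> Hom a b" and f: "holomorphic_fun A UNIV f"
  shows "DF_diff A a b (form_scale f \<alpha>) = form_scale f (DF_diff A a b \<alpha>)"
proof (rule Hom_eqI[OF Hom_DF_diff[OF ab Hom_hscale[OF ab h f]] Hom_hscale[OF ab Hom_DF_diff[OF ab h] f]])
  fix p vs i j
  have e: "ents a b (form_scale f \<alpha>) p = (\<lambda>vs i j. f p * ents a b \<alpha> p vs i j)"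
    by (intro ext) (rule ents_Hom_scale[OF h])
  have v: "finv b a (\<lambda>vs i j. x * Y vs i j) = (\<lambda>vs i j. x * finv b a Y vs i j)"
    for x and Y :: "(complex ^ 'd) list \<Rightarrow> _"
    by (simp add: invol_def algebra_simps)
  show "ents a b (DF_diff A a b (form_scale f \<alpha>)) p vs i j = ents a b (form_scale f (DF_diff A a b \<alpha>)) p vs i j"
    unfolding ents_Hom_scale[OF Hom_DF_diff[OF ab h]] ents_diff[OF ab h]
      ents_diff[OF ab Hom_hscale[OF ab h f]] e v dolb_scale[OF ab h f] ents_Hom_scale[OF Hom_dolb[OF ab h]]
      wedge_mult_left wedge_mult_right
    by (simp add: algebra_simps)
qed

lemma comp_add_form:
  assumes abc: "obj a" "obj b" "obj c" and h: "\<alpha> \<in> Hom a b" "\<beta> \<in> Hom b c"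
  shows "\<alpha>' \<in> Hom a b \<Longrightarrow> DF_comp a b c \<beta> (form_add \<alpha> \<alpha>') = form_add (DF_comp a b c \<beta> \<alpha>) (DF_comp a b c \<beta> \<alpha>')"
    and "\<beta>' \<in> Hom b c \<Longrightarrow> DF_comp a b c (form_add \<beta> \<beta>') \<alpha> = form_add (DF_comp a b c \<beta> \<alpha>) (DF_comp a b c \<beta>' \<alpha>)"
proof -
  assume k: "\<alpha>' \<in> Hom a b"
  note m = Hom_comp[OF abc h] Hom_comp[OF abc k h(2)]
  have e: "ents a b (form_add \<alpha> \<alpha>') p = (\<lambda>vs i j. ents a b \<alpha> p vs i j + ents a b \<alpha>' p vs i j)" for p
    by (intro ext) (rule ents_Hom_add[OF h(1) k])
  show "DF_comp a b c \<beta> (form_add \<alpha> \<alpha>') = form_add (DF_comp a b c \<beta> \<alpha>) (DF_comp a b c \<beta> \<alpha>')"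
    by (rule Hom_eqI[OF Hom_comp[OF abc Hom_add[OF abc(1,2) h(1) k] h(2)] Hom_add[OF abc(1,3) m]])
      (simp only: ents_Hom_add[OF m] ents_comp[OF h] ents_comp[OF k h(2)] ents_comp[OF Hom_add[OF abc(1,2) h(1) k] h(2)] e wedge_add_right)
next
  assume k: "\<beta>' \<in> Hom b c"
  note m = Hom_comp[OF abc h] Hom_comp[OF abc h(1) k]
  have e: "ents b c (form_add \<beta> \<beta>') p = (\<lambda>vs i j. ents b c \<beta> p vs i j + ents b c \<beta>' p vs i j)" for p
    by (intro ext) (rule ents_Hom_add[OF h(2) k])
  show "DF_comp a b c (form_add \<beta> \<beta>') \<alpha> = form_add (DF_comp a b c \<beta> \<alpha>) (DF_comp a b c \<beta>' \<alpha>)"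
    by (rule Hom_eqI[OF Hom_comp[OF abc h(1) Hom_add[OF abc(2,3) h(2) k]] Hom_add[OF abc(1,3) m]])
      (simp only: ents_Hom_add[OF m] ents_comp[OF h] ents_comp[OF h(1) k] ents_comp[OF h(1) Hom_add[OF abc(2,3) h(2) k]] e wedge_add_left)
qed

lemma comp_scale_form:
  assumes abc: "obj a" "obj b" "obj c" and h: "\<alpha> \<in> Hom a b" "\<beta> \<in> Hom b c" and f: "smooth_fun A UNIV f"
  shows "DF_comp a b c \<beta> (form_scale f \<alpha>) = form_scale f (DF_comp a b c \<beta> \<alpha>)"
    and "DF_comp a b c (form_scale f \<beta>) \<alpha> = form_scale f (DF_comp a b c \<beta> \<alpha>)"
proof -
  note m = Hom_comp[OF abc h]
  note s = Hom_scale[OF abc(1,2) h(1) f] Hom_scale[OF abc(2,3) h(2) f]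
  have e: "ents a b (form_scale f \<alpha>) p = (\<lambda>vs i j. f p * ents a b \<alpha> p vs i j)"
    "ents b c (form_scale f \<beta>) p = (\<lambda>vs i j. f p * ents b c \<beta> p vs i j)" for p
    by (intro ext, rule ents_Hom_scale[OF h(1)], intro ext, rule ents_Hom_scale[OF h(2)])
  show "DF_comp a b c \<beta> (form_scale f \<alpha>) = form_scale f (DF_comp a b c \<beta> \<alpha>)"
    by (rule Hom_eqI[OF Hom_comp[OF abc s(1) h(2)] Hom_scale[OF abc(1,3) m f]])
      (simp only: ents_Hom_scale[OF m] ents_comp[OF h] ents_comp[OF s(1) h(2)] e wedge_mult_right)
  show "DF_comp a b c (form_scale f \<beta>) \<alpha> = form_scale f (DF_comp a b c \<beta> \<alpha>)"
    by (rule Hom_eqI[OF Hom_comp[OF abc h(1) s(2)] Hom_scale[OF abc(1,3) m f]])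
      (simp only: ents_Hom_scale[OF m] ents_comp[OF h] ents_comp[OF h(1) s(2)] e wedge_mult_left)
qed

lemma comp_assoc_form:
  assumes o: "obj a" "obj b" "obj c" "obj d" and h: "\<alpha> \<in> Hom a b" "\<beta> \<in> Hom b c" "\<gamma> \<in> Hom c d"
  shows "DF_comp a c d \<gamma> (DF_comp a b c \<beta> \<alpha>) = DF_comp a b d (DF_comp b c d \<gamma> \<beta>) \<alpha>"
proof -
  note m = Hom_comp[OF o(1,2,3) h(1,2)] Hom_comp[OF o(2,3,4) h(2,3)]
  show ?thesis
    by (rule Hom_eqI[OF Hom_comp[OF o(1,3,4) m(1) h(3)] Hom_comp[OF o(1,2,4) h(1) m(2)]])
      (simp only: ents_comp[OF m(1) h(3)] ents_comp[OF h(1) m(2)] ents_comp[OF h(1,2)] ents_comp[OF h(2,3)] fprod_assoc)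
qed

section \<open>Identity morphisms and the axioms of a dg-category\<close>

abbreviation idf :: "'x factorization \<Rightarrow> ('x, 'd) matform" where
  "idf a \<equiv> section_form (fact_rank a) (fact_rank a) (\<lambda>p. 1\<^sub>m (fact_rank a))"

lemma Hom_idf:
  assumes a: "obj a" shows "idf a \<in> Hom a a" "idf a \<in> form_deg a a 0"
proof -
  show "idf a \<in> Hom a a"
  proof (rule Hom_section[OF a a one_carrier_mat])
    fix c t t' i j
    assume c: "c \<in> A" and t: "t \<in> bundle_trivs (fact_bundle a)" "t' \<in> bundle_trivs (fact_bundle a)"
    have S: "open (chart_image c (fst t \<inter> fst t'))" by (rule triv_overlap_open[OF a a t c])
    show "smooth_on (\<lambda>z. ent (fact_rank a) (fact_rank a) (snd t' (chart_inv c z) * 1\<^sub>m (fact_rank a) * mat_inv (snd t (chart_inv c z))) i j)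
        (chart_image c (fst t \<inter> fst t'))"
    proof (cases "i < fact_rank a \<and> j < fact_rank a")
      case True
      then have "holomorphic_fun A (fst t \<inter> fst t') (\<lambda>p. (snd t' p * mat_inv (snd t p)) $$ (i, j))"
        using obj_bundle(1)[OF a] t unfolding holomorphic_bundle_def by blast
      then have "smooth_on (\<lambda>z. (snd t' (chart_inv c z) * mat_inv (snd t (chart_inv c z))) $$ (i, j)) (chart_image c (fst t \<inter> fst t'))"
        using cholomorphic_on_smooth[OF _ S] c unfolding holomorphic_fun_def by blast
      then show ?thesis
      proof (rule smooth_on_transform[OF S])
        fix z assume "z \<in> chart_image c (fst t \<inter> fst t')"
        from chart_imageE(2)[OF c this] have p: "chart_inv c z \<in> fst t'" by simp
        show "ent (fact_rank a) (fact_rank a) (snd t' (chart_inv c z) * 1\<^sub>m (fact_rank a) * mat_inv (snd t (chart_inv c z))) i j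
          = (snd t' (chart_inv c z) * mat_inv (snd t (chart_inv c z))) $$ (i, j)"
          unfolding right_mult_one_mat[OF bundle_triv(1)[OF obj_bundle(1)[OF a] t(2) p]] using True by (simp add: ent_def)
      qed
    next
      case False
      show ?thesis unfolding ent_def if_not_P[OF False] by (rule smooth_on_const)
    qed
  qed
  show "idf a \<in> form_deg a a 0"
  proof (rule Hom_degI)
    show "finv a a (ents a a (idf a) p) = (\<lambda>vs i j. bit_sign 0 * ents a a (idf a) p vs i j)" for p
      unfolding ents_section
      by (subst invol_form0) (auto simp: ent_one parity_sign_square bit_sign_def)
  qed
qed

lemma comp_idf:
  assumes ab: "obj a" "obj b" and h: "\<alpha> \<in> Hom a b"
  shows "DF_comp a a b \<alpha> (idf a) = \<alpha>" "DF_comp a b b (idf b) \<alpha> = \<alpha>"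
proof -
  note i = Hom_idf(1)[OF ab(1)] Hom_idf(1)[OF ab(2)]
  show "DF_comp a a b \<alpha> (idf a) = \<alpha>"
    by (rule Hom_eqI[OF Hom_comp[OF ab(1,1,2) i(1) h] h]) (simp only: ents_comp[OF i(1) h] ents_section prod_scalar_right[where w = 1, unfolded mult_1])
  show "DF_comp a b b (idf b) \<alpha> = \<alpha>"
    by (rule Hom_eqI[OF Hom_comp[OF ab(1,2,2) h i(2)] h]) (simp only: ents_comp[OF h i(2)] ents_section prod_scalar_left[where w = 1, unfolded mult_1])
qed

lemma DF_simps:
  "a \<in> dg_obj (DF A W) \<longleftrightarrow> obj a" "dg_hom (DF A W) a b = form_module a b (Hom a b)"
  "dg_deg (DF A W) a b s = Hom a b \<inter> form_deg a b s" "dg_diff (DF A W) = DF_diff A" "dg_comp (DF A W) = DF_comp"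
  by (simp_all add: DF_def)

lemma diff_zero_form:
  assumes ab: "obj a" "obj b" shows "DF_diff A a b (form_zero a b) = form_zero a b"
proof -
  note z = Hom_zero[OF ab]
  have s: "form_scale (\<lambda>p. 0) \<alpha> = form_zero a b" if "\<alpha> \<in> Hom a b" for \<alpha>
    by (rule Hom_eqI[OF Hom_hscale[OF ab that holomorphic_fun_const] z]) (simp add: ents_Hom_scale[OF that] ents_form_zero)
  show ?thesis
    using diff_scale_form[OF ab z holomorphic_fun_const[of A UNIV 0]] unfolding s[OF z] s[OF Hom_DF_diff[OF ab z]] .
qed

lemma leibniz_homogeneous:
  assumes abc: "obj a" "obj b" "obj c" and h: "\<alpha> \<in> Hom a b" "\<beta> \<in> Hom b c" "\<beta> \<in> form_deg b c s"
  shows "DF_diff A a c (DF_comp a b c \<beta> \<alpha>)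
    = form_add (DF_comp a b c (DF_diff A b c \<beta>) \<alpha>) (form_scale (\<lambda>p. bit_sign s) (DF_comp a b c \<beta> (DF_diff A a b \<alpha>)))"
  unfolding DF_leibniz[OF abc h(1,2)] form_invol_homogeneous[OF abc(2,3) h(2,3)]
    comp_scale_form(2)[OF abc Hom_DF_diff[OF abc(1,2) h(1)] h(2) smooth_fun_const] ..

text \<open>The argument of \<open>strict_identity_closed\<close>, repeated because cohomological
  units are among the axioms still to be verified for \<open>DF\<close>.\<close>

lemma diff_idf:
  assumes a: "obj a" shows "DF_diff A a a (idf a) = form_zero a a"
proof -
  note i = Hom_idf[OF a]
  note d = Hom_DF_diff[OF a a i(1)]
  have "DF_diff A a a (idf a) = form_add (DF_diff A a a (idf a)) (DF_diff A a a (idf a))"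
    using leibniz_homogeneous[OF a a a i(1) i] unfolding comp_idf[OF a a i(1)] comp_idf[OF a a d]
    by (simp add: bit_sign_def form_scale_one)
  then have "ents a a (DF_diff A a a (idf a)) p vs i j = ents a a (form_add (DF_diff A a a (idf a)) (DF_diff A a a (idf a))) p vs i j" for p vs i j
    by (rule arg_cong)
  then show ?thesis
    unfolding ents_Hom_add[OF d d] by (intro Hom_eqI[OF d Hom_zero[OF a a]]) (simp add: ents_form_zero)
qed

lemma DF_coh_identity:
  assumes a: "obj a" shows "coh_identity (DF A W) a (idf a)"
proof -
  have r: "cohomologous (DF A W) a b \<alpha> \<alpha>" if "obj a" "obj b" "\<alpha> \<in> Hom a b" for a b \<alpha>
    unfolding cohomologous_def DF_simps form_module_simps
    using Hom_zero[OF that(1,2)] diff_zero_form[OF that(1,2)] Hom_add_zero[OF that] Hom_add_comm[OF that(1,2,3) Hom_zero[OF that(1,2)]]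
    by (intro bexI[of _ "form_zero a b"]) simp_all
  show ?thesis
    unfolding coh_identity_def cocycles_def DF_simps form_module_simps
    using Hom_idf[OF a] diff_idf[OF a] comp_idf a r by (auto simp: DF_simps)
qed

lemma dg_category_DF: "dg_category (holomorphic_ring A) (DF A W)"
proof (intro dg_category.intro, unfold DF_simps form_module_simps holomorphic_ring_simps, goal_cases)
  case (1 a b) then show ?case by (rule Hom_module)
next
  case (2 a b s)
  then show ?case
    by (intro form_submoduleI) (auto intro: Hom_add Hom_zero Hom_hscale deg_add deg_zero deg_scale)
next
  case (3 a b f)
  show ?case
  proof (rule ex1I[of _ "(form_scale (\<lambda>p. 1 / 2) (form_add f (form_invol a b f)), form_scale (\<lambda>p. 1 / 2) (form_add f (form_uminus (form_invol a b f))))"])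
    show "case (form_scale (\<lambda>p. 1 / 2) (form_add f (form_invol a b f)), form_scale (\<lambda>p. 1 / 2) (form_add f (form_uminus (form_invol a b f)))) of
      (f0, f1) \<Rightarrow> f0 \<in> Hom a b \<inter> form_deg a b 0 \<and> f1 \<in> Hom a b \<inter> form_deg a b 1 \<and> f = form_add f0 f1"
      using deg_decomposition_ex[OF 3] unfolding prod.case by (intro conjI)
    fix y assume y: "case y of (f0, f1) \<Rightarrow> f0 \<in> Hom a b \<inter> form_deg a b 0 \<and> f1 \<in> Hom a b \<inter> form_deg a b 1 \<and> f = form_add f0 f1"
    obtain f0 f1 where "y = (f0, f1)" by (cases y)
    with y show "y = (form_scale (\<lambda>p. 1 / 2) (form_add f (form_invol a b f)), form_scale (\<lambda>p. 1 / 2) (form_add f (form_uminus (form_invol a b f))))"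
      using deg_parts[OF 3(1,2), of f0 f1 f] by simp
  qed
next
  case (4 a b f s) then show ?case using Hom_DF_diff[of a b f] deg_diff[of a b f s] by simp
next
  case (5 a b f g) then show ?case by (rule diff_add_form)
next
  case (6 a b f r) then show ?case by (rule diff_scale_form)
next
  case (7 a b f)
  then show ?case
    by (intro Hom_eqI[OF Hom_DF_diff[OF _ _ Hom_DF_diff] Hom_zero]) (simp_all only: DF_diff_square ents_form_zero)
next
  case (8 a b c f s g t) then show ?case using Hom_comp[of a b c f g] deg_comp[of f a b g c s t] by simp
next
  case (9 a b c f f' g) then show ?case by (intro comp_add_form(1))
next
  case (10 a b c f g g') then show ?case by (intro comp_add_form(2))
next
  case (11 a b c r f g) then show ?case by (intro comp_scale_form(1) holomorphic_fun_smooth[OF open_UNIV])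
next
  case (12 a b c r f g) then show ?case by (intro comp_scale_form(2) holomorphic_fun_smooth[OF open_UNIV])
next
  case (13 a b c d f g h) then show ?case by (intro comp_assoc_form)
next
  case (14 a b c f g s)
  then have g: "g \<in> Hom b c" "g \<in> form_deg b c s" by auto
  note m = Hom_comp[OF 14(1,2,3) Hom_DF_diff[OF 14(1,2,4)] g(1)]
  show ?case
    unfolding leibniz_homogeneous[OF 14(1,2,3,4) g] Hom_a_inv[OF 14(1,3) m] bit_sign_def by (simp add: form_scale_one)
next
  case (15 a) then show ?case using DF_coh_identity by blast
qed

end

section \<open>Bump functions\<close>

text \<open>The index makes the family closed under differentiation up to linear combinations, so
  smoothness follows by one induction over all \<open>n\<close>. The member \<open>n = 0\<close> is
  the classical flat function.\<close>

definition bump_fun :: "nat \<Rightarrow> real \<Rightarrow> real" where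
  "bump_fun n t = (if t > 0 then inverse t ^ n * exp (- inverse t) else 0)"

lemma bump_fun_pos: "bump_fun n t \<ge> 0" "bump_fun n t > 0 \<longleftrightarrow> t > 0"
  by (simp_all add: bump_fun_def)

lemma bump_fun_deriv:
  "(bump_fun n has_field_derivative bump_fun (n + 2) t - n * bump_fun (Suc n) t) (at t)"
proof -
  consider "t > 0" | "t < 0" | "t = 0" by linarith
  then show ?thesis
  proof cases
    case 1
    have "((\<lambda>s. inverse s ^ n * exp (- inverse s)) has_field_derivative
        inverse t ^ (n + 2) * exp (- inverse t) - n * (inverse t ^ Suc n * exp (- inverse t))) (at t)"
    proof -
      have "((\<lambda>s. inverse s ^ n) has_field_derivative - (n * inverse t ^ Suc n)) (at t)"
      proof (induction n)
        case (Suc n)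
        show ?case
          unfolding power_Suc[of _ n]
          by (rule DERIV_cong[OF DERIV_mult[OF DERIV_inverse Suc]]) (use 1 in \<open>simp_all add: algebra_simps power2_eq_square\<close>)
      qed simp
      moreover have "((\<lambda>s. exp (- inverse s)) has_field_derivative exp (- inverse t) * (inverse t * inverse t)) (at t)"
        using 1 by (auto intro!: derivative_eq_intros simp: power2_eq_square)
      ultimately show ?thesis by (rule DERIV_cong[OF DERIV_mult]) (simp add: algebra_simps)
    qed
    then have "((\<lambda>s. inverse s ^ n * exp (- inverse s)) has_field_derivative bump_fun (n + 2) t - n * bump_fun (Suc n) t) (at t)"
      using 1 by (simp add: bump_fun_def)
    then show ?thesis
      by (rule has_field_derivative_transform_within_open[where S = "{0<..}"]) (use 1 in \<open>auto simp: bump_fun_def\<close>)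
  next
    case 2
    have "((\<lambda>s. 0) has_field_derivative bump_fun (n + 2) t - n * bump_fun (Suc n) t) (at t)"
      using 2 by (simp add: bump_fun_def)
    then show ?thesis
      by (rule has_field_derivative_transform_within_open[where S = "{..<0}"]) (use 2 in \<open>auto simp: bump_fun_def\<close>)
  next
    case 3
    \<comment> \<open>The difference quotient at 0 is zero on the left; on the right it is a power
      of \<open>1 / y\<close> times a decaying exponential.\<close>
    have "((\<lambda>y. bump_fun n y / y) \<longlongrightarrow> 0) (at 0)"
    proof (rule filterlim_split_at)
      show "((\<lambda>y. bump_fun n y / y) \<longlongrightarrow> 0) (at_left 0)"
        by (rule tendsto_eventually) (auto simp: eventually_at_filter bump_fun_def)
      have "((\<lambda>y. inverse y ^ Suc n / exp (inverse y)) \<longlongrightarrow> 0) (at_right (0::real))"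
        by (rule filterlim_compose[OF tendsto_power_div_exp_0 filterlim_inverse_at_top_right])
      moreover have "\<forall>\<^sub>F y in at_right 0. inverse y ^ Suc n / exp (inverse y) = bump_fun n y / y"
        by (auto simp: eventually_at_filter bump_fun_def exp_minus divide_simps)
      ultimately show "((\<lambda>y. bump_fun n y / y) \<longlongrightarrow> 0) (at_right 0)"
        by (rule Lim_transform_eventually)
    qed
    then show ?thesis
      unfolding has_field_derivative_iff 3 by (simp add: bump_fun_def)
  qed
qed

text \<open>Smoothness is defined for complex values, so the real argument \<open>q\<close> enters
  as the real part of a smooth \<open>Q\<close>. By the chain rule the derivatives are combinations
  of the same kind with higher indices.\<close>

lemma Ck_on_bump_fun:
  fixes Q :: "complex ^ 'd::finite \<Rightarrow> complex"
  assumes Q: "smooth_on Q UNIV" and q: "\<And>z. q z = Re (Q z)"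
  shows "Ck_on k (\<lambda>z. complex_of_real (bump_fun n (q z))) UNIV"
proof -
  have D: "((\<lambda>z. complex_of_real (bump_fun n (q z))) has_derivative
      (\<lambda>v. complex_of_real (Re (frechet_derivative Q (at z) v)) *
        (complex_of_real (bump_fun (n + 2) (q z)) + - complex_of_real n * complex_of_real (bump_fun (Suc n) (q z))))) (at z)" for n z
  proof -
    have "(q has_derivative (\<lambda>v. Re (frechet_derivative Q (at z) v))) (at z)"
      using bounded_linear.has_derivative[OF bounded_linear_Re smooth_on_has_derivative[OF Q UNIV_I]] q by (simp add: fun_eq_iff[symmetric] ext[OF q])
    from has_derivative_of_real[OF DERIV_compose_FDERIV[OF bump_fun_deriv this], where ?'a = complex]
    show ?thesis by (simp add: algebra_simps)
  qed
  show ?thesis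
  proof (induction k arbitrary: n)
    case 0
    show ?case
      unfolding Ck_on.simps by (intro continuous_at_imp_continuous_on ballI has_derivative_continuous[OF D])
  next
    case (Suc k)
    note f = has_derivative_frechetD[OF D]
    have "smooth_on (\<lambda>z. complex_of_real (Re (frechet_derivative Q (at z) v))) UNIV" for v
      by (rule smooth_on_linear_comp[OF open_UNIV bounded_linear_compose[OF bounded_linear_of_real bounded_linear_Re]
            smooth_on_frechet_derivative[OF Q]])
    then have *: "Ck_on k (\<lambda>z. complex_of_real (Re (frechet_derivative Q (at z) v))) UNIV" for v
      unfolding smooth_on_def by blast
    show ?case
      unfolding Ck_on.simps f[THEN conjunct2]
      by (intro conjI ballI allI f[THEN conjunct1] Ck_on_mult Ck_on_add Ck_on_const Suc.IH * open_UNIV)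
  qed
qed

lemma smooth_on_bump:
  fixes a :: "complex ^ 'd::finite"
  shows "smooth_on (\<lambda>z. complex_of_real (bump_fun 0 (e\<^sup>2 - (norm (z - a))\<^sup>2))) UNIV"
proof -
  \<comment> \<open>The squared distance as a polynomial in the coordinates and their conjugates,
    whose smoothness is algebraic.\<close>
  define Q where "Q z = complex_of_real (e\<^sup>2) - (\<Sum>k\<in>UNIV. (z $ k - a $ k) * cnj (z $ k - a $ k))" for z
  have c: "smooth_on (\<lambda>z :: complex ^ 'd. z $ k - a $ k) UNIV" for k
    by (intro smooth_on_diff smooth_on_const smooth_on_bounded_linear bounded_linear_vec_nth open_UNIV)
  have "smooth_on Q UNIV"
    unfolding Q_def[abs_def] by (intro smooth_on_diff smooth_on_const smooth_on_sum smooth_on_mult smooth_on_cnj c open_UNIV)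
  then show ?thesis
    unfolding smooth_on_def
  proof (intro allI Ck_on_bump_fun[of Q], unfold smooth_on_def)
    fix z
    have "(norm (z - a))\<^sup>2 = (\<Sum>k\<in>UNIV. (norm (z $ k - a $ k))\<^sup>2)"
      unfolding norm_vec_def L2_set_def by (subst real_sqrt_pow2) (simp_all add: sum_nonneg)
    moreover have "Re (w * cnj w) = (norm w)\<^sup>2" for w
      unfolding complex_norm_square[symmetric] by (rule Re_complex_of_real)
    ultimately show "e\<^sup>2 - (norm (z - a))\<^sup>2 = Re (Q z)"
      unfolding Q_def minus_complex.sel Re_sum Re_complex_of_real by (simp only:)
  qed blast
qed

lemma locally_finite_compact:
  fixes \<N> :: "'a::t2_space set set"
  assumes N: "locally_finite_in euclidean \<N>" and K: "compact K"
  shows "finite {N \<in> \<N>. N \<inter> K \<noteq> {}}"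
proof -
  have "\<forall>x. \<exists>T. open T \<and> x \<in> T \<and> finite {N \<in> \<N>. N \<inter> T \<noteq> {}}"
    using N unfolding locally_finite_in_def by simp
  then obtain T where T: "\<And>x. open (T x) \<and> x \<in> T x \<and> finite {N \<in> \<N>. N \<inter> T x \<noteq> {}}" by metis
  obtain D where D: "D \<subseteq> K" "finite D" "K \<subseteq> (\<Union>x\<in>D. T x)"
  proof (rule compactE_image[OF K, of K T])
    show "open (T x)" for x using T by blast
    show "K \<subseteq> (\<Union>x\<in>K. T x)" using T by blast
  qed
  have "{N \<in> \<N>. N \<inter> K \<noteq> {}} \<subseteq> (\<Union>x\<in>D. {N \<in> \<N>. N \<inter> T x \<noteq> {}})" using D(3) by blast
  then show ?thesis by (rule finite_subset) (use D(2) T in blast)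
qed

context complex_manifold
begin

text \<open>A flat bump on a coordinate ball, extended by zero; \<open>U\<close> and
  \<open>C\<close> come from the open and the closed ball. Positivity exactly on \<open>U\<close>
  allows the positivity sets to be used as a cover.\<close>

lemma bump_at:
  assumes V: "open V" "p \<in> V"
  obtains r U C where "open U" "p \<in> U" "U \<subseteq> C" "C \<subseteq> V" "compact C"
    "\<And>x. r x \<ge> 0" "\<And>x. r x > 0 \<longleftrightarrow> x \<in> U" "smooth_fun A UNIV (\<lambda>x. complex_of_real (r x))"
proof -
  define c where "c = chart_at A p"
  have c: "c \<in> A" "p \<in> fst c" unfolding c_def by (rule chart_at)+
  have "snd c p \<in> chart_image c V" by (rule chart_imageI[OF c(2) V(2)])
  then obtain e where e: "e > 0" "cball (snd c p) e \<subseteq> chart_image c V"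
    using chart_image_open[OF c(1) V(1)] open_contains_cball by blast
  define U where "U = fst c \<inter> snd c -` ball (snd c p) e"
  define C where "C = chart_inv c ` cball (snd c p) e"
  define f where "f z = bump_fun 0 (e\<^sup>2 - (norm (z - snd c p))\<^sup>2)" for z
  define r where "r x = (if x \<in> fst c then f (snd c x) else 0)" for x
  note h = chart_homeomorphism[OF c(1)]
  have C: "C \<subseteq> V" "C \<subseteq> fst c" using e(2) chart_imageE[OF c(1)] unfolding C_def by blast+
  have "continuous_on (cball (snd c p) e) (chart_inv c)"
    using h e(2) chart_image_mono[of V UNIV c] unfolding homeomorphism_def by (blast intro: continuous_on_subset)
  then have cC: "compact C" unfolding C_def by (intro compact_continuous_image compact_cball)
  have U: "U \<subseteq> C"
  proof
    fix x assume "x \<in> U"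
    then have "x = chart_inv c (snd c x)" "snd c x \<in> cball (snd c p) e"
      unfolding U_def using chart_inv_snd[OF c(1)] by auto
    then show "x \<in> C" unfolding C_def by (rule image_eqI)
  qed
  have "f z > 0 \<longleftrightarrow> z \<in> ball (snd c p) e" for z
  proof -
    have "f z > 0 \<longleftrightarrow> \<not> e\<^sup>2 \<le> (norm (z - snd c p))\<^sup>2" unfolding f_def bump_fun_pos by linarith
    also have "\<dots> \<longleftrightarrow> \<not> e \<le> norm (z - snd c p)" by (subst power_mono_iff) (use e(1) in auto)
    finally show ?thesis unfolding mem_ball dist_norm norm_minus_commute[of "snd c p"] by linarith
  qed
  then have rU: "r x > 0 \<longleftrightarrow> x \<in> U" for x
    by (auto simp: r_def U_def)
  have rnn: "r x \<ge> 0" for x by (simp add: r_def f_def bump_fun_pos)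
  have oU: "open U" unfolding U_def
    using h by (intro continuous_open_preimage open_ball chart_open[OF c(1)]) (simp add: homeomorphism_def)
  have sm: "smooth_fun A UNIV (\<lambda>x. complex_of_real (r x))"
  proof (rule smooth_fun_local)
    fix x
    show "\<exists>T. open T \<and> x \<in> T \<and> smooth_fun A T (\<lambda>x. complex_of_real (r x))"
    proof (cases "x \<in> fst c")
      case True
      have "smooth_on (\<lambda>z. complex_of_real (r (chart_inv c z))) (chart_image c (fst c))"
      proof (rule smooth_on_transform[OF chart_image_open[OF c(1) chart_open[OF c(1)]]])
        show "smooth_on (\<lambda>z. complex_of_real (f z)) (chart_image c (fst c))"
          unfolding f_def by (rule smooth_on_subset[OF smooth_on_bump subset_UNIV])
      qed (use chart_imageE[OF c(1)] in \<open>simp add: r_def\<close>)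
      then have "smooth_fun A (fst c) (\<lambda>x. complex_of_real (r x))"
        by (rule smooth_fun_chartI[OF c(1) chart_open[OF c(1)] subset_refl])
      then show ?thesis using True chart_open[OF c(1)] by (intro exI[of _ "fst c"] conjI)
    next
      case False
      \<comment> \<open>In a Hausdorff space the compact \<open>C\<close> is closed, so off the
        chart domain its complement is a neighbourhood on which the bump vanishes.\<close>
      have o: "open (- C)" using compact_imp_closed[OF cC] by blast
      have "smooth_fun A (- C) (\<lambda>x. complex_of_real (r x))"
      proof (subst smooth_fun_cong[OF o])
        show "smooth_fun A (- C) (\<lambda>x. 0)" by (rule smooth_fun_const)
        fix x assume "x \<in> - C"
        then have "\<not> r x > 0" using rU U by blast
        then show "complex_of_real (r x) = 0" using rnn[of x] by simp
      qed
      moreover have "x \<in> - C" using False C(2) by blast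
      ultimately show ?thesis using o by (intro exI[of _ "- C"] conjI)
    qed
  qed
  have pU: "p \<in> U" using c(2) e(1) by (simp add: U_def)
  show thesis by (rule that[OF oU pU U C(1) cC rnn rU sm])
qed

text \<open>
  The members of \<open>I\<close> form a locally finite refinement of the positivity sets of bump functions
  supported in the members of a first locally finite cover by relatively compact sets; relative
  compactness keeps the supports locally finite.
\<close>

lemma bump_family:
  assumes para: "paracompact_space (euclidean :: 'x topology)"
    and good: "\<And>p. \<exists>V. open V \<and> p \<in> V \<and> good V"
    and mono: "\<And>V V'. good V \<Longrightarrow> open V' \<Longrightarrow> V' \<subseteq> V \<Longrightarrow> good V'"
  obtains I :: "'x set set" and V C :: "'x set \<Rightarrow> 'x set" and r :: "'x set \<Rightarrow> 'x \<Rightarrow> real" where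
    "\<And>i. i \<in> I \<Longrightarrow> open (V i) \<and> good (V i) \<and> compact (C i) \<and> C i \<subseteq> V i"
    "\<And>i. i \<in> I \<Longrightarrow> smooth_fun A UNIV (\<lambda>p. complex_of_real (r i p))"
    "\<And>i p. r i p \<ge> 0" "\<And>i p. p \<notin> C i \<Longrightarrow> r i p = 0"
    "\<And>p. \<exists>T. open T \<and> p \<in> T \<and> finite {i \<in> I. C i \<inter> T \<noteq> {}}"
    "\<And>p. \<exists>i\<in>I. r i p > 0"
proof -
  have para: "\<exists>\<V>. (\<forall>V\<in>\<V>. open V) \<and> \<Union>\<V> = UNIV \<and> (\<forall>V\<in>\<V>. \<exists>U\<in>\<U>. V \<subseteq> U) \<and> locally_finite_in euclidean \<V>"
    if "\<And>U. U \<in> \<U> \<Longrightarrow> open U" "\<Union>\<U> = UNIV" for \<U> :: "'x set set"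
    using para that unfolding paracompact_space_def by simp
  \<comment> \<open>The first cover consists of relatively compact good sets; compactness is used
    below to count refining sets.\<close>
  define \<U> where "\<U> = {U. open U \<and> good U \<and> (\<exists>K. compact K \<and> U \<subseteq> K)}"
  have "p \<in> \<Union>\<U>" for p
  proof -
    obtain V where V: "open V" "p \<in> V" "good V" using good by blast
    obtain r :: "'x \<Rightarrow> real" and U C where U: "open U" "p \<in> U" "U \<subseteq> C" "C \<subseteq> V" "compact C"
      by (rule bump_at[OF V(1,2)])
    then have "U \<in> \<U>" unfolding \<U>_def using mono[OF V(3) U(1)] by blast
    then show ?thesis using U(2) by blast
  qed
  then have "\<Union>\<U> = UNIV" by blast
  moreover have "open U" if "U \<in> \<U>" for U using that unfolding \<U>_def by blast
  ultimately obtain \<V> where V: "(\<forall>V\<in>\<V>. open V) \<and> \<Union>\<V> = UNIV \<and> (\<forall>V\<in>\<V>. \<exists>U\<in>\<U>. V \<subseteq> U) \<and> locally_finite_in euclidean \<V>"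
    using para[of \<U>] by metis
  have \<V>: "\<And>V. V \<in> \<V> \<Longrightarrow> open V" "\<Union>\<V> = UNIV" "\<And>V. V \<in> \<V> \<Longrightarrow> \<exists>U\<in>\<U>. V \<subseteq> U" "locally_finite_in euclidean \<V>"
    using V by simp_all
  have g: "good V" "\<exists>K. compact K \<and> V \<subseteq> K" if V: "V \<in> \<V>" for V
  proof -
    obtain U where U: "U \<in> \<U>" "V \<subseteq> U" using \<V>(3)[OF V] by (rule bexE)
    then show "good V" using mono[of U V] \<V>(1)[OF V] unfolding \<U>_def by simp
    show "\<exists>K. compact K \<and> V \<subseteq> K" using U unfolding \<U>_def by blast
  qed
  have "\<forall>p. \<exists>V. V \<in> \<V> \<and> p \<in> V"
  proof
    fix p
    have "p \<in> \<Union>\<V>" unfolding \<V>(2) by (rule UNIV_I)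
    then show "\<exists>V. V \<in> \<V> \<and> p \<in> V" by (simp add: Union_iff Bex_def)
  qed
  then obtain vv where vv: "\<And>p. vv p \<in> \<V> \<and> p \<in> vv p" by metis
  define B where "B p r U C \<longleftrightarrow> open U \<and> p \<in> U \<and> U \<subseteq> C \<and> C \<subseteq> vv p \<and> compact C \<and> (\<forall>x. r x \<ge> 0) \<and> (\<forall>x. r x > 0 \<longleftrightarrow> x \<in> U)
      \<and> smooth_fun A UNIV (\<lambda>x. complex_of_real (r x))" for p r U C
  have "\<forall>p. \<exists>r U C. B p r U C"
  proof
    fix p
    have v: "open (vv p)" "p \<in> vv p" using vv \<V>(1) by auto
    show "\<exists>r U C. B p r U C"
    proof (rule bump_at[OF v])
      fix r :: "'x \<Rightarrow> real" and U C
      assume "open U" "p \<in> U" "U \<subseteq> C" "C \<subseteq> vv p" "compact C"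
        "\<And>x. r x \<ge> 0" "\<And>x. r x > 0 \<longleftrightarrow> x \<in> U" "smooth_fun A UNIV (\<lambda>x. complex_of_real (r x))"
      then show "\<exists>r U C. B p r U C"
        unfolding B_def by (intro exI[of _ r] exI[of _ U] exI[of _ C] conjI allI)
    qed
  qed
  then obtain R U C where "\<And>p. B p (R p) (U p) (C p)" by metis
  then have R: "open (U p)" "p \<in> U p" "U p \<subseteq> C p" "C p \<subseteq> vv p" "compact (C p)" "R p x \<ge> 0" "R p x > 0 \<longleftrightarrow> x \<in> U p"
      "smooth_fun A UNIV (\<lambda>x. complex_of_real (R p x))" for p x
    unfolding B_def by simp_all
  have "open T" if "T \<in> range U" for T
    using that by (rule rangeE) (simp add: R(1))
  moreover have "\<Union>(range U) = UNIV"
  proof (rule sym, rule UNIV_eq_I)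
    show "p \<in> \<Union>(range U)" for p using R(2)[of p] by (rule UN_I[OF UNIV_I])
  qed
  ultimately obtain \<N> where N: "(\<forall>V\<in>\<N>. open V) \<and> \<Union>\<N> = UNIV \<and> (\<forall>V\<in>\<N>. \<exists>T\<in>range U. V \<subseteq> T) \<and> locally_finite_in euclidean \<N>"
    using para[of "range U"] by metis
  have \<N>: "\<Union>\<N> = UNIV" "locally_finite_in euclidean \<N>" using N by simp_all
  have "\<forall>N. \<exists>x. N \<in> \<N> \<longrightarrow> N \<subseteq> U x" using N by (simp add: Bex_def image_iff) metis
  then obtain x where x: "\<And>N. N \<in> \<N> \<Longrightarrow> N \<subseteq> U (x N)" by metis
  define I where "I = \<N> - {{}}"
  have sub: "U (x i) \<subseteq> vv (x i)" for i using R(3,4) by (rule subset_trans)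
  show thesis
  proof (rule that[of I "\<lambda>i. vv (x i)" "\<lambda>i. C (x i)" "\<lambda>i. R (x i)"])
    show "open (vv (x i)) \<and> good (vv (x i)) \<and> compact (C (x i)) \<and> C (x i) \<subseteq> vv (x i)" for i
      using R(4,5)[of "x i"] vv[of "x i"] \<V>(1) g(1) by simp
    show "smooth_fun A UNIV (\<lambda>p. complex_of_real (R (x i) p))" for i by (rule R(8))
    show "R (x i) p \<ge> 0" for i p by (rule R(6))
    show "R (x i) p = 0" if "p \<notin> C (x i)" for i p
    proof -
      have "\<not> R (x i) p > 0" unfolding R(7) using that R(3)[of "x i"] by (rule contra_subsetD[rotated])
      then show ?thesis using R(6)[of "x i" p] by linarith
    qed
    show "\<exists>i\<in>I. R (x i) p > 0" for p
    proof -
      have "p \<in> \<Union>\<N>" unfolding \<N>(1) by (rule UNIV_I)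
      then obtain N where N: "N \<in> \<N>" "p \<in> N" by (rule UnionE)
      have "R (x N) p > 0" unfolding R(7) using x[OF N(1)] N(2) by (rule subsetD)
      moreover have "N \<in> I" using N unfolding I_def by blast
      ultimately show ?thesis by (rule bexI)
    qed
    show "\<exists>T. open T \<and> p \<in> T \<and> finite {i \<in> I. C (x i) \<inter> T \<noteq> {}}" for p
    proof -
      obtain T where T: "open T" "p \<in> T" "finite {V \<in> \<V>. V \<inter> T \<noteq> {}}"
        using \<V>(4) unfolding locally_finite_in_def by auto
      \<comment> \<open>A nonempty refining set inside \<open>V\<close> meets the compact set around
        \<open>V\<close>, and local finiteness allows only finitely many of those.\<close>
      have fin: "finite {N \<in> \<N>. N \<noteq> {} \<and> N \<subseteq> V}" if V: "V \<in> \<V>" for V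
      proof -
        obtain K where K: "compact K" "V \<subseteq> K" using g(2)[OF V] by (elim exE conjE)
        have "{N \<in> \<N>. N \<noteq> {} \<and> N \<subseteq> V} \<subseteq> {N \<in> \<N>. N \<inter> K \<noteq> {}}" using K(2) by blast
        then show ?thesis using locally_finite_compact[OF \<N>(2) K(1)] by (rule finite_subset)
      qed
      \<comment> \<open>A support that meets \<open>T\<close> lies in one of the finitely many
        members of the first cover that meet \<open>T\<close>.\<close>
      have "{i \<in> I. C (x i) \<inter> T \<noteq> {}} \<subseteq> (\<Union>V\<in>{V \<in> \<V>. V \<inter> T \<noteq> {}}. {N \<in> \<N>. N \<noteq> {} \<and> N \<subseteq> V})"
      proof
        fix i assume i: "i \<in> {i \<in> I. C (x i) \<inter> T \<noteq> {}}"
        then have I: "i \<in> \<N>" "i \<noteq> {}" "C (x i) \<inter> T \<noteq> {}" unfolding I_def by simp_all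
        have "vv (x i) \<inter> T \<noteq> {}" using I(3) R(4)[of "x i"] by blast
        then have "vv (x i) \<in> {V \<in> \<V>. V \<inter> T \<noteq> {}}" using vv[of "x i"] by simp
        moreover have "i \<in> {N \<in> \<N>. N \<noteq> {} \<and> N \<subseteq> vv (x i)}"
          using I(1,2) subset_trans[OF x[OF I(1)] sub] by simp
        ultimately show "i \<in> (\<Union>V\<in>{V \<in> \<V>. V \<inter> T \<noteq> {}}. {N \<in> \<N>. N \<noteq> {} \<and> N \<subseteq> V})"
          by (rule UN_I)
      qed
      moreover have "finite (\<Union>V\<in>{V \<in> \<V>. V \<inter> T \<noteq> {}}. {N \<in> \<N>. N \<noteq> {} \<and> N \<subseteq> V})"
        using T(3) by (rule finite_UN_I) (simp add: fin)
      ultimately have "finite {i \<in> I. C (x i) \<inter> T \<noteq> {}}" by (rule finite_subset)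
      then show ?thesis using T(1,2) by blast
    qed
  qed
qed

end

section \<open>Contracting the identity away from the critical set\<close>

lemma conjugate_anticommutator:
  fixes T Ti D M :: "complex mat"
  assumes c: "T \<in> carrier_mat n n" "Ti \<in> carrier_mat n n" "D \<in> carrier_mat n n" "M \<in> carrier_mat n n"
    and inv: "Ti * T = 1\<^sub>m n" and DM: "(T * D * Ti) * M + M * (T * D * Ti) = 1\<^sub>m n"
  shows "D * (Ti * M * T) + (Ti * M * T) * D = 1\<^sub>m n"
proof -
  note m = mult_carrier_mat[of _ n n _ n] and as = assoc_mult_mat[of _ n n _ n _ n]
  have TiT: "Ti * (T * X) = X" if X: "X \<in> carrier_mat n n" for X
  proof -
    have "Ti * (T * X) = Ti * T * X" by (rule as[OF c(2,1) X, symmetric])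
    then show ?thesis unfolding inv left_mult_one_mat[OF X] .
  qed
  have "Ti * ((T * D * Ti) * M + M * (T * D * Ti)) * T = Ti * ((T * D * Ti) * M) * T + Ti * (M * (T * D * Ti)) * T"
    by (simp add: mult_add_distrib_mat[of _ n n _ n] add_mult_distrib_mat[of _ n n _ _ n] m c)
  also have "Ti * ((T * D * Ti) * M) * T = D * (Ti * M * T)" by (simp add: as m c TiT)
  also have "Ti * (M * (T * D * Ti)) * T = (Ti * M * T) * D" by (simp add: as m c inv right_mult_one_mat[OF c(3)])
  finally show ?thesis unfolding DM using c inv by simp
qed

lemma sum_rearrange:
  fixes e f :: "nat \<Rightarrow> complex"
  shows "(\<Sum>m<r. (\<Sum>n<r. e n * (x * (\<Sum>i\<in>J. c i * q i n m))) * f m)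
    = x * (\<Sum>i\<in>J. \<Sum>m<r. \<Sum>n<r. c i * (e n * q i n m * f m))"
proof -
  have "(\<Sum>m<r. (\<Sum>n<r. e n * (x * (\<Sum>i\<in>J. c i * q i n m))) * f m)
      = (\<Sum>m<r. \<Sum>n<r. \<Sum>i\<in>J. x * (c i * (e n * q i n m * f m)))"
    by (simp add: sum_distrib_left sum_distrib_right mult_ac)
  also have "\<dots> = (\<Sum>m<r. \<Sum>i\<in>J. \<Sum>n<r. x * (c i * (e n * q i n m * f m)))"
    by (intro sum.cong refl sum.swap)
  also have "\<dots> = (\<Sum>i\<in>J. \<Sum>m<r. \<Sum>n<r. x * (c i * (e n * q i n m * f m)))"
    by (rule sum.swap)
  finally show ?thesis by (simp only: sum_distrib_left)
qed

context complex_manifold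
begin

text \<open>The index set of the sum varies with the point. Near a given point it can be replaced by
  one fixed finite set, since the additional terms vanish.\<close>

lemma smooth_fun_locally_finite_sum:
  assumes U: "open U" and h: "\<And>k. k \<in> I \<Longrightarrow> smooth_fun A U (h k)" "\<And>p k. k \<in> I \<Longrightarrow> p \<notin> C k \<Longrightarrow> h k p = 0"
    and fin: "\<And>p. \<exists>T. open T \<and> p \<in> T \<and> finite {k \<in> I. C k \<inter> T \<noteq> {}}"
  shows "smooth_fun A U (\<lambda>p. \<Sum>k\<in>{k \<in> I. p \<in> C k}. h k p)"
proof (rule smooth_fun_local)
  fix p assume p: "p \<in> U"
  obtain T where T: "open T" "p \<in> T" "finite {k \<in> I. C k \<inter> T \<noteq> {}}" using fin[of p] by blast
  have o: "open (U \<inter> T)" using U T(1) by (rule open_Int)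
  have "smooth_fun A (U \<inter> T) (\<lambda>p. \<Sum>k\<in>{k \<in> I. p \<in> C k}. h k p)"
  proof (subst smooth_fun_cong[OF o])
    show "smooth_fun A (U \<inter> T) (\<lambda>p. \<Sum>k\<in>{k \<in> I. C k \<inter> T \<noteq> {}}. h k p)"
      by (rule smooth_fun_sum[OF o]) (rule smooth_fun_subset[OF h(1) Int_lower1], simp)
    fix p assume "p \<in> U \<inter> T"
    then show "(\<Sum>k\<in>{k \<in> I. p \<in> C k}. h k p) = (\<Sum>k\<in>{k \<in> I. C k \<inter> T \<noteq> {}}. h k p)"
      by (intro sum.mono_neutral_left T(3)) (auto simp: h(2))
  qed
  then show "\<exists>S. open S \<and> p \<in> S \<and> smooth_fun A S (\<lambda>p. \<Sum>k\<in>{k \<in> I. p \<in> C k}. h k p)"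
    using o p T(2) by (intro exI[of _ "U \<inter> T"] conjI IntI)
qed

end

context landau_ginzburg
begin

text \<open>A smooth endomorphism \<open>Q\<close> over \<open>V\<close> with
  \<open>D Q + Q D = 1\<close>. No parity is imposed, which keeps the local construction and the
  gluing simple.\<close>

definition section_homotopy :: "'x factorization \<Rightarrow> 'x set \<Rightarrow> ('x \<Rightarrow> nat \<Rightarrow> nat \<Rightarrow> complex) \<Rightarrow> bool" where
  "section_homotopy a V Q \<longleftrightarrow> (let r = fact_rank a in
     (\<forall>t\<in>bundle_trivs (fact_bundle a). \<forall>t'\<in>bundle_trivs (fact_bundle a). \<forall>i j. smooth_fun A (fst t \<inter> fst t' \<inter> V)
        (\<lambda>p. sandwich r r (ent r r (snd t' p)) (Q p) (ent r r (mat_inv (snd t p))) i j)) \<and>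
     (\<forall>p\<in>V. \<forall>i j. (\<Sum>l<r. ent r r (fact_map a p) i l * ent r r (mat r r (\<lambda>(i, j). Q p i j)) l j)
        + (\<Sum>l<r. ent r r (mat r r (\<lambda>(i, j). Q p i j)) i l * ent r r (fact_map a p) l j) = ent r r (1\<^sub>m r) i j))"

lemma section_homotopy_subset: "section_homotopy a V Q \<Longrightarrow> V' \<subseteq> V \<Longrightarrow> section_homotopy a V' Q"
  unfolding section_homotopy_def Let_def by (meson Int_mono smooth_fun_subset subset_iff subset_refl)

text \<open>The derivative of the matrix of \<open>D\<close> depends on chart, frame and direction.
  This is harmless: only the anticommutation relation is needed, and it survives conjugation back to
  the fibre.\<close>

lemma local_homotopy:
  assumes a: "obj a" and p0: "p0 \<notin> critical_set A W"
  shows "\<exists>V Q. open V \<and> p0 \<in> V \<and> section_homotopy a V Q"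
proof -
  let ?r = "fact_rank a" and ?E = "fact_bundle a"
  define c where "c = chart_at A p0"
  define t0 where "t0 = triv_at ?E p0"
  note E = obj_bundle(1)[OF a]
  have c: "c \<in> A" "p0 \<in> fst c" unfolding c_def by (rule chart_at)+
  have t0: "t0 \<in> bundle_trivs ?E" "p0 \<in> fst t0" unfolding t0_def by (rule triv_at[OF E])+
  let ?f = "\<lambda>z. W (chart_inv c z)"
  have f: "cholomorphic_on ?f (chart_image c UNIV)" using W_holomorphic c(1) unfolding holomorphic_fun_def by simp
  have z0: "snd c p0 \<in> chart_image c UNIV" by (rule chart_imageI[OF c(2) UNIV_I])
  obtain v where "del_at ?f (snd c p0) v \<noteq> 0" using p0 unfolding critical_set_def c_def by blast
  \<comment> \<open>For a holomorphic function the complex-linear part is the whole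
    derivative.\<close>
  moreover have "del_at ?f (snd c p0) v = frechet_derivative ?f (at (snd c p0)) v"
    unfolding del_at_def cholomorphic_onD(2)[OF f z0] by (simp add: mult.assoc[symmetric])
  ultimately have v: "frechet_derivative ?f (at (snd c p0)) v \<noteq> 0" by simp
  define w where "w z = frechet_derivative ?f (at z) v" for z
  have w: "cholomorphic_on w (chart_image c UNIV)"
    unfolding w_def[abs_def] by (rule cholomorphic_on_frechet_derivative[OF f chart_image_UNIV_open[OF c(1)]])
  define S where "S = chart_image c (fst t0 \<inter> fst t0)"
  have S: "open S" unfolding S_def by (rule triv_overlap_open[OF a a t0(1) t0(1) c(1)])
  have SU: "S \<subseteq> chart_image c UNIV" unfolding S_def by (rule chart_image_mono[OF subset_UNIV])
  define D where "D i j z = ent ?r ?r (snd t0 (chart_inv c z) * fact_map a (chart_inv c z) * mat_inv (snd t0 (chart_inv c z))) i j" for i j z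
  have D: "cholomorphic_on (D i j) S" for i j
    unfolding D_def[abs_def] S_def by (rule section_triv_holomorphic[OF a c(1) t0(1) t0(1)])
  define D' where "D' i j z = frechet_derivative (D i j) (at z) v" for i j z
  have D': "cholomorphic_on (D' i j) S" for i j
    unfolding D'_def[abs_def] by (rule cholomorphic_on_frechet_derivative[OF D S])
  have T: "snd t0 p \<in> carrier_mat ?r ?r" "mat_inv (snd t0 p) \<in> carrier_mat ?r ?r" "snd t0 p * mat_inv (snd t0 p) = 1\<^sub>m ?r"
    "mat_inv (snd t0 p) * snd t0 p = 1\<^sub>m ?r" if "p \<in> fst t0" for p
    using bundle_triv[OF E t0(1) that] by simp_all
  have DD: "(\<Sum>l<?r. D i l z * D l j z) = ?f z * ent ?r ?r (1\<^sub>m ?r) i j" if "z \<in> S" for i j z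
  proof -
    let ?p = "chart_inv c z"
    have p: "?p \<in> fst t0" using chart_imageE(2)[OF c(1) that[unfolded S_def]] by simp
    note m = obj_map(1)[OF a, of ?p]
    note mc = mult_carrier_mat[of _ ?r ?r _ ?r] and as = assoc_mult_mat[of _ ?r ?r _ ?r _ ?r]
    have k: "mat_inv (snd t0 ?p) * (snd t0 ?p * X) = X" if "X \<in> carrier_mat ?r ?r" for X
      unfolding as[OF T(2)[OF p] T(1)[OF p] that, symmetric] T(4)[OF p] by (rule left_mult_one_mat[OF that])
    have "(snd t0 ?p * fact_map a ?p * mat_inv (snd t0 ?p)) * (snd t0 ?p * fact_map a ?p * mat_inv (snd t0 ?p))
        = snd t0 ?p * ((fact_map a ?p * fact_map a ?p) * mat_inv (snd t0 ?p))"
      by (simp add: as mc T(1,2)[OF p] m k)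
    also have "\<dots> = W ?p \<cdot>\<^sub>m 1\<^sub>m ?r"
      unfolding obj_map(3)[OF a] using T[OF p] mult_smult_assoc_mat[OF one_carrier_mat T(2)[OF p], of "W ?p"] mult_smult_distrib[OF T(1,2)[OF p], of "W ?p"] by simp
    finally have "ent ?r ?r ((snd t0 ?p * fact_map a ?p * mat_inv (snd t0 ?p)) * (snd t0 ?p * fact_map a ?p * mat_inv (snd t0 ?p))) i j
        = ent ?r ?r (W ?p \<cdot>\<^sub>m 1\<^sub>m ?r) i j" by simp
    then show ?thesis
      unfolding D_def ent_smult[OF one_carrier_mat] by (subst (asm) ent_mult[of _ ?r ?r]) (simp_all add: mc T(1,2)[OF p] m)
  qed
  \<comment> \<open>Both sides of \<open>DD\<close> have the same derivative in the fixed direction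
    \<open>v\<close>.\<close>
  have dDD: "(\<Sum>l<?r. D' i l z * D l j z) + (\<Sum>l<?r. D i l z * D' l j z) = w z * ent ?r ?r (1\<^sub>m ?r) i j" if z: "z \<in> S" for i j z
  proof -
    have "((\<lambda>z. \<Sum>l<?r. D i l z * D l j z) has_derivative (\<lambda>u. \<Sum>l<?r. D i l z * frechet_derivative (D l j) (at z) u
        + frechet_derivative (D i l) (at z) u * D l j z)) (at z)"
      by (intro has_derivative_sum has_derivative_mult cholomorphic_onD(1)[OF D z])
    from has_derivative_transform_within_open[OF this S z DD]
    have "((\<lambda>z. ?f z * ent ?r ?r (1\<^sub>m ?r) i j) has_derivative (\<lambda>u. \<Sum>l<?r. D i l z * frechet_derivative (D l j) (at z) u
        + frechet_derivative (D i l) (at z) u * D l j z)) (at z)" .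
    from has_derivative_unique[OF has_derivative_mult_left[OF cholomorphic_onD(1)[OF f subsetD[OF SU z]]] this]
    have "w z * ent ?r ?r (1\<^sub>m ?r) i j = (\<Sum>l<?r. D i l z * D' l j z + D' i l z * D l j z)"
      unfolding w_def D'_def by (rule fun_cong)
    then show ?thesis by (simp add: sum.distrib add.commute)
  qed
  define O' where "O' = {z \<in> S. w z \<noteq> 0}"
  have wc: "continuous_on S w"
    by (rule smooth_on_continuous[OF cholomorphic_on_smooth[OF cholomorphic_on_subset[OF w SU] S]])
  have "open (S \<inter> w -` (- {0}))" by (rule continuous_open_preimage[OF wc S open_Compl[OF closed_singleton]])
  moreover have "S \<inter> w -` (- {0}) = O'" unfolding O'_def by blast
  ultimately have O': "open O'" by simp
  define V where "V = fst c \<inter> snd c -` O'"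
  have V: "open V" unfolding V_def
    using chart_homeomorphism[OF c(1)] by (intro continuous_open_preimage O' chart_open[OF c(1)]) (simp add: homeomorphism_def)
  have VO: "snd c p \<in> O'" "chart_inv c (snd c p) = p" "p \<in> fst t0" "p \<in> fst c" if "p \<in> V" for p
  proof -
    show 1: "snd c p \<in> O'" "p \<in> fst c" using that unfolding V_def by auto
    show 2: "chart_inv c (snd c p) = p" by (rule chart_inv_snd[OF c(1) 1(2)])
    have "snd c p \<in> chart_image c (fst t0 \<inter> fst t0)" using 1(1) unfolding O'_def S_def by simp
    from chart_imageE(2)[OF c(1) this] show "p \<in> fst t0" unfolding 2 by simp
  qed
  \<comment> \<open>\<open>M\<close> is the solution in the frame \<open>t0\<close>, and
    \<open>Q\<close> carries it back to the fibre bases.\<close>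
  define M where "M p i j = (if i < ?r \<and> j < ?r then inverse (w (snd c p)) * D' i j (snd c p) else 0)" for p i j
  define Q where "Q p = sandwich ?r ?r (ent ?r ?r (mat_inv (snd t0 p))) (M p) (ent ?r ?r (snd t0 p))" for p
  have cV: "z \<in> O'" "chart_inv c z \<in> V" "snd c (chart_inv c z) = z" if "z \<in> chart_image c V" for z
    using VO(1)[OF chart_imageE(2)[OF c(1) that]] chart_imageE[OF c(1) that] by simp_all
  have sM: "smooth_fun A V (\<lambda>p. M p i j)" for i j
  proof (cases "i < ?r \<and> j < ?r")
    case True
    have o: "open (chart_image c V)" by (rule chart_image_open[OF c(1) V])
    have sub: "chart_image c V \<subseteq> S" using cV(1) unfolding O'_def by blast
    show ?thesis
    proof (rule smooth_fun_chartI[OF c(1) V], use VO(4) in blast, rule smooth_on_transform[OF o])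
      show "smooth_on (\<lambda>z. inverse (w z) * D' i j z) (chart_image c V)"
        by (intro smooth_on_mult smooth_on_inverse o cholomorphic_on_smooth[OF cholomorphic_on_subset[OF w subset_trans[OF sub SU]] o]
          cholomorphic_on_smooth[OF cholomorphic_on_subset[OF D' sub] o]) (use cV(1) O'_def in blast)
    qed (use True cV(3) in \<open>simp add: M_def\<close>)
  next
    case False
    show ?thesis unfolding M_def if_not_P[OF False] by (rule smooth_fun_const)
  qed
  have "section_homotopy a V Q"
    unfolding section_homotopy_def Let_def
  proof (intro conjI ballI allI)
    fix t t' i j assume t: "t \<in> bundle_trivs ?E" "t' \<in> bundle_trivs ?E"
    let ?U = "fst t \<inter> fst t' \<inter> V"
    have U: "open ?U" by (intro open_Int V triv_open[OF E t(1)] triv_open[OF E t(2)])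
    have st: "smooth_fun A ?U (\<lambda>p. ent ?r ?r (snd u' p * mat_inv (snd u p)) i j)"
      if u: "u \<in> bundle_trivs ?E" "u' \<in> bundle_trivs ?E" "?U \<subseteq> fst u \<inter> fst u'" for u u' i j
    proof (cases "i < ?r \<and> j < ?r")
      case True
      then have "holomorphic_fun A (fst u \<inter> fst u') (\<lambda>p. (snd u' p * mat_inv (snd u p)) $$ (i, j))"
        using bundle_transition_fun[OF E u(1,2)] by blast
      then show ?thesis unfolding ent_def if_P[OF True] using holomorphic_fun_smooth[OF U] holomorphic_fun_subset u(3) by blast
    next
      case False
      show ?thesis unfolding ent_def if_not_P[OF False] by (rule smooth_fun_const)
    qed
    have eq: "sandwich ?r ?r (ent ?r ?r (snd t' p)) (Q p) (ent ?r ?r (mat_inv (snd t p))) i j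
       = sandwich ?r ?r (ent ?r ?r (snd t' p * mat_inv (snd t0 p))) (M p) (ent ?r ?r (snd t0 p * mat_inv (snd t p))) i j" if p: "p \<in> ?U" for p
    proof -
      have "p \<in> fst t" "p \<in> fst t'" "p \<in> V" using p by auto
      then show ?thesis unfolding Q_def
        by (intro sandwich_sandwich bundle_triv(1,2)[OF E t(1)] bundle_triv(1,2)[OF E t(2)] T(1,2) VO(3)) (auto simp: M_def)
    qed
    show "smooth_fun A ?U (\<lambda>p. sandwich ?r ?r (ent ?r ?r (snd t' p)) (Q p) (ent ?r ?r (mat_inv (snd t p))) i j)"
    proof (subst smooth_fun_cong[OF U eq], assumption)
      show "smooth_fun A ?U (\<lambda>p. sandwich ?r ?r (ent ?r ?r (snd t' p * mat_inv (snd t0 p))) (M p) (ent ?r ?r (snd t0 p * mat_inv (snd t p))) i j)"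
        unfolding sandwich_def
        by (intro smooth_fun_sum smooth_fun_mult U st[OF t0(1) t(2)] st[OF t(1) t0(1)] smooth_fun_subset[OF sM Int_lower2])
          (use VO(3) in auto)
    qed
  next
    fix p i j assume p: "p \<in> V"
    let ?D = "fact_map a p" and ?T = "snd t0 p" and ?Ti = "mat_inv (snd t0 p)" and ?M = "mat ?r ?r (\<lambda>(i, j). M p i j)"
    note TT = T[OF VO(3)[OF p]]
    have z: "snd c p \<in> S" "w (snd c p) \<noteq> 0" using VO(1)[OF p] unfolding O'_def by auto
    have eM: "ent ?r ?r ?M i j = M p i j" for i j by (simp add: ent_mat M_def)
    have eD: "ent ?r ?r (?T * ?D * ?Ti) i j = D i j (snd c p)" for i j unfolding D_def VO(2)[OF p] ..
    have Mc: "?M \<in> carrier_mat ?r ?r" by simp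
    note m = obj_map(1)[OF a, of p]
    have Dc: "?T * ?D * ?Ti \<in> carrier_mat ?r ?r" by (intro mult_carrier_mat[of _ ?r ?r] TT(1,2) m)
    have "?T * ?D * ?Ti * ?M + ?M * (?T * ?D * ?Ti) = 1\<^sub>m ?r"
    proof (rule ent_eqI[of _ ?r ?r])
      fix i j
      have MD: "M p k l = inverse (w (snd c p)) * D' k l (snd c p)" if "k < ?r" "l < ?r" for k l using that by (simp add: M_def)
      show "ent ?r ?r (?T * ?D * ?Ti * ?M + ?M * (?T * ?D * ?Ti)) i j = ent ?r ?r (1\<^sub>m ?r) i j"
      proof (cases "i < ?r \<and> j < ?r")
        case True
        have "ent ?r ?r (?T * ?D * ?Ti * ?M + ?M * (?T * ?D * ?Ti)) i j
            = (\<Sum>l<?r. D i l (snd c p) * M p l j) + (\<Sum>l<?r. M p i l * D l j (snd c p))"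
          unfolding ent_add[OF mult_carrier_mat[OF Dc Mc] mult_carrier_mat[OF Mc Dc]] ent_mult[OF Dc Mc] ent_mult[OF Mc Dc] eM eD ..
        also have "\<dots> = inverse (w (snd c p)) * ((\<Sum>l<?r. D' i l (snd c p) * D l j (snd c p)) + (\<Sum>l<?r. D i l (snd c p) * D' l j (snd c p)))"
          using True by (simp add: MD sum_distrib_left distrib_left mult_ac)
        also have "\<dots> = ent ?r ?r (1\<^sub>m ?r) i j" unfolding dDD[OF z(1)] using z(2) by simp
        finally show ?thesis .
      qed (auto simp: ent_def)
    qed (use mult_carrier_mat[OF Dc Mc] mult_carrier_mat[OF Mc Dc] in simp_all)
    from conjugate_anticommutator[OF TT(1,2) m Mc TT(4) this]
    have id: "?D * (?Ti * ?M * ?T) + (?Ti * ?M * ?T) * ?D = 1\<^sub>m ?r" .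
    have Qc: "?Ti * ?M * ?T \<in> carrier_mat ?r ?r" by (intro mult_carrier_mat[of _ ?r ?r] TT(1,2) Mc)
    have eMf: "ent ?r ?r ?M = M p" by (intro ext) (rule eM)
    have "mat ?r ?r (\<lambda>(i, j). Q p i j) = ?Ti * ?M * ?T"
    proof (rule ent_eqI[OF _ Qc])
      fix i j
      show "ent ?r ?r (mat ?r ?r (\<lambda>(i, j). Q p i j)) i j = ent ?r ?r (?Ti * ?M * ?T) i j"
        unfolding ent_sandwich[OF TT(2) Mc TT(1)] eMf ent_mat Q_def
        by (auto simp: sandwich_def ent_def)
    qed simp
    then show "(\<Sum>l<?r. ent ?r ?r ?D i l * ent ?r ?r (mat ?r ?r (\<lambda>(i, j). Q p i j)) l j)
        + (\<Sum>l<?r. ent ?r ?r (mat ?r ?r (\<lambda>(i, j). Q p i j)) i l * ent ?r ?r ?D l j) = ent ?r ?r (1\<^sub>m ?r) i j"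
      using arg_cong[OF id, of "\<lambda>X. ent ?r ?r X i j"]
      unfolding ent_add[OF mult_carrier_mat[OF m Qc] mult_carrier_mat[OF Qc m]] ent_mult[OF m Qc] ent_mult[OF Qc m] by simp
  qed
  moreover have "p0 \<in> V"
    using c(2) v chart_imageI[OF c(2), of "fst t0 \<inter> fst t0"] t0(2) unfolding V_def O'_def S_def w_def by simp
  ultimately show ?thesis using V by blast
qed

text \<open>The relation \<open>D Q + Q D = 1\<close> is affine in \<open>Q\<close>, so normalised
  averages of local solutions are solutions wherever every contributing piece is one.\<close>

lemma global_homotopy:
  assumes para: "paracompact_space (euclidean :: 'x topology)" and crit: "compact (critical_set A W)" and a: "obj a"
  obtains P K where "\<And>p. P p \<in> carrier_mat (fact_rank a) (fact_rank a)"
    "section_form (fact_rank a) (fact_rank a) P \<in> Hom a a" "compact K"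
    "\<And>p. p \<notin> K \<Longrightarrow> fact_map a p * P p + P p * fact_map a p = 1\<^sub>m (fact_rank a)"
proof -
  let ?r = "fact_rank a" and ?E = "fact_bundle a"
  let ?Z = "critical_set A W"
  note E = obj_bundle(1)[OF a]
  have "\<exists>U C. open U \<and> x \<in> U \<and> U \<subseteq> C \<and> compact C" for x :: 'x
    by (rule bump_at[OF open_UNIV UNIV_I[of x]]) blast
  then obtain U' C' where UC: "\<And>x :: 'x. open (U' x) \<and> x \<in> U' x \<and> U' x \<subseteq> C' x \<and> compact (C' x)" by metis
  have "?Z \<subseteq> (\<Union>x\<in>?Z. U' x)" using UC by blast
  then obtain F where F: "F \<subseteq> ?Z" "finite F" "?Z \<subseteq> (\<Union>x\<in>F. U' x)"
    using compactE_image[OF crit, of ?Z U'] UC by metis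
  define L where "L = (\<Union>x\<in>F. U' x)"
  define K where "K = (\<Union>x\<in>F. C' x)"
  have L: "open L" "?Z \<subseteq> L" "L \<subseteq> K" "compact K"
    using UC F unfolding L_def K_def by (blast intro: compact_UN)+
  define good where "good V \<longleftrightarrow> V \<subseteq> L \<or> (\<exists>Q. section_homotopy a V Q)" for V
  have good: "\<exists>V. open V \<and> p \<in> V \<and> good V" for p
  proof (cases "p \<in> ?Z")
    case True
    then show ?thesis using L(1,2) unfolding good_def by (intro exI[of _ L]) blast
  next
    case False
    from local_homotopy[OF a this] show ?thesis unfolding good_def by blast
  qed
  have mono: "good V \<Longrightarrow> open V' \<Longrightarrow> V' \<subseteq> V \<Longrightarrow> good V'" for V V'
    unfolding good_def using section_homotopy_subset subset_trans by metis
  show thesis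
  proof (rule bump_family[OF para good mono])
    fix I :: "'x set set" and V C :: "'x set \<Rightarrow> 'x set" and g :: "'x set \<Rightarrow> 'x \<Rightarrow> real"
    assume I: "\<And>i. i \<in> I \<Longrightarrow> open (V i) \<and> good (V i) \<and> compact (C i) \<and> C i \<subseteq> V i"
      and sg: "\<And>i. i \<in> I \<Longrightarrow> smooth_fun A UNIV (\<lambda>p. complex_of_real (g i p))"
      and g: "\<And>i p. g i p \<ge> 0" "\<And>i p. p \<notin> C i \<Longrightarrow> g i p = 0"
      and fin: "\<And>p. \<exists>T. open T \<and> p \<in> T \<and> finite {i \<in> I. C i \<inter> T \<noteq> {}}"
      and pos: "\<And>p. \<exists>i\<in>I. g i p > 0"
    define J where "J p = {i \<in> I. p \<in> C i}" for p
    have J: "finite (J p)" for p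
    proof -
      obtain T where T: "p \<in> T" "finite {i \<in> I. C i \<inter> T \<noteq> {}}" using fin by blast
      show ?thesis by (rule finite_subset[OF _ T(2)]) (use T(1) J_def in blast)
    qed
    \<comment> \<open>Pieces without a local solution contribute the zero section, which is smooth;
      they spoil the relation only inside \<open>K\<close>.\<close>
    define q where "q i = (if \<exists>Q. section_homotopy a (V i) Q then SOME Q. section_homotopy a (V i) Q else (\<lambda>p k l. 0))" for i
    have q: "section_homotopy a (V i) (q i)" if "\<exists>Q. section_homotopy a (V i) Q" for i
      unfolding q_def if_P[OF that] by (rule someI_ex[OF that])
    define s where "s p = (\<Sum>i\<in>J p. g i p)" for p
    have s: "s p > 0" for p
    proof -
      obtain i where i: "i \<in> I" "g i p > 0" using pos by blast
      then have "i \<in> J p" using g(2)[of p i] unfolding J_def by force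
      then have "g i p \<le> s p" unfolding s_def by (rule member_le_sum) (simp_all add: g(1) J)
      then show ?thesis using i(2) by linarith
    qed
    \<comment> \<open>Division by the sum of the weights turns the bump functions into a partition
      of unity.\<close>
    define x where "x p = inverse (complex_of_real (s p))" for p
    have sx: "smooth_fun A UNIV x"
    proof -
      have "smooth_fun A UNIV (\<lambda>p. \<Sum>i\<in>{i \<in> I. p \<in> C i}. complex_of_real (g i p))"
        by (rule smooth_fun_locally_finite_sum[OF open_UNIV sg _ fin]) (simp_all add: g(2))
      then have "smooth_fun A UNIV (\<lambda>p. complex_of_real (s p))" unfolding s_def J_def of_real_sum .
      then show ?thesis unfolding x_def[abs_def] by (rule smooth_fun_inverse[OF open_UNIV]) (simp add: less_imp_neq[OF s, symmetric])
    qed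
    define P where "P p = mat ?r ?r (\<lambda>(k, l). x p * (\<Sum>i\<in>J p. complex_of_real (g i p) * q i p k l))" for p
    have Pc: "P p \<in> carrier_mat ?r ?r" for p by (simp add: P_def)
    have eP: "ent ?r ?r (P p) k l = x p * (\<Sum>i\<in>J p. complex_of_real (g i p) * ent ?r ?r (mat ?r ?r (\<lambda>(k, l). q i p k l)) k l)" for p k l
      by (cases "k < ?r"; cases "l < ?r") (simp_all add: P_def ent_mat)
    have "section_form ?r ?r P \<in> Hom a a"
    proof (rule Hom_section[OF a a Pc])
      fix c t t' k l
      assume c: "c \<in> A" and t: "t \<in> bundle_trivs ?E" "t' \<in> bundle_trivs ?E"
      let ?U = "fst t \<inter> fst t'"
      have U: "open ?U" by (intro open_Int triv_open[OF E t(1)] triv_open[OF E t(2)])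
      let ?h = "\<lambda>i p. complex_of_real (g i p) * sandwich ?r ?r (ent ?r ?r (snd t' p)) (q i p) (ent ?r ?r (mat_inv (snd t p))) k l"
      have h: "smooth_fun A ?U (?h i)" if i: "i \<in> I" for i
      proof (rule smooth_fun_local)
        fix p assume p: "p \<in> ?U"
        show "\<exists>T. open T \<and> p \<in> T \<and> smooth_fun A T (?h i)"
        proof (cases "p \<in> C i")
          case True
          have o: "open (?U \<inter> V i)" using open_Int[OF U, of "V i"] I[OF i] by simp
          have "smooth_fun A (?U \<inter> V i) (\<lambda>p. sandwich ?r ?r (ent ?r ?r (snd t' p)) (q i p) (ent ?r ?r (mat_inv (snd t p))) k l)"
          proof (cases "\<exists>Q. section_homotopy a (V i) Q")
            case True
            from q[OF this] show ?thesis unfolding section_homotopy_def Let_def using t by blast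
          next
            case False
            show ?thesis unfolding q_def if_not_P[OF False] sandwich_def by (simp add: smooth_fun_const)
          qed
          then have "smooth_fun A (?U \<inter> V i) (?h i)"
            by (rule smooth_fun_mult[OF o smooth_fun_subset[OF sg[OF i] subset_UNIV]])
          then show ?thesis using p True I[OF i] o by (intro exI[of _ "?U \<inter> V i"] conjI) auto
        next
          case False
          have o: "open (- C i)" using I[OF i] compact_imp_closed by blast
          have "smooth_fun A (- C i) (?h i)"
            by (subst smooth_fun_cong[OF o, of _ "\<lambda>p. 0"]) (simp_all add: g(2) smooth_fun_const)
          then show ?thesis using o False by (intro exI[of _ "- C i"] conjI) auto
        qed
      qed
      have "smooth_fun A ?U (\<lambda>p. x p * (\<Sum>i\<in>{i \<in> I. p \<in> C i}. ?h i p))"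
        by (rule smooth_fun_mult[OF U smooth_fun_subset[OF sx subset_UNIV] smooth_fun_locally_finite_sum[OF U h _ fin]]) (simp_all add: g(2))
      then have "smooth_on (\<lambda>z. x (chart_inv c z) * (\<Sum>i\<in>{i \<in> I. chart_inv c z \<in> C i}. ?h i (chart_inv c z))) (chart_image c ?U)"
        unfolding smooth_fun_def using c by blast
      then show "smooth_on (\<lambda>z. ent ?r ?r (snd t' (chart_inv c z) * P (chart_inv c z) * mat_inv (snd t (chart_inv c z))) k l) (chart_image c ?U)"
      proof (rule smooth_on_transform[OF triv_overlap_open[OF a a t c]])
        fix z assume z: "z \<in> chart_image c ?U"
        let ?p = "chart_inv c z"
        have p: "?p \<in> fst t" "?p \<in> fst t'" using chart_imageE(2)[OF c z] by auto
        have "ent ?r ?r (snd t' ?p * P ?p * mat_inv (snd t ?p)) k l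
            = (\<Sum>m<?r. (\<Sum>n<?r. ent ?r ?r (snd t' ?p) k n * (x ?p * (\<Sum>i\<in>J ?p. complex_of_real (g i ?p) * q i ?p n m))) * ent ?r ?r (mat_inv (snd t ?p)) m l)"
          unfolding ent_sandwich[OF bundle_triv(1)[OF E t(2) p(2)] Pc bundle_triv(2)[OF E t(1) p(1)]] sandwich_def
          by (intro sum.cong refl arg_cong2[of _ _ _ _ "(*)"]) (simp add: eP ent_mat)
        also have "\<dots> = x ?p * (\<Sum>i\<in>J ?p. \<Sum>m<?r. \<Sum>n<?r. complex_of_real (g i ?p) * (ent ?r ?r (snd t' ?p) k n * q i ?p n m * ent ?r ?r (mat_inv (snd t ?p)) m l))"
          by (rule sum_rearrange)
        also have "\<dots> = x ?p * (\<Sum>i\<in>{i \<in> I. ?p \<in> C i}. ?h i ?p)"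
          unfolding sandwich_def J_def sum_distrib_left sum_distrib_right ..
        finally show "ent ?r ?r (snd t' ?p * P ?p * mat_inv (snd t ?p)) k l = x ?p * (\<Sum>i\<in>{i \<in> I. ?p \<in> C i}. ?h i ?p)" .
      qed
    qed
    note PH = this
    have "fact_map a p * P p + P p * fact_map a p = 1\<^sub>m ?r" if p: "p \<notin> K" for p
    proof (rule ent_eqI[of _ ?r ?r])
      note m = obj_map(1)[OF a, of p]
      let ?q = "\<lambda>i. ent ?r ?r (mat ?r ?r (\<lambda>(k, l). q i p k l))" and ?D = "ent ?r ?r (fact_map a p)"
      show "fact_map a p * P p + P p * fact_map a p \<in> carrier_mat ?r ?r" using m Pc[of p] by simp
      fix k l
      have hom: "(\<Sum>n<?r. ?D k n * ?q i n l) + (\<Sum>n<?r. ?q i k n * ?D n l) = ent ?r ?r (1\<^sub>m ?r) k l" if i: "i \<in> J p" for i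
      proof -
        have iI: "i \<in> I" "p \<in> V i" using i I unfolding J_def by auto
        \<comment> \<open>A piece that reaches a point outside \<open>K\<close> is not contained in
          \<open>L\<close>, so being good forces it to carry a local solution.\<close>
        then have "\<not> V i \<subseteq> L" using p L(3) by blast
        then have "\<exists>Q. section_homotopy a (V i) Q" using I[OF iI(1)] unfolding good_def by blast
        from q[OF this] show ?thesis using iI(2) unfolding section_homotopy_def Let_def by blast
      qed
      have "ent ?r ?r (fact_map a p * P p + P p * fact_map a p) k l
          = (\<Sum>n<?r. ?D k n * (x p * (\<Sum>i\<in>J p. complex_of_real (g i p) * ?q i n l)))
            + (\<Sum>n<?r. (x p * (\<Sum>i\<in>J p. complex_of_real (g i p) * ?q i k n)) * ?D n l)"
        unfolding ent_add[OF mult_carrier_mat[OF m Pc] mult_carrier_mat[OF Pc m]] ent_mult[OF m Pc] ent_mult[OF Pc m] eP ..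
      also have "\<dots> = x p * (\<Sum>i\<in>J p. complex_of_real (g i p) * ((\<Sum>n<?r. ?D k n * ?q i n l) + (\<Sum>n<?r. ?q i k n * ?D n l)))"
        unfolding sum_distrib_left sum_distrib_right distrib_left sum.distrib
        by (rule arg_cong2[of _ _ _ _ "(+)"]; subst sum.swap; intro sum.cong refl; simp add: mult_ac)
      also have "\<dots> = x p * (complex_of_real (s p) * ent ?r ?r (1\<^sub>m ?r) k l)"
        unfolding s_def of_real_sum sum_distrib_right by (simp add: hom cong: sum.cong)
      also have "\<dots> = ent ?r ?r (1\<^sub>m ?r) k l"
        unfolding x_def using less_imp_neq[OF s[of p], symmetric] by simp
      finally show "ent ?r ?r (fact_map a p * P p + P p * fact_map a p) k l = ent ?r ?r (1\<^sub>m ?r) k l" .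
    qed simp
    then show thesis by (rule that[of P K, OF Pc PH L(4)])
  qed
qed

end

context landau_ginzburg
begin

section \<open>Compactly supported forms\<close>

text \<open>Easier to propagate than \<open>form_support\<close>: it contains no closure and is a
  pointwise condition on entries.\<close>

definition vanishes_outside :: "'x factorization \<Rightarrow> 'x factorization \<Rightarrow> 'x set \<Rightarrow> ('x, 'd) matform \<Rightarrow> bool" where
  "vanishes_outside a b K \<alpha> \<longleftrightarrow> (\<forall>p vs i j. p \<notin> K \<longrightarrow> ents a b \<alpha> p vs i j = 0)"

lemma vanishes_outsideD:
  assumes "vanishes_outside a b K \<alpha>" "p \<notin> K" shows "ents a b \<alpha> p = (\<lambda>vs i j. 0)"
  using assms unfolding vanishes_outside_def by (intro ext) simp

text \<open>A compact set is closed here, so it contains the closure that defines the support, and a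
  closed subset of it is compact.\<close>

lemma compact_hom_forms_iff:
  "\<alpha> \<in> compact_hom_forms A a b \<longleftrightarrow> \<alpha> \<in> Hom a b \<and> (\<exists>K. compact K \<and> vanishes_outside a b K \<alpha>)"
proof (intro iffI conjI)
  let ?s = "form_support (fact_bundle a) (fact_bundle b) \<alpha>"
  assume "\<alpha> \<in> compact_hom_forms A a b"
  then have h: "\<alpha> \<in> Hom a b" "compact ?s" unfolding compact_hom_forms_def by auto
  show "\<alpha> \<in> Hom a b" by (rule h(1))
  have "{p. \<exists>vs. \<alpha> p vs \<noteq> 0\<^sub>m (fact_rank b) (fact_rank a)} \<subseteq> ?s"
    unfolding form_support_def by (rule closure_subset)
  then have "\<alpha> p vs = 0\<^sub>m (fact_rank b) (fact_rank a)" if "p \<notin> ?s" for p vs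
    using that by blast
  then have "vanishes_outside a b ?s \<alpha>"
    unfolding vanishes_outside_def ents_def by (simp add: ent_zero)
  then show "\<exists>K. compact K \<and> vanishes_outside a b K \<alpha>" using h(2) by (intro exI[of _ ?s] conjI)
next
  assume "\<alpha> \<in> Hom a b \<and> (\<exists>K. compact K \<and> vanishes_outside a b K \<alpha>)"
  then obtain K where h: "\<alpha> \<in> Hom a b" "compact K" "vanishes_outside a b K \<alpha>" by (elim conjE exE)
  have "\<alpha> p vs = 0\<^sub>m (fact_rank b) (fact_rank a)" if "p \<notin> K" for p vs
    using vanishes_outsideD[OF h(3) that]
    by (intro ent_eqI[OF Hom_carrier[OF h(1)] zero_carrier_mat]) (simp add: ents_def fun_eq_iff ent_zero)
  then have "{p. \<exists>vs. \<alpha> p vs \<noteq> 0\<^sub>m (fact_rank b) (fact_rank a)} \<subseteq> K" by blast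
  then have "form_support (fact_bundle a) (fact_bundle b) \<alpha> \<subseteq> K"
    unfolding form_support_def by (rule closure_minimal[OF _ compact_imp_closed[OF h(2)]])
  then have "K \<inter> form_support (fact_bundle a) (fact_bundle b) \<alpha> = form_support (fact_bundle a) (fact_bundle b) \<alpha>" by blast
  moreover have "compact (K \<inter> form_support (fact_bundle a) (fact_bundle b) \<alpha>)"
    unfolding form_support_def by (rule compact_Int_closed[OF h(2) closed_closure])
  ultimately have "compact (form_support (fact_bundle a) (fact_bundle b) \<alpha>)" by (simp only:)
  then show "\<alpha> \<in> compact_hom_forms A a b" using h(1) unfolding compact_hom_forms_def by simp
qed

lemma compact_homI: "\<alpha> \<in> Hom a b \<Longrightarrow> compact K \<Longrightarrow> vanishes_outside a b K \<alpha> \<Longrightarrow> \<alpha> \<in> compact_hom_forms A a b"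
  unfolding compact_hom_forms_iff by (intro conjI exI[of _ K])

lemma compact_homE:
  assumes "\<alpha> \<in> compact_hom_forms A a b"
  obtains K where "compact K" "vanishes_outside a b K \<alpha>"
  using assms unfolding compact_hom_forms_iff by (elim conjE exE)

text \<open>The complement of \<open>K\<close> is open, so a form that vanishes there has vanishing
  components near each of its points, and differentiation is local.\<close>

lemma vanishes_outside_dolb:
  assumes ab: "obj a" "obj b" and \<alpha>: "\<alpha> \<in> Hom a b" and K: "compact K" "vanishes_outside a b K \<alpha>"
  shows "vanishes_outside a b K (dolb a b \<alpha>)"
  unfolding vanishes_outside_def
proof (intro allI impI)
  fix p vs i j assume p: "p \<notin> K"
  note E = obj_bundle(1)[OF ab(1)] obj_bundle(1)[OF ab(2)]
  let ?c = "chart_at A p" and ?t = "triv_at (fact_bundle a) p" and ?t' = "triv_at (fact_bundle b) p"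
  note t = triv_at[OF E(1), of p] triv_at[OF E(2), of p]
  let ?U = "- K \<inter> (fst ?t \<inter> fst ?t')"
  have U: "open (chart_image ?c ?U)"
    by (intro chart_image_open[OF chart_at(1)] open_Int open_Compl compact_imp_closed[OF K(1)] triv_open[OF E(1) t(1)] triv_open[OF E(2) t(3)])
  have z: "snd ?c p \<in> chart_image ?c ?U" using p t by (intro chart_imageI chart_at(2)) simp
  have 0: "lf a b ?c ?t ?t' \<alpha> x ws k l = 0" if x: "x \<in> chart_image ?c ?U" for x ws k l
  proof -
    have q: "chart_inv ?c x \<notin> K" "chart_inv ?c x \<in> fst ?t" "chart_inv ?c x \<in> fst ?t'"
      using chart_imageE(2)[OF chart_at(1) x] by auto
    have "ent (fact_rank b) (fact_rank a) (\<alpha> (chart_inv ?c x) us) k l = 0" for us k l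
      using K(2) q(1) unfolding vanishes_outside_def ents_def by blast
    then show ?thesis
      unfolding lform_eq[OF E t(1,3) q(2,3) Hom_carrier[OF \<alpha>]] sandwich_def by simp
  qed
  have "dbar_mat (lf a b ?c ?t ?t' \<alpha>) (snd ?c p) vs k l = dbar_mat (\<lambda>z vs i j. 0) (snd ?c p) vs k l" for k l
    unfolding dbar_mat_def by (rule dbar_cong[OF U z]) (rule 0)
  then have "dbar_mat (lf a b ?c ?t ?t' \<alpha>) (snd ?c p) vs k l = 0" for k l
    using dbar_mat_zero[of "\<lambda>z vs i j. 0"] by simp
  then show "ents a b (dolb a b \<alpha>) p vs i j = 0"
    unfolding ents_def ent_dolbeault(2)[OF E] sandwich_def by simp
qed

lemma compact_hom_Hom: "\<alpha> \<in> compact_hom_forms A a b \<Longrightarrow> \<alpha> \<in> Hom a b"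
  unfolding compact_hom_forms_iff by (rule conjunct1)

lemma compact_hom_zero: "obj a \<Longrightarrow> obj b \<Longrightarrow> form_zero a b \<in> compact_hom_forms A a b"
  by (rule compact_homI[OF Hom_zero compact_empty]) (simp_all add: vanishes_outside_def ents_form_zero)

lemma compact_hom_add:
  assumes ab: "obj a" "obj b" and \<alpha>: "\<alpha> \<in> compact_hom_forms A a b" "\<beta> \<in> compact_hom_forms A a b"
  shows "form_add \<alpha> \<beta> \<in> compact_hom_forms A a b"
proof -
  note h = compact_hom_Hom[OF \<alpha>(1)] compact_hom_Hom[OF \<alpha>(2)]
  obtain K where K: "compact K" "vanishes_outside a b K \<alpha>" using \<alpha>(1) by (rule compact_homE)
  obtain L where L: "compact L" "vanishes_outside a b L \<beta>" using \<alpha>(2) by (rule compact_homE)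
  have "vanishes_outside a b (K \<union> L) (form_add \<alpha> \<beta>)"
    using K(2) L(2) unfolding vanishes_outside_def ents_Hom_add[OF h] by simp
  then show ?thesis by (rule compact_homI[OF Hom_add[OF ab h] compact_Un[OF K(1) L(1)]])
qed

lemma compact_hom_scale:
  assumes ab: "obj a" "obj b" and \<alpha>: "\<alpha> \<in> compact_hom_forms A a b" and f: "holomorphic_fun A UNIV f"
  shows "form_scale f \<alpha> \<in> compact_hom_forms A a b"
proof -
  note h = compact_hom_Hom[OF \<alpha>]
  obtain K where K: "compact K" "vanishes_outside a b K \<alpha>" using \<alpha> by (rule compact_homE)
  have "vanishes_outside a b K (form_scale f \<alpha>)"
    using K(2) unfolding vanishes_outside_def ents_Hom_scale[OF h] by simp
  then show ?thesis by (rule compact_homI[OF Hom_hscale[OF ab h f] K(1)])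
qed

lemma compact_hom_invol:
  assumes ab: "obj a" "obj b" and \<alpha>: "\<alpha> \<in> compact_hom_forms A a b"
  shows "form_invol a b \<alpha> \<in> compact_hom_forms A a b"
proof -
  obtain K where K: "compact K" "vanishes_outside a b K \<alpha>" using \<alpha> by (rule compact_homE)
  have "vanishes_outside a b K (form_invol a b \<alpha>)"
    using K(2) unfolding vanishes_outside_def ents_invol invol_def by simp
  then show ?thesis by (rule compact_homI[OF Hom_invol[OF ab compact_hom_Hom[OF \<alpha>]] K(1)])
qed

lemma compact_hom_comp:
  assumes abc: "obj a" "obj b" "obj c" and h: "\<alpha> \<in> Hom a b" "\<beta> \<in> Hom b c"
    and c: "\<alpha> \<in> compact_hom_forms A a b \<or> \<beta> \<in> compact_hom_forms A b c"
  shows "DF_comp a b c \<beta> \<alpha> \<in> compact_hom_forms A a c"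
proof -
  obtain K where K: "compact K" "vanishes_outside a b K \<alpha> \<or> vanishes_outside b c K \<beta>"
    using c by (elim disjE compact_homE) simp_all
  have "vanishes_outside a c K (DF_comp a b c \<beta> \<alpha>)"
    unfolding vanishes_outside_def ents_comp[OF h]
  proof (intro allI impI)
    fix p vs i j assume p: "p \<notin> K"
    from K(2) show "fprod c b (ents b c \<beta> p) (ents a b \<alpha> p) vs i j = 0"
    proof
      assume "vanishes_outside a b K \<alpha>"
      from vanishes_outsideD[OF this p] show ?thesis by (simp only: wedge_zero_right)
    next
      assume "vanishes_outside b c K \<beta>"
      from vanishes_outsideD[OF this p] show ?thesis by (simp only: wedge_zero_left)
    qed
  qed
  then show ?thesis by (rule compact_homI[OF Hom_comp[OF abc h] K(1)])
qed

lemma compact_hom_diff: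
  assumes ab: "obj a" "obj b" and \<alpha>: "\<alpha> \<in> compact_hom_forms A a b"
  shows "DF_diff A a b \<alpha> \<in> compact_hom_forms A a b"
proof -
  note h = compact_hom_Hom[OF \<alpha>]
  obtain K where K: "compact K" "vanishes_outside a b K \<alpha>" using \<alpha> by (rule compact_homE)
  have "vanishes_outside a b K (DF_diff A a b \<alpha>)"
    unfolding vanishes_outside_def ents_diff[OF ab h]
  proof (intro allI impI)
    fix p vs i j assume p: "p \<notin> K"
    have i: "finv b a (\<lambda>vs i j. 0) = (\<lambda>(vs :: (complex ^ 'd) list) i j. 0)" by (simp add: invol_def)
    show "ents a b (dolb a b \<alpha>) p vs i j + (fprod b b (Fm b p) (ents a b \<alpha> p) vs i j - fprod b a (finv b a (ents a b \<alpha> p)) (Fm a p) vs i j) = 0"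
      unfolding vanishes_outsideD[OF vanishes_outside_dolb[OF ab h K] p] vanishes_outsideD[OF K(2) p] i wedge_zero_left wedge_zero_right by simp
  qed
  then show ?thesis by (rule compact_homI[OF Hom_DF_diff[OF ab h] K(1)])
qed

section \<open>A compactly supported identity up to homotopy\<close>

text \<open>\<open>Q\<close> is the odd part of \<open>P\<close>. As \<open>D\<close> is odd, its
  anticommutator with the odd part is the even part of its anticommutator with \<open>P\<close>,
  namely the even part of the identity, which is the identity. The factor
  \<open>(1 + ?s i * ?s j) / 2\<close> selects the even entries.\<close>

lemma odd_homotopy_degree_zero:
  assumes a: "obj a" and P: "\<And>p. P p \<in> carrier_mat (fact_rank a) (fact_rank a)"
    and h: "section_form (fact_rank a) (fact_rank a) P \<in> Hom a a"
    and p: "fact_map a p * P p + P p * fact_map a p = 1\<^sub>m (fact_rank a)"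
    and Q: "Q = form_scale (\<lambda>p. 1 / 2) (form_add (section_form (fact_rank a) (fact_rank a) P)
        (form_uminus (form_invol a a (section_form (fact_rank a) (fact_rank a) P))))"
  shows "ents a a (DF_diff A a a Q) p [] i j = ents a a (idf a) p [] i j"
proof -
  let ?r = "fact_rank a" and ?P = "section_form (fact_rank a) (fact_rank a) P"
  let ?D = "ent ?r ?r (fact_map a p)" and ?e = "ent ?r ?r (P p)" and ?s = "parity_sign a"
  note E = obj_bundle(1)[OF a]
  have Qh: "Q \<in> Hom a a" "Q \<in> form_deg a a 1" using deg_decomposition_ex(2)[OF a a h] unfolding Q by blast+
  note i = Hom_invol[OF a a h]
  have eQ: "ents a a Q p [] k l = (1 - ?s k * ?s l) / 2 * ?e k l" for k l
    unfolding Q ents_Hom_scale[OF Hom_add[OF a a h Hom_uminus[OF a a i]]] ents_Hom_add[OF h Hom_uminus[OF a a i]]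
      ents_Hom_scale[OF i] ents_invol ents_section by (simp add: invol_def form0_def field_simps)
  have D: "?s k * ?s l * ?D k l = - ?D k l" for k l
    using fun_cong[OF fun_cong[OF fun_cong[OF invol_Fm[OF a, of p]]], of "[]" k l] by (simp add: invol_def form0_def)
  have 1: "?D i k * ((1 - ?s k * ?s j) / 2 * ?e k j) = (1 + ?s i * ?s j) / 2 * (?D i k * ?e k j)" for k
  proof -
    have "?s k * ?s j * ?D i k = - (?s i * ?s j * ?D i k)"
    proof -
      have "?s i * ?s j * ?D i k = (?s i * ?s j) * - (?s i * ?s k * ?D i k)" unfolding D by simp
      also have "\<dots> = - ((?s i * ?s i) * (?s k * ?s j * ?D i k))" by (simp add: mult_ac)
      finally show ?thesis unfolding parity_sign_square by simp
    qed
    from arg_cong[OF this, of "\<lambda>x. x * ?e k j"] show ?thesis by (simp add: field_simps)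
  qed
  have 2: "(1 - ?s i * ?s k) / 2 * ?e i k * ?D k j = (1 + ?s i * ?s j) / 2 * (?e i k * ?D k j)" for k
  proof -
    have "?s i * ?s k * ?D k j = - (?s i * ?s j * ?D k j)"
    proof -
      have "?s i * ?s j * ?D k j = (?s i * ?s j) * - (?s k * ?s j * ?D k j)" unfolding D by simp
      also have "\<dots> = - ((?s j * ?s j) * (?s i * ?s k * ?D k j))" by (simp add: mult_ac)
      finally show ?thesis unfolding parity_sign_square by simp
    qed
    from arg_cong[OF this, of "\<lambda>x. x * ?e i k"] show ?thesis by (simp add: field_simps)
  qed
  \<comment> \<open>The Dolbeault operator contributes nothing in form degree 0.\<close>
  have d: "ents a a (dolb a a Q) p [] i j = 0"
    unfolding ents_def ent_dolbeault(2)[OF E E] by (simp add: sandwich_def dbar_mat_def dbar_def)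
  have "ents a a (DF_diff A a a Q) p [] i j = (\<Sum>k<?r. ?D i k * ents a a Q p [] k j) + (\<Sum>k<?r. ents a a Q p [] i k * ?D k j)"
    unfolding ents_diff[OF a a Qh(1)] d Hom_degD[OF Qh(2)] by (simp add: form0_def bit_sign_def sum_negf)
  also have "\<dots> = (1 + ?s i * ?s j) / 2 * ((\<Sum>k<?r. ?D i k * ?e k j) + (\<Sum>k<?r. ?e i k * ?D k j))"
    unfolding eQ 1 2 distrib_left sum_distrib_left ..
  also have "(\<Sum>k<?r. ?D i k * ?e k j) + (\<Sum>k<?r. ?e i k * ?D k j) = ent ?r ?r (1\<^sub>m ?r) i j"
    using arg_cong[OF p, of "\<lambda>M. ent ?r ?r M i j"] obj_map(1)[OF a, of p] P[of p]
    by (simp add: ent_add[of _ ?r ?r] ent_mult[of _ ?r ?r] mult_carrier_mat[of _ ?r ?r _ ?r])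
  also have "(1 + ?s i * ?s j) / 2 * ent ?r ?r (1\<^sub>m ?r) i j = ent ?r ?r (1\<^sub>m ?r) i j"
    by (simp add: ent_one parity_sign_square)
  finally show ?thesis by (simp add: ents_section form0_def)
qed

text \<open>The primitive of \<open>1 - T^n\<close> is a telescoping sum: \<open>1 - T\<close> is
  the boundary of \<open>Q\<close>, and \<open>T\<close> is closed and even, so composition with
  \<open>T\<close> commutes with the differential.\<close>

lemma compact_identity:
  assumes para: "paracompact_space (euclidean :: 'x topology)" and crit: "compact (critical_set A W)" and a: "obj a"
  shows "\<exists>u g. u \<in> compact_hom_forms A a a \<and> u \<in> form_deg a a 0 \<and> g \<in> Hom a a \<and> g \<in> form_deg a a 1 \<and>
    idf a = form_add u (DF_diff A a a g)"
proof -
  let ?r = "fact_rank a"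
  have "\<exists>P K. (\<forall>p. P p \<in> carrier_mat ?r ?r) \<and> section_form ?r ?r P \<in> Hom a a \<and> compact K
      \<and> (\<forall>p. p \<notin> K \<longrightarrow> fact_map a p * P p + P p * fact_map a p = 1\<^sub>m ?r)"
  proof (rule global_homotopy[OF para crit a])
    fix P K
    assume "\<And>p. P p \<in> carrier_mat ?r ?r" "section_form ?r ?r P \<in> Hom a a" "compact K"
      "\<And>p. p \<notin> K \<Longrightarrow> fact_map a p * P p + P p * fact_map a p = 1\<^sub>m ?r"
    then show ?thesis by (intro exI[of _ P] exI[of _ K] conjI allI impI)
  qed
  then obtain P K where PK: "(\<forall>p. P p \<in> carrier_mat ?r ?r) \<and> section_form ?r ?r P \<in> Hom a a \<and> compact K
      \<and> (\<forall>p. p \<notin> K \<longrightarrow> fact_map a p * P p + P p * fact_map a p = 1\<^sub>m ?r)"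
    by (elim exE)
  then have P: "\<And>p. P p \<in> carrier_mat ?r ?r" "section_form ?r ?r P \<in> Hom a a"
    and K: "compact K" "\<And>p. p \<notin> K \<Longrightarrow> fact_map a p * P p + P p * fact_map a p = 1\<^sub>m ?r"
    by simp_all
  define Q :: "('x, 'd) matform" where "Q = form_scale (\<lambda>p. 1 / 2) (form_add (section_form ?r ?r P) (form_uminus (form_invol a a (section_form ?r ?r P))))"
  have Q: "Q \<in> Hom a a" "Q \<in> form_deg a a 1" using deg_decomposition_ex(2)[OF a a P(2)] unfolding Q_def by blast+
  note i = Hom_idf[OF a]
  note dQ = Hom_DF_diff[OF a a Q(1)] deg_diff[OF a a Q]
  define T where "T = form_add (idf a) (form_uminus (DF_diff A a a Q))"
  have T: "T \<in> Hom a a" unfolding T_def by (intro Hom_add[OF a a] Hom_uminus[OF a a] i dQ)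
  have Tdeg: "T \<in> form_deg a a 0"
    unfolding T_def using dQ(2) by (intro deg_add[OF a a] deg_scale Hom_uminus[OF a a] i dQ(1)) simp
  have eT: "ents a a T p vs i j = ents a a (idf a) p vs i j - ents a a (DF_diff A a a Q) p vs i j" for p vs i j
    unfolding T_def ents_Hom_add[OF i(1) Hom_uminus[OF a a dQ(1)]] ents_Hom_scale[OF dQ(1)] by simp
  have idT: "idf a = form_add T (DF_diff A a a Q)"
    by (rule Hom_eqI[OF i(1) Hom_add[OF a a T dQ(1)]]) (simp add: ents_Hom_add[OF T dQ(1)] eT)
  have dT: "DF_diff A a a T = form_zero a a"
  proof (rule Hom_eqI[OF Hom_DF_diff[OF a a T] Hom_zero[OF a a]])
    fix p vs k l
    show "ents a a (DF_diff A a a T) p vs k l = ents a a (form_zero a a) p vs k l"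
      unfolding T_def diff_add_form[OF a a i(1) Hom_uminus[OF a a dQ(1)]] diff_scale_form[OF a a dQ(1) holomorphic_fun_const] diff_idf[OF a]
        ents_Hom_add[OF Hom_zero[OF a a] Hom_uminus[OF a a Hom_DF_diff[OF a a dQ(1)]]] ents_Hom_scale[OF Hom_DF_diff[OF a a dQ(1)]]
        DF_diff_square[OF a a Q(1)] by (simp add: ents_form_zero)
  qed
  have T0: "ents a a T p [] k l = 0" if "p \<notin> K" for p k l
    unfolding eT odd_homotopy_degree_zero[OF a P K(2)[OF that] Q_def] by simp
  define tp where "tp n = (DF_comp a a a T ^^ n) (idf a)" for n
  have tp: "tp 0 = idf a" "tp (Suc n) = DF_comp a a a T (tp n)" for n by (simp_all add: tp_def)
  have H: "tp n \<in> Hom a a \<and> tp n \<in> form_deg a a 0" for n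
  proof (induction n)
    case (Suc n)
    then show ?case unfolding tp using Hom_comp[OF a a a _ T] deg_comp[OF _ T _ Tdeg, of "tp n" a 0] by simp
  qed (simp add: tp i)
  \<comment> \<open>Outside \<open>K\<close> the degree 0 part of \<open>T\<close> vanishes, so each
    further factor raises the lowest form degree by one.\<close>
  have low: "ents a a (tp n) p vs k l = 0" if "p \<notin> K" "length vs < n" for n p vs k l
    using that(2)
  proof (induction n arbitrary: vs k l)
    case (Suc n)
    show ?case
      unfolding tp ents_comp[OF conjunct1[OF H] T]
      by (rule wedge_low_degree[where m = 1 and n = n]) (use Suc T0[OF that(1)] in auto)
  qed simp
  \<comment> \<open>The recursion for the primitive is \<open>T \<circ> g + Q\<close>: substitute
    \<open>1 = T^n + dg\<close> into \<open>T = T \<circ> 1\<close> and then use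
    \<open>1 = T + dQ\<close>.\<close>
  have g: "\<exists>g. g \<in> Hom a a \<and> g \<in> form_deg a a 1 \<and> idf a = form_add (tp n) (DF_diff A a a g)" for n
  proof (induction n)
    case 0
    have "form_add (idf a) (form_zero a a) = idf a"
      using Hom_add_zero[OF a a i(1)] Hom_add_comm[OF a a i(1) Hom_zero[OF a a]] by simp
    then show ?case
      unfolding tp by (intro exI[of _ "form_zero a a"]) (simp add: Hom_zero[OF a a] deg_zero diff_zero_form[OF a a])
  next
    case (Suc n)
    then obtain g where g: "g \<in> Hom a a" "g \<in> form_deg a a 1" "idf a = form_add (tp n) (DF_diff A a a g)" by blast
    note t = conjunct1[OF H[of n]] and dg = Hom_DF_diff[OF a a g(1)] and Tg = Hom_comp[OF a a a g(1) T]
    note Tt = Hom_comp[OF a a a t T] and Tdg = Hom_comp[OF a a a dg T]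
    have z: "DF_comp a a a (form_zero a a) g = form_zero a a"
      by (rule Hom_eqI[OF Hom_comp[OF a a a g(1) Hom_zero[OF a a]] Hom_zero[OF a a]])
        (simp add: ents_comp[OF g(1) Hom_zero[OF a a]] ents_form_zero[abs_def] wedge_zero_left)
    have d: "DF_diff A a a (DF_comp a a a T g) = DF_comp a a a T (DF_diff A a a g)"
      unfolding leibniz_homogeneous[OF a a a g(1) T Tdeg] dT z
      by (simp add: bit_sign_def form_scale_one Hom_add_zero[OF a a Tdg])
    have "T = DF_comp a a a T (idf a)" using comp_idf(1)[OF a a T] by simp
    also have "\<dots> = form_add (tp (Suc n)) (DF_diff A a a (DF_comp a a a T g))"
      unfolding tp d by (subst g(3)) (rule comp_add_form(1)[OF a a a t T dg])
    finally have "idf a = form_add (form_add (tp (Suc n)) (DF_diff A a a (DF_comp a a a T g))) (DF_diff A a a Q)"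
      using idT by simp
    also have "\<dots> = form_add (tp (Suc n)) (DF_diff A a a (form_add (DF_comp a a a T g) Q))"
      unfolding diff_add_form[OF a a Tg Q(1)] tp(2) by (rule Hom_add_assoc[OF a a Tt Hom_DF_diff[OF a a Tg] dQ(1)])
    finally show ?case
      using Hom_add[OF a a Tg Q(1)] deg_add[OF a a Tg Q(1) _ Q(2)] deg_comp[OF g(1) T g(2) Tdeg] by auto
  qed
  \<comment> \<open>With this exponent \<open>low\<close> covers all degrees up to d, and
    \<open>antialt_top_degree\<close> covers the degrees above d.\<close>
  let ?u = "tp (Suc CARD('d))"
  have "vanishes_outside a a K ?u"
    unfolding vanishes_outside_def
  proof (intro allI impI)
    fix p vs k l assume p: "p \<notin> K"
    show "ents a a ?u p vs k l = 0"
    proof (cases "length vs < Suc CARD('d)")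
      case False
      then show ?thesis
        unfolding ents_def by (intro antialt_top_degree[OF hom_formsD(2)[OF conjunct1[OF H]]]) simp
    qed (rule low[OF p])
  qed
  then have "?u \<in> compact_hom_forms A a a" by (rule compact_homI[OF conjunct1[OF H] K(1)])
  then show ?thesis using g[of "Suc CARD('d)"] H[of "Suc CARD('d)"] by (elim exE conjE) (intro exI conjI)
qed

lemma unital_dg_ideal_compact:
  assumes para: "paracompact_space (euclidean :: 'x topology)" and crit: "compact (critical_set A W)"
  shows "unital_dg_ideal (holomorphic_ring A) (DF A W) (compact_hom_forms A)"
proof (intro unital_dg_ideal.intro dg_category_DF unital_dg_ideal_axioms.intro, unfold DF_simps form_module_simps, goal_cases)
  case (1 a b)
  then show ?case
    by (intro form_submoduleI) (auto intro: compact_hom_Hom compact_hom_zero compact_hom_add compact_hom_scale)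
next
  case (2 a b f0 f1)
  then have h: "f0 \<in> Hom a b" "f1 \<in> Hom a b" "f0 \<in> form_deg a b 0" "f1 \<in> form_deg a b 1" by auto
  note c = compact_hom_scale[OF 2(1,2) _ holomorphic_fun_const] compact_hom_add[OF 2(1,2) 2(5)] compact_hom_invol[OF 2(1,2) 2(5)]
  \<comment> \<open>The parity parts are half sums and half differences with the involution, all of
    which keep a compact support.\<close>
  show ?case
    by (subst deg_parts(1)[OF 2(1,2) h refl], subst deg_parts(2)[OF 2(1,2) h refl]) (intro conjI c)
next
  case (3 a b f) then show ?case by (rule compact_hom_diff)
next
  case (4 a b c f g) then show ?case by (intro compact_hom_comp) (auto intro: compact_hom_Hom)
next
  case (5 a b c f g) then show ?case by (intro compact_hom_comp) (auto intro: compact_hom_Hom)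
next
  case (6 a)
  obtain u g where u: "u \<in> compact_hom_forms A a a" "u \<in> form_deg a a 0" "g \<in> Hom a a" "g \<in> form_deg a a 1"
    "idf a = form_add u (DF_diff A a a g)"
    using compact_identity[OF para crit 6] by blast
  have "dg_category.strict_identity (DF A W) a (idf a)"
    unfolding dg_category.strict_identity_def[OF dg_category_DF] DF_simps form_module_simps
    using Hom_idf[OF 6] comp_idf 6 by (auto simp: DF_simps)
  then show ?case using u compact_hom_Hom[OF u(1)] by blast
qed

lemma DF\<^sub>c_eq_restrict: "DF\<^sub>c A W = dg_restrict (DF A W) (compact_hom_forms A)"
proof -
  have "compact_hom_forms A a b \<inter> form_deg a b s = Hom a b \<inter> form_deg a b s \<inter> compact_hom_forms A a b" for a b s
    using compact_hom_Hom by blast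
  then show ?thesis by (simp add: DF\<^sub>c_def DF_def dg_restrict_def form_module_def)
qed

end

theorem proposition4p11:
  fixes A :: "('x::t2_space, 'd::finite) chart set" and W :: "'x \<Rightarrow> complex"
  assumes "landau_ginzburg_pair A W"
    and "compact (critical_set A W)"
  shows "quasi_equivalence (holomorphic_ring A) (DF\<^sub>c A W) (DF A W) incl_obj incl_mor"
proof -
  interpret landau_ginzburg A W
    using assms(1) unfolding landau_ginzburg_pair_def
    by (intro landau_ginzburg.intro complex_manifold.intro landau_ginzburg_axioms.intro) auto
  have "paracompact_space (euclidean :: 'x topology)"
    using assms(1) unfolding landau_ginzburg_pair_def by blast
  from unital_dg_ideal.inclusion_quasi_equivalence[OF unital_dg_ideal_compact[OF this assms(2)]]
  show ?thesis unfolding DF\<^sub>c_eq_restrict incl_obj_def[abs_def] incl_mor_def[abs_def] .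
qed

end
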